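(* Let $k\ge 2$, $j\in\{1,\dots,k-1\}$, and let $s^{DV}_j(u)$ be the $k$-th order De Vylder type approximation of the $j$-th moment of the surplus before ruin $s_j(u):=\mathbb E[U_{T-}^j\mid T<\infty]$: it is the same quantity computed for a compound Poisson reserve model $(U^{DV}_t)$ such that $\mathbb{E}[(U_t(u))^i]=\mathbb{E}[(U^{DV}_t(u))^i]$ for all $i=1,\dots,k$, $t\ge 0$ and $u\ge 0$. Suppose that both reserve models $(U_t)$ and $(U^{DV}_t)$ satisfy the following assumptions, written here for $(U_t)$ and analogously for $(U^{DV}_t)$: (A1) there exists $R>0$ with $\int_0^\infty e^{Rx}\frac{f_I(x)}{1+\theta}\,dx=1$; (A2) $m_k^{\exp}:=\int_0^\infty x^k e^{Rx}\frac{f_I(x)}{1+\theta}\,dx<\infty$; (A3) $h_I:=\sup_{x\ge 0} f_I(x)/\overline F_I(x)<\infty$. Then, for $u\ge0$ and $\theta>0$ in a bounded interval, $$s_j(u)-s^{DV}_j(u)=\mathcal O(1),$$ and, for the relative error, $$\frac{s_j(u)-s^{DV}_j(u)}{s_j(u)}=\mathcal O(1).$$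
   Context: Reserve model: $U_t=U_t(u)=u+ct-\sum_{i=1}^{N_t}Z_i$, where $u\ge0$ is the initial reserve, $c>0$ is the premium per unit time, $(N_t)_{t\ge0}$ is a Poisson process of intensity $\lambda>0$, and $(Z_i)_{i\ge1}$ are positive i.i.d. random variables, independent of $(N_t)$, with cumulative distribution function $F$ of unbounded support. Write $m_j:=\mathbb E(Z_1^j)$ and $\overline\Phi:=1-\Phi$ for any distribution function $\Phi$. Set $f_I(x):=\overline F(x)/m_1$, $F_I(x):=\int_0^x f_I(y)\,dy$, and $\theta:=\frac{c}{\lambda m_1}-1$ (safety loading coefficient). The time of ruin is $T=T(u):=\inf\{t\ge0:U_t<0\}$; the surplus before ruin is the left limit $U_{T-}$. The model $(U^{DV}_t)$ is of the same form, with the same initial reserve $u$, and with all parameters and derived quantities defined in the same way and carrying the superscript $DV$ ($c^{DV},\lambda^{DV},F^{DV},m_j^{DV},\theta^{DV},f_I^{DV},F_I^{DV},R^{DV},T^{DV},\dots$). No particular form of the claim distribution $F^{DV}$ is assumed. Dependence on $\theta$: $\lambda$ and $F$ are fixed and $\theta$ varies through $c=(1+\theta)\lambda m_1$; the quantities $s_j,R,m_k^{\exp}$ depend implicitly on $\theta$. The moments $m_j^{DV}$ do not depend on $\theta$, and $\theta^{DV}$ depends linearly on $\theta$. Notation $\mathcal O$: $a(u,\theta)=\mathcal O(b(u,\theta))$ means that there is a constant $C\ge0$, independent of $(u,\theta)$, with $|a(u,\theta)|\le C|b(u,\theta)|$ for all $u\ge0$ and all $\theta>0$ in a bounded interval.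 The constant $C$ may depend on the $m_j$'s, $m_k^{\exp}$ and $h_I$ and on the corresponding quantities of the approximating model (these are treated as constants, i.e. bounded over the range of $\theta$). *)

theory Defs
  imports "HOL-Probability.Probability"
begin

definition poisson_process :: "'a measure \<Rightarrow> real \<Rightarrow> (real \<Rightarrow> 'a \<Rightarrow> nat) \<Rightarrow> bool" where
  "poisson_process M lam N \<longleftrightarrow>
     prob_space M \<and>
     (\<forall>t\<ge>0. N t \<in> measurable M (count_space UNIV)) \<and>
     (\<forall>\<omega>\<in>space M. N 0 \<omega> = 0 \<and> mono_on {0..} (\<lambda>t. N t \<omega>) \<and>
        (\<forall>t\<ge>0. continuous (at_right t) (\<lambda>s. N s \<omega>))) \<and>
     (\<forall>s t. 0 \<le> s \<and> s < t \<longrightarrow>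
        distr M (count_space UNIV) (\<lambda>\<omega>. N t \<omega> - N s \<omega>)
          = measure_pmf (poisson_pmf (lam * (t - s)))) \<and>
     (\<forall>(t :: nat \<Rightarrow> real) n. 0 \<le> t 0 \<and> (\<forall>i<n. t i \<le> t (Suc i)) \<longrightarrow>
        prob_space.indep_vars M (\<lambda>_. count_space UNIV)
          (\<lambda>i \<omega>. N (t (Suc i)) \<omega> - N (t i) \<omega>) {..<n})"

text \<open>The claims are \<^term>\<open>Z i\<close> for \<^term>\<open>i \<ge> 1\<close>; the value \<^term>\<open>Z 0\<close> is never used.\<close>

definition claim_cdf :: "'a measure \<Rightarrow> (nat \<Rightarrow> 'a \<Rightarrow> real) \<Rightarrow> real \<Rightarrow> real" where
  "claim_cdf M Z = cdf (distr M borel (Z 1))"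

definition claim_moment :: "'a measure \<Rightarrow> (nat \<Rightarrow> 'a \<Rightarrow> real) \<Rightarrow> nat \<Rightarrow> real" where
  "claim_moment M Z i = (\<integral>\<omega>. Z 1 \<omega> ^ i \<partial>M)"

text \<open>Independence of the whole claim sequence from the whole counting process is expressed
  through the corresponding random elements of product spaces.\<close>

definition reserve_model ::
  "'a measure \<Rightarrow> real \<Rightarrow> real \<Rightarrow> (real \<Rightarrow> 'a \<Rightarrow> nat) \<Rightarrow> (nat \<Rightarrow> 'a \<Rightarrow> real) \<Rightarrow> bool" where
  "reserve_model M c lam N Z \<longleftrightarrow>
     prob_space M \<and> c > 0 \<and> lam > 0 \<and>
     poisson_process M lam N \<and>
     prob_space.indep_vars M (\<lambda>_. borel) Z {1..} \<and>
     (\<forall>i\<ge>1. distr M borel (Z i) = distr M borel (Z 1)) \<and>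
     (\<forall>i\<ge>1. AE \<omega> in M. Z i \<omega> > 0) \<and>
     prob_space.indep_var M
       (PiM {0..} (\<lambda>_. count_space UNIV)) (\<lambda>\<omega>. \<lambda>t\<in>{0..}. N t \<omega>)
       (PiM {1..} (\<lambda>_. borel)) (\<lambda>\<omega>. \<lambda>i\<in>{1..}. Z i \<omega>) \<and>
     (\<forall>x. claim_cdf M Z x < 1)"

definition reserve ::
  "real \<Rightarrow> (real \<Rightarrow> 'a \<Rightarrow> nat) \<Rightarrow> (nat \<Rightarrow> 'a \<Rightarrow> real) \<Rightarrow> real \<Rightarrow> real \<Rightarrow> 'a \<Rightarrow> real" where
  "reserve c N Z u t \<omega> = u + c * t - (\<Sum>i=1..N t \<omega>. Z i \<omega>)"

definition ruin_time :: "(real \<Rightarrow> 'a \<Rightarrow> real) \<Rightarrow> 'a \<Rightarrow> ereal" where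
  "ruin_time U \<omega> = (INF t\<in>{t. 0 \<le> t \<and> U t \<omega> < 0}. ereal t)"

text \<open>Left limit of the path at the time of ruin; only meaningful if that time is finite.\<close>

definition surplus_before_ruin :: "(real \<Rightarrow> 'a \<Rightarrow> real) \<Rightarrow> 'a \<Rightarrow> real" where
  "surplus_before_ruin U \<omega> = Lim (at_left (real_of_ereal (ruin_time U \<omega>))) (\<lambda>t. U t \<omega>)"

definition surplus_moment :: "'a measure \<Rightarrow> (real \<Rightarrow> 'a \<Rightarrow> real) \<Rightarrow> nat \<Rightarrow> real" where
  "surplus_moment M U j =
     (LINT \<omega>:{\<omega> \<in> space M. ruin_time U \<omega> < \<infinity>}|M. surplus_before_ruin U \<omega> ^ j)
       / measure M {\<omega> \<in> space M. ruin_time U \<omega> < \<infinity>}"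

definition safety_loading :: "'a measure \<Rightarrow> real \<Rightarrow> real \<Rightarrow> (nat \<Rightarrow> 'a \<Rightarrow> real) \<Rightarrow> real" where
  "safety_loading M c lam Z = c / (lam * claim_moment M Z 1) - 1"

definition f_I :: "'a measure \<Rightarrow> (nat \<Rightarrow> 'a \<Rightarrow> real) \<Rightarrow> real \<Rightarrow> real" where
  "f_I M Z x = (1 - claim_cdf M Z x) / claim_moment M Z 1"

definition F_I :: "'a measure \<Rightarrow> (nat \<Rightarrow> 'a \<Rightarrow> real) \<Rightarrow> real \<Rightarrow> real" where
  "F_I M Z x = (LBINT y:{0..x}. f_I M Z y)"

text \<open>A positive solution of the Lundberg equation; it is unique whenever it exists.\<close>

definition adjustment_coefficient ::
  "'a measure \<Rightarrow> real \<Rightarrow> real \<Rightarrow> (nat \<Rightarrow> 'a \<Rightarrow> real) \<Rightarrow> real \<Rightarrow> bool" where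
  "adjustment_coefficient M c lam Z R \<longleftrightarrow> R > 0 \<and>
     (\<integral>\<^sup>+x\<in>{0..}. ennreal (exp (R * x) * f_I M Z x / (1 + safety_loading M c lam Z)) \<partial>lborel) = 1"

definition exp_moment ::
  "'a measure \<Rightarrow> real \<Rightarrow> real \<Rightarrow> (nat \<Rightarrow> 'a \<Rightarrow> real) \<Rightarrow> real \<Rightarrow> nat \<Rightarrow> ennreal" where
  "exp_moment M c lam Z R k =
     (\<integral>\<^sup>+x\<in>{0..}. ennreal (x ^ k * exp (R * x) * f_I M Z x / (1 + safety_loading M c lam Z)) \<partial>lborel)"

definition h_I :: "'a measure \<Rightarrow> (nat \<Rightarrow> 'a \<Rightarrow> real) \<Rightarrow> ennreal" where
  "h_I M Z = (SUP x\<in>{0..}. ennreal (f_I M Z x / (1 - F_I M Z x)))"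

text \<open>Equality of the first \<^term>\<open>k\<close> moments at all times and for all initial reserves.\<close>

definition moments_match ::
  "nat \<Rightarrow> 'a measure \<Rightarrow> (real \<Rightarrow> real \<Rightarrow> 'a \<Rightarrow> real) \<Rightarrow>
     'b measure \<Rightarrow> (real \<Rightarrow> real \<Rightarrow> 'b \<Rightarrow> real) \<Rightarrow> bool" where
  "moments_match k M U M' U' \<longleftrightarrow>
     (\<forall>i\<in>{1..k}. \<forall>t\<ge>0. \<forall>u\<ge>0. (\<integral>\<omega>. U u t \<omega> ^ i \<partial>M) = (\<integral>\<omega>. U' u t \<omega> ^ i \<partial>M'))"

end

theory Submission
  imports Defs
begin

text \<open>
  Both conditional moments turn out to be bounded uniformly in \<open>u\<close> and \<open>\<theta>\<close>, and the moment of the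
  original model is bounded away from zero; both claims follow from these two facts. The two models
  are never compared with each other, except that equality of the means pins down the intensity of
  the approximating model.

  The conditional moment is the quotient of \<open>moment_mass j u\<close>, the integral of
  \<open>U\<^bsub>T-\<^esub>\<^sup>j\<close> over the event of ruin, and the probability of that event. Both decay like \<open>exp (- R u)\<close>,
  so sharp exponential bounds from above for the numerator and from below for the denominator are
  needed. The tool is the defective renewal equation \<open>v = g * v + f\<close> with kernel
  \<open>g = f_I / (1 + \<theta>)\<close>. Tilted by \<open>exp (R x)\<close>, the kernel becomes a probability density, and assumption (A3)
  bounds its hazard rate by a constant \<open>H\<close>. For such a kernel the function
  \<open>a u + H * (\<integral> a over [0,u])\<close> is an explicit supersolution for the forcing term \<open>a\<close>
  (\<open>renewal_supersolution\<close>), and comparison (\<open>renewal_comparison\<close>) yields bounds without any renewal theorem,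
  hence with explicit constants.

  The renewal inequalities are derived from the reserve observed on grids of mesh \<open>h\<close>. There the reserve
  is a random walk killed at its first negative value, and a function of the walk summed until ruin
  has expectation \<open>green h\<close>. Integrated over a half line, the step equation of \<open>green h\<close> becomes a
  renewal inequality with kernel \<open>g\<close> up to an error of order \<open>h\<close> (\<open>ruin_prob_renewal_fine\<close>,
  \<open>green_window_inequality\<close>); letting \<open>h\<close> tend to zero removes the error. Pathwise, passing between the unit grid and a
  finer one costs a shift of the initial reserve by a multiple of \<open>c\<close> and a constant factor, so the
  limit controls the walk on the unit grid as well (\<open>limit_ruin_prob_supersolution\<close>, \<open>green_upper_bound\<close>).

  For the numerator: if ruin occurs within a unit interval with claim total \<open>S\<close>, started with reserve \<open>x\<close>,
  then \<open>x < S\<close> and \<open>U\<^bsub>T-\<^esub>\<close> is at most \<open>S + c\<close>. So the numerator is at most the Green function of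
  \<open>overshoot_mean\<close>, whose integral against \<open>(1 + x) exp (R x)\<close> costs \<open>j + 1\<close> powers of \<open>x\<close>; this is where \<open>j < k\<close> and (A2) enter.

  For the lower bound on the moment: let the walk start at \<open>u - K\<close>. It falls below zero with
  probability of order \<open>exp (- R u)\<close>, and for large \<open>K\<close> the deficit then exceeds \<open>K - c\<close> only in a
  small part of these cases (\<open>green_deficit_tail\<close>). Otherwise the true reserve, which is larger by \<open>K\<close>, lies
  between \<open>c\<close> and \<open>K\<close>, and a unit interval without claims followed by one huge claim produces ruin from a
  surplus of at least \<open>c\<close> (\<open>forced_ruin\<close>). The event of that last stage has a fixed positive probability.
\<close>

section \<open>Defective renewal inequalities\<close>

definition renewal_conv :: "(real \<Rightarrow> ennreal) \<Rightarrow> (real \<Rightarrow> ennreal) \<Rightarrow> real \<Rightarrow> ennreal" where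
  "renewal_conv g f u = (\<integral>\<^sup>+y\<in>{0..u}. g y * f (u - y) \<partial>lborel)"

lemma renewal_conv_mono:
  assumes "\<And>y. 0 \<le> y \<Longrightarrow> f y \<le> f' y"
  shows "renewal_conv g f u \<le> renewal_conv g f' u"
  unfolding renewal_conv_def
  by (intro nn_integral_mono) (auto simp: indicator_def intro!: mult_left_mono assms)

lemma renewal_conv_add:
  assumes [measurable]: "g \<in> borel_measurable borel" "f \<in> borel_measurable borel"
    "f' \<in> borel_measurable borel"
  shows "renewal_conv g (\<lambda>x. f x + f' x) u = renewal_conv g f u + renewal_conv g f' u"
  unfolding renewal_conv_def by (subst nn_integral_add[symmetric]) (auto simp: algebra_simps)

lemma renewal_conv_cmult:
  assumes [measurable]: "g \<in> borel_measurable borel" "f \<in> borel_measurable borel"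
  shows "renewal_conv g (\<lambda>x. a * f x) u = a * renewal_conv g f u"
  unfolding renewal_conv_def by (subst nn_integral_cmult[symmetric]) (auto simp: algebra_simps)

text \<open>
  Iterating the two inequalities, the difference of a bounded subsolution and a supersolution shrinks
  by the factor \<open>q < 1\<close>, the total mass of the kernel, in each step.
\<close>

lemma renewal_comparison:
  assumes meas [measurable]: "g \<in> borel_measurable borel" "z \<in> borel_measurable borel"
    and mass: "(\<integral>\<^sup>+y\<in>{0..}. g y \<partial>lborel) \<le> ennreal q" and q: "0 \<le> q" "q < 1"
    and bdd: "\<And>u. 0 \<le> u \<Longrightarrow> v u \<le> ennreal V"
    and sub: "\<And>u. 0 \<le> u \<Longrightarrow> v u \<le> renewal_conv g v u + f u"
    and super: "\<And>u. 0 \<le> u \<Longrightarrow> renewal_conv g z u + f u \<le> z u"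
    and u: "0 \<le> u"
  shows "v u \<le> z u"
proof -
  have const: "renewal_conv g (\<lambda>_. ennreal x) u \<le> ennreal (q * x)" if "0 \<le> x" for x u
  proof -
    have "renewal_conv g (\<lambda>_. ennreal x) u \<le> (\<integral>\<^sup>+y. ennreal x * (g y * indicator {0..} y) \<partial>lborel)"
      unfolding renewal_conv_def by (intro nn_integral_mono) (auto simp: indicator_def mult.commute)
    also have "\<dots> = ennreal x * (\<integral>\<^sup>+y\<in>{0..}. g y \<partial>lborel)"
      by (subst nn_integral_cmult) auto
    also have "\<dots> \<le> ennreal x * ennreal q" by (intro mult_left_mono mass) auto
    finally show ?thesis using q that by (simp add: ennreal_mult[symmetric] mult.commute)
  qed
  define W where "W = max V 0"
  have step: "v u \<le> z u + ennreal (q ^ n * W)" if "0 \<le> u" for n u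
    using that
  proof (induction n arbitrary: u)
    case 0
    have "v u \<le> ennreal W" using bdd[OF 0] by (rule order_trans) (auto simp: W_def intro!: ennreal_leI)
    also have "\<dots> \<le> z u + ennreal W" by simp
    finally show ?case by simp
  next
    case (Suc n)
    have "v u \<le> renewal_conv g (\<lambda>x. z x + ennreal (q ^ n * W)) u + f u"
      by (intro order_trans[OF sub[OF Suc.prems]] add_right_mono renewal_conv_mono Suc.IH)
    also have "\<dots> = renewal_conv g z u + f u + renewal_conv g (\<lambda>x. ennreal (q ^ n * W)) u"
      by (subst renewal_conv_add) (auto simp: add_ac)
    also have "\<dots> \<le> z u + ennreal (q * (q ^ n * W))"
      using q by (intro add_mono super Suc.prems const) (auto simp: W_def)
    finally show ?case by (simp add: mult.assoc)
  qed
  show ?thesis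
  proof (rule LIMSEQ_le_const)
    have "(\<lambda>n. q ^ n * W) \<longlonglongrightarrow> 0 * W"
      using q by (intro tendsto_intros LIMSEQ_realpow_zero) auto
    hence "(\<lambda>n. z u + ennreal (q ^ n * W)) \<longlonglongrightarrow> z u + ennreal 0"
      by (intro tendsto_add tendsto_const tendsto_ennrealI) simp
    thus "(\<lambda>n. z u + ennreal (q ^ n * W)) \<longlonglongrightarrow> z u" by simp
    show "\<exists>N. \<forall>n\<ge>N. v u \<le> z u + ennreal (q ^ n * W)" using step[OF u] by blast
  qed
qed

lemma nn_integral_reflect:
  fixes f :: "real \<Rightarrow> ennreal"
  assumes [measurable]: "f \<in> borel_measurable borel"
  shows "(\<integral>\<^sup>+y\<in>{0..u}. f (u - y) \<partial>lborel) = (\<integral>\<^sup>+y\<in>{0..u}. f y \<partial>lborel)"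
proof -
  have "(\<integral>\<^sup>+y\<in>{0..u}. f y \<partial>lborel) = (\<integral>\<^sup>+y. (\<lambda>y. f y * indicator {0..u} y) (u + (-1) * y) \<partial>lborel)"
    by (subst nn_integral_real_affine[where c="-1" and t=u]) auto
  also have "\<dots> = (\<integral>\<^sup>+y\<in>{0..u}. f (u - y) \<partial>lborel)"
    by (intro nn_integral_cong) (auto simp: indicator_def)
  finally show ?thesis ..
qed

lemma renewal_conv_commute:
  assumes [measurable]: "g \<in> borel_measurable borel" "f \<in> borel_measurable borel"
  shows "renewal_conv g f u = (\<integral>\<^sup>+y\<in>{0..u}. f y * g (u - y) \<partial>lborel)"
  unfolding renewal_conv_def
  using nn_integral_reflect[of "\<lambda>y. f y * g (u - y)" u] by (simp add: mult.commute)

text \<open>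
  The common end point is a null set, so the closed half lines can be used on both sides.
\<close>

lemma nn_integral_split_at:
  fixes f :: "real \<Rightarrow> ennreal"
  assumes [measurable]: "f \<in> borel_measurable borel" and "0 \<le> x"
  shows "(\<integral>\<^sup>+y\<in>{0..x}. f y \<partial>lborel) + (\<integral>\<^sup>+y\<in>{x..}. f y \<partial>lborel) = (\<integral>\<^sup>+y\<in>{0..}. f y \<partial>lborel)"
proof -
  have "(\<integral>\<^sup>+y\<in>{0..x}. f y \<partial>lborel) + (\<integral>\<^sup>+y\<in>{x..}. f y \<partial>lborel)
      = (\<integral>\<^sup>+y. f y * indicator {0..x} y + f y * indicator {x..} y \<partial>lborel)"
    by (subst nn_integral_add) auto
  also have "\<dots> = (\<integral>\<^sup>+y\<in>{0..}. f y \<partial>lborel)"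
  proof (rule nn_integral_cong_AE)
    show "AE y in lborel. f y * indicator {0..x} y + f y * indicator {x..} y = f y * indicator {0..} y"
      using AE_lborel_singleton[of x]
      by eventually_elim (use assms(2) in \<open>auto simp: indicator_def\<close>)
  qed
  finally show ?thesis .
qed

lemma measurable_tail_integral [measurable]:
  fixes f :: "real \<Rightarrow> ennreal"
  assumes [measurable]: "f \<in> borel_measurable borel"
  shows "(\<lambda>x. \<integral>\<^sup>+y\<in>{x..}. f y \<partial>lborel) \<in> borel_measurable borel"
    and "(\<lambda>x. \<integral>\<^sup>+y\<in>{0..x}. f y \<partial>lborel) \<in> borel_measurable borel"
proof -
  have "(\<lambda>x. \<integral>\<^sup>+y. f y * (if x \<le> y then 1 else 0) \<partial>lborel) \<in> borel_measurable borel"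
    by measurable
  also have "(\<lambda>x. \<integral>\<^sup>+y. f y * (if x \<le> y then 1 else 0) \<partial>lborel) = (\<lambda>x. \<integral>\<^sup>+y\<in>{x..}. f y \<partial>lborel)"
    by (intro ext nn_integral_cong) (auto simp: indicator_def)
  finally show "(\<lambda>x. \<integral>\<^sup>+y\<in>{x..}. f y \<partial>lborel) \<in> borel_measurable borel" .
  have "(\<lambda>x. \<integral>\<^sup>+y. f y * (if 0 \<le> y \<and> y \<le> x then 1 else 0) \<partial>lborel) \<in> borel_measurable borel"
    by measurable
  also have "(\<lambda>x. \<integral>\<^sup>+y. f y * (if 0 \<le> y \<and> y \<le> x then 1 else 0) \<partial>lborel) = (\<lambda>x. \<integral>\<^sup>+y\<in>{0..x}. f y \<partial>lborel)"
    by (intro ext nn_integral_cong) (auto simp: indicator_def)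
  finally show "(\<lambda>x. \<integral>\<^sup>+y\<in>{0..x}. f y \<partial>lborel) \<in> borel_measurable borel" .
qed

text \<open>
  If the kernel is a probability density with hazard rate at most \<open>h\<close>, the potential of \<open>a\<close> is dominated
  by \<open>a\<close> plus \<open>h\<close> times its integral: the mass of \<open>a\<close> at \<open>x\<close> contributes \<open>a x * g (u - x)\<close>, which is paid for by
  \<open>h\<close> times the part \<open>a x * G (u - x)\<close> that the convolution with the integral leaves out.
\<close>

lemma renewal_supersolution_proper:
  fixes g a :: "real \<Rightarrow> ennreal"
  assumes [measurable]: "g \<in> borel_measurable borel" "a \<in> borel_measurable borel"
    and mass: "(\<integral>\<^sup>+y\<in>{0..}. g y \<partial>lborel) = 1"
    and hazard: "\<And>x. 0 \<le> x \<Longrightarrow> g x \<le> h * (\<integral>\<^sup>+y\<in>{x..}. g y \<partial>lborel)"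
  shows "renewal_conv g (\<lambda>x. a x + h * (\<integral>\<^sup>+y\<in>{0..x}. a y \<partial>lborel)) u
      \<le> h * (\<integral>\<^sup>+y\<in>{0..u}. a y \<partial>lborel)"
proof -
  define G where "G x = (\<integral>\<^sup>+y\<in>{x..}. g y \<partial>lborel)" for x
  define I where "I x = (\<integral>\<^sup>+y\<in>{0..x}. a y \<partial>lborel)" for x
  have [measurable]: "G \<in> borel_measurable borel" "I \<in> borel_measurable borel"
    unfolding G_def[abs_def] I_def[abs_def] by measurable
  have 1: "renewal_conv g a u \<le> h * (\<integral>\<^sup>+x\<in>{0..u}. a x * G (u - x) \<partial>lborel)"
  proof -
    have haz: "g (u - x) \<le> h * G (u - x)" if "x \<le> u" for x
      using hazard[of "u - x"] that by (simp add: G_def)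
    have haz': "a x * g (u - x) \<le> h * (a x * G (u - x))" if "x \<le> u" for x
      using mult_left_mono[OF haz[OF that], of "a x"] by (simp add: mult_ac)
    have "renewal_conv g a u = (\<integral>\<^sup>+x\<in>{0..u}. a x * g (u - x) \<partial>lborel)"
      by (rule renewal_conv_commute) auto
    also have "\<dots> \<le> (\<integral>\<^sup>+x. h * (a x * G (u - x) * indicator {0..u} x) \<partial>lborel)"
      by (intro nn_integral_mono)
         (auto simp: indicator_def haz')
    also have "\<dots> = h * (\<integral>\<^sup>+x\<in>{0..u}. a x * G (u - x) \<partial>lborel)"
      by (rule nn_integral_cmult) auto
    finally show ?thesis .
  qed
  have 2: "renewal_conv g I u = (\<integral>\<^sup>+x\<in>{0..u}. a x * (\<integral>\<^sup>+y\<in>{0..u-x}. g y \<partial>lborel) \<partial>lborel)"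
  proof -
    let ?k = "\<lambda>x y. a x * g y * (if 0 \<le> x \<and> 0 \<le> y \<and> x + y \<le> u then 1 else 0)"
    have "renewal_conv g I u = (\<integral>\<^sup>+y. \<integral>\<^sup>+x. ?k x y \<partial>lborel \<partial>lborel)"
      unfolding renewal_conv_def
    proof (rule nn_integral_cong)
      fix y
      have "g y * I (u - y) * indicator {0..u} y
          = (\<integral>\<^sup>+x. (g y * indicator {0..u} y) * (a x * indicator {0..u - y} x) \<partial>lborel)"
        unfolding I_def by (subst nn_integral_cmult) (auto simp: mult_ac)
      also have "\<dots> = (\<integral>\<^sup>+x. ?k x y \<partial>lborel)"
        by (rule nn_integral_cong) (auto simp: indicator_def mult.commute)
      finally show "g y * I (u - y) * indicator {0..u} y = (\<integral>\<^sup>+x. ?k x y \<partial>lborel)" .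
    qed
    also have "\<dots> = (\<integral>\<^sup>+x. \<integral>\<^sup>+y. ?k x y \<partial>lborel \<partial>lborel)"
      by (rule lborel_pair.Fubini') measurable
    also have "\<dots> = (\<integral>\<^sup>+x\<in>{0..u}. a x * (\<integral>\<^sup>+y\<in>{0..u-x}. g y \<partial>lborel) \<partial>lborel)"
    proof (rule nn_integral_cong)
      fix x
      have "a x * (\<integral>\<^sup>+y\<in>{0..u-x}. g y \<partial>lborel) * indicator {0..u} x
          = (\<integral>\<^sup>+y. (a x * indicator {0..u} x) * (g y * indicator {0..u - x} y) \<partial>lborel)"
        by (subst nn_integral_cmult) (auto simp: mult_ac)
      also have "\<dots> = (\<integral>\<^sup>+y. ?k x y \<partial>lborel)"
        by (rule nn_integral_cong) (auto simp: indicator_def mult.commute)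
      finally show "(\<integral>\<^sup>+y. ?k x y \<partial>lborel)
          = a x * (\<integral>\<^sup>+y\<in>{0..u-x}. g y \<partial>lborel) * indicator {0..u} x" by simp
    qed
    finally show ?thesis .
  qed
  have "renewal_conv g (\<lambda>x. a x + h * I x) u = renewal_conv g a u + h * renewal_conv g I u"
    by (simp add: renewal_conv_add renewal_conv_cmult)
  also have "\<dots> \<le> h * ((\<integral>\<^sup>+x\<in>{0..u}. a x * G (u - x) \<partial>lborel)
       + (\<integral>\<^sup>+x\<in>{0..u}. a x * (\<integral>\<^sup>+y\<in>{0..u-x}. g y \<partial>lborel) \<partial>lborel))"
    using 1 unfolding 2 by (simp add: distrib_left add_right_mono)
  also have "(\<integral>\<^sup>+x\<in>{0..u}. a x * G (u - x) \<partial>lborel)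
       + (\<integral>\<^sup>+x\<in>{0..u}. a x * (\<integral>\<^sup>+y\<in>{0..u-x}. g y \<partial>lborel) \<partial>lborel)
      = (\<integral>\<^sup>+x. a x * G (u - x) * indicator {0..u} x
          + a x * (\<integral>\<^sup>+y\<in>{0..u-x}. g y \<partial>lborel) * indicator {0..u} x \<partial>lborel)"
    by (rule nn_integral_add[symmetric]) measurable
  also have "\<dots> = (\<integral>\<^sup>+x\<in>{0..u}. a x \<partial>lborel)"
  proof (rule nn_integral_cong)
    fix x
    show "a x * G (u - x) * indicator {0..u} x
        + a x * (\<integral>\<^sup>+y\<in>{0..u-x}. g y \<partial>lborel) * indicator {0..u} x = a x * indicator {0..u} x"
    proof (cases "x \<in> {0..u}")
      case True
      then have "(\<integral>\<^sup>+y\<in>{0..u-x}. g y \<partial>lborel) + G (u - x) = 1"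
        unfolding G_def using nn_integral_split_at[of g "u - x"] by (simp add: mass)
      then show ?thesis using True by (simp add: distrib_left[symmetric] add.commute)
    qed simp
  qed
  finally show ?thesis unfolding I_def .
qed

lemma renewal_conv_tilt:
  assumes [measurable]: "g \<in> borel_measurable borel" "f \<in> borel_measurable borel"
  shows "renewal_conv g (\<lambda>x. ennreal (exp (- R * x)) * f x) u
      = ennreal (exp (- R * u)) * renewal_conv (\<lambda>x. ennreal (exp (R * x)) * g x) f u"
proof -
  have e: "ennreal (exp (- R * (u - y))) = ennreal (exp (- R * u)) * ennreal (exp (R * y))" for y
    by (simp add: ennreal_mult[symmetric] exp_add[symmetric] algebra_simps)
  have "renewal_conv g (\<lambda>x. ennreal (exp (- R * x)) * f x) u
      = (\<integral>\<^sup>+y. ennreal (exp (- R * u)) * ((ennreal (exp (R * y)) * g y) * f (u - y) * indicator {0..u} y) \<partial>lborel)"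
    unfolding renewal_conv_def by (intro nn_integral_cong, subst e) (simp only: mult_ac)
  then show ?thesis
    unfolding renewal_conv_def by (subst (asm) nn_integral_cmult) auto
qed

text \<open>
  The previous lemma after an exponential change of measure. The hazard bound is inherited by the tilted
  kernel because \<open>exp (R y)\<close> only grows on the tail.
\<close>

lemma renewal_supersolution:
  fixes g a :: "real \<Rightarrow> ennreal"
  assumes [measurable]: "g \<in> borel_measurable borel" "a \<in> borel_measurable borel"
    and R: "0 \<le> R" and mass: "(\<integral>\<^sup>+y\<in>{0..}. ennreal (exp (R * y)) * g y \<partial>lborel) = 1"
    and hazard: "\<And>x. 0 \<le> x \<Longrightarrow> g x \<le> h * (\<integral>\<^sup>+y\<in>{x..}. g y \<partial>lborel)"
  defines "w \<equiv> \<lambda>x. ennreal (exp (- R * x)) * (a x + h * (\<integral>\<^sup>+y\<in>{0..x}. a y \<partial>lborel))"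
  shows "renewal_conv g w u + ennreal (exp (- R * u)) * a u \<le> w u"
proof -
  let ?g = "\<lambda>x. ennreal (exp (R * x)) * g x"
  have haz: "?g x \<le> h * (\<integral>\<^sup>+y\<in>{x..}. ?g y \<partial>lborel)" if "0 \<le> x" for x
  proof -
    have "?g x \<le> ennreal (exp (R * x)) * (h * (\<integral>\<^sup>+y\<in>{x..}. g y \<partial>lborel))"
      by (intro mult_left_mono hazard that) auto
    also have "\<dots> = h * (\<integral>\<^sup>+y\<in>{x..}. ennreal (exp (R * x)) * g y \<partial>lborel)"
      by (subst mult.left_commute, subst nn_integral_cmult[symmetric]) (auto simp: mult_ac)
    also have "\<dots> \<le> h * (\<integral>\<^sup>+y\<in>{x..}. ?g y \<partial>lborel)"
      using R by (intro mult_left_mono nn_integral_mono)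
                 (auto simp: indicator_def intro!: mult_right_mono ennreal_leI mult_left_mono)
    finally show ?thesis .
  qed
  have "renewal_conv g w u = ennreal (exp (- R * u)) *
     renewal_conv ?g (\<lambda>x. a x + h * (\<integral>\<^sup>+y\<in>{0..x}. a y \<partial>lborel)) u"
    unfolding w_def by (rule renewal_conv_tilt) measurable
  also have "\<dots> \<le> ennreal (exp (- R * u)) * (h * (\<integral>\<^sup>+y\<in>{0..u}. a y \<partial>lborel))"
    by (intro mult_left_mono renewal_supersolution_proper mass haz) auto
  finally show ?thesis unfolding w_def by (simp add: distrib_left add.commute add_left_mono)
qed

lemma nn_integral_tail_integral:
  fixes f :: "real \<Rightarrow> ennreal"
  assumes [measurable]: "f \<in> borel_measurable borel" and K: "0 \<le> K"
  shows "(\<integral>\<^sup>+u\<in>{0..}. (\<integral>\<^sup>+x\<in>{u + K..}. f x \<partial>lborel) \<partial>lborel)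
       = (\<integral>\<^sup>+x\<in>{0..}. ennreal (x - K) * f x \<partial>lborel)"
proof -
  let ?k = "\<lambda>x u. f x * (if 0 \<le> u \<and> u \<le> x - K then 1 else 0)"
  have "(\<integral>\<^sup>+u\<in>{0..}. (\<integral>\<^sup>+x\<in>{u + K..}. f x \<partial>lborel) \<partial>lborel)
      = (\<integral>\<^sup>+u. \<integral>\<^sup>+x. ?k x u \<partial>lborel \<partial>lborel)"
    by (rule nn_integral_cong, subst nn_integral_multc[symmetric], measurable)
       (intro nn_integral_cong, auto simp: indicator_def)
  also have "\<dots> = (\<integral>\<^sup>+x. \<integral>\<^sup>+u. ?k x u \<partial>lborel \<partial>lborel)"
    by (rule lborel_pair.Fubini') measurable
  also have "\<dots> = (\<integral>\<^sup>+x\<in>{0..}. ennreal (x - K) * f x \<partial>lborel)"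
  proof (rule nn_integral_cong)
    fix x
    have "(\<integral>\<^sup>+u. ?k x u \<partial>lborel) = (\<integral>\<^sup>+u. f x * indicator {0..x - K} u \<partial>lborel)"
      by (intro nn_integral_cong) (auto simp: indicator_def)
    also have "\<dots> = f x * emeasure lborel {0..x - K}"
      by (subst nn_integral_cmult_indicator) auto
    also have "emeasure lborel {0..x - K} = ennreal (x - K) * indicator {0..} x"
      using K by (auto simp: indicator_def emeasure_lborel_Icc_eq ennreal_neg)
    finally show "(\<integral>\<^sup>+u. ?k x u \<partial>lborel) = ennreal (x - K) * f x * indicator {0..} x"
      by (simp add: mult_ac)
  qed
  finally show ?thesis .
qed

locale tilted_density =
  fixes g :: "real \<Rightarrow> ennreal" and R q h D :: real and k :: nat
  assumes g_measurable [measurable]: "g \<in> borel_measurable borel"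
    and R_pos: "0 < R" and h_nonneg: "0 \<le> h" and D_pos: "0 < D" and q: "0 \<le> q" "q < 1" and k: "2 \<le> k"
    and defective: "(\<integral>\<^sup>+x\<in>{0..}. g x \<partial>lborel) \<le> ennreal q"
    and tilted_mass: "(\<integral>\<^sup>+x\<in>{0..}. ennreal (exp (R * x)) * g x \<partial>lborel) = 1"
    and hazard: "\<And>x. 0 \<le> x \<Longrightarrow> g x \<le> ennreal h * (\<integral>\<^sup>+y\<in>{x..}. g y \<partial>lborel)"
    and tilted_moment: "\<And>i. i \<le> k \<Longrightarrow>
      (\<integral>\<^sup>+x\<in>{0..}. ennreal (x ^ i) * (ennreal (exp (R * x)) * g x) \<partial>lborel) \<le> ennreal D"
begin

abbreviation tilt :: "real \<Rightarrow> ennreal" where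
  "tilt x \<equiv> ennreal (exp (R * x)) * g x"

text \<open>
  The supersolution has to be bounded in \<open>u\<close>, hence both the supremum and the integral of the tilted
  forcing term enter.
\<close>

lemma renewal_upper_bound:
  assumes [measurable]: "a \<in> borel_measurable borel"
    and bdd: "\<And>u. 0 \<le> u \<Longrightarrow> v u \<le> ennreal V"
    and sub: "\<And>u. 0 \<le> u \<Longrightarrow> v u \<le> renewal_conv g v u + ennreal (exp (- R * u)) * a u"
    and a_le: "\<And>u. 0 \<le> u \<Longrightarrow> a u \<le> A" and a_int: "(\<integral>\<^sup>+u\<in>{0..}. a u \<partial>lborel) \<le> A"
    and u: "0 \<le> u"
  shows "v u \<le> ennreal (exp (- R * u)) * ((1 + ennreal h) * A)"
proof -
  let ?w = "\<lambda>x. ennreal (exp (- R * x)) * (a x + ennreal h * (\<integral>\<^sup>+y\<in>{0..x}. a y \<partial>lborel))"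
  have "v u \<le> ?w u"
  proof (rule renewal_comparison[OF g_measurable _ defective q bdd sub _ u])
    show "?w \<in> borel_measurable borel" by measurable
    show "renewal_conv g ?w u + ennreal (exp (- R * u)) * a u \<le> ?w u" for u
      using R_pos by (intro renewal_supersolution hazard tilted_mass) auto
  qed
  also have "a u + ennreal h * (\<integral>\<^sup>+y\<in>{0..u}. a y \<partial>lborel) \<le> A + ennreal h * A"
  proof (intro add_mono mult_left_mono a_le u)
    have "(\<integral>\<^sup>+y\<in>{0..u}. a y \<partial>lborel) \<le> (\<integral>\<^sup>+y\<in>{0..}. a y \<partial>lborel)"
      by (intro nn_integral_mono) (auto simp: indicator_def)
    then show "(\<integral>\<^sup>+y\<in>{0..u}. a y \<partial>lborel) \<le> A" using a_int by (rule order_trans)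
  qed auto
  finally show ?thesis by (simp add: mult_left_mono distrib_right)
qed

definition cutoff :: real where "cutoff = 2 * (1 + h) * D"

text \<open>
  The function \<open>exp (- R u)\<close> solves the renewal equation with forcing term \<open>exp (- R u) * G u\<close>, where
  \<open>G\<close> is the tail of the tilted kernel. The part of this forcing term with jumps shorter than \<open>u + cutoff\<close> is at
  most \<open>exp (R * cutoff)\<close> times the untilted tail, so a multiple of \<open>\<psi>\<close> pays for it. The rest is controlled by
  \<open>renewal_supersolution\<close>, and the cutoff is chosen so that this correction is at most half of \<open>exp (- R u)\<close>.
\<close>

lemma ruin_functional_lower_bound:
  assumes [measurable]: "\<psi> \<in> borel_measurable borel"
    and super: "\<And>u. 0 \<le> u \<Longrightarrow> renewal_conv g \<psi> u + (\<integral>\<^sup>+x\<in>{u..}. g x \<partial>lborel) \<le> \<psi> u"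
    and u: "0 \<le> u"
  shows "ennreal (exp (- R * u)) \<le> 2 * ennreal (exp (R * cutoff)) * \<psi> u"
proof -
  let ?K = cutoff
  have K: "0 < ?K" using h_nonneg D_pos by (auto simp: cutoff_def)
  define G where "G u = (\<integral>\<^sup>+x\<in>{u..}. tilt x \<partial>lborel)" for u
  define a where "a u = G (u + ?K)" for u
  have [measurable]: "G \<in> borel_measurable borel" "a \<in> borel_measurable borel"
    unfolding a_def[abs_def] G_def[abs_def] by measurable
  define w where "w x = ennreal (exp (- R * x)) * (a x + ennreal h * (\<integral>\<^sup>+y\<in>{0..x}. a y \<partial>lborel))" for x
  have [measurable]: "w \<in> borel_measurable borel" unfolding w_def[abs_def] by measurable
  \<comment> \<open>The multiple of \<open>\<psi>\<close> pays for jumps that are too short, \<open>w\<close> for the others.\<close>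
  define z where "z x = ennreal (exp (R * ?K)) * \<psi> x + w x" for x
  have a0: "a u \<le> ennreal (D / ?K)" if "0 \<le> u" for u
  proof -
    have "a u \<le> (\<integral>\<^sup>+x. ennreal (1 / ?K) * (ennreal (x ^ 1) * tilt x * indicator {0..} x) \<partial>lborel)"
      unfolding a_def G_def
    proof (intro nn_integral_mono)
      fix x
      have "tilt x \<le> ennreal (1 / ?K) * (ennreal (x ^ 1) * tilt x)" if "?K \<le> x"
      proof -
        have "1 \<le> ennreal (1 / ?K * x)" using that K by (auto simp: field_simps)
        also have "\<dots> = ennreal (1 / ?K) * ennreal (x ^ 1)"
          using that K by (subst ennreal_mult[symmetric]) auto
        finally have "1 * tilt x \<le> ennreal (1 / ?K) * ennreal (x ^ 1) * tilt x"
          by (rule mult_right_mono) simp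
        then show ?thesis by (simp only: mult_ac mult_1_left)
      qed
      then show "tilt x * indicator {u + ?K..} x
          \<le> ennreal (1 / ?K) * (ennreal (x ^ 1) * tilt x * indicator {0..} x)"
        using that K by (auto simp: indicator_def)
    qed
    also have "\<dots> = ennreal (1 / ?K) * (\<integral>\<^sup>+x\<in>{0..}. ennreal (x ^ 1) * tilt x \<partial>lborel)"
      by (rule nn_integral_cmult) auto
    also have "\<dots> \<le> ennreal (1 / ?K) * ennreal D"
      using k by (intro mult_left_mono tilted_moment) auto
    also have "\<dots> = ennreal (D / ?K)" using K D_pos by (simp add: ennreal_mult'[symmetric])
    finally show ?thesis .
  qed
  have a1: "(\<integral>\<^sup>+u\<in>{0..}. a u \<partial>lborel) \<le> ennreal (D / ?K)"
  proof -
    have "(\<integral>\<^sup>+u\<in>{0..}. a u \<partial>lborel) = (\<integral>\<^sup>+x\<in>{0..}. ennreal (x - ?K) * tilt x \<partial>lborel)"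
      unfolding a_def G_def using K by (subst nn_integral_tail_integral) auto
    also have "\<dots> \<le> (\<integral>\<^sup>+x. ennreal (1 / ?K) * (ennreal (x ^ 2) * tilt x * indicator {0..} x) \<partial>lborel)"
    proof (intro nn_integral_mono)
      fix x
      have "ennreal (x - ?K) \<le> ennreal (1 / ?K * x ^ 2)" if "0 \<le> x"
      proof (intro ennreal_leI)
        have "(x - ?K) * ?K \<le> x ^ 2"
          using sum_squares_bound[of x ?K] mult_nonneg_nonneg[of x ?K] that K
          unfolding power2_eq_square left_diff_distrib by linarith
        then show "x - ?K \<le> 1 / ?K * x ^ 2" using K by (simp add: field_simps)
      qed
      moreover have "ennreal (1 / ?K * x ^ 2) = ennreal (1 / ?K) * ennreal (x ^ 2)"
        using K by (subst ennreal_mult[symmetric]) auto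
      ultimately have "ennreal (x - ?K) * tilt x \<le> ennreal (1 / ?K) * ennreal (x ^ 2) * tilt x" if "0 \<le> x"
        using that by (intro mult_right_mono) auto
      then have "ennreal (x - ?K) * tilt x \<le> ennreal (1 / ?K) * (ennreal (x ^ 2) * tilt x)" if "0 \<le> x"
        using that by (simp only: mult.assoc)
      then show "ennreal (x - ?K) * tilt x * indicator {0..} x
          \<le> ennreal (1 / ?K) * (ennreal (x ^ 2) * tilt x * indicator {0..} x)"
        by (auto simp: indicator_def)
    qed
    also have "\<dots> = ennreal (1 / ?K) * (\<integral>\<^sup>+x\<in>{0..}. ennreal (x ^ 2) * tilt x \<partial>lborel)"
      by (rule nn_integral_cmult) auto
    also have "\<dots> \<le> ennreal (1 / ?K) * ennreal D"
      using k by (intro mult_left_mono tilted_moment) auto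
    also have "\<dots> = ennreal (D / ?K)" using K D_pos by (simp add: ennreal_mult'[symmetric])
    finally show ?thesis .
  qed
  have w_le: "w u \<le> ennreal (exp (- R * u)) * ennreal (1 / 2)" if "0 \<le> u" for u
  proof -
    have "(\<integral>\<^sup>+y\<in>{0..u}. a y \<partial>lborel) \<le> (\<integral>\<^sup>+y\<in>{0..}. a y \<partial>lborel)"
      by (intro nn_integral_mono) (auto simp: indicator_def)
    also note a1
    finally have "a u + ennreal h * (\<integral>\<^sup>+y\<in>{0..u}. a y \<partial>lborel)
        \<le> ennreal (D / ?K) + ennreal h * ennreal (D / ?K)"
      by (intro add_mono mult_left_mono a0 that) auto
    also have "\<dots> = ennreal ((1 + h) * (D / ?K))"
      using h_nonneg D_pos K by (simp add: ennreal_mult'[symmetric] ennreal_plus[symmetric] distrib_right add_divide_distrib del: ennreal_plus)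
    also have "(1 + h) * (D / ?K) = 1 / 2"
      using h_nonneg D_pos by (simp add: cutoff_def)
    finally show ?thesis unfolding w_def by (intro mult_left_mono) auto
  qed
  have "ennreal (exp (- R * u)) \<le> z u"
  proof (rule renewal_comparison[where g=g and f="\<lambda>u. ennreal (exp (- R * u)) * G u" and V=1,
        OF g_measurable _ defective q _ _ _ u])
    show "z \<in> borel_measurable borel" unfolding z_def[abs_def] by measurable
    show "ennreal (exp (- R * u)) \<le> ennreal 1" if "0 \<le> u" for u
      using that R_pos by (intro ennreal_leI) auto
    show "ennreal (exp (- R * u)) \<le> renewal_conv g (\<lambda>x. ennreal (exp (- R * x))) u + ennreal (exp (- R * u)) * G u"
      if "0 \<le> u" for u
    proof -
      have "renewal_conv g (\<lambda>x. ennreal (exp (- R * x)) * 1) u + ennreal (exp (- R * u)) * G u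
         = ennreal (exp (- R * u)) * ((\<integral>\<^sup>+x\<in>{0..u}. tilt x \<partial>lborel) + G u)"
        by (subst renewal_conv_tilt) (auto simp: renewal_conv_def distrib_left)
      also have "(\<integral>\<^sup>+x\<in>{0..u}. tilt x \<partial>lborel) + G u = 1"
        unfolding G_def using nn_integral_split_at[of tilt u] that tilted_mass by simp
      finally show ?thesis by simp
    qed
    show "renewal_conv g z u + ennreal (exp (- R * u)) * G u \<le> z u" if "0 \<le> u" for u
    proof -
      have split: "ennreal (exp (- R * u)) * G u
          \<le> ennreal (exp (R * ?K)) * (\<integral>\<^sup>+x\<in>{u..}. g x \<partial>lborel) + ennreal (exp (- R * u)) * a u"
      proof -
        have "ennreal (exp (- R * u)) * G u = (\<integral>\<^sup>+x. ennreal (exp (- R * u)) * (tilt x * indicator {u..} x) \<partial>lborel)"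
          unfolding G_def by (rule nn_integral_cmult[symmetric]) auto
        also have "\<dots> \<le> (\<integral>\<^sup>+x. ennreal (exp (R * ?K)) * (g x * indicator {u..} x)
             + ennreal (exp (- R * u)) * (tilt x * indicator {u + ?K..} x) \<partial>lborel)"
        proof (intro nn_integral_mono)
          fix x
          have "ennreal (exp (- R * u)) * tilt x \<le> ennreal (exp (R * ?K)) * g x" if "x \<le> u + ?K"
          proof -
            have "exp (- R * u) * exp (R * x) \<le> exp (R * ?K)"
              using mult_left_mono[OF that, of R] R_pos by (simp add: exp_add[symmetric] algebra_simps)
            then have "ennreal (exp (- R * u) * exp (R * x)) * g x \<le> ennreal (exp (R * ?K)) * g x"
              by (intro mult_right_mono ennreal_leI) auto
            then show ?thesis by (simp add: ennreal_mult mult_ac)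
          qed
          then show "ennreal (exp (- R * u)) * (tilt x * indicator {u..} x)
             \<le> ennreal (exp (R * ?K)) * (g x * indicator {u..} x)
             + ennreal (exp (- R * u)) * (tilt x * indicator {u + ?K..} x)"
            by (auto simp: indicator_def)
        qed
        also have "\<dots> = ennreal (exp (R * ?K)) * (\<integral>\<^sup>+x\<in>{u..}. g x \<partial>lborel) + ennreal (exp (- R * u)) * a u"
          unfolding a_def G_def by (simp add: nn_integral_add nn_integral_cmult)
        finally show ?thesis .
      qed
      have "renewal_conv g z u = ennreal (exp (R * ?K)) * renewal_conv g \<psi> u + renewal_conv g w u"
        unfolding z_def by (simp add: renewal_conv_add renewal_conv_cmult)
      then have "renewal_conv g z u + ennreal (exp (- R * u)) * G u
         \<le> ennreal (exp (R * ?K)) * (renewal_conv g \<psi> u + (\<integral>\<^sup>+x\<in>{u..}. g x \<partial>lborel))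
           + (renewal_conv g w u + ennreal (exp (- R * u)) * a u)"
        using add_left_mono[OF split, of "renewal_conv g z u"] by (simp add: distrib_left add_ac)
      also have "\<dots> \<le> z u"
        unfolding z_def
      proof (intro add_mono mult_left_mono super that)
        show "renewal_conv g w u + ennreal (exp (- R * u)) * a u \<le> w u"
          unfolding w_def using R_pos by (intro renewal_supersolution hazard tilted_mass) auto
      qed auto
      finally show ?thesis .
    qed
  qed
  also have "z u \<le> ennreal (exp (R * ?K)) * \<psi> u + ennreal (exp (- R * u)) * ennreal (1 / 2)"
    unfolding z_def by (intro add_left_mono w_le u)
  finally have le: "ennreal (exp (- R * u)) \<le> ennreal (exp (R * ?K)) * \<psi> u + ennreal (exp (- R * u)) * ennreal (1 / 2)" .
  show ?thesis
  proof (cases "\<psi> u")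
    case (real r)
    have "ennreal (exp (R * ?K) * r + exp (- R * u) * (1 / 2))
        = ennreal (exp (R * ?K) * r) + ennreal (exp (- R * u) * (1 / 2))"
      using real by (intro ennreal_plus) auto
    moreover have "ennreal (exp (R * ?K) * r) = ennreal (exp (R * ?K)) * \<psi> u"
      using real by (simp add: ennreal_mult')
    moreover have "ennreal (exp (- R * u) * (1 / 2)) = ennreal (exp (- R * u)) * ennreal (1 / 2)"
      by (rule ennreal_mult') simp
    ultimately have "ennreal (exp (R * ?K)) * \<psi> u + ennreal (exp (- R * u)) * ennreal (1 / 2)
        = ennreal (exp (R * ?K) * r + exp (- R * u) * (1 / 2))" by simp
    with le have "ennreal (exp (- R * u)) \<le> ennreal (exp (R * ?K) * r + exp (- R * u) * (1 / 2))"
      by (simp only:)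
    then have "exp (- R * u) \<le> exp (R * ?K) * r + exp (- R * u) * (1 / 2)"
      using real by (subst (asm) ennreal_le_iff) auto
    then have "exp (- R * u) \<le> 2 * exp (R * ?K) * r" by simp
    then have "ennreal (exp (- R * u)) \<le> ennreal (2 * exp (R * ?K) * r)" by (rule ennreal_leI)
    also have "\<dots> = 2 * ennreal (exp (R * ?K)) * \<psi> u" using real by (simp add: ennreal_mult)
    finally show ?thesis .
  qed (simp add: ennreal_mult_top)
qed

end

section \<open>The integrated tail of the claims\<close>

locale risk_process = prob_space M for M :: "'a measure" +
  fixes c lam :: real and N :: "real \<Rightarrow> 'a \<Rightarrow> nat" and Z :: "nat \<Rightarrow> 'a \<Rightarrow> real"
  assumes model: "reserve_model M c lam N Z"
begin

lemma c_pos: "0 < c" and lam_pos: "0 < lam"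
  using model by (auto simp: reserve_model_def)

definition claim_law :: "real measure" where "claim_law = distr M borel (Z 1)"

abbreviation claim_tail :: "real \<Rightarrow> real" where "claim_tail x \<equiv> 1 - claim_cdf M Z x"

lemma claim_measurable: "1 \<le> i \<Longrightarrow> Z i \<in> borel_measurable M"
  using model by (auto simp: reserve_model_def indep_vars_def)

lemma first_claim_measurable [measurable]: "Z (Suc 0) \<in> borel_measurable M"
  by (rule claim_measurable) simp

sublocale claim: real_distribution claim_law
  unfolding claim_law_def by (intro real_distribution_distr) simp

lemma first_claim_pos: "AE \<omega> in M. 0 < Z (Suc 0) \<omega>"
  using model by (simp add: reserve_model_def)

lemma claim_pos: "AE z in claim_law. 0 < z"
  unfolding claim_law_def using first_claim_pos by (subst AE_distr_iff) auto

lemma claim_cdf_eq: "claim_cdf M Z = cdf claim_law"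
  by (simp add: claim_cdf_def claim_law_def)

lemma claim_tail_eq_measure: "claim_tail x = measure claim_law {x<..}"
proof -
  have "measure claim_law (UNIV - {..x}) = measure claim_law UNIV - measure claim_law {..x}"
    by (intro claim.finite_measure_Diff) auto
  moreover have "UNIV - {..x} = {x<..}" by auto
  ultimately show ?thesis using claim.prob_space by (simp add: claim_cdf_eq cdf_def)
qed

lemma claim_tail_pos: "0 < claim_tail x"
  using model by (auto simp: reserve_model_def)

lemma claim_tail_le_1: "claim_tail x \<le> 1"
  by (simp add: claim_tail_eq_measure)

lemma claim_tail_antimono: "x \<le> y \<Longrightarrow> claim_tail y \<le> claim_tail x"
  unfolding claim_tail_eq_measure by (intro claim.finite_measure_mono) auto

lemma claim_tail_0: "claim_tail 0 = 1"
  unfolding claim_tail_eq_measure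
  by (subst claim.prob_eq_1) (use claim_pos in auto)

lemma claim_cdf_measurable [measurable]: "claim_cdf M Z \<in> borel_measurable borel"
  unfolding claim_cdf_eq by (intro borel_measurable_mono monoI claim.cdf_nondecreasing)

lemma claim_tail_right_continuous: "continuous (at_right x) claim_tail"
  unfolding claim_cdf_eq by (intro continuous_intros claim.cdf_is_right_cont)

lemma emeasure_claim_law_greaterThan: "emeasure claim_law {x<..} = ennreal (claim_tail x)"
  by (simp add: claim_tail_eq_measure claim.emeasure_eq_measure)

text \<open>
  Integration by parts for the claim law, in the form of Tonelli's theorem.
\<close>

lemma nn_integral_claim_tail:
  fixes w :: "real \<Rightarrow> ennreal"
  assumes [measurable]: "w \<in> borel_measurable borel"
  shows "(\<integral>\<^sup>+x\<in>{0..}. w x * ennreal (claim_tail x) \<partial>lborel)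
       = (\<integral>\<^sup>+z. (\<integral>\<^sup>+x\<in>{0..<z}. w x \<partial>lborel) \<partial>claim_law)"
proof -
  interpret P: pair_sigma_finite claim_law lborel ..
  have "(\<integral>\<^sup>+x\<in>{0..}. w x * ennreal (claim_tail x) \<partial>lborel)
      = (\<integral>\<^sup>+x. \<integral>\<^sup>+z. w x * (if 0 \<le> x \<and> x < z then 1 else 0) \<partial>claim_law \<partial>lborel)"
  proof (rule nn_integral_cong)
    fix x
    have "(\<integral>\<^sup>+z. w x * (if 0 \<le> x \<and> x < z then 1 else 0) \<partial>claim_law)
        = (\<integral>\<^sup>+z. (w x * indicator {0..} x) * indicator {x<..} z \<partial>claim_law)"
      by (intro nn_integral_cong) (auto simp: indicator_def)
    also have "\<dots> = (w x * indicator {0..} x) * ennreal (claim_tail x)"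
      by (subst nn_integral_cmult_indicator) (simp_all add: emeasure_claim_law_greaterThan)
    finally show "w x * ennreal (claim_tail x) * indicator {0..} x =
        (\<integral>\<^sup>+z. w x * (if 0 \<le> x \<and> x < z then 1 else 0) \<partial>claim_law)" by (simp add: mult_ac)
  qed
  also have "\<dots> = (\<integral>\<^sup>+z. \<integral>\<^sup>+x. w x * (if 0 \<le> x \<and> x < z then 1 else 0) \<partial>lborel \<partial>claim_law)"
    by (rule P.Fubini') measurable
  also have "\<dots> = (\<integral>\<^sup>+z. (\<integral>\<^sup>+x\<in>{0..<z}. w x \<partial>lborel) \<partial>claim_law)"
    by (intro nn_integral_cong) (auto simp: indicator_def)
  finally show ?thesis .
qed

end

locale lundberg_model = risk_process +
  fixes R :: real
  assumes adjustment: "adjustment_coefficient M c lam Z R"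
begin

abbreviation \<theta> :: real where "\<theta> \<equiv> safety_loading M c lam Z"

lemma R_pos: "0 < R"
  using adjustment by (simp add: adjustment_coefficient_def)

lemma mean_claim_pos: "0 < claim_moment M Z 1"
proof -
  have "0 \<le> claim_moment M Z 1"
    unfolding claim_moment_def
    using first_claim_pos by (intro integral_nonneg_AE) (auto elim: eventually_mono)
  moreover have "claim_moment M Z 1 \<noteq> 0"
    using adjustment by (auto simp: adjustment_coefficient_def f_I_def)
  ultimately show ?thesis by simp
qed

lemma claim_integrable: "integrable M (Z (Suc 0))"
  using mean_claim_pos not_integrable_integral_eq[of M "Z (Suc 0)"]
  by (auto simp: claim_moment_def)

lemma integral_claim_tail: "(\<integral>\<^sup>+x\<in>{0..}. ennreal (claim_tail x) \<partial>lborel) = ennreal (claim_moment M Z 1)"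
proof -
  have "(\<integral>\<^sup>+x\<in>{0..}. ennreal (claim_tail x) \<partial>lborel)
      = (\<integral>\<^sup>+z. (\<integral>\<^sup>+x\<in>{0..<z}. 1 \<partial>lborel) \<partial>claim_law)"
    using nn_integral_claim_tail[of "\<lambda>_. 1"] by simp
  also have "\<dots> = (\<integral>\<^sup>+z. ennreal z \<partial>claim_law)"
    by (intro nn_integral_cong_AE eventually_mono[OF claim_pos]) auto
  also have "\<dots> = (\<integral>\<^sup>+\<omega>. ennreal (Z (Suc 0) \<omega>) \<partial>M)"
    unfolding claim_law_def by (subst nn_integral_distr) auto
  also have "\<dots> = ennreal (\<integral>\<omega>. Z (Suc 0) \<omega> \<partial>M)"
    using first_claim_pos by (intro nn_integral_eq_integral claim_integrable) (auto elim: eventually_mono)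
  finally show ?thesis by (simp add: claim_moment_def)
qed

lemma one_plus_loading: "1 + \<theta> = c / (lam * claim_moment M Z 1)" and one_plus_loading_pos: "0 < 1 + \<theta>"
  using c_pos lam_pos mean_claim_pos by (simp_all add: safety_loading_def)

definition ladder_density :: "real \<Rightarrow> ennreal" where
  "ladder_density x = ennreal (lam / c * claim_tail x)"

lemma ladder_density_measurable [measurable]: "ladder_density \<in> borel_measurable borel"
  unfolding ladder_density_def[abs_def] by measurable

lemma f_I_over_loading: "f_I M Z x / (1 + \<theta>) = lam / c * claim_tail x"
  using c_pos lam_pos mean_claim_pos unfolding one_plus_loading f_I_def by (simp add: field_simps)

lemma f_I_eq_ladder: "ennreal (f_I M Z x) = ennreal (1 + \<theta>) * ladder_density x"
  using one_plus_loading_pos f_I_over_loading[of x]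
  by (simp add: ladder_density_def ennreal_mult'[symmetric] field_simps)

lemma tilted_ladder_mass: "(\<integral>\<^sup>+x\<in>{0..}. ennreal (exp (R * x)) * ladder_density x \<partial>lborel) = 1"
proof -
  have "(\<integral>\<^sup>+x\<in>{0..}. ennreal (exp (R * x)) * ladder_density x \<partial>lborel)
     = (\<integral>\<^sup>+x\<in>{0..}. ennreal (exp (R * x) * f_I M Z x / (1 + \<theta>)) \<partial>lborel)"
  proof (rule nn_integral_cong)
    fix x
    have "exp (R * x) * f_I M Z x / (1 + \<theta>) = exp (R * x) * (lam / c * claim_tail x)"
      by (simp only: f_I_over_loading[symmetric] times_divide_eq_right)
    then show "ennreal (exp (R * x)) * ladder_density x * indicator {0..} x
        = ennreal (exp (R * x) * f_I M Z x / (1 + \<theta>)) * indicator {0..} x"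
      by (simp only: ladder_density_def ennreal_mult' exp_ge_zero)
  qed
  then show ?thesis using adjustment by (simp add: adjustment_coefficient_def)
qed

lemma ladder_mass: "(\<integral>\<^sup>+x\<in>{0..}. ladder_density x \<partial>lborel) = ennreal (1 / (1 + \<theta>))"
proof -
  have "(\<integral>\<^sup>+x\<in>{0..}. ladder_density x \<partial>lborel) 
     = (\<integral>\<^sup>+x. ennreal (lam / c) * (ennreal (claim_tail x) * indicator {0..} x) \<partial>lborel)"
    unfolding ladder_density_def using lam_pos c_pos
    by (intro nn_integral_cong, subst ennreal_mult') (auto simp: mult_ac)
  also have "\<dots> = ennreal (lam / c) * ennreal (claim_moment M Z 1)"
    by (subst nn_integral_cmult) (auto simp: integral_claim_tail)
  also have "\<dots> = ennreal (1 / (1 + \<theta>))"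
    using lam_pos c_pos mean_claim_pos by (subst ennreal_mult[symmetric]) (auto simp: one_plus_loading)
  finally show ?thesis .
qed

text \<open>
  A positive loading is forced by the existence of an adjustment coefficient: tilting by a positive
  exponent strictly increases the mass of the ladder density. Unbounded claims make the increase on
  \<open>[1,2]\<close> strictly positive.
\<close>

lemma loading_pos: "0 < \<theta>"
proof -
  define \<delta> where "\<delta> = R * (lam / c * claim_tail 2)"
  have \<delta>: "0 < \<delta>" unfolding \<delta>_def using R_pos lam_pos c_pos claim_tail_pos by simp
  have "ennreal (1 / (1 + \<theta>)) + ennreal \<delta>
      = (\<integral>\<^sup>+x\<in>{0..}. ladder_density x \<partial>lborel) + (\<integral>\<^sup>+x. ennreal \<delta> * indicator {1..2::real} x \<partial>lborel)"
    by (subst nn_integral_cmult_indicator) (auto simp: ladder_mass)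
  also have "\<dots> = (\<integral>\<^sup>+x. ladder_density x * indicator {0..} x + ennreal \<delta> * indicator {1..2} x \<partial>lborel)"
    by (rule nn_integral_add[symmetric]) auto
  also have "\<dots> \<le> (\<integral>\<^sup>+x\<in>{0..}. ennreal (exp (R * x)) * ladder_density x \<partial>lborel)"
  proof (rule nn_integral_mono)
    fix x :: real
    have big: "ladder_density x + ennreal \<delta> \<le> ennreal (exp (R * x)) * ladder_density x" if "1 \<le> x" "x \<le> 2"
    proof -
      let ?l = "lam / c * claim_tail x"
      have l: "0 \<le> ?l" "lam / c * claim_tail 2 \<le> ?l"
        using lam_pos c_pos claim_tail_pos[of x] claim_tail_antimono[OF that(2)]
        by (auto intro!: mult_left_mono divide_right_mono simp: less_imp_le)
      have "1 + R \<le> exp (R * x)"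
        using exp_ge_add_one_self[of "R * x"] mult_left_mono[OF that(1), of R] R_pos by linarith
      then have "(1 + R) * ?l \<le> exp (R * x) * ?l" using l by (intro mult_right_mono) auto
      moreover have "\<delta> \<le> R * ?l" unfolding \<delta>_def using mult_left_mono[OF l(2), of R] R_pos by simp
      ultimately have "?l + \<delta> \<le> exp (R * x) * ?l" by (simp only: distrib_right mult_1_left)
      then have "ennreal (?l + \<delta>) \<le> ennreal (exp (R * x) * ?l)" by (rule ennreal_leI)
      moreover have "ennreal (?l + \<delta>) = ennreal ?l + ennreal \<delta>"
        using l \<delta> by (intro ennreal_plus) auto
      moreover have "ennreal (exp (R * x) * ?l) = ennreal (exp (R * x)) * ennreal ?l"
        by (intro ennreal_mult') auto
      ultimately show ?thesis unfolding ladder_density_def by (simp only:)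
    qed
    have small: "ladder_density x \<le> ennreal (exp (R * x)) * ladder_density x" if "0 \<le> x"
    proof -
      have "1 \<le> ennreal (exp (R * x))" using that R_pos by auto
      from mult_right_mono[OF this, of "ladder_density x"] show ?thesis by simp
    qed
    show "ladder_density x * indicator {0..} x + ennreal \<delta> * indicator {1..2} x
       \<le> ennreal (exp (R * x)) * ladder_density x * indicator {0..} x"
      using big small by (auto simp: indicator_def)
  qed
  also have "\<dots> = 1" by (rule tilted_ladder_mass)
  finally have "ennreal (1 / (1 + \<theta>) + \<delta>) \<le> ennreal 1"
    using one_plus_loading_pos \<delta> by simp
  then have "1 / (1 + \<theta>) < 1" using \<delta> by (subst (asm) ennreal_le_iff) auto
  then show ?thesis using one_plus_loading_pos by (simp add: divide_less_eq)
qed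

lemma f_I_pos: "0 < f_I M Z x"
  using claim_tail_pos mean_claim_pos by (simp add: f_I_def)

lemma f_I_le: "f_I M Z x \<le> 1 / claim_moment M Z 1"
  using claim_tail_le_1 mean_claim_pos by (simp add: f_I_def divide_right_mono)

lemma f_I_measurable [measurable]: "f_I M Z \<in> borel_measurable borel"
  unfolding f_I_def[abs_def] by measurable

lemma f_I_mass: "(\<integral>\<^sup>+x\<in>{0..}. ennreal (f_I M Z x) \<partial>lborel) = 1"
proof -
  have "(\<integral>\<^sup>+x\<in>{0..}. ennreal (f_I M Z x) \<partial>lborel)
      = (\<integral>\<^sup>+x. ennreal (1 + \<theta>) * (ladder_density x * indicator {0..} x) \<partial>lborel)"
    by (simp add: f_I_eq_ladder mult_ac)
  also have "\<dots> = ennreal (1 + \<theta>) * ennreal (1 / (1 + \<theta>))"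
    by (subst nn_integral_cmult) (auto simp: ladder_mass)
  also have "\<dots> = 1" using loading_pos by (subst ennreal_mult[symmetric]) auto
  finally show ?thesis .
qed

lemma F_I_eq: "ennreal (F_I M Z x) = (\<integral>\<^sup>+y\<in>{0..x}. ennreal (f_I M Z y) \<partial>lborel)"
proof -
  have "(\<integral>\<^sup>+y\<in>{0..x}. ennreal (f_I M Z y) \<partial>lborel) = (\<integral>\<^sup>+y. ennreal (indicator {0..x} y *\<^sub>R f_I M Z y) \<partial>lborel)"
    by (intro nn_integral_cong) (auto simp: indicator_def)
  also have "\<dots> = ennreal (\<integral>y. indicator {0..x} y *\<^sub>R f_I M Z y \<partial>lborel)"
  proof (rule nn_integral_eq_integral)
    show "integrable lborel (\<lambda>y. indicator {0..x} y *\<^sub>R f_I M Z y)"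
      by (intro integrableI_bounded_set_indicator[where B="1 / claim_moment M Z 1"])
         (use f_I_le f_I_pos in \<open>auto simp: less_imp_le emeasure_lborel_Icc_eq\<close>)
  qed (use f_I_pos in \<open>auto simp: less_imp_le\<close>)
  finally show ?thesis by (simp add: F_I_def set_lebesgue_integral_def)
qed

lemma F_I_nonneg: "0 \<le> F_I M Z x"
  unfolding F_I_def set_lebesgue_integral_def
  using f_I_pos by (intro integral_nonneg_AE) (auto simp: less_imp_le)

lemma F_I_tail:
  assumes "0 \<le> x"
  shows "ennreal (1 - F_I M Z x) = (\<integral>\<^sup>+y\<in>{x..}. ennreal (f_I M Z y) \<partial>lborel)"
proof -
  have "ennreal (F_I M Z x) + (\<integral>\<^sup>+y\<in>{x..}. ennreal (f_I M Z y) \<partial>lborel) = ennreal 1"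
    unfolding F_I_eq using nn_integral_split_at[of "\<lambda>y. ennreal (f_I M Z y)" x] assms f_I_mass by simp
  then show ?thesis
    using F_I_nonneg[of x] by (metis add.commute ennreal_add_diff_cancel_right ennreal_minus ennreal_neq_top)
qed

lemma F_I_less_1:
  assumes "0 \<le> x"
  shows "F_I M Z x < 1"
proof -
  have "0 < ennreal (f_I M Z (x + 1))" using f_I_pos by simp
  also have "\<dots> = (\<integral>\<^sup>+y. ennreal (f_I M Z (x + 1)) * indicator {x..x + 1} y \<partial>lborel)"
    by (subst nn_integral_cmult_indicator) auto
  also have "\<dots> \<le> (\<integral>\<^sup>+y\<in>{x..}. ennreal (f_I M Z y) \<partial>lborel)"
    using claim_tail_antimono mean_claim_pos
    by (intro nn_integral_mono) (auto simp: indicator_def f_I_def intro!: ennreal_leI divide_right_mono)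
  finally have "0 < ennreal (1 - F_I M Z x)" unfolding F_I_tail[OF assms] .
  then show ?thesis by simp
qed

text \<open>
  The hazard rate of \<open>f_I\<close> is unaffected by the normalising factor \<open>1 / (1 + \<theta>)\<close>.
\<close>

lemma ladder_hazard:
  assumes H: "h_I M Z \<le> ennreal H" and x: "0 \<le> x"
  shows "ladder_density x \<le> ennreal H * (\<integral>\<^sup>+y\<in>{x..}. ladder_density y \<partial>lborel)"
proof -
  let ?t = "1 - F_I M Z x"
  have t: "0 < ?t" using F_I_less_1[OF x] by simp
  have "ennreal (f_I M Z x / ?t) \<le> ennreal H"
    using x by (intro order_trans[OF _ H]) (auto simp: h_I_def intro!: SUP_upper)
  then have "ennreal (f_I M Z x / ?t) * ennreal ?t \<le> ennreal H * ennreal ?t" by (rule mult_right_mono) simp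
  also have "ennreal (f_I M Z x / ?t) * ennreal ?t = ennreal (f_I M Z x)"
    using t f_I_pos by (subst ennreal_mult[symmetric]) (auto simp: less_imp_le)
  also have "ennreal ?t = ennreal (1 + \<theta>) * (\<integral>\<^sup>+y\<in>{x..}. ladder_density y \<partial>lborel)"
    unfolding F_I_tail[OF x] by (subst nn_integral_cmult[symmetric]) (auto simp: f_I_eq_ladder mult_ac)
  finally have "ennreal (1 / (1 + \<theta>)) * ennreal (f_I M Z x)
      \<le> ennreal (1 / (1 + \<theta>)) * (ennreal H * (ennreal (1 + \<theta>) * (\<integral>\<^sup>+y\<in>{x..}. ladder_density y \<partial>lborel)))"
    by (rule mult_left_mono) simp
  moreover have "ennreal (1 / (1 + \<theta>)) * (ennreal (1 + \<theta>) * a) = a" for a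
    unfolding mult.assoc[symmetric] using loading_pos by (subst ennreal_mult[symmetric]) auto
  ultimately show ?thesis unfolding f_I_eq_ladder by (simp add: mult.left_commute[of "ennreal H"])
qed

text \<open>
  Powers below \<open>k\<close> are interpolated between the Lundberg equation (power \<open>0\<close>) and the moment
  bound (power \<open>k\<close>).
\<close>

lemma ladder_moment:
  assumes B: "exp_moment M c lam Z R k \<le> ennreal B" "0 \<le> B" and i: "i \<le> k"
  shows "(\<integral>\<^sup>+x\<in>{0..}. ennreal (x ^ i) * (ennreal (exp (R * x)) * ladder_density x) \<partial>lborel) \<le> ennreal (1 + B)"
proof -
  let ?t = "\<lambda>x. ennreal (exp (R * x)) * ladder_density x"
  have "(\<integral>\<^sup>+x\<in>{0..}. ennreal (x ^ i) * ?t x \<partial>lborel)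
      \<le> (\<integral>\<^sup>+x. ?t x * indicator {0..} x + ennreal (x ^ k) * ?t x * indicator {0..} x \<partial>lborel)"
  proof (rule nn_integral_mono)
    fix x :: real
    have "ennreal (x ^ i) * ?t x \<le> ?t x + ennreal (x ^ k) * ?t x" if "0 \<le> x"
    proof -
      have "x ^ i \<le> 1 + x ^ k"
      proof (cases "x \<le> 1")
        case True then show ?thesis using that by (smt (verit) power_le_one zero_le_power)
      next
        case False then show ?thesis using power_increasing[OF i, of x] by linarith
      qed
      then have "ennreal (x ^ i) * ?t x \<le> ennreal (1 + x ^ k) * ?t x"
        by (intro mult_right_mono ennreal_leI) auto
      then show ?thesis using that by (simp add: distrib_right)
    qed
    then show "ennreal (x ^ i) * ?t x * indicator {0..} x
      \<le> ?t x * indicator {0..} x + ennreal (x ^ k) * ?t x * indicator {0..} x"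
      by (auto simp: indicator_def)
  qed
  also have "\<dots> = 1 + (\<integral>\<^sup>+x\<in>{0..}. ennreal (x ^ k) * ?t x \<partial>lborel)"
    by (subst nn_integral_add) (auto simp: tilted_ladder_mass)
  also have "(\<integral>\<^sup>+x\<in>{0..}. ennreal (x ^ k) * ?t x \<partial>lborel) = exp_moment M c lam Z R k"
    unfolding exp_moment_def
  proof (rule nn_integral_cong)
    fix x :: real
    have "x ^ k * exp (R * x) * f_I M Z x / (1 + \<theta>) = x ^ k * (exp (R * x) * (lam / c * claim_tail x))"
      by (simp only: f_I_over_loading[symmetric] times_divide_eq_right mult.assoc)
    moreover have "ennreal (x ^ k) * ?t x = ennreal (x ^ k * (exp (R * x) * (lam / c * claim_tail x)))" if "0 \<le> x"
      using that by (simp only: ladder_density_def ennreal_mult' exp_ge_zero zero_le_power)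
    ultimately have "ennreal (x ^ k) * ?t x = ennreal (x ^ k * exp (R * x) * f_I M Z x / (1 + \<theta>))" if "0 \<le> x"
      using that by (simp only:)
    then show "ennreal (x ^ k) * ?t x * indicator {0..} x
        = ennreal (x ^ k * exp (R * x) * f_I M Z x / (1 + \<theta>)) * indicator {0..} x"
      by (auto split: split_indicator)
  qed
  also have "1 + exp_moment M c lam Z R k \<le> 1 + ennreal B" by (intro add_left_mono B)
  also have "\<dots> = ennreal (1 + B)" using B by simp
  finally show ?thesis .
qed

lemma hazard_bound_pos:
  assumes H: "h_I M Z \<le> ennreal H"
  shows "1 / claim_moment M Z 1 \<le> H"
proof -
  have "F_I M Z 0 = 0" 
    using F_I_eq[of 0] F_I_nonneg[of 0] 
      nn_integral_indicator_singleton[of "0::real" lborel "\<lambda>y. ennreal (f_I M Z y)"] by simp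
  then have "ennreal (1 / claim_moment M Z 1) = ennreal (f_I M Z 0 / (1 - F_I M Z 0))"
    by (simp add: f_I_def claim_tail_0)
  also have "\<dots> \<le> h_I M Z" unfolding h_I_def by (intro SUP_upper) auto
  finally have "ennreal (1 / claim_moment M Z 1) \<le> ennreal H" using H by (rule order_trans)
  then show ?thesis using mean_claim_pos by (simp add: ennreal_le_iff2 not_le)
qed

text \<open>
  Since \<open>f_I \<le> 1 / m_1 \<le> H\<close>, the distribution \<open>F_I\<close> has mass at least one half beyond \<open>1 / (2 H)\<close>, and the
  Lundberg equation then limits \<open>R\<close>. This keeps \<open>R\<close> bounded when the loading is.
\<close>

lemma exp_R_bound:
  assumes H: "h_I M Z \<le> ennreal H"
  shows "exp (R / (2 * H)) \<le> 2 * (1 + \<theta>)"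
proof -
  have m: "1 / claim_moment M Z 1 \<le> H" by (rule hazard_bound_pos[OF H])
  have H0: "0 < H" using m mean_claim_pos by (smt (verit) divide_pos_pos)
  define x where "x = 1 / (2 * H)"
  have x: "0 < x" "x * H = 1 / 2" using H0 by (auto simp: x_def)
  have "ennreal (F_I M Z x) \<le> (\<integral>\<^sup>+y. ennreal H * indicator {0..x} y \<partial>lborel)"
    unfolding F_I_eq using m f_I_le
    by (intro nn_integral_mono) (auto simp: indicator_def intro!: ennreal_leI intro: order_trans)
  also have "\<dots> = ennreal (H * x)"
    using H0 x by (subst nn_integral_cmult_indicator) (auto simp: ennreal_mult)
  finally have F: "F_I M Z x \<le> 1 / 2" using x H0 by (subst (asm) ennreal_le_iff) (auto simp: mult.commute)
  have "ennreal (exp (R * x) * (1 / 2)) \<le> ennreal (exp (R * x)) * ennreal (1 - F_I M Z x)"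
    unfolding ennreal_mult'[symmetric, OF exp_ge_zero] using F by (intro ennreal_leI mult_left_mono) auto
  also have "\<dots> = (\<integral>\<^sup>+y. ennreal (exp (R * x)) * (ennreal (f_I M Z y) * indicator {x..} y) \<partial>lborel)"
    unfolding F_I_tail[OF less_imp_le[OF x(1)]] by (rule nn_integral_cmult[symmetric]) auto
  also have "\<dots> \<le> (\<integral>\<^sup>+y. ennreal (1 + \<theta>) * (ennreal (exp (R * y)) * ladder_density y * indicator {0..} y) \<partial>lborel)"
    unfolding f_I_eq_ladder using R_pos x
    by (intro nn_integral_mono, subst mult.assoc, subst mult.left_commute)
       (auto simp: indicator_def intro!: mult_left_mono mult_right_mono ennreal_leI)
  also have "\<dots> = ennreal (1 + \<theta>)"
    by (subst nn_integral_cmult) (auto simp: tilted_ladder_mass)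
  finally show ?thesis using loading_pos by (subst (asm) ennreal_le_iff) (auto simp: x_def field_simps)
qed

text \<open>
  The Lundberg equation in the form of a moment generating function.
\<close>

lemma exp_claim: "(\<integral>\<^sup>+z. ennreal (exp (R * z)) \<partial>claim_law) = ennreal (1 + R * c / lam)"
proof -
  have "(\<integral>\<^sup>+z. ennreal (exp (R * z)) \<partial>claim_law)
     = (\<integral>\<^sup>+z. 1 + ennreal R * (\<integral>\<^sup>+x\<in>{0..<z}. ennreal (exp (R * x)) \<partial>lborel) \<partial>claim_law)"
  proof (rule nn_integral_cong_AE, use claim_pos in eventually_elim)
    fix z :: real assume z: "0 < z"
    have "(\<integral>\<^sup>+x\<in>{0..<z}. ennreal (exp (R * x)) \<partial>lborel) = (\<integral>\<^sup>+x\<in>{0..z}. ennreal (exp (R * x)) \<partial>lborel)"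
      by (intro nn_integral_cong_AE eventually_mono[OF AE_lborel_singleton[of z]]) (auto simp: indicator_def)
    also have "\<dots> = ennreal (exp (R * z) / R - exp (R * 0) / R)"
      using R_pos z by (intro nn_integral_FTC_Icc) (auto intro!: derivative_eq_intros)
    finally have "1 + ennreal R * (\<integral>\<^sup>+x\<in>{0..<z}. ennreal (exp (R * x)) \<partial>lborel)
        = ennreal 1 + ennreal (R * (exp (R * z) / R - exp (R * 0) / R))"
      using R_pos by (simp add: ennreal_mult')
    also have "\<dots> = ennreal (1 + R * (exp (R * z) / R - exp (R * 0) / R))"
      using R_pos z by (intro ennreal_plus[symmetric]) (auto simp: field_simps)
    finally show "ennreal (exp (R * z)) = 1 + ennreal R * (\<integral>\<^sup>+x\<in>{0..<z}. ennreal (exp (R * x)) \<partial>lborel)"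
      using R_pos by (simp add: field_simps)
  qed
  also have "\<dots> = 1 + ennreal R * (\<integral>\<^sup>+z. (\<integral>\<^sup>+x\<in>{0..<z}. ennreal (exp (R * x)) \<partial>lborel) \<partial>claim_law)"
  proof -
    have [measurable]: "(\<lambda>z. \<integral>\<^sup>+x\<in>{0..<z}. ennreal (exp (R * x)) \<partial>lborel) \<in> borel_measurable borel"
    proof -
      have "(\<lambda>z. \<integral>\<^sup>+x. ennreal (exp (R * x)) * (if 0 \<le> x \<and> x < z then 1 else 0) \<partial>lborel) \<in> borel_measurable borel"
        by measurable
      also have "(\<lambda>z. \<integral>\<^sup>+x. ennreal (exp (R * x)) * (if 0 \<le> x \<and> x < z then 1 else 0) \<partial>lborel)
         = (\<lambda>z. \<integral>\<^sup>+x\<in>{0..<z}. ennreal (exp (R * x)) \<partial>lborel)"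
        by (intro ext nn_integral_cong) (auto simp: indicator_def)
      finally show ?thesis .
    qed
    show ?thesis using claim.emeasure_space_1
      by (subst nn_integral_add) (auto simp: nn_integral_cmult)
  qed
  also have "(\<integral>\<^sup>+z. (\<integral>\<^sup>+x\<in>{0..<z}. ennreal (exp (R * x)) \<partial>lborel) \<partial>claim_law)
      = (\<integral>\<^sup>+x\<in>{0..}. ennreal (exp (R * x)) * ennreal (claim_tail x) \<partial>lborel)"
    by (rule nn_integral_claim_tail[symmetric]) auto
  also have "\<dots> = (\<integral>\<^sup>+x. ennreal (c / lam) * (ennreal (exp (R * x)) * ladder_density x * indicator {0..} x) \<partial>lborel)"
  proof (rule nn_integral_cong)
    fix x
    have "ennreal (c / lam) * ladder_density x = ennreal (claim_tail x)"
      unfolding ladder_density_def using c_pos lam_pos by (simp add: ennreal_mult'[symmetric])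
    then show "ennreal (exp (R * x)) * ennreal (claim_tail x) * indicator {0..} x
      = ennreal (c / lam) * (ennreal (exp (R * x)) * ladder_density x * indicator {0..} x)"
      by (metis mult.assoc mult.left_commute)
  qed
  also have "\<dots> = ennreal (c / lam)"
    by (subst nn_integral_cmult) (auto simp: tilted_ladder_mass)
  also have "1 + ennreal R * ennreal (c / lam) = ennreal (1 + R * c / lam)"
    using R_pos c_pos lam_pos by (simp add: ennreal_mult[symmetric] ennreal_plus[symmetric] ennreal_1[symmetric] del: ennreal_plus ennreal_1)
  finally show ?thesis .
qed

lemma ladder_tilted_density:
  assumes "h_I M Z \<le> ennreal H" "exp_moment M c lam Z R k \<le> ennreal B" "0 \<le> B" "2 \<le> k"
  shows "tilted_density ladder_density R (1 / (1 + \<theta>)) H (1 + B) k"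
proof
  show "0 \<le> H" using hazard_bound_pos[OF assms(1)] mean_claim_pos by (smt (verit) divide_pos_pos)
qed (use assms R_pos loading_pos ladder_mass tilted_ladder_mass ladder_hazard ladder_moment in auto)

end

section \<open>The instant of ruin and measurability of the surplus before ruin\<close>

text \<open>
  The value of \<open>p\<close> at the predecessor of the first negative member with index in \<open>{1..n}\<close>, and \<open>0\<close> if there is no such
  member. Along a grid of times the predecessor approximates the surplus before ruin.
\<close>

primrec grid_ruin :: "(real \<Rightarrow> ennreal) \<Rightarrow> nat \<Rightarrow> (nat \<Rightarrow> real) \<Rightarrow> ennreal" where
  "grid_ruin p 0 r = 0"
| "grid_ruin p (Suc n) r = (if r 1 < 0 then p (r 0) else grid_ruin p n (\<lambda>i. r (Suc i)))"

lemma grid_ruin_at_first_passage: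
  assumes "r (Suc i) < 0" "\<And>l. l < i \<Longrightarrow> 0 \<le> r (Suc l)"
  shows "grid_ruin p n r = (if i < n then p (r i) else 0)"
  using assms
proof (induction n arbitrary: i r)
  case (Suc n)
  show ?case
  proof (cases i)
    case (Suc j)
    have "0 \<le> r (Suc 0)" using Suc.prems(2)[of 0] \<open>i = Suc j\<close> by simp
    moreover have "grid_ruin p n (\<lambda>i. r (Suc i)) = (if j < n then p (r (Suc j)) else 0)"
      using Suc.prems \<open>i = Suc j\<close> by (intro Suc.IH) auto
    ultimately show ?thesis using \<open>i = Suc j\<close> by simp
  qed (use Suc.prems in simp)
qed simp

lemma grid_ruin_no_passage: "(\<And>l. 0 \<le> r (Suc l)) \<Longrightarrow> grid_ruin p n r = 0"
proof (induction n arbitrary: r)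
  case (Suc n)
  have "\<not> r 1 < 0" using Suc.prems[of 0] by simp
  moreover have "grid_ruin p n (\<lambda>i. r (Suc i)) = 0" by (rule Suc.IH) (rule Suc.prems)
  ultimately show ?case by simp
qed simp

lemma SUP_grid_ruin:
  assumes "r (Suc i) < 0" "\<And>l. l < i \<Longrightarrow> 0 \<le> r (Suc l)"
  shows "(SUP n. grid_ruin p n r) = p (r i)"
proof -
  have "grid_ruin p n r = (if i < n then p (r i) else 0)" for n
    using grid_ruin_at_first_passage[of r i p n] assms by blast
  then show ?thesis
    by (intro antisym SUP_least SUP_upper2[of "Suc i"]) (simp_all only: if_True lessI UNIV_I order_refl zero_le split: if_split, simp)
qed

lemma grid_ruin_measurable [measurable]:
  assumes [measurable]: "p \<in> borel_measurable borel"
  shows "grid_ruin p n \<in> borel_measurable (PiM UNIV (\<lambda>_. borel))"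
proof (induction n)
  case (Suc n)
  have [measurable]: "(\<lambda>r i. r (Suc i)) \<in> PiM UNIV (\<lambda>_. borel) \<rightarrow>\<^sub>M PiM UNIV (\<lambda>_. borel :: real measure)"
    by (intro measurable_PiM_single') (auto simp: space_PiM)
  note Suc[measurable]
  have "(\<lambda>r. if r 1 < 0 then p (r 0) else grid_ruin p n (\<lambda>i. r (Suc i))) \<in> borel_measurable (PiM UNIV (\<lambda>_. borel))"
    by measurable
  then show ?case by (simp only: grid_ruin.simps)
qed (simp add: fun_eq_iff)

context risk_process
begin

abbreviation surplus :: "real \<Rightarrow> real \<Rightarrow> 'a \<Rightarrow> real" where "surplus \<equiv> reserve c N Z"

definition ruined :: "real \<Rightarrow> 'a set" where
  "ruined u = {\<omega> \<in> space M. ruin_time (surplus u) \<omega> < \<infinity>}"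

lemma counting_mono: "\<omega> \<in> space M \<Longrightarrow> 0 \<le> s \<Longrightarrow> s \<le> t \<Longrightarrow> N s \<omega> \<le> N t \<omega>"
  and counting_0: "\<omega> \<in> space M \<Longrightarrow> N 0 \<omega> = 0"
  and counting_right_continuous: "\<omega> \<in> space M \<Longrightarrow> 0 \<le> t \<Longrightarrow> continuous (at_right t) (\<lambda>s. N s \<omega>)"
  and counting_measurable: "0 \<le> t \<Longrightarrow> N t \<in> M \<rightarrow>\<^sub>M count_space UNIV"
  using model by (auto simp: reserve_model_def poisson_process_def mono_on_def)

lemma counting_constant_right:
  assumes "\<omega> \<in> space M" "0 \<le> t"
  shows "\<exists>e>0. \<forall>s. t \<le> s \<and> s < t + e \<longrightarrow> N s \<omega> = N t \<omega>"
proof -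
  have "((\<lambda>s. N s \<omega>) \<longlongrightarrow> N t \<omega>) (at_right t)"
    using counting_right_continuous[OF assms] by (simp add: continuous_within)
  then have "eventually (\<lambda>s. N s \<omega> = N t \<omega>) (at_right t)" by (simp add: tendsto_discrete)
  then obtain b where b: "t < b" "\<And>s. t < s \<Longrightarrow> s < b \<Longrightarrow> N s \<omega> = N t \<omega>"
    by (auto simp: eventually_at_right_field)
  then show ?thesis by (intro exI[of _ "b - t"]) (auto simp: le_less)
qed

text \<open>
  Between \<open>0\<close> and \<open>t\<close> the monotone path takes finitely many values, so it is constant
  just before \<open>t\<close>, although only right continuity is known.
\<close>

lemma counting_constant_left:
  assumes w: "\<omega> \<in> space M" and t: "0 < t"
  shows "\<exists>e m. 0 < e \<and> e \<le> t \<and> (\<forall>s. t - e \<le> s \<and> s < t \<longrightarrow> N s \<omega> = m)"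
proof -
  define A where "A = (\<lambda>s. N s \<omega>) ` {0..<t}"
  have "A \<subseteq> {..N t \<omega>}" using counting_mono[OF w] by (auto simp: A_def)
  then have fin: "finite A" by (rule finite_subset) simp
  have ne: "A \<noteq> {}" using t by (auto simp: A_def)
  from Max_in[OF fin ne] obtain s0 where s0: "0 \<le> s0" "s0 < t" "N s0 \<omega> = Max A" by (auto simp: A_def)
  have "N s \<omega> = Max A" if "s0 \<le> s" "s < t" for s
    using Max_ge[OF fin, of "N s \<omega>"] counting_mono[OF w s0(1) that(1)] that s0 by (auto simp: A_def)
  then show ?thesis using s0 by (intro exI[of _ "t - s0"] exI[of _ "Max A"]) auto
qed

text \<open>
  The infimum defining the ruin time is attained: the path moves upwards between claims and is right
  continuous.
\<close>

lemma first_ruin_instant: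
  assumes w: "\<omega> \<in> space M" and u: "0 \<le> u" and ruin: "\<exists>t\<ge>0. surplus u t \<omega> < 0"
  obtains T where "0 < T" "surplus u T \<omega> < 0" "\<And>t. 0 \<le> t \<Longrightarrow> t < T \<Longrightarrow> 0 \<le> surplus u t \<omega>"
    "ruin_time (surplus u) \<omega> = ereal T"
proof -
  define A where "A = {t. 0 \<le> t \<and> surplus u t \<omega> < 0}"
  have ne: "A \<noteq> {}" and bdd: "bdd_below A" using ruin by (auto simp: A_def intro!: bdd_belowI[of _ 0])
  define T where "T = Inf A"
  have T_le: "T \<le> t" if "t \<in> A" for t unfolding T_def by (rule cInf_lower[OF that bdd])
  have T0: "0 \<le> T" unfolding T_def by (rule cInf_greatest[OF ne]) (auto simp: A_def)
  obtain e where e: "0 < e" "\<And>s. T \<le> s \<Longrightarrow> s < T + e \<Longrightarrow> N s \<omega> = N T \<omega>"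
    using counting_constant_right[OF w T0] by auto
  obtain a where a: "a \<in> A" "a < T + e"
    using cInf_lessD[OF ne, of "T + e"] e(1) by (auto simp: T_def)
  have "surplus u T \<omega> = surplus u a \<omega> - c * (a - T)"
    using e(2)[OF T_le[OF a(1)] a(2)] by (simp add: reserve_def algebra_simps)
  also have "\<dots> \<le> surplus u a \<omega>" using c_pos T_le[OF a(1)] by simp
  also have "\<dots> < 0" using a(1) by (simp add: A_def)
  finally have neg: "surplus u T \<omega> < 0" .
  have "T \<noteq> 0" using neg u counting_0[OF w] by (auto simp: reserve_def)
  have "ruin_time (surplus u) \<omega> = ereal T"
    unfolding ruin_time_def A_def[symmetric] using T_le neg T0
    by (intro antisym INF_lower INF_greatest) (auto simp: A_def)
  moreover have "0 \<le> surplus u t \<omega>" if "0 \<le> t" "t < T" for t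
    using T_le[of t] that by (auto simp: A_def not_less[symmetric])
  ultimately show thesis using that[of T] neg T0 \<open>T \<noteq> 0\<close> by simp
qed

lemma ruined_iff:
  assumes "\<omega> \<in> space M" "0 \<le> u"
  shows "\<omega> \<in> ruined u \<longleftrightarrow> (\<exists>t\<ge>0. surplus u t \<omega> < 0)"
proof
  assume "\<omega> \<in> ruined u"
  then show "\<exists>t\<ge>0. surplus u t \<omega> < 0"
  proof (rule contrapos_pp)
    assume "\<not> (\<exists>t\<ge>0. surplus u t \<omega> < 0)"
    then have none: "{t. 0 \<le> t \<and> surplus u t \<omega> < 0} = {}" by auto
    have "ruin_time (surplus u) \<omega> = \<infinity>"
      unfolding ruin_time_def none by (simp add: top_ereal_def)
    then show "\<omega> \<notin> ruined u" by (simp add: ruined_def)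
  qed
next
  assume "\<exists>t\<ge>0. surplus u t \<omega> < 0"
  from first_ruin_instant[OF assms this] show "\<omega> \<in> ruined u"
    using assms by (metis (mono_tags, lifting) CollectI PInfty_neq_ereal(1) ereal_infty_less(1) ruined_def)
qed

lemma surplus_left_limit:
  assumes w: "\<omega> \<in> space M" and T: "0 < T" and ruin: "ruin_time (surplus u) \<omega> = ereal T"
    and const: "0 < e" "\<And>s. T - e \<le> s \<Longrightarrow> s < T \<Longrightarrow> N s \<omega> = m"
  shows "surplus_before_ruin (surplus u) \<omega> = u + c * T - (\<Sum>i=1..m. Z i \<omega>)"
proof -
  have "((\<lambda>t. u + c * t - (\<Sum>i=1..m. Z i \<omega>)) \<longlongrightarrow> u + c * T - (\<Sum>i=1..m. Z i \<omega>)) (at_left T)"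
    by (intro tendsto_intros)
  moreover have "eventually (\<lambda>t. surplus u t \<omega> = u + c * t - (\<Sum>i=1..m. Z i \<omega>)) (at_left T)"
    unfolding eventually_at_left_field using const
    by (intro exI[of _ "T - e"]) (auto simp: reserve_def)
  ultimately have "((\<lambda>t. surplus u t \<omega>) \<longlongrightarrow> u + c * T - (\<Sum>i=1..m. Z i \<omega>)) (at_left T)"
    by (simp add: tendsto_cong)
  then show ?thesis unfolding surplus_before_ruin_def ruin by (intro tendsto_Lim) auto
qed

definition ruin_penalty :: "(real \<Rightarrow> real) \<Rightarrow> real \<Rightarrow> 'a \<Rightarrow> ennreal" where
  "ruin_penalty p u \<omega> = ennreal (p (surplus_before_ruin (surplus u) \<omega>)) * indicator (ruined u) \<omega>"

definition grid_penalty :: "(real \<Rightarrow> real) \<Rightarrow> real \<Rightarrow> real \<Rightarrow> 'a \<Rightarrow> ennreal" where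
  "grid_penalty p h u \<omega> = (SUP n. grid_ruin (\<lambda>x. ennreal (p x)) n (\<lambda>i. surplus u (h * real i) \<omega>))"

lemma surplus_mono: "u \<le> v \<Longrightarrow> surplus u t \<omega> \<le> surplus v t \<omega>"
  by (simp add: reserve_def)

text \<open>
  On a fine grid the last point before the first negative value lies within the stretch just before ruin on which
  the counting process is constant, and it converges to the ruin time. This exhibits the surplus before
  ruin as a limit of functions of countably many reserve values, which settles its measurability.
\<close>

lemma grid_penalty_tendsto:
  assumes w: "\<omega> \<in> space M" and u: "0 \<le> u" and p: "continuous_on UNIV p"
    and h: "\<And>m. 0 < h m" "h \<longlonglongrightarrow> 0" and v: "\<And>m. u \<le> v m" "v \<longlonglongrightarrow> u"
  shows "(\<lambda>m. grid_penalty p (h m) (v m) \<omega>) \<longlonglongrightarrow> ruin_penalty p u \<omega>"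
proof (cases "\<omega> \<in> ruined u")
  case False
  then have "0 \<le> surplus u t \<omega>" if "0 \<le> t" for t
    using ruined_iff[OF w u] that by (auto simp: not_less[symmetric])
  then have nonneg: "0 \<le> surplus (v m) t \<omega>" if "0 \<le> t" for t m
    using surplus_mono[OF v(1)] that order_trans by blast
  have "0 \<le> surplus (v m) (h m * real i) \<omega>" for m i
    using h(1)[of m] by (intro nonneg) simp
  then have "grid_penalty p (h m) (v m) \<omega> = 0" for m
    unfolding grid_penalty_def by (subst grid_ruin_no_passage) (blast, simp)
  then show ?thesis using False by (simp add: ruin_penalty_def)
next
  case True
  then obtain T where T: "0 < T" "surplus u T \<omega> < 0" "\<And>t. 0 \<le> t \<Longrightarrow> t < T \<Longrightarrow> 0 \<le> surplus u t \<omega>"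
    "ruin_time (surplus u) \<omega> = ereal T"
    using first_ruin_instant[OF w u] ruined_iff[OF w u] by metis
  obtain e1 where e1: "0 < e1" "\<And>s. T \<le> s \<Longrightarrow> s < T + e1 \<Longrightarrow> N s \<omega> = N T \<omega>"
    using counting_constant_right[OF w less_imp_le[OF T(1)]] by auto
  obtain e2 m0 where e2: "0 < e2" "e2 \<le> T" "\<And>s. T - e2 \<le> s \<Longrightarrow> s < T \<Longrightarrow> N s \<omega> = m0"
    using counting_constant_left[OF w T(1)] by auto
  define d where "d = - surplus u T \<omega>"
  have d: "0 < d" using T(2) by (simp add: d_def)
  define k where "k m = nat \<lceil>T / h m\<rceil>" for m
  have k: "T \<le> h m * real (k m)" "h m * real (k m) < T + h m" "0 < k m" for m
  proof -
    have "real (k m) = of_int \<lceil>T / h m\<rceil>" using T(1) h(1)[of m] by (simp add: k_def)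
    then have "T / h m \<le> real (k m)" "real (k m) < T / h m + 1" by linarith+
    then show "T \<le> h m * real (k m)" "h m * real (k m) < T + h m" using h(1)[of m] by (auto simp: field_simps)
    then show "0 < k m" using T(1) by (intro Nat.gr0I) auto
  qed
  define t where "t m = h m * real (k m - 1)" for m
  have t_eq: "t m = h m * real (k m) - h m" for m
    using k(3)[of m] by (simp add: t_def of_nat_diff algebra_simps)
  have t: "T - h m \<le> t m" "t m < T" for m using k[of m] by (auto simp: t_eq)
  have t_lim: "t \<longlonglongrightarrow> T"
  proof (rule tendsto_sandwich)
    show "(\<lambda>m. T - h m) \<longlonglongrightarrow> T" using tendsto_diff[OF tendsto_const h(2), of T] by simp
  qed (use t in \<open>auto intro!: always_eventually less_imp_le\<close>)
  have ev: "eventually (\<lambda>m. h m < e1 \<and> h m < e2 \<and> h m < d / (2 * c) \<and> v m < u + d / 2) sequentially"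
    using e1 e2 d c_pos
    by (intro eventually_conj order_tendstoD(2)[OF h(2)] order_tendstoD(2)[OF v(2)]) auto
  have "eventually (\<lambda>m. grid_penalty p (h m) (v m) \<omega> = ennreal (p (v m + c * t m - (\<Sum>i=1..m0. Z i \<omega>)))) sequentially"
    using ev
  proof eventually_elim
    case (elim m)
    have "surplus (v m) (h m * real (k m)) \<omega> = (v m - u) + surplus u T \<omega> + c * (h m * real (k m) - T)"
      using e1(2)[of "h m * real (k m)"] k[of m] elim by (simp add: reserve_def algebra_simps)
    also have "c * (h m * real (k m) - T) \<le> c * h m" using k[of m] c_pos by simp
    also have "c * h m \<le> d / 2" using elim c_pos by (simp add: field_simps)
    finally have neg: "surplus (v m) (h m * real (k m)) \<omega> < 0" using elim by (simp add: d_def)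
    have pos: "0 \<le> surplus (v m) (h m * real (Suc l)) \<omega>" if "l < k m - 1" for l
    proof -
      have "h m * real (Suc l) \<le> t m" unfolding t_def using that h(1)[of m] by (intro mult_left_mono) auto
      also have "\<dots> < T" by (rule t)
      finally have "0 \<le> surplus u (h m * real (Suc l)) \<omega>" using h(1)[of m] by (intro T(3)) auto
      then show ?thesis using surplus_mono[OF v(1)] order_trans by blast
    qed
    have "grid_penalty p (h m) (v m) \<omega> = ennreal (p (surplus (v m) (h m * real (k m - 1)) \<omega>))"
      unfolding grid_penalty_def
      by (rule SUP_grid_ruin) (use neg pos k(3)[of m] in auto)
    also have "surplus (v m) (h m * real (k m - 1)) \<omega> = v m + c * t m - (\<Sum>i=1..m0. Z i \<omega>)"
      using e2(3)[of "t m"] t[of m] elim unfolding t_def by (simp add: reserve_def)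
    finally show ?case .
  qed
  moreover have "(\<lambda>m. ennreal (p (v m + c * t m - (\<Sum>i=1..m0. Z i \<omega>)))) \<longlonglongrightarrow>
      ennreal (p (u + c * T - (\<Sum>i=1..m0. Z i \<omega>)))"
    using p by (intro tendsto_ennrealI isCont_tendsto_compose[where g=p] tendsto_intros v t_lim)
               (simp add: continuous_on_eq_continuous_at)
  ultimately have "(\<lambda>m. grid_penalty p (h m) (v m) \<omega>) \<longlonglongrightarrow> ennreal (p (u + c * T - (\<Sum>i=1..m0. Z i \<omega>)))"
    by (simp add: tendsto_cong)
  then show ?thesis using True surplus_left_limit[OF w T(1,4) e2(1,3)] by (simp add: ruin_penalty_def)
qed

lemma surplus_before_ruin_nonneg:
  assumes "\<omega> \<in> ruined u" and u: "0 \<le> u"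
  shows "0 \<le> surplus_before_ruin (surplus u) \<omega>"
proof -
  have w: "\<omega> \<in> space M" using assms by (simp add: ruined_def)
  obtain T where T: "0 < T" "\<And>t. 0 \<le> t \<Longrightarrow> t < T \<Longrightarrow> 0 \<le> surplus u t \<omega>"
    "ruin_time (surplus u) \<omega> = ereal T"
    using first_ruin_instant[OF w u] ruined_iff[OF w u] assms by metis
  obtain e m where e: "0 < e" "e \<le> T" "\<And>s. T - e \<le> s \<Longrightarrow> s < T \<Longrightarrow> N s \<omega> = m"
    using counting_constant_left[OF w T(1)] by auto
  have "0 \<le> surplus u (T - e) \<omega>" using T(2)[of "T - e"] e by simp
  also have "\<dots> \<le> u + c * T - (\<Sum>i=1..m. Z i \<omega>)"
    using e(3)[of "T - e"] e(1) c_pos by (simp add: reserve_def algebra_simps)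
  finally show ?thesis using surplus_left_limit[OF w T(1,3) e(1,3)] by simp
qed

lemma surplus_measurable:
  assumes "0 \<le> t"
  shows "surplus u t \<in> borel_measurable M"
proof -
  have "(\<lambda>\<omega>. \<Sum>i=1..N t \<omega>. Z i \<omega>) \<in> borel_measurable M"
    by (rule measurable_compose_countable[where f="\<lambda>n \<omega>. \<Sum>i=1..n. Z i \<omega>", OF _ counting_measurable[OF assms]])
       (auto intro!: borel_measurable_sum claim_measurable)
  then show ?thesis unfolding reserve_def[abs_def] by measurable
qed

lemma grid_measurable:
  assumes "0 \<le> h"
  shows "(\<lambda>\<omega> i. surplus u (h * real i) \<omega>) \<in> M \<rightarrow>\<^sub>M PiM UNIV (\<lambda>_. borel)"
  using assms by (intro measurable_PiM_single') (auto intro!: surplus_measurable)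

lemma grid_penalty_measurable:
  assumes [measurable]: "p \<in> borel_measurable borel" and h: "0 \<le> h"
  shows "grid_penalty p h u \<in> borel_measurable M"
  unfolding grid_penalty_def[abs_def]
  by (intro borel_measurable_SUP measurable_compose[OF grid_measurable[OF h] grid_ruin_measurable]) auto

lemma ruin_penalty_measurable:
  assumes p: "continuous_on UNIV p" and u: "0 \<le> u"
  shows "ruin_penalty p u \<in> borel_measurable M"
proof (rule borel_measurable_LIMSEQ_order)
  show "grid_penalty p (1 / real (Suc m)) u \<in> borel_measurable M" for m
    using borel_measurable_continuous_onI[OF p] by (intro grid_penalty_measurable) auto
  show "(\<lambda>m. grid_penalty p (1 / real (Suc m)) u \<omega>) \<longlonglongrightarrow> ruin_penalty p u \<omega>" if "\<omega> \<in> space M" for \<omega>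
    using grid_penalty_tendsto[OF that u p, of "\<lambda>m. 1 / real (Suc m)" "\<lambda>_. u"] LIMSEQ_inverse_real_of_nat
    by (simp add: inverse_eq_divide)
qed

lemma ruined_measurable [measurable]:
  assumes "0 \<le> u"
  shows "ruined u \<in> sets M"
proof -
  have "ruined u = ruin_penalty (\<lambda>_. 1) u -` {0<..} \<inter> space M"
    by (auto simp: ruin_penalty_def ruined_def indicator_def)
  then show ?thesis
    using measurable_sets[OF ruin_penalty_measurable[OF _ assms, of "\<lambda>_. 1"], of "{0<..}"] by simp
qed

end

section \<open>Random walks killed at their first negative value\<close>

lemma partial_sum_measurable [measurable (raw)]:
  fixes z :: "'l \<Rightarrow> nat \<Rightarrow> real"
  assumes "k \<in> L \<rightarrow>\<^sub>M count_space UNIV" "\<And>m. (\<lambda>x. z x m) \<in> borel_measurable L"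
  shows "(\<lambda>x. \<Sum>m<k x. z x m) \<in> borel_measurable L"
  by (rule measurable_compose_countable[where f="\<lambda>n x. \<Sum>m<n. z x m" and g=k])
     (use assms in auto)

text \<open>
  The first \<open>k\<close> members of an independent sequence are independent of the remaining ones, and the latter
  again form such a sequence.
\<close>

lemma (in sequence_space) nn_integral_comb_seq:
  assumes [measurable]: "H \<in> borel_measurable S"
  shows "(\<integral>\<^sup>+z. H z \<partial>S) = (\<integral>\<^sup>+z. \<integral>\<^sup>+z'. H (comb_seq k z z') \<partial>S \<partial>S)"
proof -
  have "(\<integral>\<^sup>+z. H z \<partial>S) = (\<integral>\<^sup>+z. H z \<partial>distr (S \<Otimes>\<^sub>M S) S (\<lambda>(z, z'). comb_seq k z z'))"
    by (simp only: PiM_comb_seq)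
  also have "\<dots> = (\<integral>\<^sup>+x. H (comb_seq k (fst x) (snd x)) \<partial>(S \<Otimes>\<^sub>M S))"
    by (subst nn_integral_distr) (auto simp: split_beta)
  also have "\<dots> = (\<integral>\<^sup>+z. \<integral>\<^sup>+z'. H (comb_seq k z z') \<partial>S \<partial>S)"
    by (subst P.nn_integral_fst[symmetric]) auto
  finally show ?thesis .
qed

lemma (in sequence_space) nn_integral_case_nat:
  assumes [measurable]: "H \<in> borel_measurable S"
  shows "(\<integral>\<^sup>+z. H z \<partial>S) = (\<integral>\<^sup>+x. \<integral>\<^sup>+z. H (case_nat x z) \<partial>S \<partial>M)"
proof -
  have "(\<integral>\<^sup>+z. H z \<partial>S) = (\<integral>\<^sup>+z. H z \<partial>distr (M \<Otimes>\<^sub>M S) S (\<lambda>(x, z). case_nat x z))"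
    by (simp only: PiM_iter)
  also have "\<dots> = (\<integral>\<^sup>+x. H (case_nat (fst x) (snd x)) \<partial>(M \<Otimes>\<^sub>M S))"
    by (subst nn_integral_distr) (auto simp: split_beta)
  also have "\<dots> = (\<integral>\<^sup>+x. \<integral>\<^sup>+z. H (case_nat x z) \<partial>S \<partial>M)"
    by (subst P.nn_integral_fst[symmetric]) auto
  finally show ?thesis .
qed

text \<open>
  The walk starts in \<open>x\<close> and gains \<open>a\<close> per cell; cell \<open>l\<close> contains \<open>\<nu> l\<close> claims, which are read off consecutively from
  the sequence \<open>z\<close>.
\<close>

definition walk_pos :: "real \<Rightarrow> real \<Rightarrow> (nat \<Rightarrow> nat) \<Rightarrow> (nat \<Rightarrow> real) \<Rightarrow> nat \<Rightarrow> real" where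
  "walk_pos a x \<nu> z i = x + a * real i - (\<Sum>m<(\<Sum>l<i. \<nu> l). z m)"

abbreviation shift_seq :: "nat \<Rightarrow> (nat \<Rightarrow> 'b) \<Rightarrow> nat \<Rightarrow> 'b" where
  "shift_seq k s \<equiv> (\<lambda>m. s (m + k))"

lemma walk_pos_0 [simp]: "walk_pos a x \<nu> z 0 = x"
  by (simp add: walk_pos_def)

lemma walk_pos_Suc:
  "walk_pos a x \<nu> z (Suc i)
     = walk_pos a (x + a - (\<Sum>m<\<nu> 0. z m)) (shift_seq 1 \<nu>) (shift_seq (\<nu> 0) z) i"
proof -
  have "(\<Sum>l<Suc i. \<nu> l) = \<nu> 0 + (\<Sum>l<i. \<nu> (l + 1))"
    by (simp add: sum.lessThan_Suc_shift del: sum.lessThan_Suc)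
  moreover have "(\<Sum>m<k + n. z m) = (\<Sum>m<k. z m) + (\<Sum>m<n. z (m + k))" for k n
    by (induction n) (simp_all add: add.commute add.left_commute)
  ultimately show ?thesis by (simp only: walk_pos_def) (simp add: algebra_simps)
qed

type_synonym cell_cost = "real \<Rightarrow> (nat \<Rightarrow> nat) \<Rightarrow> (nat \<Rightarrow> real) \<Rightarrow> ennreal"

text \<open>
  A cost that depends on the current position, the counts of the current and later cells and the
  claims that have not been used yet is summed over the first \<open>n\<close> cells, stopping when the walk becomes negative.
\<close>

primrec walk_sum :: "real \<Rightarrow> cell_cost \<Rightarrow> nat \<Rightarrow> cell_cost" where
  "walk_sum a f 0 x \<nu> z = 0"
| "walk_sum a f (Suc n) x \<nu> z = f x \<nu> z
     + (if x + a - (\<Sum>m<\<nu> 0. z m) < 0 then 0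
        else walk_sum a f n (x + a - (\<Sum>m<\<nu> 0. z m)) (shift_seq 1 \<nu>) (shift_seq (\<nu> 0) z))"

text \<open>
  A walk started below zero is alive until after its first step; walks started at \<open>u - c\<close> and
  \<open>u - K\<close> occur below for all \<open>u\<close>.
\<close>

definition walk_alive :: "real \<Rightarrow> real \<Rightarrow> (nat \<Rightarrow> nat) \<Rightarrow> (nat \<Rightarrow> real) \<Rightarrow> nat \<Rightarrow> bool" where
  "walk_alive a x \<nu> z i \<longleftrightarrow> (\<forall>l<i. 0 \<le> walk_pos a x \<nu> z (Suc l))"

lemma walk_alive_0 [simp]: "walk_alive a x \<nu> z 0"
  by (simp add: walk_alive_def)

lemma walk_alive_Suc:
  "walk_alive a x \<nu> z (Suc i) \<longleftrightarrow> 0 \<le> x + a - (\<Sum>m<\<nu> 0. z m) \<and>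
     walk_alive a (x + a - (\<Sum>m<\<nu> 0. z m)) (shift_seq 1 \<nu>) (shift_seq (\<nu> 0) z) i"
  unfolding walk_alive_def walk_pos_Suc[of a x \<nu> z] by (auto simp: less_Suc_eq_0_disj walk_pos_0)

lemma walk_sum_eq:
  "walk_sum a f n x \<nu> z = (\<Sum>i<n. if walk_alive a x \<nu> z i
      then f (walk_pos a x \<nu> z i) (shift_seq i \<nu>) (shift_seq (\<Sum>l<i. \<nu> l) z) else 0)"
proof (induction n arbitrary: x \<nu> z)
  case (Suc n)
  let ?x = "x + a - (\<Sum>m<\<nu> 0. z m)" and ?\<nu> = "shift_seq 1 \<nu>" and ?z = "shift_seq (\<nu> 0) z"
  have K: "(\<Sum>l<Suc i. \<nu> l) = \<nu> 0 + (\<Sum>l<i. \<nu> (l + 1))" for i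
    by (simp add: sum.lessThan_Suc_shift del: sum.lessThan_Suc)
  have "(if ?x < 0 then 0 else walk_sum a f n ?x ?\<nu> ?z)
      = (\<Sum>i<n. if walk_alive a x \<nu> z (Suc i)
      then f (walk_pos a x \<nu> z (Suc i)) (shift_seq (Suc i) \<nu>) (shift_seq (\<Sum>l<Suc i. \<nu> l) z) else 0)"
    unfolding Suc walk_alive_Suc[of a x] walk_pos_Suc[of a x] K
    by (auto simp: add_ac not_less intro!: sum.cong)
  then show ?case by (simp add: sum.lessThan_Suc_shift del: sum.lessThan_Suc)
qed simp

definition cell_cost_measurable :: "cell_cost \<Rightarrow> bool" where
  "cell_cost_measurable f \<longleftrightarrow> (\<lambda>(x, \<nu>, z). f x \<nu> z) \<in> borel_measurable
     (borel \<Otimes>\<^sub>M (PiM UNIV (\<lambda>_. count_space UNIV) \<Otimes>\<^sub>M PiM UNIV (\<lambda>_. borel)))"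

lemma cell_cost_measurableD:
  assumes "cell_cost_measurable f" "x \<in> borel_measurable L"
    and "\<nu> \<in> L \<rightarrow>\<^sub>M PiM UNIV (\<lambda>_. count_space UNIV)" "z \<in> L \<rightarrow>\<^sub>M PiM UNIV (\<lambda>_. borel)"
  shows "(\<lambda>w. f (x w) (\<nu> w) (z w)) \<in> borel_measurable L"
  using measurable_compose[OF measurable_Pair[OF assms(2) measurable_Pair[OF assms(3,4)]]
      assms(1)[unfolded cell_cost_measurable_def]] by simp

lemma shift_seq_measurable:
  assumes "k \<in> L \<rightarrow>\<^sub>M count_space UNIV" "s \<in> L \<rightarrow>\<^sub>M PiM UNIV (\<lambda>_. A)"
  shows "(\<lambda>w. shift_seq (k w) (s w)) \<in> L \<rightarrow>\<^sub>M PiM UNIV (\<lambda>_. A)"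
proof (rule measurable_PiM_single')
  show "(\<lambda>w. s w (i + k w)) \<in> L \<rightarrow>\<^sub>M A" for i
    by (rule measurable_compose_countable[where f="\<lambda>n w. s w (i + n)" and g=k])
       (use assms in \<open>auto intro: measurable_compose[OF _ measurable_component_singleton]\<close>)
  then show "(\<lambda>w i. s w (i + k w)) \<in> space L \<rightarrow> (\<Pi>\<^sub>E i\<in>UNIV. space A)"
    by (auto dest: measurable_space)
qed

lemma walk_sum_measurable:
  assumes f: "cell_cost_measurable f"
  shows "cell_cost_measurable (walk_sum a f n)"
proof (induction n)
  case (Suc n)
  show ?case unfolding cell_cost_measurable_def split_beta walk_sum.simps
  proof (intro borel_measurable_add cell_cost_measurableD[OF f] measurable_If)
    let ?L = "borel \<Otimes>\<^sub>M (PiM UNIV (\<lambda>_. count_space UNIV) \<Otimes>\<^sub>M PiM UNIV (\<lambda>_. borel))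
      :: (real \<times> (nat \<Rightarrow> nat) \<times> (nat \<Rightarrow> real)) measure"
    show "(\<lambda>w. walk_sum a f n (fst w + a - (\<Sum>m<fst (snd w) 0. snd (snd w) m))
        (shift_seq 1 (fst (snd w))) (shift_seq (fst (snd w) 0) (snd (snd w)))) \<in> borel_measurable ?L"
      by (intro cell_cost_measurableD[OF Suc] shift_seq_measurable) measurable
  qed measurable
qed (simp add: cell_cost_measurable_def split_beta)

context risk_process
begin

sublocale claims: sequence_space claim_law ..

abbreviation "claims \<equiv> claims.S"

lemma sets_claim_law [simp, measurable_cong]: "sets claim_law = sets borel"
  by (simp add: claim_law_def)

lemma space_claim_law [simp]: "space claim_law = UNIV"
  by (simp add: claim_law_def)

lemma sets_claims [measurable_cong]: "sets claims = sets (PiM UNIV (\<lambda>_. borel))"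
  by (intro sets_PiM_cong) auto

lemma emeasure_claims_UNIV [simp]: "emeasure claims (space claims) = 1"
  by (rule claims.P.emeasure_space_1)

abbreviation cell_count :: "real \<Rightarrow> nat pmf" where
  "cell_count h \<equiv> poisson_pmf (lam * h)"

text \<open>
  The compound Poisson law of the total claim amount in a cell of length \<open>h\<close>.
\<close>

definition cell_claims :: "real \<Rightarrow> real measure" where
  "cell_claims h = distr (measure_pmf (cell_count h) \<Otimes>\<^sub>M claims) borel (\<lambda>x. \<Sum>m<fst x. snd x m)"

text \<open>
  The numbers of claims in the successive cells of length \<open>h\<close>.
\<close>

definition cell_counts :: "real \<Rightarrow> (nat \<Rightarrow> nat) measure" where
  "cell_counts h = PiM UNIV (\<lambda>_. measure_pmf (cell_count h))"

lemma sets_cell_counts [measurable_cong]: "sets (cell_counts h) = sets (PiM UNIV (\<lambda>_. count_space UNIV))"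
  unfolding cell_counts_def by (intro sets_PiM_cong) auto

lemma prob_space_cell_counts: "prob_space (cell_counts h)"
  unfolding cell_counts_def by (intro prob_space_PiM measure_pmf.prob_space_axioms)

definition walk_step :: "real \<Rightarrow> (real \<Rightarrow> ennreal) \<Rightarrow> real \<Rightarrow> ennreal" where
  "walk_step h f x = (\<integral>\<^sup>+s. (if x + c * h - s < 0 then 0 else f (x + c * h - s)) \<partial>cell_claims h)"

text \<open>
  The expected sum of \<open>F\<close> along the walk before ruin, over at most \<open>n\<close> steps of length \<open>h\<close>.
\<close>

primrec green :: "real \<Rightarrow> (real \<Rightarrow> ennreal) \<Rightarrow> nat \<Rightarrow> real \<Rightarrow> ennreal" where
  "green h F 0 = (\<lambda>_. 0)"
| "green h F (Suc n) = (\<lambda>x. F x + walk_step h (green h F n) x)"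

lemma prob_space_cell_claims: "prob_space (cell_claims h)"
proof -
  interpret K: prob_space "measure_pmf (cell_count h)" by (rule measure_pmf.prob_space_axioms)
  interpret KC: pair_prob_space "measure_pmf (cell_count h)" claims ..
  show ?thesis unfolding cell_claims_def by (rule KC.prob_space_distr) measurable
qed

lemma sets_cell_claims [simp, measurable_cong]: "sets (cell_claims h) = sets borel"
  and space_cell_claims [simp]: "space (cell_claims h) = UNIV"
  by (simp_all add: cell_claims_def)

lemma nn_integral_cell_claims:
  assumes [measurable]: "f \<in> borel_measurable borel"
  shows "(\<integral>\<^sup>+s. f s \<partial>cell_claims h)
     = (\<integral>\<^sup>+k. (\<integral>\<^sup>+z. f (\<Sum>m<k. z m) \<partial>claims) \<partial>measure_pmf (cell_count h))"
  unfolding cell_claims_def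
  by (subst nn_integral_distr, simp, simp, subst claims.P.nn_integral_fst[symmetric]) auto

lemma walk_step_measurable [measurable]:
  assumes [measurable]: "f \<in> borel_measurable borel"
  shows "walk_step h f \<in> borel_measurable borel"
proof -
  interpret Q: prob_space "cell_claims h" by (rule prob_space_cell_claims)
  show ?thesis unfolding walk_step_def[abs_def] by measurable
qed

lemma green_measurable [measurable]:
  "F \<in> borel_measurable borel \<Longrightarrow> green h F n \<in> borel_measurable borel"
  by (induction n) auto

lemma cell_costD:
  assumes "cell_cost_measurable f" "x \<in> borel_measurable L"
    and "\<nu> \<in> L \<rightarrow>\<^sub>M cell_counts h" "z \<in> L \<rightarrow>\<^sub>M claims"
  shows "(\<lambda>w. f (x w) (\<nu> w) (z w)) \<in> borel_measurable L"
  using assms by (intro cell_cost_measurableD) (simp_all cong: measurable_cong_sets add: sets_cell_counts sets_claims measurable_cong_sets[OF refl sets_cell_counts] measurable_cong_sets[OF refl sets_claims])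

text \<open>
  Counts and claims are averaged as an independent pair. For grids finer than the unit grid this pair
  is taken on a product space, not on \<open>M\<close>.
\<close>

definition cell_mean :: "real \<Rightarrow> cell_cost \<Rightarrow> real \<Rightarrow> ennreal" where
  "cell_mean h f x = (\<integral>\<^sup>+\<nu>. \<integral>\<^sup>+z. f x \<nu> z \<partial>claims \<partial>cell_counts h)"

lemma cell_cost_inner_measurable:
  assumes f: "cell_cost_measurable f" and "x \<in> borel_measurable L" "\<nu> \<in> L \<rightarrow>\<^sub>M cell_counts h"
  shows "(\<lambda>w. \<integral>\<^sup>+z. f (x w) (\<nu> w) z \<partial>claims) \<in> borel_measurable L"
proof (rule claims.P.borel_measurable_nn_integral)
  show "(\<lambda>(w, z). f (x w) (\<nu> w) z) \<in> borel_measurable (L \<Otimes>\<^sub>M claims)"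
    unfolding split_beta'
    by (rule cell_costD[OF f, where h=h]) (auto intro: measurable_compose[OF measurable_fst] assms)
qed

lemma cell_mean_measurable:
  assumes f: "cell_cost_measurable f"
  shows "cell_mean h f \<in> borel_measurable borel"
proof -
  interpret C: prob_space "cell_counts h" by (rule prob_space_cell_counts)
  show ?thesis unfolding cell_mean_def[abs_def]
  proof (rule C.borel_measurable_nn_integral)
    show "(\<lambda>(x, \<nu>). \<integral>\<^sup>+z. f x \<nu> z \<partial>claims) \<in> borel_measurable (borel \<Otimes>\<^sub>M cell_counts h)"
      unfolding split_beta' by (rule cell_cost_inner_measurable[OF f, where h=h]) auto
  qed
qed

text \<open>
  The Markov property: given the number of claims in the first cell, the claims not yet used and the
  later counts are again distributed like the whole data.
\<close>

lemma nn_integral_walk_sum: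
  assumes f: "cell_cost_measurable f"
  shows "cell_mean h (walk_sum (c * h) f n) x = green h (cell_mean h f) n x"
proof (induction n arbitrary: x)
  case 0 show ?case by (simp add: cell_mean_def)
next
  case (Suc n)
  interpret C: prob_space "cell_counts h" by (rule prob_space_cell_counts)
  interpret K: prob_space "measure_pmf (cell_count h)" by (rule measure_pmf.prob_space_axioms)
  interpret CS: sequence_space "measure_pmf (cell_count h)" ..
  interpret CC: pair_prob_space "cell_counts h" claims ..
  interpret KC: pair_prob_space "measure_pmf (cell_count h)" claims ..
  have CS: "CS.S = cell_counts h" by (simp add: cell_counts_def)
  note w = walk_sum_measurable[OF f, of "c * h" n]
  note cell_mean_measurable[OF w, measurable]
  let ?S = "\<lambda>k z. \<Sum>m<k. z m :: real"
  let ?x = "\<lambda>k z. x + c * h - ?S k z"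
  let ?w = "walk_sum (c * h) f n"
  let ?R = "\<lambda>\<nu> z. if ?x (\<nu> 0) z < 0 then 0 else ?w (?x (\<nu> 0) z) (shift_seq 1 \<nu>) (shift_seq (\<nu> 0) z)"
  let ?v = "\<lambda>s. if x + c * h - s < 0 then 0 else cell_mean h ?w (x + c * h - s)"
  have R [measurable]: "(\<lambda>y. ?R (fst y) (snd y)) \<in> borel_measurable (cell_counts h \<Otimes>\<^sub>M claims)"
  proof (rule measurable_If)
    have [measurable]: "fst \<in> cell_counts h \<Otimes>\<^sub>M claims \<rightarrow>\<^sub>M PiM UNIV (\<lambda>_. count_space UNIV)"
      "snd \<in> cell_counts h \<Otimes>\<^sub>M claims \<rightarrow>\<^sub>M PiM UNIV (\<lambda>_. borel)"
      by measurable
    show "(\<lambda>y. ?w (?x (fst y 0) (snd y)) (shift_seq 1 (fst y)) (shift_seq (fst y 0) (snd y)))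
        \<in> borel_measurable (cell_counts h \<Otimes>\<^sub>M claims)"
      by (intro cell_cost_measurableD[OF walk_sum_measurable[OF f]] shift_seq_measurable) measurable
  qed measurable
  have R': "(\<lambda>y. ?R (\<nu> y) (z y)) \<in> borel_measurable L"
    if "\<nu> \<in> L \<rightarrow>\<^sub>M cell_counts h" "z \<in> L \<rightarrow>\<^sub>M claims" for \<nu> z and L :: "'x measure"
    using measurable_compose[OF measurable_Pair[OF that] R] by (simp only: fst_conv snd_conv)
  have space_counts: "\<nu> \<in> space (cell_counts h)" for \<nu>
    by (simp add: cell_counts_def space_PiM)
  have Rz: "?R \<nu> \<in> borel_measurable claims" for \<nu>
    by (rule R') (simp_all add: space_counts)
  have fz: "f x \<nu> \<in> borel_measurable claims" for \<nu>
    by (rule cell_costD[OF f, where h=h]) (simp_all add: space_counts)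
  have R2: "(\<lambda>\<nu>. \<integral>\<^sup>+z. ?R \<nu> z \<partial>claims) \<in> borel_measurable (cell_counts h)"
    by (rule claims.P.borel_measurable_nn_integral) (subst split_beta', rule R)
  have split: "cell_mean h (walk_sum (c * h) f (Suc n)) x
      = cell_mean h f x + (\<integral>\<^sup>+\<nu>. \<integral>\<^sup>+z. ?R \<nu> z \<partial>claims \<partial>cell_counts h)"
  proof -
    have "cell_mean h (walk_sum (c * h) f (Suc n)) x
        = (\<integral>\<^sup>+\<nu>. \<integral>\<^sup>+z. f x \<nu> z + ?R \<nu> z \<partial>claims \<partial>cell_counts h)"
      by (simp only: cell_mean_def walk_sum.simps)
    also have "\<dots> = (\<integral>\<^sup>+\<nu>. (\<integral>\<^sup>+z. f x \<nu> z \<partial>claims) + (\<integral>\<^sup>+z. ?R \<nu> z \<partial>claims) \<partial>cell_counts h)"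
      by (intro nn_integral_cong nn_integral_add fz Rz)
    also have "\<dots> = cell_mean h f x + (\<integral>\<^sup>+\<nu>. \<integral>\<^sup>+z. ?R \<nu> z \<partial>claims \<partial>cell_counts h)"
      unfolding cell_mean_def by (intro nn_integral_add R2 cell_cost_inner_measurable[OF f, where h=h]) auto
    finally show ?thesis .
  qed
  have "(\<integral>\<^sup>+\<nu>. \<integral>\<^sup>+z. ?R \<nu> z \<partial>claims \<partial>cell_counts h)
      = (\<integral>\<^sup>+k. \<integral>\<^sup>+\<nu>. \<integral>\<^sup>+z. ?R (case_nat k \<nu>) z \<partial>claims \<partial>cell_counts h \<partial>measure_pmf (cell_count h))"
    unfolding CS[symmetric]
    by (rule CS.nn_integral_case_nat) (simp only: CS R2)
  also have "\<dots> = (\<integral>\<^sup>+k. (\<integral>\<^sup>+z. ?v (?S k z) \<partial>claims) \<partial>measure_pmf (cell_count h))"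
  proof (rule nn_integral_cong)
    fix k :: nat
    let ?V = "\<lambda>\<nu> z z'. if ?x k z < 0 then 0 else ?w (?x k z) \<nu> z'"
    have *: "?R (case_nat k \<nu>) (comb_seq k z z') = ?V \<nu> z z'" for \<nu> z z'
    proof -
      have "?S k (comb_seq k z z') = ?S k z" by (intro sum.cong) (auto simp: comb_seq_def)
      moreover have "shift_seq k (comb_seq k z z') = z'" by (auto simp: comb_seq_add fun_eq_iff)
      ultimately show ?thesis by simp
    qed
    have "(\<integral>\<^sup>+\<nu>. \<integral>\<^sup>+z. ?R (case_nat k \<nu>) z \<partial>claims \<partial>cell_counts h)
        = (\<integral>\<^sup>+\<nu>. \<integral>\<^sup>+z. \<integral>\<^sup>+z'. ?R (case_nat k \<nu>) (comb_seq k z z') \<partial>claims \<partial>claims \<partial>cell_counts h)"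
      by (rule nn_integral_cong) (rule claims.nn_integral_comb_seq[OF Rz])
    also have "\<dots> = (\<integral>\<^sup>+\<nu>. \<integral>\<^sup>+z. \<integral>\<^sup>+z'. ?V \<nu> z z' \<partial>claims \<partial>claims \<partial>cell_counts h)"
      by (simp only: *)
    also have "\<dots> = (\<integral>\<^sup>+z. \<integral>\<^sup>+\<nu>. \<integral>\<^sup>+z'. ?V \<nu> z z' \<partial>claims \<partial>cell_counts h \<partial>claims)"
    proof (rule CC.Fubini'[symmetric])
      show "(\<lambda>(\<nu>, z). \<integral>\<^sup>+z'. ?V \<nu> z z' \<partial>claims) \<in> borel_measurable (cell_counts h \<Otimes>\<^sub>M claims)"
        unfolding split_beta' if_distrib[of "\<lambda>f. integral\<^sup>N claims f"]
      proof (rule claims.P.borel_measurable_nn_integral)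
        show "(\<lambda>(y, z'). ?V (fst y) (snd y) z') \<in> borel_measurable ((cell_counts h \<Otimes>\<^sub>M claims) \<Otimes>\<^sub>M claims)"
          unfolding split_beta'
          by (intro measurable_If cell_costD[OF w, where h=h]) measurable
      qed
    qed
    also have "\<dots> = (\<integral>\<^sup>+z. ?v (?S k z) \<partial>claims)"
      by (intro nn_integral_cong) (simp add: cell_mean_def)
    finally show "(\<integral>\<^sup>+\<nu>. \<integral>\<^sup>+z. ?R (case_nat k \<nu>) z \<partial>claims \<partial>cell_counts h)
        = (\<integral>\<^sup>+z. ?v (?S k z) \<partial>claims)" .
  qed
  also have "\<dots> = (\<integral>\<^sup>+s. ?v s \<partial>cell_claims h)"
    by (rule nn_integral_cell_claims[symmetric]) measurable
  finally have "(\<integral>\<^sup>+\<nu>. \<integral>\<^sup>+z. ?R \<nu> z \<partial>claims \<partial>cell_counts h) = walk_step h (green h (cell_mean h f) n) x"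
    by (simp only: walk_step_def Suc.IH)
  then show ?case by (simp only: split green.simps)
qed

end

section \<open>The law of the claims in grid cells\<close>

text \<open>
  The probability generating function of the Poisson distribution.
\<close>

lemma nn_integral_poisson_exp:
  assumes "0 < a" "0 \<le> x"
  shows "(\<integral>\<^sup>+k. ennreal x ^ k \<partial>measure_pmf (poisson_pmf a)) = ennreal (exp (a * (x - 1)))"
proof -
  have "(\<integral>\<^sup>+k. ennreal x ^ k \<partial>measure_pmf (poisson_pmf a))
      = (\<Sum>k. ennreal (pmf (poisson_pmf a) k) * ennreal x ^ k)"
    by (simp add: nn_integral_measure_pmf nn_integral_count_space_nat)
  also have "\<dots> = (\<Sum>k. ennreal ((a * x) ^ k /\<^sub>R fact k * exp (- a)))"
    using assms by (intro suminf_cong)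
      (simp add: ennreal_power ennreal_mult''[symmetric] field_simps power_mult_distrib)
  also have "\<dots> = ennreal (exp (a * x) * exp (- a))"
    using assms
    by (intro suminf_ennreal_eq sums_mult2 exp_converges) auto
  also have "exp (a * x) * exp (- a) = exp (a * (x - 1))"
    by (simp add: exp_add[symmetric] algebra_simps)
  finally show ?thesis .
qed

context risk_process
begin

text \<open>
  The independent and stationary increments give the finite-dimensional distributions, which determine the law of the
  whole sequence.
\<close>

lemma distr_cell_counts:
  assumes h: "0 < h"
  shows "distr M (PiM UNIV (\<lambda>_. count_space UNIV)) (\<lambda>\<omega> l. N (h * real (Suc l)) \<omega> - N (h * real l) \<omega>) = cell_counts h"
proof -
  let ?X = "\<lambda>l \<omega>. N (h * real (Suc l)) \<omega> - N (h * real l) \<omega>"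
  have [measurable]: "N (h * real l) \<in> M \<rightarrow>\<^sub>M count_space UNIV"
    "N (h * (1 + real l)) \<in> M \<rightarrow>\<^sub>M count_space UNIV" for l
    using h by (auto intro!: counting_measurable)
  have rv: "?X l \<in> M \<rightarrow>\<^sub>M count_space UNIV" for l by measurable
  have incr: "indep_vars (\<lambda>_. count_space UNIV) ?X {..<n}" for n
  proof -
    have "0 \<le> h * real 0 \<and> (\<forall>i<n. h * real i \<le> h * real (Suc i))" using h by simp
    then show ?thesis
      using model unfolding reserve_model_def poisson_process_def
      by (elim conjE) (drule spec[of _ "\<lambda>i. h * real i"], blast)
  qed
  have "indep_vars (\<lambda>_. count_space UNIV) ?X UNIV"
    unfolding indep_vars_def2
  proof (intro conjI ballI rv, subst indep_sets_finite_index_sets, intro allI impI)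
    fix J :: "nat set" assume "finite J"
    then obtain n where "J \<subseteq> {..<n}" using finite_nat_iff_bounded by auto
    then have "indep_vars (\<lambda>_. count_space UNIV) ?X J" by (rule indep_vars_subset[OF incr])
    then show "indep_sets (\<lambda>i. {?X i -` A \<inter> space M |A. A \<in> sets (count_space UNIV)}) J"
      by (simp add: indep_vars_def2)
  qed
  then have "distr M (PiM UNIV (\<lambda>_. count_space UNIV)) (\<lambda>\<omega>. \<lambda>l\<in>UNIV. ?X l \<omega>)
     = PiM UNIV (\<lambda>l. distr M (count_space UNIV) (?X l))"
    by (subst (asm) indep_vars_iff_distr_eq_PiM') (auto intro: rv)
  also have "(\<lambda>l. distr M (count_space UNIV) (?X l)) = (\<lambda>_. measure_pmf (cell_count h))"
  proof
    fix l
    have "distr M (count_space UNIV) (?X l) = measure_pmf (poisson_pmf (lam * (h * real (Suc l) - h * real l)))"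
      using model h unfolding reserve_model_def poisson_process_def by (simp add: mult_strict_left_mono)
    then show "distr M (count_space UNIV) (?X l) = measure_pmf (cell_count h)" by (simp add: algebra_simps)
  qed
  finally show ?thesis by (simp add: cell_counts_def restrict_def)
qed

lemma distr_claims: "distr M (PiM UNIV (\<lambda>_. borel)) (\<lambda>\<omega> m. Z (Suc m) \<omega>) = claims"
proof -
  have "indep_vars (\<lambda>_. borel) Z {1..}" using model by (simp add: reserve_model_def)
  then have "distr M (PiM {1..} (\<lambda>_. borel)) (\<lambda>\<omega>. \<lambda>i\<in>{1..}. Z i \<omega>) = PiM {1..} (\<lambda>i. distr M borel (Z i))"
    by (subst (asm) indep_vars_iff_distr_eq_PiM') (simp_all add: claim_measurable)
  also have "\<dots> = PiM {1..} (\<lambda>_. claim_law)"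
  proof (rule PiM_cong)
    fix i :: nat assume "i \<in> {1..}"
    moreover have "\<forall>i\<ge>1. distr M borel (Z i) = distr M borel (Z 1)"
      using model unfolding reserve_model_def by (elim conjE)
    ultimately show "distr M borel (Z i) = claim_law"
      unfolding claim_law_def atLeast_iff by blast
  qed simp
  finally have D: "distr M (PiM {1..} (\<lambda>_. borel)) (\<lambda>\<omega>. \<lambda>i\<in>{1..}. Z i \<omega>) = PiM {1..} (\<lambda>_. claim_law)" .
  have Zr [measurable]: "(\<lambda>\<omega>. \<lambda>i\<in>{1..}. Z i \<omega>) \<in> M \<rightarrow>\<^sub>M PiM {1..} (\<lambda>_. borel)"
    by (intro measurable_restrict claim_measurable) auto
  have shift: "(\<lambda>z. \<lambda>n\<in>UNIV. z (Suc n)) \<in> PiM {1..} (\<lambda>_. borel :: real measure) \<rightarrow>\<^sub>M PiM UNIV (\<lambda>_. borel)"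
    by (intro measurable_restrict measurable_component_singleton) auto
  have "claims = distr (PiM {1..} (\<lambda>_. claim_law)) claims (\<lambda>z. \<lambda>n\<in>UNIV. z (Suc n))"
    using distr_PiM_reindex[of "{1..}" "\<lambda>_. claim_law" Suc UNIV] claim.prob_space_axioms by auto
  also have "\<dots> = distr (PiM {1..} (\<lambda>_. claim_law)) (PiM UNIV (\<lambda>_. borel)) (\<lambda>z. \<lambda>n\<in>UNIV. z (Suc n))"
    by (intro distr_cong sets_claims) auto
  also have "\<dots> = distr M (PiM UNIV (\<lambda>_. borel)) (\<lambda>\<omega> m. Z (Suc m) \<omega>)"
    unfolding D[symmetric] by (subst distr_distr[OF shift Zr]) (simp add: comp_def restrict_def)
  finally show ?thesis ..
qed

definition cell_increments :: "real \<Rightarrow> 'a \<Rightarrow> nat \<Rightarrow> nat" where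
  "cell_increments h \<omega> l = N (h * real (Suc l)) \<omega> - N (h * real l) \<omega>"

definition claim_seq :: "'a \<Rightarrow> nat \<Rightarrow> real" where
  "claim_seq \<omega> m = Z (Suc m) \<omega>"

lemma cell_increments_measurable:
  assumes "0 \<le> h"
  shows "cell_increments h \<in> M \<rightarrow>\<^sub>M PiM UNIV (\<lambda>_. count_space UNIV)"
proof (rule measurable_PiM_single')
  have [measurable]: "N (h * real l) \<in> M \<rightarrow>\<^sub>M count_space UNIV"
    "N (h * (1 + real l)) \<in> M \<rightarrow>\<^sub>M count_space UNIV" for l
    using assms by (auto intro!: counting_measurable)
  show "(\<lambda>\<omega>. cell_increments h \<omega> l) \<in> M \<rightarrow>\<^sub>M count_space UNIV" for l
    unfolding cell_increments_def by measurable
qed auto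

lemma claim_seq_measurable: "claim_seq \<in> M \<rightarrow>\<^sub>M PiM UNIV (\<lambda>_. borel)"
  unfolding claim_seq_def[abs_def] by (intro measurable_PiM_single') (auto intro: claim_measurable)

lemma nn_integral_cell_counts:
  assumes "0 < h" "F \<in> borel_measurable (cell_counts h)"
  shows "(\<integral>\<^sup>+\<nu>. F \<nu> \<partial>cell_counts h) = (\<integral>\<^sup>+\<omega>. F (cell_increments h \<omega>) \<partial>M)"
proof -
  have "cell_counts h = distr M (PiM UNIV (\<lambda>_. count_space UNIV)) (cell_increments h)"
    using distr_cell_counts[OF assms(1)] by (simp add: cell_increments_def[abs_def])
  moreover have "F \<in> borel_measurable (PiM UNIV (\<lambda>_. count_space UNIV))"
    using assms(2) measurable_cong_sets[OF sets_cell_counts refl] by blast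
  ultimately show ?thesis
    using cell_increments_measurable[of h] assms(1) by (simp add: nn_integral_distr)
qed

text \<open>
  The counts at integer times are a measurable function of the counting process, hence independent of the claims;
  the joint law on the unit grid is therefore the product of the two marginal laws.
\<close>

lemma nn_integral_unit_grid:
  assumes F: "(\<lambda>x. F (fst x) (snd x)) \<in> borel_measurable (PiM UNIV (\<lambda>_. count_space UNIV) \<Otimes>\<^sub>M PiM UNIV (\<lambda>_. borel))"
  shows "(\<integral>\<^sup>+\<omega>. F (cell_increments 1 \<omega>) (claim_seq \<omega>) \<partial>M)
       = (\<integral>\<^sup>+\<nu>. \<integral>\<^sup>+z. F \<nu> z \<partial>claims \<partial>cell_counts 1)"
proof -
  let ?S = "PiM {0..} (\<lambda>_. count_space UNIV) :: (nat \<Rightarrow> real) measure"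
  let ?T = "PiM {1..} (\<lambda>_. borel) :: (nat \<Rightarrow> real) measure"
  let ?X = "\<lambda>\<omega> n. real ((\<lambda>t\<in>{0..}. N t \<omega>) (real n))" and ?Y = "\<lambda>\<omega>. \<lambda>i\<in>{1..}. Z i \<omega>"
  \<comment> \<open>The path at integer times is stored as a real sequence; the floors recover the counts.\<close>
  define \<phi> where "\<phi> x l = nat \<lfloor>x (Suc l)\<rfloor> - nat \<lfloor>x l\<rfloor>" for x :: "nat \<Rightarrow> real" and l
  define \<sigma> where "\<sigma> y m = y (Suc m)" for y :: "nat \<Rightarrow> real" and m
  have "indep_var ?S ?X ?T ?Y"
    using model by (simp add: reserve_model_def)
  then have X: "?X \<in> M \<rightarrow>\<^sub>M ?S" and Y: "?Y \<in> M \<rightarrow>\<^sub>M ?T"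
    and XY: "distr M ?S ?X \<Otimes>\<^sub>M distr M ?T ?Y = distr M (?S \<Otimes>\<^sub>M ?T) (\<lambda>\<omega>. (?X \<omega>, ?Y \<omega>))"
    unfolding indep_var_distribution_eq by auto
  have \<phi> [measurable]: "\<phi> \<in> ?S \<rightarrow>\<^sub>M PiM UNIV (\<lambda>_. count_space UNIV)"
  proof (rule measurable_PiM_single')
    have [measurable]: "(\<lambda>x. nat \<lfloor>x l\<rfloor>) \<in> ?S \<rightarrow>\<^sub>M count_space UNIV" for l
      by (rule measurable_compose[OF measurable_component_singleton[of l]]) auto
    show "(\<lambda>x. \<phi> x l) \<in> ?S \<rightarrow>\<^sub>M count_space UNIV" for l
      unfolding \<phi>_def by measurable
  qed auto
  have \<sigma> [measurable]: "\<sigma> \<in> ?T \<rightarrow>\<^sub>M PiM UNIV (\<lambda>_. borel)"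
    unfolding \<sigma>_def[abs_def] by (intro measurable_PiM_single' measurable_component_singleton) auto
  have \<phi>X: "\<phi> (?X \<omega>) = cell_increments 1 \<omega>" for \<omega>
    by (auto simp: \<phi>_def cell_increments_def fun_eq_iff)
  have \<sigma>Y: "\<sigma> (?Y \<omega>) = claim_seq \<omega>" for \<omega>
    by (auto simp: \<sigma>_def claim_seq_def fun_eq_iff)
  interpret DX: prob_space "distr M ?S ?X" by (rule prob_space_distr[OF X])
  interpret DY: prob_space "distr M ?T ?Y" by (rule prob_space_distr[OF Y])
  have G [measurable]: "(\<lambda>x. F (\<phi> (fst x)) (\<sigma> (snd x))) \<in> borel_measurable (?S \<Otimes>\<^sub>M ?T)"
    using measurable_compose[OF measurable_Pair[OF measurable_compose[OF measurable_fst \<phi>]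
        measurable_compose[OF measurable_snd \<sigma>]] F] by simp
  have G': "(\<lambda>x. F (\<phi> (fst x)) (\<sigma> (snd x))) \<in> borel_measurable (distr M ?S ?X \<Otimes>\<^sub>M distr M ?T ?Y)"
    by (subst measurable_cong_sets[OF sets_pair_measure_cong[OF sets_distr sets_distr] refl]) (rule G)
  have Fz: "F \<nu> \<in> borel_measurable (PiM UNIV (\<lambda>_. borel))" for \<nu>
    using measurable_compose[OF measurable_Pair1'[of \<nu> "PiM UNIV (\<lambda>_. count_space UNIV)"] F]
    by (simp add: space_PiM)
  have Fint: "(\<lambda>\<nu>. \<integral>\<^sup>+z. F \<nu> z \<partial>claims) \<in> borel_measurable (cell_counts 1)"
  proof (rule claims.P.borel_measurable_nn_integral)
    have "sets (cell_counts 1 \<Otimes>\<^sub>M claims)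
        = sets (PiM UNIV (\<lambda>_. count_space UNIV) \<Otimes>\<^sub>M PiM UNIV (\<lambda>_. borel))"
      by (intro sets_pair_measure_cong sets_cell_counts sets_claims)
    then show "(\<lambda>(\<nu>, z). F \<nu> z) \<in> borel_measurable (cell_counts 1 \<Otimes>\<^sub>M claims)"
      using F measurable_cong_sets[of "cell_counts 1 \<Otimes>\<^sub>M claims"] unfolding split_beta' by blast
  qed
  have claims_Y: "claims = distr (distr M ?T ?Y) (PiM UNIV (\<lambda>_. borel)) \<sigma>"
    unfolding distr_distr[OF \<sigma> Y] comp_def \<sigma>Y
    using distr_claims by (simp add: claim_seq_def[abs_def])
  have "(\<integral>\<^sup>+\<omega>. F (cell_increments 1 \<omega>) (claim_seq \<omega>) \<partial>M)
      = (\<integral>\<^sup>+\<omega>. (\<lambda>x. F (\<phi> (fst x)) (\<sigma> (snd x))) (?X \<omega>, ?Y \<omega>) \<partial>M)"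
    by (simp only: fst_conv snd_conv \<phi>X \<sigma>Y)
  also have "\<dots> = (\<integral>\<^sup>+x. F (\<phi> (fst x)) (\<sigma> (snd x)) \<partial>(distr M ?S ?X \<Otimes>\<^sub>M distr M ?T ?Y))"
    unfolding XY using G by (intro nn_integral_distr[symmetric] measurable_Pair X Y) simp
  also have "\<dots> = (\<integral>\<^sup>+x. \<integral>\<^sup>+y. F (\<phi> x) (\<sigma> y) \<partial>distr M ?T ?Y \<partial>distr M ?S ?X)"
    by (subst DY.nn_integral_fst[symmetric, OF G']) simp
  also have "\<dots> = (\<integral>\<^sup>+x. \<integral>\<^sup>+z. F (\<phi> x) z \<partial>claims \<partial>distr M ?S ?X)"
    unfolding claims_Y by (intro nn_integral_cong nn_integral_distr[symmetric]) (simp_all only: measurable_distr_eq1 \<sigma> Fz)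
  also have "\<dots> = (\<integral>\<^sup>+\<omega>. \<integral>\<^sup>+z. F (\<phi> (?X \<omega>)) z \<partial>claims \<partial>M)"
  proof (rule nn_integral_distr[OF X])
    have "(\<lambda>\<nu>. \<integral>\<^sup>+z. F \<nu> z \<partial>claims) \<in> borel_measurable (PiM UNIV (\<lambda>_. count_space UNIV))"
      using Fint by (subst (asm) measurable_cong_sets[OF sets_cell_counts refl])
    then have "(\<lambda>x. \<integral>\<^sup>+z. F (\<phi> x) z \<partial>claims) \<in> borel_measurable ?S"
      by (rule measurable_compose[OF \<phi>])
    then show "(\<lambda>x. \<integral>\<^sup>+z. F (\<phi> x) z \<partial>claims) \<in> borel_measurable (distr M ?S ?X)"
      by (simp only: measurable_distr_eq1)
  qed
  also have "\<dots> = (\<integral>\<^sup>+\<nu>. \<integral>\<^sup>+z. F \<nu> z \<partial>claims \<partial>cell_counts 1)"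
    unfolding \<phi>X by (rule nn_integral_cell_counts[symmetric]) (use Fint in auto)
  finally show ?thesis .
qed

lemma claims_pos: "AE z in claims. \<forall>m. 0 < z m"
  unfolding AE_all_countable using claim_pos claim.prob_space_axioms
  by (intro allI AE_PiM_component) auto

lemma cell_claims_nonneg: "AE s in cell_claims h. 0 \<le> s"
proof -
  have "emeasure (cell_claims h) {..<0} = (\<integral>\<^sup>+s. indicator {..<0} s \<partial>cell_claims h)"
    by (rule nn_integral_indicator[symmetric]) simp
  also have "\<dots> = (\<integral>\<^sup>+k. (\<integral>\<^sup>+z. indicator {..<0} (\<Sum>m<k. z m) \<partial>claims) \<partial>measure_pmf (cell_count h))"
    by (rule nn_integral_cell_claims) simp
  also have "\<dots> = (\<integral>\<^sup>+k. 0 \<partial>measure_pmf (cell_count h))"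
  proof (rule nn_integral_cong)
    fix k :: nat
    have "(\<integral>\<^sup>+z. indicator {..<0} (\<Sum>m<k. z m) \<partial>claims) = (\<integral>\<^sup>+z. 0 \<partial>claims)"
      by (intro nn_integral_cong_AE, use claims_pos in eventually_elim)
         (auto simp: indicator_def not_less less_imp_le intro!: sum_nonneg)
    then show "(\<integral>\<^sup>+z. indicator {..<0} (\<Sum>m<k. z m) \<partial>claims) = (0 :: ennreal)" by simp
  qed
  finally have "{..<0} \<in> null_sets (cell_claims h)" by (simp add: null_sets_def)
  from AE_not_in[OF this] show ?thesis by (auto simp: not_less)
qed

lemma cell_claims_zero_mass:
  assumes "0 < h" "0 \<in> A" "A \<in> sets borel"
  shows "ennreal (exp (- lam * h)) \<le> emeasure (cell_claims h) A"
proof -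
  have "ennreal (exp (- lam * h)) = (\<integral>\<^sup>+k. indicator {0} k \<partial>measure_pmf (cell_count h))"
    using assms lam_pos by (simp add: emeasure_pmf_single)
  also have "\<dots> \<le> (\<integral>\<^sup>+k. (\<integral>\<^sup>+z. indicator A (\<Sum>m<k. z m) \<partial>claims) \<partial>measure_pmf (cell_count h))"
    using assms by (intro nn_integral_mono) (auto simp: indicator_def)
  also have "\<dots> = emeasure (cell_claims h) A"
    using assms by (subst nn_integral_cell_claims[symmetric]) auto
  finally show ?thesis .
qed

text \<open>
  A short cell contains exactly one claim with probability close to \<open>lam * h\<close>, and two or more
  with probability at most \<open>(lam * h)\<^sup>2\<close>.
\<close>

lemma cell_claims_tail_bounds:
  assumes h: "0 < h" and x: "0 \<le> x"
  shows "lam * h * exp (- lam * h) * claim_tail x \<le> measure (cell_claims h) {x<..}"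
    and "measure (cell_claims h) {x<..} \<le> lam * h * claim_tail x + (lam * h) ^ 2"
proof -
  let ?q = "measure_pmf (cell_count h)" and ?a = "lam * h"
  let ?P = "\<lambda>k. \<integral>\<^sup>+z. indicator {x<..} (\<Sum>m<k. z m) \<partial>claims"
  have a: "0 < ?a" using h lam_pos by simp
  interpret CC: prob_space "cell_claims h" by (rule prob_space_cell_claims)
  define r where "r = 1 - exp (- ?a) - ?a * exp (- ?a)"
  have e1: "exp (- ?a) + ?a * exp (- ?a) \<le> 1"
    using exp_ge_add_one_self[of ?a] by (simp add: exp_minus field_simps)
  have r: "0 \<le> r" "r \<le> ?a ^ 2"
  proof -
    show "0 \<le> r" using e1 by (simp add: r_def)
    have "(1 - ?a) * (1 + ?a) \<le> exp (- ?a) * (1 + ?a)"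
      using exp_ge_add_one_self[of "- ?a"] a by (intro mult_right_mono) auto
    then show "r \<le> ?a ^ 2" by (simp add: r_def algebra_simps power2_eq_square)
  qed
  have P1: "?P 1 = ennreal (claim_tail x)"
  proof -
    have "?P 1 = (\<integral>\<^sup>+y. indicator {x<..} y \<partial>distr claims claim_law (\<lambda>z. z 0))"
      by (subst nn_integral_distr) auto
    also have "distr claims claim_law (\<lambda>z. z 0) = claim_law" by (rule claims.PiM_component) simp
    finally show ?thesis by (simp add: emeasure_claim_law_greaterThan)
  qed
  have P0: "?P 0 = 0" using x by simp
  have P_le: "?P k \<le> 1" for k
  proof -
    have "?P k \<le> (\<integral>\<^sup>+z. 1 \<partial>claims)" by (intro nn_integral_mono) (auto simp: indicator_def)
    then show ?thesis by simp
  qed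
  have "emeasure (cell_claims h) {x<..} = (\<integral>\<^sup>+s. indicator {x<..} s \<partial>cell_claims h)"
    by (rule nn_integral_indicator[symmetric]) simp
  also have "\<dots> = (\<integral>\<^sup>+k. ?P k \<partial>?q)" by (rule nn_integral_cell_claims) simp
  finally have E: "emeasure (cell_claims h) {x<..} = (\<integral>\<^sup>+k. ?P k \<partial>?q)" .
  have q1: "emeasure ?q {1} = ennreal (?a * exp (- ?a))"
    using a by (simp add: emeasure_pmf_single)
  have q2: "emeasure ?q {2..} = ennreal r"
  proof -
    have "{2..} = UNIV - {0, 1 :: nat}" by auto
    then have "measure ?q {2..} = 1 - measure ?q {0, 1}"
      by (simp add: measure_pmf.prob_compl[of "{0,1}" "cell_count h", simplified])
    also have "measure ?q {0, 1} = exp (- ?a) + ?a * exp (- ?a)"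
      using a by (simp add: measure_measure_pmf_finite)
    finally show ?thesis by (simp add: measure_pmf.emeasure_eq_measure r_def diff_diff_eq)
  qed
  have "ennreal (?a * exp (- ?a) * claim_tail x) = ennreal (claim_tail x) * emeasure ?q {1}"
    unfolding q1 using lam_pos h claim_tail_pos[of x]
    by (subst ennreal_mult[symmetric]) (auto simp: mult_ac less_imp_le)
  also have "\<dots> = (\<integral>\<^sup>+k. ennreal (claim_tail x) * indicator {1} k \<partial>?q)"
    by (rule nn_integral_cmult_indicator[symmetric]) simp
  also have "\<dots> \<le> (\<integral>\<^sup>+k. ?P k \<partial>?q)"
    using P1 by (intro nn_integral_mono) (auto simp: indicator_def)
  finally have lower: "?a * exp (- ?a) * claim_tail x \<le> measure (cell_claims h) {x<..}"
    unfolding E[symmetric] CC.emeasure_eq_measure by (subst (asm) ennreal_le_iff) auto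
  have "(\<integral>\<^sup>+k. ?P k \<partial>?q) \<le> (\<integral>\<^sup>+k. ennreal (claim_tail x) * indicator {1} k + indicator {2..} k \<partial>?q)"
  proof (rule nn_integral_mono)
    fix k :: nat
    consider "k = 0" | "k = 1" | "2 \<le> k" by linarith
    then show "?P k \<le> ennreal (claim_tail x) * indicator {1} k + indicator {2..} k"
    proof cases
      case 3 then show ?thesis using P_le[of k] by simp
    qed (use P0 P1 in auto)
  qed
  also have "\<dots> = ennreal (claim_tail x) * emeasure ?q {1} + emeasure ?q {2..}"
    by (subst nn_integral_add) (auto simp: nn_integral_cmult_indicator)
  finally have "(\<integral>\<^sup>+k. ?P k \<partial>?q) \<le> ennreal (claim_tail x) * emeasure ?q {1} + emeasure ?q {2..}" .
  also have "\<dots> = ennreal (?a * exp (- ?a) * claim_tail x + r)"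
  proof -
    have "ennreal (?a * exp (- ?a) * claim_tail x + r) = ennreal (?a * exp (- ?a) * claim_tail x) + ennreal r"
      using lam_pos h claim_tail_pos[of x] r by (intro ennreal_plus mult_nonneg_nonneg) auto
    also have "ennreal (?a * exp (- ?a) * claim_tail x) = ennreal (claim_tail x) * ennreal (?a * exp (- ?a))"
      using lam_pos h claim_tail_pos[of x] by (subst ennreal_mult[symmetric]) (auto simp: mult_ac less_imp_le)
    finally show ?thesis unfolding q1 q2 ..
  qed
  finally have up: "(\<integral>\<^sup>+k. ?P k \<partial>?q) \<le> ennreal (?a * exp (- ?a) * claim_tail x + r)" .
  have nonneg: "0 \<le> ?a * exp (- ?a) * claim_tail x + r"
    using lam_pos h claim_tail_pos[of x] r by (intro add_nonneg_nonneg mult_nonneg_nonneg) auto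
  have upper: "measure (cell_claims h) {x<..} \<le> ?a * exp (- ?a) * claim_tail x + r"
    using up unfolding E[symmetric] CC.emeasure_eq_measure using nonneg by (subst (asm) ennreal_le_iff) auto
  show "lam * h * exp (- lam * h) * claim_tail x \<le> measure (cell_claims h) {x<..}"
    using lower by simp
  have "?a * exp (- ?a) * claim_tail x \<le> ?a * claim_tail x"
  proof (rule mult_right_mono)
    have "?a * exp (- ?a) \<le> ?a * 1" using lam_pos h by (intro mult_left_mono) auto
    then show "?a * exp (- ?a) \<le> ?a" by simp
  qed (use claim_tail_pos[of x] in simp)
  then show "measure (cell_claims h) {x<..} \<le> lam * h * claim_tail x + (lam * h) ^ 2"
    using upper r by linarith
qed

end

context lundberg_model
begin

text \<open>
  By the Lundberg equation the exponential of \<open>- R\<close> times the reserve has constant mean along the grid.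
\<close>

lemma exp_cell_claims:
  assumes h: "0 < h"
  shows "(\<integral>\<^sup>+s. ennreal (exp (R * s)) \<partial>cell_claims h) = ennreal (exp (R * c * h))"
proof -
  let ?e = "1 + R * c / lam"
  have e: "0 \<le> ?e" using R_pos c_pos lam_pos by simp
  have block: "(\<integral>\<^sup>+z. ennreal (exp (R * (\<Sum>m<k. z m))) \<partial>claims) = ennreal ?e ^ k" for k
  proof (induction k)
    case (Suc k)
    have "(\<integral>\<^sup>+z. ennreal (exp (R * (\<Sum>m<Suc k. z m))) \<partial>claims)
       = (\<integral>\<^sup>+s. \<integral>\<^sup>+z. ennreal (exp (R * (\<Sum>m<Suc k. case_nat s z m))) \<partial>claims \<partial>claim_law)"
      by (rule claims.nn_integral_case_nat) measurable
    also have "\<dots> = (\<integral>\<^sup>+s. \<integral>\<^sup>+z. ennreal (exp (R * s)) * ennreal (exp (R * (\<Sum>m<k. z m))) \<partial>claims \<partial>claim_law)"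
      by (simp add: lessThan_Suc_eq_insert_0 sum.reindex distrib_left exp_add ennreal_mult del: sum.lessThan_Suc)
    also have "\<dots> = (\<integral>\<^sup>+s. ennreal (exp (R * s)) * ennreal ?e ^ k \<partial>claim_law)"
      by (subst nn_integral_cmult) (auto simp: Suc)
    also have "\<dots> = ennreal ?e ^ Suc k"
      by (subst nn_integral_multc) (auto simp: exp_claim)
    finally show ?case .
  qed simp
  have "(\<integral>\<^sup>+s. ennreal (exp (R * s)) \<partial>cell_claims h)
     = (\<integral>\<^sup>+k. ennreal ?e ^ k \<partial>measure_pmf (cell_count h))"
    by (subst nn_integral_cell_claims) (auto simp: block)
  also have "\<dots> = ennreal (exp (lam * h * (?e - 1)))"
    using h lam_pos e by (intro nn_integral_poisson_exp) auto
  also have "lam * h * (?e - 1) = R * c * h" using lam_pos by simp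
  finally show ?thesis .
qed

end

section \<open>Pathwise comparison of the reserve with its grid values\<close>

definition ruin_cost :: "real \<Rightarrow> cell_cost" where
  "ruin_cost a x \<nu> z = (if x + a - (\<Sum>m<\<nu> 0. z m) < 0 then 1 else 0)"

lemma walk_sum_ruin_le:
  "walk_sum a (ruin_cost a) n x \<nu> z \<le> (if \<exists>i. walk_pos a x \<nu> z (Suc i) < 0 then 1 else 0)"
proof (induction n arbitrary: x \<nu> z)
  case (Suc n)
  let ?x = "x + a - (\<Sum>m<\<nu> 0. z m)"
  show ?case
  proof (cases "?x < 0")
    case True
    then have "walk_pos a x \<nu> z (Suc 0) < 0" by (simp only: walk_pos_Suc walk_pos_0)
    then have "\<exists>i. walk_pos a x \<nu> z (Suc i) < 0" by blast
    then show ?thesis using True by (simp add: ruin_cost_def)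
  next
    case False
    have "walk_sum a (ruin_cost a) (Suc n) x \<nu> z
        = walk_sum a (ruin_cost a) n ?x (shift_seq 1 \<nu>) (shift_seq (\<nu> 0) z)"
      using False by (simp add: ruin_cost_def)
    also have "\<dots> \<le> (if \<exists>i. walk_pos a ?x (shift_seq 1 \<nu>) (shift_seq (\<nu> 0) z) (Suc i) < 0 then 1 else 0)"
      by (rule Suc.IH)
    also have "\<dots> \<le> (if \<exists>i. walk_pos a x \<nu> z (Suc i) < 0 then 1 else 0)"
      unfolding walk_pos_Suc[of a x \<nu> z, symmetric] by auto
    finally show ?thesis .
  qed
qed simp

lemma walk_sum_ruin_ge:
  "walk_pos a x \<nu> z (Suc i) < 0 \<Longrightarrow> 1 \<le> walk_sum a (ruin_cost a) (Suc i) x \<nu> z"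
proof (induction i arbitrary: x \<nu> z)
  case 0
  then show ?case by (simp add: ruin_cost_def walk_pos_Suc del: One_nat_def)
next
  case (Suc i)
  let ?x = "x + a - (\<Sum>m<\<nu> 0. z m)"
  show ?case
  proof (cases "?x < 0")
    case False
    have "1 \<le> walk_sum a (ruin_cost a) (Suc i) ?x (shift_seq 1 \<nu>) (shift_seq (\<nu> 0) z)"
      using Suc.prems by (intro Suc.IH) (simp only: walk_pos_Suc[of a x])
    then show ?thesis
      using False by (subst walk_sum.simps(2)) (simp add: ruin_cost_def)
  qed (simp add: ruin_cost_def)
qed

lemma walk_sum_mono_cost:
  "(\<And>x \<nu> z. f x \<nu> z \<le> g x \<nu> z) \<Longrightarrow> walk_sum a f n x \<nu> z \<le> walk_sum a g n x \<nu> z"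
  unfolding walk_sum_eq by (intro sum_mono) auto

context risk_process
begin

definition positive_claims :: "'a \<Rightarrow> bool" where
  "positive_claims \<omega> \<longleftrightarrow> (\<forall>i\<ge>1. 0 < Z i \<omega>)"

lemma AE_positive_claims: "AE \<omega> in M. positive_claims \<omega>"
proof -
  have "AE \<omega> in M. \<forall>i. 1 \<le> i \<longrightarrow> 0 < Z i \<omega>"
    unfolding AE_all_countable using model by (auto simp: reserve_model_def)
  then show ?thesis by (simp add: positive_claims_def)
qed

lemma sum_cell_increments:
  assumes w: "\<omega> \<in> space M" and h: "0 \<le> h"
  shows "(\<Sum>l<i. cell_increments h \<omega> l) = N (h * real i) \<omega>"
proof (induction i)
  case (Suc i)
  have "N (h * real i) \<omega> \<le> N (h * real (Suc i)) \<omega>"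
    using h by (intro counting_mono[OF w]) (auto intro: mult_left_mono)
  then show ?case using Suc by (simp add: cell_increments_def)
qed (use counting_0[OF w] in simp)

lemma walk_pos_process:
  assumes "\<omega> \<in> space M" "0 \<le> h"
  shows "walk_pos (c * h) x (cell_increments h \<omega>) z i
     = x + c * (h * real i) - (\<Sum>m<N (h * real i) \<omega>. z m)"
  using sum_cell_increments[OF assms] by (simp add: walk_pos_def)

lemma surplus_eq: "surplus u t \<omega> = u + c * t - (\<Sum>m<N t \<omega>. claim_seq \<omega> m)"
proof -
  have "(\<Sum>i=1..n. Z i \<omega>) = (\<Sum>m<n. Z (Suc m) \<omega>)" for n
    by (rule sum.reindex_bij_witness[of _ Suc "\<lambda>i. i - 1"]) auto
  then show ?thesis by (simp only: reserve_def claim_seq_def)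
qed

lemma unit_walk_pos:
  assumes "\<omega> \<in> space M"
  shows "walk_pos c u (cell_increments 1 \<omega>) (claim_seq \<omega>) i = surplus u (real i) \<omega>"
  using walk_pos_process[OF assms, of 1 u "claim_seq \<omega>" i] by (simp add: surplus_eq)

text \<open>
  Claims are positive, so the reserve increases at most at the premium rate. This is the only
  path property behind the comparisons of grids.
\<close>

lemma surplus_diff_le:
  assumes w: "\<omega> \<in> space M" and pos: "positive_claims \<omega>" and t: "0 \<le> s" "s \<le> t"
  shows "surplus u t \<omega> \<le> surplus u s \<omega> + c * (t - s)"
proof -
  have "(\<Sum>m<N s \<omega>. claim_seq \<omega> m) \<le> (\<Sum>m<N t \<omega>. claim_seq \<omega> m)"
    using counting_mono[OF w t] pos
    by (intro sum_mono2) (auto simp: positive_claims_def claim_seq_def less_imp_le)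
  then show ?thesis by (simp add: surplus_eq algebra_simps)
qed

text \<open>
  Charged to the unit cell in which ruin happens: its claims \<open>S\<close> exceed the reserve at its beginning, and
  \<open>S + c\<close> bounds the surplus before ruin.
\<close>

definition overshoot_cost :: "nat \<Rightarrow> cell_cost" where
  "overshoot_cost j x \<nu> z = (let S = (\<Sum>m<\<nu> 0. z m) in if x < S then ennreal ((S + c) ^ j) else 0)"

text \<open>
  Let \<open>i\<close> be the last integer strictly before ruin. During the unit interval after \<open>i\<close> the reserve gains at most \<open>c\<close>,
  and the claims of the whole interval exceed the reserve at time \<open>i\<close>.
\<close>

lemma surplus_moment_le_walk_sum:
  assumes w: "\<omega> \<in> ruined u" and u: "0 \<le> u" and pos: "positive_claims \<omega>"
  shows "\<exists>n. ennreal (surplus_before_ruin (surplus u) \<omega> ^ j)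
      \<le> walk_sum c (overshoot_cost j) n u (cell_increments 1 \<omega>) (claim_seq \<omega>)"
proof -
  have sp: "\<omega> \<in> space M" using w by (simp add: ruined_def)
  obtain T where T: "0 < T" "surplus u T \<omega> < 0" "\<And>t. 0 \<le> t \<Longrightarrow> t < T \<Longrightarrow> 0 \<le> surplus u t \<omega>"
    "ruin_time (surplus u) \<omega> = ereal T"
    using first_ruin_instant[OF sp u] ruined_iff[OF sp u] w by metis
  obtain e m0 where e: "0 < e" "e \<le> T" "\<And>s. T - e \<le> s \<Longrightarrow> s < T \<Longrightarrow> N s \<omega> = m0"
    using counting_constant_left[OF sp T(1)] by auto
  define i where "i = nat (\<lceil>T\<rceil> - 1)"
  have i: "real i < T" "T \<le> real i + 1"
    using T(1) unfolding i_def by (simp_all add: of_nat_nat) linarith+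
  let ?X = "surplus_before_ruin (surplus u) \<omega>"
  let ?S = "\<Sum>m<cell_increments 1 \<omega> i. claim_seq \<omega> (m + N (real i) \<omega>)"
  have N_i: "(\<Sum>l<i. cell_increments 1 \<omega> l) = N (real i) \<omega>"
    using sum_cell_increments[OF sp, of 1 i] by simp
  have X: "?X = u + c * T - (\<Sum>i=1..m0. Z i \<omega>)"
    by (rule surplus_left_limit[OF sp T(1,4) e(1,3)])
  have "?X \<le> surplus u (real i) \<omega> + c"
  proof -
    define s where "s = max (real i) (T - e)"
    have s: "real i \<le> s" "s < T" "N s \<omega> = m0" "0 \<le> s" using i e by (auto simp: s_def)
    have "?X = surplus u s \<omega> + c * (T - s)" using s by (simp add: X reserve_def algebra_simps)
    also have "\<dots> \<le> surplus u (real i) \<omega> + c * (s - real i) + c * (T - s)"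
      using surplus_diff_le[OF sp pos _ s(1)] by simp
    also have "\<dots> = surplus u (real i) \<omega> + c * (T - real i)" by (simp add: algebra_simps)
    also have "c * (T - real i) \<le> c * 1" using i c_pos by (intro mult_left_mono) auto
    finally show ?thesis by simp
  qed
  moreover have S: "surplus u (real i) \<omega> < ?S"
  proof -
    have "surplus u (real (Suc i)) \<omega> \<le> surplus u T \<omega> + c * (real (Suc i) - T)"
      using i T by (intro surplus_diff_le[OF sp pos]) auto
    also have "c * (real (Suc i) - T) \<le> c * 1" using i c_pos by (intro mult_left_mono) auto
    finally have "surplus u (real (Suc i)) \<omega> < c" using T(2) by simp
    moreover have "surplus u (real (Suc i)) \<omega> = surplus u (real i) \<omega> + c - ?S"
    proof -
      have "N (real (Suc i)) \<omega> = N (real i) \<omega> + cell_increments 1 \<omega> i"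
        using counting_mono[OF sp, of "real i" "real (Suc i)"] by (simp add: cell_increments_def)
      moreover have "(\<Sum>m<k + n. z m) = (\<Sum>m<k. z m) + (\<Sum>m<n. z (m + k))" for z :: "nat \<Rightarrow> real" and k n
        by (induction n) (simp_all add: add.commute add.left_commute)
      ultimately show ?thesis by (simp add: surplus_eq algebra_simps)
    qed
    ultimately show ?thesis by simp
  qed
  ultimately have "?X ^ j \<le> (?S + c) ^ j"
    using surplus_before_ruin_nonneg[OF w u] by (intro power_mono) auto
  then have "ennreal (?X ^ j) \<le> overshoot_cost j (surplus u (real i) \<omega>)
     (shift_seq i (cell_increments 1 \<omega>)) (shift_seq (N (real i) \<omega>) (claim_seq \<omega>))"
    using S by (simp add: overshoot_cost_def Let_def ennreal_leI)
  moreover have "walk_alive c u (cell_increments 1 \<omega>) (claim_seq \<omega>) i"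
    unfolding walk_alive_def unit_walk_pos[OF sp] using i by (intro allI impI T(3)) auto
  ultimately have "ennreal (?X ^ j) \<le> (if walk_alive c u (cell_increments 1 \<omega>) (claim_seq \<omega>) i
      then overshoot_cost j (walk_pos c u (cell_increments 1 \<omega>) (claim_seq \<omega>) i)
        (shift_seq i (cell_increments 1 \<omega>)) (shift_seq (\<Sum>l<i. cell_increments 1 \<omega> l) (claim_seq \<omega>)) else 0)"
    by (simp only: N_i unit_walk_pos[OF sp] if_True)
  also have "\<dots> \<le> walk_sum c (overshoot_cost j) (Suc i) u (cell_increments 1 \<omega>) (claim_seq \<omega>)"
    unfolding walk_sum_eq by (rule member_le_sum) auto
  finally show ?thesis ..
qed

lemma walk_ruin_imp_ruined:
  assumes sp: "\<omega> \<in> space M" and u: "0 \<le> u"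
  shows "walk_sum c (ruin_cost c) n u (cell_increments 1 \<omega>) (claim_seq \<omega>) \<le> indicator (ruined u) \<omega>"
proof -
  have "\<omega> \<in> ruined u" if "walk_pos c u (cell_increments 1 \<omega>) (claim_seq \<omega>) (Suc i) < 0" for i
    using that unfolding unit_walk_pos[OF sp] ruined_iff[OF sp u] by (intro exI[of _ "real (Suc i)"]) auto
  then show ?thesis
    by (intro order_trans[OF walk_sum_ruin_le]) (auto simp: indicator_def)
qed

lemma ruined_imp_walk_below:
  assumes sp: "\<omega> \<in> space M" and u: "0 \<le> u" and pos: "positive_claims \<omega>" and w: "\<omega> \<in> ruined u"
  shows "\<exists>i. walk_pos c (u - c) (cell_increments 1 \<omega>) (claim_seq \<omega>) (Suc i) < 0"
proof -
  obtain t where t: "0 \<le> t" "surplus u t \<omega> < 0" using w ruined_iff[OF sp u] by auto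
  define i where "i = nat \<lfloor>t\<rfloor>"
  have i: "real i \<le> t" "t \<le> real (Suc i)" using t by (auto simp: i_def) linarith
  have "surplus u (real (Suc i)) \<omega> \<le> surplus u t \<omega> + c * (real (Suc i) - t)"
    using i t by (intro surplus_diff_le[OF sp pos]) auto
  also have "c * (real (Suc i) - t) \<le> c * 1" using i c_pos by (intro mult_left_mono) auto
  finally have "surplus u (real (Suc i)) \<omega> < c" using t by simp
  then show ?thesis unfolding unit_walk_pos[OF sp] by (intro exI[of _ i]) (simp add: reserve_def)
qed

text \<open>
  After time \<open>p\<close> nothing happens for one unit of time, so the reserve climbs by \<open>c\<close>; the first claim
  afterwards is larger than anything the reserve can reach before \<open>p + 2\<close>. So ruin occurs at this claim, and from a surplus of at least \<open>c\<close>.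
\<close>

lemma forced_ruin:
  assumes sp: "\<omega> \<in> space M" and u: "0 \<le> u" and pos: "positive_claims \<omega>"
    and alive: "\<And>t. 0 \<le> t \<Longrightarrow> t \<le> real p \<Longrightarrow> 0 \<le> surplus u t \<omega>"
    and small: "surplus u (real p) \<omega> < K"
    and quiet: "N (real p + 1) \<omega> = N (real p) \<omega>" and claim: "N (real p + 1) \<omega> < N (real p + 2) \<omega>"
    and big: "K + 3 * c < claim_seq \<omega> (N (real p) \<omega>)"
  shows "\<omega> \<in> ruined u \<and> c \<le> surplus_before_ruin (surplus u) \<omega>"
proof -
  have after: "surplus u t \<omega> < 0" if "0 \<le> t" "t \<le> real p + 2" "N (real p) \<omega> < N t \<omega>" for t
  proof -
    have "(\<Sum>m<Suc (N (real p) \<omega>). claim_seq \<omega> m) \<le> (\<Sum>m<N t \<omega>. claim_seq \<omega> m)"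
      using that pos by (intro sum_mono2) (auto simp: positive_claims_def claim_seq_def less_imp_le)
    moreover have "c * t \<le> c * (real p + 2)" using that c_pos by (intro mult_left_mono) auto
    ultimately have "surplus u t \<omega> \<le> surplus u (real p) \<omega> + 2 * c - claim_seq \<omega> (N (real p) \<omega>)"
      by (simp add: surplus_eq algebra_simps)
    then show ?thesis using small big c_pos by simp
  qed
  have "\<exists>t\<ge>0. surplus u t \<omega> < 0"
    using after[of "real p + 2"] claim quiet by (intro exI[of _ "real p + 2"]) simp
  then have w: "\<omega> \<in> ruined u" using ruined_iff[OF sp u] by blast
  obtain T where T: "0 < T" "surplus u T \<omega> < 0" "\<And>t. 0 \<le> t \<Longrightarrow> t < T \<Longrightarrow> 0 \<le> surplus u t \<omega>"
    "ruin_time (surplus u) \<omega> = ereal T"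
    using first_ruin_instant[OF sp u \<open>\<exists>t\<ge>0. surplus u t \<omega> < 0\<close>] by metis
  have mid: "surplus u t \<omega> = surplus u (real p) \<omega> + c * (t - real p)" if "real p \<le> t" "N t \<omega> = N (real p) \<omega>" for t
    using that by (simp add: surplus_eq algebra_simps)
  have T1: "real p + 1 < T"
  proof (rule ccontr)
    assume "\<not> real p + 1 < T"
    then have T_le: "T \<le> real p + 1" by simp
    have gt: "real p < T" using alive[of T] T(1,2) by force
    have "N T \<omega> = N (real p) \<omega>"
      using counting_mono[OF sp, of "real p" T] counting_mono[OF sp, of T "real p + 1"] gt T_le T(1) quiet by simp
    then have "surplus u T \<omega> = surplus u (real p) \<omega> + c * (T - real p)" using mid[of T] gt by simp
    then show False using T(2) alive[of "real p"] gt c_pos by (smt (verit) mult_nonneg_nonneg of_nat_0_le_iff)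
  qed
  have T2: "T \<le> real p + 2"
    using T(3)[of "real p + 2"] after[of "real p + 2"] claim quiet by force
  obtain e m0 where e: "0 < e" "e \<le> T" "\<And>s. T - e \<le> s \<Longrightarrow> s < T \<Longrightarrow> N s \<omega> = m0"
    using counting_constant_left[OF sp T(1)] by auto
  define s where "s = max (real p + 1) (T - e)"
  have s: "real p + 1 \<le> s" "s < T" "N s \<omega> = m0" using e T1 by (auto simp: s_def)
  have "N s \<omega> = N (real p) \<omega>"
  proof (rule ccontr)
    assume "N s \<omega> \<noteq> N (real p) \<omega>"
    then have "N (real p) \<omega> < N s \<omega>" using counting_mono[OF sp, of "real p" s] s by simp
    then show False using after[of s] T(3)[of s] s T2 by simp
  qed
  then have "surplus u s \<omega> = surplus u (real p) \<omega> + c * (s - real p)" using mid[of s] s by simp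
  moreover have "surplus_before_ruin (surplus u) \<omega> = surplus u s \<omega> + c * (T - s)"
    using surplus_left_limit[OF sp T(1,4) e(1,3)] s by (simp add: reserve_def algebra_simps)
  ultimately have "surplus_before_ruin (surplus u) \<omega> = surplus u (real p) \<omega> + c * (T - real p)"
    by (simp add: algebra_simps)
  moreover have "c * 1 \<le> c * (T - real p)" using T1 c_pos by (intro mult_left_mono) auto
  ultimately show ?thesis using w alive[of "real p"] by simp
qed

text \<open>
  For a walk started at \<open>u - K\<close>: in the current cell it falls below zero, but by no more than \<open>K - c\<close>, the next
  cell is free of claims, the following one is not, and the first unused claim is huge.
\<close>

definition forced_cost :: "real \<Rightarrow> cell_cost" where
  "forced_cost K x \<nu> z = (let y = x + c - (\<Sum>m<\<nu> 0. z m) in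
     if c - K \<le> y \<and> y < 0 \<and> \<nu> 1 = 0 \<and> 1 \<le> \<nu> 2 \<and> K + 3 * c < z (\<nu> 0) then 1 else 0)"

text \<open>
  The true reserve exceeds the walk by \<open>K\<close>, and it is never smaller than its value at the next integer time
  minus \<open>c\<close>. So it stays nonnegative up to the end of the cell in which the walk falls below zero;
  there it lies in \<open>[c, K)\<close>, and \<open>forced_ruin\<close> applies. The event can be charged only once.
\<close>

lemma walk_sum_forced_le_surplus:
  assumes sp: "\<omega> \<in> space M" and u: "0 \<le> u" and pos: "positive_claims \<omega>" and K: "c \<le> K"
  shows "ennreal (c ^ j) * walk_sum c (forced_cost K) n (u - K) (cell_increments 1 \<omega>) (claim_seq \<omega>)
    \<le> ennreal (surplus_before_ruin (surplus u) \<omega> ^ j) * indicator (ruined u) \<omega>"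
proof (cases "walk_sum c (forced_cost K) n (u - K) (cell_increments 1 \<omega>) (claim_seq \<omega>) = 0")
  case False
  let ?\<nu> = "cell_increments 1 \<omega>" and ?z = "claim_seq \<omega>"
  have "walk_sum c (forced_cost K) n (u - K) ?\<nu> ?z \<le> walk_sum c (ruin_cost c) n (u - K) ?\<nu> ?z"
    by (rule walk_sum_mono_cost) (auto simp: forced_cost_def ruin_cost_def Let_def)
  also have "\<dots> \<le> 1" by (rule order_trans[OF walk_sum_ruin_le]) auto
  finally have le1: "walk_sum c (forced_cost K) n (u - K) ?\<nu> ?z \<le> 1" .
  have N_i: "(\<Sum>l<i. ?\<nu> l) = N (real i) \<omega>" for i
    using sum_cell_increments[OF sp, of 1 i] by simp
  obtain i where i: "walk_alive c (u - K) ?\<nu> ?z i"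
    "forced_cost K (walk_pos c (u - K) ?\<nu> ?z i) (shift_seq i ?\<nu>) (shift_seq (N (real i) \<omega>) ?z) \<noteq> 0"
    using False unfolding walk_sum_eq N_i by (auto split: if_splits)
  let ?S = "\<Sum>m<?\<nu> i. ?z (m + N (real i) \<omega>)"
  have N_Suc: "N (real (Suc l)) \<omega> = N (real l) \<omega> + ?\<nu> l" for l
    using counting_mono[OF sp, of "real l" "real (Suc l)"] by (simp add: cell_increments_def)
  have shift: "surplus v (real l) \<omega> = surplus u (real l) \<omega> + (v - u)" for v l
    by (simp add: reserve_def)
  have step: "surplus v (real (Suc i)) \<omega> = surplus v (real i) \<omega> + c - ?S" for v
  proof -
    have "(\<Sum>m<k + n. z m) = (\<Sum>m<k. z m) + (\<Sum>m<n. z (m + k))" for z :: "nat \<Rightarrow> real" and k n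
      by (induction n) (simp_all add: add.commute add.left_commute)
    then show ?thesis using N_Suc[of i] by (simp add: surplus_eq algebra_simps)
  qed
  have f: "c - K \<le> surplus (u - K) (real (Suc i)) \<omega>" "surplus (u - K) (real (Suc i)) \<omega> < 0"
     "?\<nu> (Suc i) = 0" "1 \<le> ?\<nu> (Suc (Suc i))" "K + 3 * c < ?z (N (real (Suc i)) \<omega>)"
    using i(2) unfolding unit_walk_pos[OF sp] forced_cost_def Let_def step[of "u - K"] N_Suc[of i]
    by (auto split: if_splits simp: add.commute numeral_2_eq_2)
  have above: "c \<le> surplus u (real (Suc l)) \<omega>" if "l \<le> i" for l
  proof (cases "l = i")
    case True then show ?thesis using f(1) shift[of "u - K" "Suc i"] by simp
  next
    case False
    then have "0 \<le> surplus (u - K) (real (Suc l)) \<omega>"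
      using i(1) that unfolding walk_alive_def unit_walk_pos[OF sp] by auto
    then show ?thesis using K shift[of "u - K" "Suc l"] by simp
  qed
  have alive: "0 \<le> surplus u t \<omega>" if "0 \<le> t" "t \<le> real (Suc i)" for t
  proof (cases "t = 0")
    case True then show ?thesis using u counting_0[OF sp] by (simp add: reserve_def)
  next
    case False
    define l where "l = nat (\<lceil>t\<rceil> - 1)"
    have l: "real l < t" "t \<le> real (Suc l)" using that False unfolding l_def by (simp_all add: of_nat_nat) linarith+
    then have "l \<le> i" using that by linarith
    have "surplus u (real (Suc l)) \<omega> \<le> surplus u t \<omega> + c * (real (Suc l) - t)"
      using l that by (intro surplus_diff_le[OF sp pos]) auto
    moreover have "c * (real (Suc l) - t) \<le> c * 1" using l c_pos by (intro mult_left_mono) auto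
    ultimately show ?thesis using above[OF \<open>l \<le> i\<close>] by simp
  qed
  have "\<omega> \<in> ruined u \<and> c \<le> surplus_before_ruin (surplus u) \<omega>"
  proof (rule forced_ruin[OF sp u pos alive, of "Suc i" K])
    show "surplus u (real (Suc i)) \<omega> < K" using f(2) shift[of "u - K" "Suc i"] by simp
    show "N (real (Suc i) + 1) \<omega> = N (real (Suc i)) \<omega>"
      using N_Suc[of "Suc i"] f(3) by (simp add: algebra_simps)
    show "N (real (Suc i) + 1) \<omega> < N (real (Suc i) + 2) \<omega>"
      using N_Suc[of "Suc (Suc i)"] f(4) by (simp add: algebra_simps)
  qed (use f in auto)
  then show ?thesis
    using le1 c_pos mult_mono[of "ennreal (c ^ j)" "ennreal (surplus_before_ruin (surplus u) \<omega> ^ j)"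
        "walk_sum c (forced_cost K) n (u - K) ?\<nu> ?z" 1]
    by (simp add: ennreal_leI power_mono)
qed simp

text \<open>
  In a unit cell without claims the fine walk, which starts at most \<open>2 c\<close> higher, has nonnegative values
  exceeding the unit walk by at most \<open>3 c\<close>. Its \<open>r\<close> grid points in this cell carry weight \<open>h = 1 / r\<close> each and together
  pay for the cost of the cell. The head start of \<open>c\<close> keeps the fine walk nonnegative between integer times.
\<close>

lemma unit_walk_le_fine_walk:
  assumes sp: "\<omega> \<in> space M" and z: "\<And>m. 0 \<le> z m" and u: "0 \<le> u" and r: "0 < r"
    and v: "u + c \<le> v" "v \<le> u + 2 * c" and q: "\<And>x y. x \<le> y \<Longrightarrow> q y \<le> q x"
  defines "h \<equiv> 1 / real r"
  shows "walk_sum c (\<lambda>x \<nu> z. if \<nu> 0 = 0 then q x else 0) n u (cell_increments 1 \<omega>) z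
    \<le> walk_sum (c * h) (\<lambda>x \<nu> z. ennreal h * q (x - 3 * c)) (n * r) v (cell_increments h \<omega>) z"
proof -
  have h: "0 < h" "h * real r = 1" using r by (auto simp: h_def)
  define U where "U t = u + c * t - (\<Sum>m<N t \<omega>. z m)" for t
  define V where "V t = v + c * t - (\<Sum>m<N t \<omega>. z m)" for t
  have VU: "V t = U t + (v - u)" for t by (simp add: U_def V_def)
  have pos1: "walk_pos c u (cell_increments 1 \<omega>) z i = U (real i)" for i
    using walk_pos_process[OF sp, of 1] by (simp add: U_def)
  have posh: "walk_pos (c * h) v (cell_increments h \<omega>) z i = V (h * real i)" for i
    using walk_pos_process[OF sp, of h] h by (simp add: V_def)
  have U_diff: "U t \<le> U s + c * (t - s)" if "0 \<le> s" "s \<le> t" for s t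
  proof -
    have "(\<Sum>m<N s \<omega>. z m) \<le> (\<Sum>m<N t \<omega>. z m)"
      using counting_mono[OF sp that] z by (intro sum_mono2) auto
    then show ?thesis by (simp add: U_def algebra_simps)
  qed
  let ?a1 = "walk_alive c u (cell_increments 1 \<omega>) z" and ?ah = "walk_alive (c * h) v (cell_increments h \<omega>) z"
  have group: "(if ?a1 m then (if cell_increments 1 \<omega> m = 0 then q (U (real m)) else 0) else 0)
      \<le> (\<Sum>i\<in>{m * r..<m * r + r}. if ?ah i then ennreal h * q (V (h * real i) - 3 * c) else 0)" for m
  proof (cases "?a1 m \<and> cell_increments 1 \<omega> m = 0")
    case True
    have alive: "0 \<le> U (real l)" if "l \<le> m" for l
    proof (cases l)
      case 0 then show ?thesis using u counting_0[OF sp] by (simp add: U_def)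
    next
      case (Suc l') then show ?thesis using True that unfolding walk_alive_def pos1 by auto
    qed
    have quiet: "N t \<omega> = N (real m) \<omega>" if "real m \<le> t" "t \<le> real (Suc m)" for t
      using True counting_mono[OF sp, of "real m" t] counting_mono[OF sp, of t "real (Suc m)"] that
      by (simp add: cell_increments_def)
    have V_pos: "0 \<le> V t" if t: "0 \<le> t" "t < real (Suc m)" for t
    proof (cases "real m \<le> t")
      case True
      have "U t = U (real m) + c * (t - real m)"
        using quiet[OF True] t by (simp add: U_def algebra_simps)
      then show ?thesis using alive[of m] True v c_pos by (simp add: VU)
    next
      case False
      \<comment> \<open>Before the quiet cell the reserve at the next integer time bounds the value at \<open>t\<close> up to \<open>c\<close>.\<close>
      define l where "l = nat \<lceil>t\<rceil>"
      have l: "t \<le> real l" "real l \<le> t + 1" using t unfolding l_def by (simp_all add: of_nat_nat)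
      have "l \<le> m" using False t unfolding l_def by linarith
      have "0 \<le> U t + c * (real l - t)" using U_diff[OF t(1) l(1)] alive[OF \<open>l \<le> m\<close>] by simp
      moreover have "c * (real l - t) \<le> c * 1" using l c_pos by (intro mult_left_mono) auto
      ultimately show ?thesis using v by (simp add: VU)
    qed
    have "(if ?a1 m then (if cell_increments 1 \<omega> m = 0 then q (U (real m)) else 0) else 0) = q (U (real m))"
      using True by simp
    also have "\<dots> = of_nat r * (ennreal h * q (U (real m)))"
    proof -
      have "of_nat r * ennreal h = ennreal (real r * h)" using h by (simp add: ennreal_mult ennreal_of_nat_eq_real_of_nat)
      then show ?thesis using h by (simp add: mult.assoc[symmetric] mult.commute)
    qed
    also have "\<dots> = (\<Sum>i\<in>{m * r..<m * r + r}. ennreal h * q (U (real m)))" by simp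
    also have "\<dots> \<le> (\<Sum>i\<in>{m * r..<m * r + r}. if ?ah i then ennreal h * q (V (h * real i) - 3 * c) else 0)"
    proof (rule sum_mono)
      fix i assume i: "i \<in> {m * r..<m * r + r}"
      have t: "real m \<le> h * real i" "h * real i < real (Suc m)"
      proof -
        have "real (m * r) \<le> real i" "real i < real ((Suc m) * r)" using i by (simp_all only: of_nat_le_iff of_nat_less_iff) auto
        then have 1: "h * real (m * r) \<le> h * real i" "h * real i < h * real (Suc m * r)"
          using h(1) by (simp_all only: mult_le_cancel_left_pos mult_less_cancel_left_pos)
        have 2: "h * real (l * r) = real l" for l
          using h(2) by (metis mult.assoc mult.commute mult_1_right of_nat_mult)
        show "real m \<le> h * real i" "h * real i < real (Suc m)"
          using 1 unfolding 2 by simp_all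
      qed
      have "?ah i" unfolding walk_alive_def posh
      proof (intro allI impI V_pos)
        fix l assume "l < i"
        then have "h * real (Suc l) \<le> h * real i" using h by (intro mult_left_mono) auto
        then show "h * real (Suc l) < real (Suc m)" using t(2) by linarith
      qed (use h in auto)
      moreover have "q (U (real m)) \<le> q (V (h * real i) - 3 * c)"
      proof (rule q)
        have "U (h * real i) \<le> U (real m) + c * (h * real i - real m)" using t by (intro U_diff) auto
        also have "c * (h * real i - real m) \<le> c * 1" using t c_pos by (intro mult_left_mono) auto
        finally show "V (h * real i) - 3 * c \<le> U (real m)" using v by (simp add: VU)
      qed
      ultimately show "ennreal h * q (U (real m)) \<le> (if ?ah i then ennreal h * q (V (h * real i) - 3 * c) else 0)"
        by (simp add: mult_left_mono)
    qed
    finally show ?thesis .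
  qed auto
  have "walk_sum c (\<lambda>x \<nu> z. if \<nu> 0 = 0 then q x else 0) n u (cell_increments 1 \<omega>) z
      = (\<Sum>m<n. if ?a1 m then (if cell_increments 1 \<omega> m = 0 then q (U (real m)) else 0) else 0)"
    unfolding walk_sum_eq pos1 by (simp cong: if_cong)
  also have "\<dots> \<le> (\<Sum>m<n. \<Sum>i\<in>{m * r..<m * r + r}. if ?ah i then ennreal h * q (V (h * real i) - 3 * c) else 0)"
    by (intro sum_mono group)
  also have "\<dots> = (\<Sum>i<n * r. if ?ah i then ennreal h * q (V (h * real i) - 3 * c) else 0)"
    by (rule sum.nat_group)
  also have "\<dots> = walk_sum (c * h) (\<lambda>x \<nu> z. ennreal h * q (x - 3 * c)) (n * r) v (cell_increments h \<omega>) z"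
    unfolding walk_sum_eq posh ..
  finally show ?thesis .
qed

text \<open>
  A negative value between two integer times is still visible at the next one if the initial
  reserve is lowered by \<open>c\<close>.
\<close>

lemma fine_ruin_imp_unit_ruin:
  assumes sp: "\<omega> \<in> space M" and z: "\<And>m. 0 \<le> z m" and h: "0 < h"
    and ruin: "walk_pos (c * h) (u + c) (cell_increments h \<omega>) z (Suc i) < 0"
  shows "\<exists>n. walk_pos c u (cell_increments 1 \<omega>) z (Suc n) < 0"
proof -
  define t where "t = h * real (Suc i)"
  define n where "n = nat (\<lceil>t\<rceil> - 1)"
  have t: "0 < t" using h by (simp add: t_def)
  then have n: "t \<le> real (Suc n)" "real (Suc n) \<le> t + 1" unfolding n_def by (simp_all add: of_nat_nat)
  have "(\<Sum>m<N t \<omega>. z m) \<le> (\<Sum>m<N (real (Suc n)) \<omega>. z m)"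
    using counting_mono[OF sp less_imp_le[OF t] n(1)] z by (intro sum_mono2) auto
  moreover have "c * real (Suc n) \<le> c * (t + 1)" using n c_pos by (intro mult_left_mono) auto
  moreover have "u + c + c * t - (\<Sum>m<N t \<omega>. z m) < 0"
    using ruin walk_pos_process[OF sp, of h "u + c" z "Suc i"] h by (simp add: t_def)
  ultimately have "u + c * real (Suc n) - (\<Sum>m<N (real (Suc n)) \<omega>. z m) < 0" by (simp add: algebra_simps)
  then show ?thesis
    using walk_pos_process[OF sp, of 1 u z "Suc n"] by (intro exI[of _ n]) simp
qed

end

section \<open>Expectations over the grid walks\<close>

lemma sequence_value_measurable:
  fixes z :: "'l \<Rightarrow> nat \<Rightarrow> real"
  assumes "k \<in> L \<rightarrow>\<^sub>M count_space UNIV" "\<And>m. (\<lambda>x. z x m) \<in> borel_measurable L"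
  shows "(\<lambda>x. z x (k x)) \<in> borel_measurable L"
  by (rule measurable_compose_countable[where f="\<lambda>n x. z x n" and g=k]) (use assms in auto)

lemma cell_cost_measurable_ruin: "cell_cost_measurable (ruin_cost a)"
  unfolding cell_cost_measurable_def split_beta' ruin_cost_def by measurable

lemma cell_cost_measurable_state:
  assumes [measurable]: "q \<in> borel_measurable borel"
  shows "cell_cost_measurable (\<lambda>x \<nu> z. q x)"
    and "cell_cost_measurable (\<lambda>x \<nu> z. if \<nu> 0 = 0 then q x else 0)"
  unfolding cell_cost_measurable_def split_beta' by measurable

lemma walk_sum_incseq: "incseq (\<lambda>n. walk_sum a f n x \<nu> z)"
  unfolding walk_sum_eq incseq_def by (auto intro!: sum_mono2)

definition walk_ruined :: "real \<Rightarrow> cell_cost" where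
  "walk_ruined a x \<nu> z = (if \<exists>i. walk_pos a x \<nu> z (Suc i) < 0 then 1 else 0)"

lemma walk_ruined_eq_SUP: "walk_ruined a x \<nu> z = (SUP n. walk_sum a (ruin_cost a) n x \<nu> z)"
proof (rule antisym)
  show "walk_ruined a x \<nu> z \<le> (SUP n. walk_sum a (ruin_cost a) n x \<nu> z)"
    unfolding walk_ruined_def by (auto intro: SUP_upper2 walk_sum_ruin_ge)
  show "(SUP n. walk_sum a (ruin_cost a) n x \<nu> z) \<le> walk_ruined a x \<nu> z"
    unfolding walk_ruined_def by (intro SUP_least walk_sum_ruin_le)
qed

lemma cell_cost_measurable_walk_ruined: "cell_cost_measurable (walk_ruined a)"
proof -
  have "(\<lambda>y. walk_sum a (ruin_cost a) n (fst y) (fst (snd y)) (snd (snd y)))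
     \<in> borel_measurable (borel \<Otimes>\<^sub>M (PiM UNIV (\<lambda>_. count_space UNIV) \<Otimes>\<^sub>M PiM UNIV (\<lambda>_. borel)))" for n
    using walk_sum_measurable[OF cell_cost_measurable_ruin, of a a n]
    unfolding cell_cost_measurable_def split_beta' .
  then show ?thesis unfolding cell_cost_measurable_def split_beta' walk_ruined_eq_SUP
    by (intro borel_measurable_SUP) auto
qed

lemma walk_ruined_antimono: "x \<le> y \<Longrightarrow> walk_ruined a y \<nu> z \<le> walk_ruined a x \<nu> z"
proof -
  assume "x \<le> y"
  then have le: "walk_pos a x \<nu> z i \<le> walk_pos a y \<nu> z i" for i by (simp add: walk_pos_def)
  show ?thesis
  proof (cases "\<exists>i. walk_pos a y \<nu> z (Suc i) < 0")
    case True
    then have "\<exists>i. walk_pos a x \<nu> z (Suc i) < 0" using le by (meson order.strict_trans1)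
    then show ?thesis by (simp only: walk_ruined_def if_True) simp
  qed (simp only: walk_ruined_def if_False zero_le)
qed

context risk_process
begin

lemma cell_mean_mono:
  "(\<And>\<nu> z. f x \<nu> z \<le> g y \<nu> z) \<Longrightarrow> cell_mean h f x \<le> cell_mean h g y"
  unfolding cell_mean_def by (intro nn_integral_mono)

text \<open>
  Counts of all grids can be realised by the same counting process, paired with a sequence of claims that is
  independent of the whole process. This makes pathwise comparisons between grids available.
\<close>

lemma cell_mean_process:
  assumes h: "0 < h" and f: "cell_cost_measurable f"
  shows "cell_mean h f x = (\<integral>\<^sup>+z. \<integral>\<^sup>+\<omega>. f x (cell_increments h \<omega>) z \<partial>M \<partial>claims)"
proof -
  interpret C: prob_space "cell_counts h" by (rule prob_space_cell_counts)
  interpret CC: pair_prob_space "cell_counts h" claims ..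
  have "cell_mean h f x = (\<integral>\<^sup>+z. \<integral>\<^sup>+\<nu>. f x \<nu> z \<partial>cell_counts h \<partial>claims)"
    unfolding cell_mean_def
  proof (rule CC.Fubini'[symmetric])
    show "(\<lambda>(\<nu>, z). f x \<nu> z) \<in> borel_measurable (cell_counts h \<Otimes>\<^sub>M claims)"
      unfolding split_beta' by (rule cell_costD[OF f, where h=h]) auto
  qed
  also have "\<dots> = (\<integral>\<^sup>+z. \<integral>\<^sup>+\<omega>. f x (cell_increments h \<omega>) z \<partial>M \<partial>claims)"
  proof (rule nn_integral_cong)
    fix z assume "z \<in> space claims"
    then show "(\<integral>\<^sup>+\<nu>. f x \<nu> z \<partial>cell_counts h) = (\<integral>\<^sup>+\<omega>. f x (cell_increments h \<omega>) z \<partial>M)"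
      by (intro nn_integral_cell_counts h cell_costD[OF f, where h=h]) auto
  qed
  finally show ?thesis .
qed

lemma cell_mean_mono_process:
  assumes "0 < h" "0 < h'" "cell_cost_measurable f" "cell_cost_measurable g"
    and le: "\<And>\<omega> z. \<omega> \<in> space M \<Longrightarrow> (\<And>m. 0 \<le> z m) \<Longrightarrow>
      f x (cell_increments h \<omega>) z \<le> g y (cell_increments h' \<omega>) z"
  shows "cell_mean h f x \<le> cell_mean h' g y"
  unfolding cell_mean_process[OF assms(1,3)] cell_mean_process[OF assms(2,4)]
proof (rule nn_integral_mono_AE, use claims_pos in eventually_elim)
  fix z :: "nat \<Rightarrow> real" assume "\<forall>m. 0 < z m"
  then show "(\<integral>\<^sup>+\<omega>. f x (cell_increments h \<omega>) z \<partial>M) \<le> (\<integral>\<^sup>+\<omega>. g y (cell_increments h' \<omega>) z \<partial>M)"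
    by (intro nn_integral_mono le) (auto simp: less_imp_le)
qed

lemma nn_integral_unit_cost:
  assumes f: "cell_cost_measurable f"
  shows "(\<integral>\<^sup>+\<omega>. f x (cell_increments 1 \<omega>) (claim_seq \<omega>) \<partial>M) = cell_mean 1 f x"
  unfolding cell_mean_def
  by (rule nn_integral_unit_grid) (rule cell_cost_measurableD[OF f]; measurable)

lemma unit_cost_measurable:
  assumes f: "cell_cost_measurable f"
  shows "(\<lambda>\<omega>. f x (cell_increments 1 \<omega>) (claim_seq \<omega>)) \<in> borel_measurable M"
  by (intro cell_cost_measurableD[OF f] cell_increments_measurable claim_seq_measurable) auto

text \<open>
  On the unit grid the independent pair of counts and claims may be replaced by the actual ones.
\<close>

lemma nn_integral_unit_walk:
  assumes f: "cell_cost_measurable f"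
  shows "(\<integral>\<^sup>+\<omega>. walk_sum c f n x (cell_increments 1 \<omega>) (claim_seq \<omega>) \<partial>M) = green 1 (cell_mean 1 f) n x"
  using nn_integral_unit_cost[OF walk_sum_measurable[OF f, of c n]] nn_integral_walk_sum[OF f, of 1 n x] by simp

lemma nn_integral_first_count:
  "(\<integral>\<^sup>+\<nu>. F (\<nu> 0) (\<lambda>l. \<nu> (Suc l)) \<partial>cell_counts h)
     = (\<integral>\<^sup>+k. \<integral>\<^sup>+\<nu>. F k \<nu> \<partial>cell_counts h \<partial>measure_pmf (cell_count h))"
  if "(\<lambda>\<nu>. F (\<nu> 0) (\<lambda>l. \<nu> (Suc l))) \<in> borel_measurable (cell_counts h)"
proof -
  interpret K: prob_space "measure_pmf (cell_count h)" by (rule measure_pmf.prob_space_axioms)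
  interpret CS: sequence_space "measure_pmf (cell_count h)" ..
  have CS: "CS.S = cell_counts h" by (simp add: cell_counts_def)
  show ?thesis
    using CS.nn_integral_case_nat[of "\<lambda>\<nu>. F (\<nu> 0) (\<lambda>l. \<nu> (Suc l))"] that unfolding CS by simp
qed

lemma count_function_measurable:
  "(\<lambda>\<nu>. f (\<nu> i) :: ennreal) \<in> borel_measurable (cell_counts h)"
proof -
  have "(\<lambda>\<nu>. \<nu> i) \<in> cell_counts h \<rightarrow>\<^sub>M count_space UNIV" by measurable
  from measurable_compose[OF this, of f] show ?thesis by simp
qed

lemma cell_mean_first_cell:
  assumes [measurable]: "G x \<in> borel_measurable borel"
  shows "cell_mean h (\<lambda>x \<nu> z. G x (\<Sum>m<\<nu> 0. z m)) x = (\<integral>\<^sup>+s. G x s \<partial>cell_claims h)"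
proof -
  interpret C: prob_space "cell_counts h" by (rule prob_space_cell_counts)
  have "cell_mean h (\<lambda>x \<nu> z. G x (\<Sum>m<\<nu> 0. z m)) x
      = (\<integral>\<^sup>+k. \<integral>\<^sup>+\<nu>. (\<integral>\<^sup>+z. G x (\<Sum>m<k. z m) \<partial>claims) \<partial>cell_counts h \<partial>measure_pmf (cell_count h))"
    unfolding cell_mean_def
    by (rule nn_integral_first_count) (rule count_function_measurable)
  also have "\<dots> = (\<integral>\<^sup>+s. G x s \<partial>cell_claims h)"
    by (subst nn_integral_cell_claims) (auto simp: C.emeasure_space_1)
  finally show ?thesis .
qed

lemma green_cmult:
  assumes [measurable]: "F \<in> borel_measurable borel"
  shows "green h (\<lambda>x. a * F x) n u = a * green h F n u"
proof (induction n arbitrary: u)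
  case (Suc n)
  have "walk_step h (green h (\<lambda>x. a * F x) n) u = a * walk_step h (green h F n) u"
  proof -
    have "walk_step h (green h (\<lambda>x. a * F x) n) u
       = (\<integral>\<^sup>+s. a * (if u + c * h - s < 0 then 0 else green h F n (u + c * h - s)) \<partial>cell_claims h)"
      unfolding walk_step_def Suc by (intro nn_integral_cong) simp
    also have "\<dots> = a * walk_step h (green h F n) u"
      unfolding walk_step_def by (rule nn_integral_cmult) measurable
    finally show ?thesis .
  qed
  then show ?case by (simp add: distrib_left)
qed simp

lemma walk_step_mono: "(\<And>x. 0 \<le> x \<Longrightarrow> f x \<le> g x) \<Longrightarrow> walk_step h f u \<le> walk_step h g u"
  unfolding walk_step_def by (intro nn_integral_mono) auto

lemma green_mono:
  assumes "\<And>x. F x \<le> G x" shows "green h F n u \<le> green h G n u"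
proof (induction n arbitrary: u)
  case (Suc n) then show ?case by (simp add: add_mono assms walk_step_mono)
qed simp

lemma green_incseq: "green h F n u \<le> green h F (Suc n) u"
proof (induction n arbitrary: u)
  case (Suc n)
  have eq: "green h F (Suc m) u = F u + walk_step h (green h F m) u" for m by simp
  have "walk_step h (green h F n) u \<le> walk_step h (green h F (Suc n)) u"
    by (rule walk_step_mono) (rule Suc.IH)
  then show ?case unfolding eq[of n] eq[of "Suc n"] by (rule add_left_mono)
qed simp

text \<open>
  The probability that the walk becomes negative in the next step.
\<close>

definition ruin_rate :: "real \<Rightarrow> real \<Rightarrow> ennreal" where
  "ruin_rate h x = emeasure (cell_claims h) {x + c * h<..}"

lemma cell_mean_ruin_cost: "cell_mean h (ruin_cost (c * h)) x = ruin_rate h x"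
proof -
  have "cell_mean h (ruin_cost (c * h)) x = (\<integral>\<^sup>+s. (if x + c * h - s < 0 then 1 else 0) \<partial>cell_claims h)"
    unfolding ruin_cost_def[abs_def]
    by (rule cell_mean_first_cell[where G="\<lambda>x s. if x + c * h - s < 0 then 1 else 0"]) measurable
  also have "\<dots> = (\<integral>\<^sup>+s. indicator {x + c * h<..} s \<partial>cell_claims h)"
    by (intro nn_integral_cong) (auto simp: indicator_def)
  finally show ?thesis by (simp add: ruin_rate_def)
qed

lemma ruin_rate_measurable [measurable]: "ruin_rate h \<in> borel_measurable borel"
  using cell_mean_measurable[OF cell_cost_measurable_ruin, of h "c * h"]
  by (simp add: cell_mean_ruin_cost[abs_def] cong: measurable_cong)

text \<open>
  The starting point may be negative: the walk is first tested after one step.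
\<close>

definition ruin_prob :: "real \<Rightarrow> real \<Rightarrow> ennreal" where
  "ruin_prob h x = cell_mean h (walk_ruined (c * h)) x"

lemma ruin_prob_measurable [measurable]: "ruin_prob h \<in> borel_measurable borel"
  unfolding ruin_prob_def[abs_def] by (rule cell_mean_measurable[OF cell_cost_measurable_walk_ruined])

lemma ruin_prob_antimono: "x \<le> y \<Longrightarrow> ruin_prob h y \<le> ruin_prob h x"
  unfolding ruin_prob_def by (intro cell_mean_mono walk_ruined_antimono)

lemma ruin_prob_eq_SUP: "ruin_prob h x = (SUP n. green h (ruin_rate h) n x)"
proof -
  interpret C: prob_space "cell_counts h" by (rule prob_space_cell_counts)
  note w = walk_sum_measurable[OF cell_cost_measurable_ruin]
  have space: "\<nu> \<in> space (cell_counts h)" for \<nu> by (simp add: cell_counts_def space_PiM)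
  have "ruin_prob h x = (\<integral>\<^sup>+\<nu>. (SUP n. \<integral>\<^sup>+z. walk_sum (c * h) (ruin_cost (c * h)) n x \<nu> z \<partial>claims) \<partial>cell_counts h)"
    unfolding ruin_prob_def cell_mean_def walk_ruined_eq_SUP
    using walk_sum_incseq
    by (intro nn_integral_cong nn_integral_monotone_convergence_SUP cell_costD[OF w, where h=h])
       (auto simp: incseq_def le_fun_def space)
  also have "\<dots> = (SUP n. cell_mean h (walk_sum (c * h) (ruin_cost (c * h)) n) x)"
    unfolding cell_mean_def
    using walk_sum_incseq
    by (intro nn_integral_monotone_convergence_SUP cell_cost_inner_measurable[OF w, where h=h])
       (auto simp: incseq_def le_fun_def intro!: nn_integral_mono)
  also have "\<dots> = (SUP n. green h (ruin_rate h) n x)"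
    unfolding nn_integral_walk_sum[OF cell_cost_measurable_ruin] by (simp only: cell_mean_ruin_cost[abs_def])
  finally show ?thesis .
qed

text \<open>
  Monotone convergence in the recursion for the Green function of \<open>ruin_rate\<close>.
\<close>

lemma ruin_prob_step: "ruin_rate h x + walk_step h (ruin_prob h) x \<le> ruin_prob h x"
proof -
  have "walk_step h (ruin_prob h) x = (SUP n. walk_step h (green h (ruin_rate h) n) x)"
  proof -
    have "walk_step h (ruin_prob h) x
       = (\<integral>\<^sup>+s. (SUP n. if x + c * h - s < 0 then 0 else green h (ruin_rate h) n (x + c * h - s)) \<partial>cell_claims h)"
      unfolding walk_step_def ruin_prob_eq_SUP by (intro nn_integral_cong) auto
    also have "\<dots> = (SUP n. walk_step h (green h (ruin_rate h) n) x)"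
      unfolding walk_step_def
    proof (rule nn_integral_monotone_convergence_SUP)
      have "(if b then 0 else green h (ruin_rate h) n y) \<le> (if b then 0 else green h (ruin_rate h) (Suc n) y)" for b n y
        by (cases b) (simp_all only: if_True if_False green_incseq order_refl)
      then show "incseq (\<lambda>n s. if x + c * h - s < 0 then 0 else green h (ruin_rate h) n (x + c * h - s))"
        by (intro incseq_SucI le_funI)
      fix n
      have [measurable]: "green h (ruin_rate h) n \<in> borel_measurable borel"
        by (rule green_measurable[OF ruin_rate_measurable])
      show "(\<lambda>s. if x + c * h - s < 0 then 0 else green h (ruin_rate h) n (x + c * h - s)) \<in> borel_measurable (cell_claims h)"
        by measurable
    qed
    finally show ?thesis .
  qed
  then have "ruin_rate h x + walk_step h (ruin_prob h) x = (SUP n. green h (ruin_rate h) (Suc n) x)"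
    by (simp add: ennreal_SUP_add_right)
  also have "\<dots> \<le> ruin_prob h x" unfolding ruin_prob_eq_SUP by (intro SUP_least SUP_upper) auto
  finally show ?thesis .
qed

lemma ruin_prob_fine_le_unit:
  assumes "0 < h"
  shows "ruin_prob h (u + c) \<le> ruin_prob 1 u"
  unfolding ruin_prob_def
proof (rule cell_mean_mono_process[OF assms _ cell_cost_measurable_walk_ruined cell_cost_measurable_walk_ruined])
  show "walk_ruined (c * h) (u + c) (cell_increments h \<omega>) z \<le> walk_ruined (c * 1) u (cell_increments 1 \<omega>) z"
    if "\<omega> \<in> space M" "\<And>m. 0 \<le> z m" for \<omega> z
    using fine_ruin_imp_unit_ruin[OF that assms, of u] unfolding walk_ruined_def by auto
qed simp

text \<open>
  A unit cell is free of claims with probability \<open>exp (- lam)\<close>, whatever happened before. Restricting the unit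
  walk to such cells makes it comparable with the fine walk.
\<close>

lemma green_unit_le_fine:
  assumes u: "0 \<le> u" and r: "0 < r" and v: "u + c \<le> v" "v \<le> u + 2 * c"
    and [measurable]: "q \<in> borel_measurable borel" and q: "\<And>x y. x \<le> y \<Longrightarrow> q y \<le> q x"
  shows "ennreal (exp (- lam)) * green 1 q n u
    \<le> green (1 / real r) (\<lambda>x. ennreal (1 / real r) * q (x - 3 * c)) (n * r) v"
proof -
  let ?h = "1 / real r"
  let ?f = "\<lambda>(x::real) (\<nu> :: nat \<Rightarrow> nat) (z :: nat \<Rightarrow> real). if \<nu> 0 = 0 then q x else 0"
  let ?g = "\<lambda>(x::real) (\<nu> :: nat \<Rightarrow> nat) (z :: nat \<Rightarrow> real). ennreal ?h * q (x - 3 * c)"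
  have f: "cell_cost_measurable ?f" by (rule cell_cost_measurable_state) measurable
  have g: "cell_cost_measurable ?g" by (rule cell_cost_measurable_state) measurable
  interpret C: prob_space "cell_counts ?h" by (rule prob_space_cell_counts)
  interpret C1: prob_space "cell_counts 1" by (rule prob_space_cell_counts)
  have "cell_mean 1 ?f x = ennreal (exp (- lam)) * q x" for x
  proof -
    have "cell_mean 1 ?f x = (\<integral>\<^sup>+\<nu>. (if \<nu> 0 = 0 then q x else 0) \<partial>cell_counts 1)"
      by (simp add: cell_mean_def)
    also have "\<dots> = (\<integral>\<^sup>+k. \<integral>\<^sup>+\<nu>. (if k = 0 then q x else 0) \<partial>cell_counts 1 \<partial>measure_pmf (cell_count 1))"
      by (rule nn_integral_first_count) (rule count_function_measurable)
    also have "\<dots> = (\<integral>\<^sup>+k. q x * indicator {0} k \<partial>measure_pmf (cell_count 1))"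
      by (intro nn_integral_cong) (simp add: C1.emeasure_space_1)
    also have "\<dots> = q x * ennreal (exp (- lam))"
      using lam_pos by (subst nn_integral_cmult_indicator) (auto simp: emeasure_pmf_single)
    finally show ?thesis by (simp add: mult.commute)
  qed
  then have "cell_mean 1 ?f = (\<lambda>x. ennreal (exp (- lam)) * q x)" by blast
  then have "ennreal (exp (- lam)) * green 1 q n u = cell_mean 1 (walk_sum (c * 1) ?f n) u"
    unfolding nn_integral_walk_sum[OF f] by (simp add: green_cmult)
  also have "\<dots> \<le> cell_mean ?h (walk_sum (c * ?h) ?g (n * r)) v"
  proof (rule cell_mean_mono_process[OF _ _ walk_sum_measurable[OF f] walk_sum_measurable[OF g]])
    show "walk_sum (c * 1) ?f n u (cell_increments 1 \<omega>) z
        \<le> walk_sum (c * ?h) ?g (n * r) v (cell_increments ?h \<omega>) z"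
      if "\<omega> \<in> space M" "\<And>m. 0 \<le> z m" for \<omega> z
      using unit_walk_le_fine_walk[OF that u r v q, where n=n] by (simp only: mult_1_right)
  qed (use r in auto)
  also have "\<dots> = green ?h (cell_mean ?h ?g) (n * r) v"
    by (rule nn_integral_walk_sum[OF g])
  also have "cell_mean ?h ?g = (\<lambda>x. ennreal ?h * q (x - 3 * c))"
    by (rule ext) (simp add: cell_mean_def C.emeasure_space_1)
  finally show ?thesis .
qed

lemma ruin_prob_unit_le:
  assumes "0 \<le> u"
  shows "ruin_prob 1 u \<le> emeasure M (ruined u)"
proof -
  have "ruin_prob 1 u = (\<integral>\<^sup>+\<omega>. walk_ruined c u (cell_increments 1 \<omega>) (claim_seq \<omega>) \<partial>M)"
    using nn_integral_unit_cost[OF cell_cost_measurable_walk_ruined, of c u] by (simp add: ruin_prob_def)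
  also have "\<dots> \<le> (\<integral>\<^sup>+\<omega>. indicator (ruined u) \<omega> \<partial>M)"
    unfolding walk_ruined_eq_SUP using assms by (intro nn_integral_mono SUP_least walk_ruin_imp_ruined) auto
  finally show ?thesis using ruined_measurable[OF assms] by simp
qed

lemma emeasure_ruined_le:
  assumes "0 \<le> u"
  shows "emeasure M (ruined u) \<le> ruin_prob 1 (u - c)"
proof -
  have "emeasure M (ruined u) = (\<integral>\<^sup>+\<omega>. indicator (ruined u) \<omega> \<partial>M)"
    using ruined_measurable[OF assms] by simp
  also have "\<dots> \<le> (\<integral>\<^sup>+\<omega>. walk_ruined c (u - c) (cell_increments 1 \<omega>) (claim_seq \<omega>) \<partial>M)"
  proof (rule nn_integral_mono_AE, use AE_positive_claims in eventually_elim)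
    fix \<omega> assume "positive_claims \<omega>"
    then show "indicator (ruined u) \<omega> \<le> walk_ruined c (u - c) (cell_increments 1 \<omega>) (claim_seq \<omega>)"
      using ruined_imp_walk_below[of \<omega> u] assms by (auto simp: indicator_def walk_ruined_def ruined_def)
  qed
  also have "\<dots> = ruin_prob 1 (u - c)"
    using nn_integral_unit_cost[OF cell_cost_measurable_walk_ruined, of c "u - c"] by (simp add: ruin_prob_def)
  finally show ?thesis .
qed

definition moment_mass :: "nat \<Rightarrow> real \<Rightarrow> ennreal" where
  "moment_mass j u = (\<integral>\<^sup>+\<omega>. ennreal (surplus_before_ruin (surplus u) \<omega> ^ j) * indicator (ruined u) \<omega> \<partial>M)"

definition overshoot_mean :: "nat \<Rightarrow> real \<Rightarrow> ennreal" where
  "overshoot_mean j x = (\<integral>\<^sup>+s. (if x < s then ennreal ((s + c) ^ j) else 0) \<partial>cell_claims 1)"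

lemma cell_cost_measurable_overshoot: "cell_cost_measurable (overshoot_cost j)"
  unfolding cell_cost_measurable_def split_beta' overshoot_cost_def Let_def by measurable

lemma cell_mean_overshoot: "cell_mean 1 (overshoot_cost j) = overshoot_mean j"
  unfolding overshoot_cost_def[abs_def] overshoot_mean_def[abs_def] Let_def
  by (rule ext) (rule cell_mean_first_cell[where G="\<lambda>x s. if x < s then ennreal ((s + c) ^ j) else 0"], measurable)

text \<open>
  Monotone convergence turns the pathwise bound into one for the expectation.
\<close>

lemma moment_mass_le_green:
  assumes u: "0 \<le> u"
  shows "moment_mass j u \<le> (SUP n. green 1 (overshoot_mean j) n u)"
proof -
  let ?w = "\<lambda>n \<omega>. walk_sum c (overshoot_cost j) n u (cell_increments 1 \<omega>) (claim_seq \<omega>)"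
  have "moment_mass j u \<le> (\<integral>\<^sup>+\<omega>. (SUP n. ?w n \<omega>) \<partial>M)"
    unfolding moment_mass_def
  proof (rule nn_integral_mono_AE, use AE_positive_claims in eventually_elim)
    fix \<omega> assume pos: "positive_claims \<omega>"
    show "ennreal (surplus_before_ruin (surplus u) \<omega> ^ j) * indicator (ruined u) \<omega> \<le> (SUP n. ?w n \<omega>)"
    proof (cases "\<omega> \<in> ruined u")
      case True
      from surplus_moment_le_walk_sum[OF this u pos, of j] show ?thesis
        using True by (auto intro: SUP_upper2)
    qed simp
  qed
  also have "\<dots> = (SUP n. \<integral>\<^sup>+\<omega>. ?w n \<omega> \<partial>M)"
    using walk_sum_incseq
    by (intro nn_integral_monotone_convergence_SUP unit_cost_measurable walk_sum_measurable cell_cost_measurable_overshoot)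
       (auto simp: incseq_def le_fun_def)
  also have "\<dots> = (SUP n. green 1 (overshoot_mean j) n u)"
    by (simp only: nn_integral_unit_walk[OF cell_cost_measurable_overshoot] cell_mean_overshoot)
  finally show ?thesis .
qed

lemma cell_cost_measurable_forced: "cell_cost_measurable (forced_cost K)"
proof -
  have [measurable]: "(\<lambda>y. snd (snd y) (fst (snd y) 0)) \<in> borel_measurable
     (borel \<Otimes>\<^sub>M (PiM UNIV (\<lambda>_. count_space UNIV) \<Otimes>\<^sub>M PiM UNIV (\<lambda>_. borel)) :: (real \<times> (nat \<Rightarrow> nat) \<times> (nat \<Rightarrow> real)) measure)"
    by (rule sequence_value_measurable) measurable
  show ?thesis unfolding cell_cost_measurable_def split_beta' forced_cost_def Let_def by measurable
qed

definition forced_prob :: "real \<Rightarrow> real" where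
  "forced_prob K = exp (- lam) * (1 - exp (- lam)) * claim_tail (K + 3 * c)"

lemma nn_integral_quiet_then_claim:
  "(\<integral>\<^sup>+\<nu>. (if \<nu> 0 = 0 \<and> 1 \<le> \<nu> 1 then 1 else 0) \<partial>cell_counts 1) = ennreal (exp (- lam) * (1 - exp (- lam)))"
proof -
  interpret C: prob_space "cell_counts 1" by (rule prob_space_cell_counts)
  let ?q = "measure_pmf (cell_count 1)"
  have some: "emeasure ?q {1..} = ennreal (1 - exp (- lam))"
  proof -
    have "{1..} = UNIV - {0 :: nat}" by auto
    then have "measure ?q {1..} = 1 - measure ?q {0}"
      by (simp add: measure_pmf.prob_compl[of "{0}" "cell_count 1", simplified])
    then show ?thesis using lam_pos by (simp add: measure_pmf.emeasure_eq_measure measure_pmf_single)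
  qed
  have m: "(\<lambda>\<nu>. if \<nu> 0 = 0 \<and> 1 \<le> \<nu> 1 then 1 else (0::ennreal)) \<in> borel_measurable (cell_counts 1)"
    by measurable
  have "(\<integral>\<^sup>+\<nu>. (if \<nu> 0 = 0 \<and> 1 \<le> \<nu> 1 then 1 else 0) \<partial>cell_counts 1)
      = (\<integral>\<^sup>+k. \<integral>\<^sup>+\<nu>. (if k = 0 \<and> 1 \<le> \<nu> 0 then 1 else 0) \<partial>cell_counts 1 \<partial>?q)"
    using nn_integral_first_count[of "\<lambda>k \<nu>. if k = 0 \<and> 1 \<le> \<nu> 0 then 1 else 0" 1] m by simp
  also have "\<dots> = (\<integral>\<^sup>+k. ennreal (1 - exp (- lam)) * indicator {0} k \<partial>?q)"
  proof (rule nn_integral_cong)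
    fix k :: nat
    have "(\<integral>\<^sup>+\<nu>. (if 1 \<le> \<nu> 0 then 1 else 0) \<partial>cell_counts 1)
        = (\<integral>\<^sup>+k. \<integral>\<^sup>+\<nu>. (if 1 \<le> k then 1 else 0) \<partial>cell_counts 1 \<partial>?q)"
      by (rule nn_integral_first_count) (rule count_function_measurable)
    also have "\<dots> = (\<integral>\<^sup>+k. indicator {1..} k \<partial>?q)"
      by (intro nn_integral_cong) (simp add: C.emeasure_space_1 indicator_def)
    also have "\<dots> = ennreal (1 - exp (- lam))" using some by simp
    finally show "(\<integral>\<^sup>+\<nu>. (if k = 0 \<and> 1 \<le> \<nu> 0 then 1 else 0) \<partial>cell_counts 1)
        = ennreal (1 - exp (- lam)) * indicator {0} k" by (cases "k = 0") auto
  qed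
  also have "\<dots> = ennreal (1 - exp (- lam)) * ennreal (exp (- lam))"
    using lam_pos by (subst nn_integral_cmult_indicator) (auto simp: emeasure_pmf_single)
  also have "\<dots> = ennreal (exp (- lam) * (1 - exp (- lam)))"
    using lam_pos by (subst ennreal_mult[symmetric]) (auto simp: mult.commute)
  finally show ?thesis .
qed

lemma nn_integral_first_claim_big:
  "(\<integral>\<^sup>+z. (if y < z 0 then 1 else 0) \<partial>claims) = ennreal (claim_tail y)"
proof -
  have "(\<integral>\<^sup>+z. (if y < z 0 then 1 else 0) \<partial>claims) = (\<integral>\<^sup>+s. indicator {y<..} s \<partial>distr claims claim_law (\<lambda>z. z 0))"
    by (subst nn_integral_distr) (auto intro!: nn_integral_cong simp: indicator_def)
  also have "distr claims claim_law (\<lambda>z. z 0) = claim_law" by (rule claims.PiM_component) simp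
  finally show ?thesis by (simp add: emeasure_claim_law_greaterThan)
qed

text \<open>
  The final stage uses later counts and an unused claim, so it is independent of the current step and has the fixed
  probability \<open>forced_prob K\<close>.
\<close>

lemma cell_mean_forced:
  "cell_mean 1 (forced_cost K) x
    = ennreal (forced_prob K) * (\<integral>\<^sup>+s. (if c - K \<le> x + c - s \<and> x + c - s < 0 then 1 else 0) \<partial>cell_claims 1)"
proof -
  interpret C: prob_space "cell_counts 1" by (rule prob_space_cell_counts)
  let ?q = "measure_pmf (cell_count 1)"
  let ?A = "\<lambda>s. if c - K \<le> x + c - s \<and> x + c - s < 0 then 1 else (0::ennreal)"
  let ?B = "\<lambda>\<nu>. if \<nu> 0 = 0 \<and> 1 \<le> \<nu> 1 then 1 else (0::ennreal)"
  let ?D = "\<lambda>z. if K + 3 * c < z 0 then 1 else (0::ennreal)"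
  have m: "(\<lambda>\<nu>. \<integral>\<^sup>+z. ?A (\<Sum>m<\<nu> 0. z m) * ?B (\<lambda>l. \<nu> (Suc l)) * ?D (shift_seq (\<nu> 0) z) \<partial>claims)
     \<in> borel_measurable (cell_counts 1)"
  proof (rule claims.P.borel_measurable_nn_integral)
    have [measurable]: "(\<lambda>y. snd y (fst y 0)) \<in> borel_measurable (cell_counts 1 \<Otimes>\<^sub>M claims)"
      by (rule sequence_value_measurable) measurable
    show "(\<lambda>(\<nu>, z). ?A (\<Sum>m<\<nu> 0. z m) * ?B (\<lambda>l. \<nu> (Suc l)) * ?D (shift_seq (\<nu> 0) z))
       \<in> borel_measurable (cell_counts 1 \<Otimes>\<^sub>M claims)"
      unfolding split_beta' add_0 by measurable
  qed
  have "cell_mean 1 (forced_cost K) x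
      = (\<integral>\<^sup>+\<nu>. \<integral>\<^sup>+z. ?A (\<Sum>m<\<nu> 0. z m) * ?B (\<lambda>l. \<nu> (Suc l)) * ?D (shift_seq (\<nu> 0) z) \<partial>claims \<partial>cell_counts 1)"
    unfolding cell_mean_def forced_cost_def Let_def
    by (intro nn_integral_cong) (simp add: numeral_2_eq_2)
  also have "\<dots> = (\<integral>\<^sup>+k. \<integral>\<^sup>+\<nu>. \<integral>\<^sup>+z. ?A (\<Sum>m<k. z m) * ?B \<nu> * ?D (shift_seq k z) \<partial>claims \<partial>cell_counts 1 \<partial>?q)"
    using m by (rule nn_integral_first_count)
  also have "\<dots> = (\<integral>\<^sup>+k. ennreal (forced_prob K) * (\<integral>\<^sup>+z. ?A (\<Sum>m<k. z m) \<partial>claims) \<partial>?q)"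
  proof (rule nn_integral_cong)
    fix k :: nat
    have "(\<integral>\<^sup>+z. ?A (\<Sum>m<k. z m) * b * ?D (shift_seq k z) \<partial>claims)
        = b * ((\<integral>\<^sup>+z. ?A (\<Sum>m<k. z m) \<partial>claims) * ennreal (claim_tail (K + 3 * c)))" for b
    proof -
      define H where "H z = ?A (\<Sum>m<k. z m) * b * (if K + 3 * c < z k then 1 else 0)" for z
      have "H \<in> borel_measurable claims" unfolding H_def[abs_def] by measurable
      from claims.nn_integral_comb_seq[OF this, of k]
      have "(\<integral>\<^sup>+z. ?A (\<Sum>m<k. z m) * b * ?D (shift_seq k z) \<partial>claims)
         = (\<integral>\<^sup>+z. \<integral>\<^sup>+z'. ?A (\<Sum>m<k. comb_seq k z z' m) * b * ?D (shift_seq k (comb_seq k z z')) \<partial>claims \<partial>claims)"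
        unfolding H_def by (simp only: add_0)
      also have "\<dots> = (\<integral>\<^sup>+z. \<integral>\<^sup>+z'. ?A (\<Sum>m<k. z m) * b * ?D z' \<partial>claims \<partial>claims)"
      proof (intro nn_integral_cong)
        fix z z' :: "nat \<Rightarrow> real"
        have "(\<Sum>m<k. comb_seq k z z' m) = (\<Sum>m<k. z m)" by (intro sum.cong) (auto simp: comb_seq_def)
        moreover have "comb_seq k z z' (0 + k) = z' 0" by (rule comb_seq_add)
        ultimately show "?A (\<Sum>m<k. comb_seq k z z' m) * b * ?D (shift_seq k (comb_seq k z z')) = ?A (\<Sum>m<k. z m) * b * ?D z'"
          by simp
      qed
      also have "\<dots> = (\<integral>\<^sup>+z. ?A (\<Sum>m<k. z m) * b * ennreal (claim_tail (K + 3 * c)) \<partial>claims)"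
        by (intro nn_integral_cong, subst nn_integral_cmult) (simp_all only: nn_integral_first_claim_big, measurable)
      also have "\<dots> = b * ((\<integral>\<^sup>+z. ?A (\<Sum>m<k. z m) \<partial>claims) * ennreal (claim_tail (K + 3 * c)))"
        by (subst nn_integral_multc, measurable, subst nn_integral_multc, measurable) (simp only: mult_ac)
      finally show ?thesis .
    qed
    then have "(\<integral>\<^sup>+\<nu>. \<integral>\<^sup>+z. ?A (\<Sum>m<k. z m) * ?B \<nu> * ?D (shift_seq k z) \<partial>claims \<partial>cell_counts 1)
       = (\<integral>\<^sup>+\<nu>. ?B \<nu> * ((\<integral>\<^sup>+z. ?A (\<Sum>m<k. z m) \<partial>claims) * ennreal (claim_tail (K + 3 * c))) \<partial>cell_counts 1)"
      by (simp only:)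
    also have "\<dots> = ennreal (exp (- lam) * (1 - exp (- lam))) * ((\<integral>\<^sup>+z. ?A (\<Sum>m<k. z m) \<partial>claims) * ennreal (claim_tail (K + 3 * c)))"
      by (subst nn_integral_multc, measurable) (simp only: nn_integral_quiet_then_claim)
    also have "\<dots> = ennreal (forced_prob K) * (\<integral>\<^sup>+z. ?A (\<Sum>m<k. z m) \<partial>claims)"
    proof -
      have "ennreal (forced_prob K) = ennreal (exp (- lam) * (1 - exp (- lam))) * ennreal (claim_tail (K + 3 * c))"
        unfolding forced_prob_def using lam_pos claim_tail_pos[of "K + 3 * c"] by (intro ennreal_mult) (auto simp: less_imp_le)
      then show ?thesis by (simp only: mult_ac)
    qed
    finally show "(\<integral>\<^sup>+\<nu>. \<integral>\<^sup>+z. ?A (\<Sum>m<k. z m) * ?B \<nu> * ?D (shift_seq k z) \<partial>claims \<partial>cell_counts 1)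
       = ennreal (forced_prob K) * (\<integral>\<^sup>+z. ?A (\<Sum>m<k. z m) \<partial>claims)" .
  qed
  also have "\<dots> = ennreal (forced_prob K) * (\<integral>\<^sup>+s. ?A s \<partial>cell_claims 1)"
    by (subst nn_integral_cell_claims, measurable) (rule nn_integral_cmult, simp)
  finally show ?thesis .
qed

lemma forced_le_moment_mass:
  assumes u: "0 \<le> u" and K: "c \<le> K"
  shows "ennreal (c ^ j) * green 1 (cell_mean 1 (forced_cost K)) n (u - K) \<le> moment_mass j u"
proof -
  have "ennreal (c ^ j) * green 1 (cell_mean 1 (forced_cost K)) n (u - K)
     = (\<integral>\<^sup>+\<omega>. ennreal (c ^ j) * walk_sum c (forced_cost K) n (u - K) (cell_increments 1 \<omega>) (claim_seq \<omega>) \<partial>M)"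
    by (subst nn_integral_cmult) (auto intro!: unit_cost_measurable walk_sum_measurable cell_cost_measurable_forced
        simp: nn_integral_unit_walk cell_cost_measurable_forced)
  also have "\<dots> \<le> moment_mass j u"
    unfolding moment_mass_def
    by (rule nn_integral_mono_AE, use AE_positive_claims AE_space in eventually_elim)
       (use u K in \<open>auto intro: walk_sum_forced_le_surplus\<close>)
  finally show ?thesis .
qed

text \<open>
  For reserves below \<open>K\<close> the final stage can be started at time \<open>0\<close>.
\<close>

lemma moment_mass_small_reserve:
  assumes u: "0 \<le> u" "u < K"
  shows "ennreal (c ^ j) * ennreal (forced_prob K) \<le> moment_mass j u"
proof -
  let ?f = "\<lambda>(x::real) \<nu> z. if \<nu> 0 = 0 \<and> 1 \<le> \<nu> 1 \<and> K + 3 * c < z 0 then 1 else (0::ennreal)"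
  have f: "cell_cost_measurable ?f" unfolding cell_cost_measurable_def split_beta' by measurable
  have "cell_mean 1 ?f u = (\<integral>\<^sup>+\<nu>. (if \<nu> 0 = 0 \<and> 1 \<le> \<nu> 1 then 1 else 0) * ennreal (claim_tail (K + 3 * c)) \<partial>cell_counts 1)"
    unfolding cell_mean_def
    by (intro nn_integral_cong) (auto simp: nn_integral_first_claim_big)
  also have "\<dots> = ennreal (exp (- lam) * (1 - exp (- lam))) * ennreal (claim_tail (K + 3 * c))"
    by (subst nn_integral_multc, measurable) (simp only: nn_integral_quiet_then_claim)
  also have "\<dots> = ennreal (forced_prob K)"
    unfolding forced_prob_def using lam_pos claim_tail_pos[of "K + 3 * c"]
    by (intro ennreal_mult[symmetric]) (auto simp: less_imp_le)
  finally have forced: "cell_mean 1 ?f u = ennreal (forced_prob K)" .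
  have "ennreal (c ^ j) * ennreal (forced_prob K)
      = ennreal (c ^ j) * (\<integral>\<^sup>+\<omega>. ?f u (cell_increments 1 \<omega>) (claim_seq \<omega>) \<partial>M)"
    by (simp only: nn_integral_unit_cost[OF f, of u] forced)
  also have "\<dots> = (\<integral>\<^sup>+\<omega>. ennreal (c ^ j) * ?f u (cell_increments 1 \<omega>) (claim_seq \<omega>) \<partial>M)"
    by (rule nn_integral_cmult[symmetric]) (rule unit_cost_measurable[OF f])
  also have "\<dots> \<le> moment_mass j u"
    unfolding moment_mass_def
  proof (rule nn_integral_mono_AE, use AE_positive_claims AE_space in eventually_elim)
    fix \<omega> assume pos: "positive_claims \<omega>" and sp: "\<omega> \<in> space M"
    have N0: "N 0 \<omega> = 0" by (rule counting_0[OF sp])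
    have N1: "N 1 \<omega> = cell_increments 1 \<omega> 0" "N 2 \<omega> = N 1 \<omega> + cell_increments 1 \<omega> 1"
      using counting_mono[OF sp, of 0 1] counting_mono[OF sp, of 1 2] N0
      by (simp_all add: cell_increments_def)
    have "\<omega> \<in> ruined u \<and> c \<le> surplus_before_ruin (surplus u) \<omega>"
      if "cell_increments 1 \<omega> 0 = 0" "1 \<le> cell_increments 1 \<omega> 1" "K + 3 * c < claim_seq \<omega> 0"
      by (rule forced_ruin[OF sp u(1) pos, of 0 K]) (use that N0 N1 u in \<open>auto simp: reserve_def\<close>)
    then show "ennreal (c ^ j) * ?f u (cell_increments 1 \<omega>) (claim_seq \<omega>)
       \<le> ennreal (surplus_before_ruin (surplus u) \<omega> ^ j) * indicator (ruined u) \<omega>"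
      using c_pos by (auto intro!: ennreal_leI power_mono)
  qed
  finally show ?thesis .
qed

end

section \<open>The step equation integrated over a half line\<close>

context risk_process
begin

text \<open>
  Integrating the step operator over starting points turns the law of the step into its tail.
\<close>

lemma integral_walk_step:
  assumes [measurable]: "f \<in> borel_measurable borel" and u: "0 \<le> u"
  shows "(\<integral>\<^sup>+x\<in>{u..}. walk_step h f x \<partial>lborel)
    = (\<integral>\<^sup>+y\<in>{0..}. f y * emeasure (cell_claims h) {u + c * h - y..} \<partial>lborel)"
proof -
  interpret Q: prob_space "cell_claims h" by (rule prob_space_cell_claims)
  interpret P: pair_sigma_finite "cell_claims h" lborel ..
  let ?k = "\<lambda>s y. f y * (if 0 \<le> y \<and> u \<le> y + s - c * h then 1 else 0)"
  have "(\<integral>\<^sup>+x\<in>{u..}. walk_step h f x \<partial>lborel)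
      = (\<integral>\<^sup>+x. \<integral>\<^sup>+s. (if u \<le> x \<and> 0 \<le> x + c * h - s then f (x + c * h - s) else 0) \<partial>cell_claims h \<partial>lborel)"
    unfolding walk_step_def
    by (intro nn_integral_cong, subst nn_integral_multc[symmetric], measurable)
       (intro nn_integral_cong, auto simp: indicator_def not_less)
  also have "\<dots> = (\<integral>\<^sup>+s. \<integral>\<^sup>+x. (if u \<le> x \<and> 0 \<le> x + c * h - s then f (x + c * h - s) else 0) \<partial>lborel \<partial>cell_claims h)"
    by (rule P.Fubini') measurable
  also have "\<dots> = (\<integral>\<^sup>+s. \<integral>\<^sup>+y. ?k s y \<partial>lborel \<partial>cell_claims h)"
  proof (rule nn_integral_cong)
    fix s
    have "(\<integral>\<^sup>+y. ?k s y \<partial>lborel) = (\<integral>\<^sup>+x. ?k s ((c * h - s) + 1 * x) \<partial>lborel)"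
      by (subst nn_integral_real_affine[where c=1 and t="c * h - s"]) auto
    then show "(\<integral>\<^sup>+x. (if u \<le> x \<and> 0 \<le> x + c * h - s then f (x + c * h - s) else 0) \<partial>lborel)
        = (\<integral>\<^sup>+y. ?k s y \<partial>lborel)"
      by (auto intro!: nn_integral_cong simp: algebra_simps)
  qed
  also have "\<dots> = (\<integral>\<^sup>+y. \<integral>\<^sup>+s. ?k s y \<partial>cell_claims h \<partial>lborel)"
    by (rule P.Fubini'[symmetric]) measurable
  also have "\<dots> = (\<integral>\<^sup>+y\<in>{0..}. f y * emeasure (cell_claims h) {u + c * h - y..} \<partial>lborel)"
  proof (rule nn_integral_cong)
    fix y
    have "(\<integral>\<^sup>+s. ?k s y \<partial>cell_claims h)
        = (\<integral>\<^sup>+s. (f y * indicator {0..} y) * indicator {u + c * h - y..} s \<partial>cell_claims h)"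
      by (intro nn_integral_cong) (auto simp: indicator_def)
    also have "\<dots> = (f y * indicator {0..} y) * emeasure (cell_claims h) {u + c * h - y..}"
      by (rule nn_integral_cmult_indicator) simp
    finally show "(\<integral>\<^sup>+s. ?k s y \<partial>cell_claims h)
        = f y * emeasure (cell_claims h) {u + c * h - y..} * indicator {0..} y" by (simp add: mult_ac)
  qed
  finally show ?thesis .
qed

lemma tail_kernel_measurable [measurable]:
  "(\<lambda>y. emeasure (cell_claims h) {t - y..}) \<in> borel_measurable borel"
  "(\<lambda>y. emeasure (cell_claims h) {..<t - y}) \<in> borel_measurable borel"
proof -
  interpret Q: prob_space "cell_claims h" by (rule prob_space_cell_claims)
  have "(\<lambda>y. \<integral>\<^sup>+s. (if t - y \<le> s then 1 else 0) \<partial>cell_claims h) \<in> borel_measurable borel"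
    by measurable
  also have "(\<lambda>y. \<integral>\<^sup>+s. (if t - y \<le> s then 1 else 0) \<partial>cell_claims h) = (\<lambda>y. emeasure (cell_claims h) {t - y..})"
  proof
    fix y
    have "(\<integral>\<^sup>+s. (if t - y \<le> s then 1 else 0) \<partial>cell_claims h) = (\<integral>\<^sup>+s. indicator {t - y..} s \<partial>cell_claims h)"
      by (intro nn_integral_cong) (auto simp: indicator_def)
    then show "(\<integral>\<^sup>+s. (if t - y \<le> s then 1 else 0) \<partial>cell_claims h) = emeasure (cell_claims h) {t - y..}" by simp
  qed
  finally show "(\<lambda>y. emeasure (cell_claims h) {t - y..}) \<in> borel_measurable borel" .
  have "(\<lambda>y. \<integral>\<^sup>+s. (if s < t - y then 1 else 0) \<partial>cell_claims h) \<in> borel_measurable borel"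
    by measurable
  also have "(\<lambda>y. \<integral>\<^sup>+s. (if s < t - y then 1 else 0) \<partial>cell_claims h) = (\<lambda>y. emeasure (cell_claims h) {..<t - y})"
  proof
    fix y
    have "(\<integral>\<^sup>+s. (if s < t - y then 1 else 0) \<partial>cell_claims h) = (\<integral>\<^sup>+s. indicator {..<t - y} s \<partial>cell_claims h)"
      by (intro nn_integral_cong) (auto simp: indicator_def)
    then show "(\<integral>\<^sup>+s. (if s < t - y then 1 else 0) \<partial>cell_claims h) = emeasure (cell_claims h) {..<t - y}" by simp
  qed
  finally show "(\<lambda>y. emeasure (cell_claims h) {..<t - y}) \<in> borel_measurable borel" .
qed

lemma tail_kernel_split: "emeasure (cell_claims h) {..<t} + emeasure (cell_claims h) {t..} = 1"
proof -
  interpret Q: prob_space "cell_claims h" by (rule prob_space_cell_claims)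
  have "emeasure (cell_claims h) {..<t} + emeasure (cell_claims h) {t..} = emeasure (cell_claims h) ({..<t} \<union> {t..})"
    by (rule plus_emeasure) auto
  also have "{..<t} \<union> {t..} = UNIV" by auto
  finally show ?thesis using Q.emeasure_space_1 by simp
qed

lemma half_line_split:
  assumes [measurable]: "W \<in> borel_measurable borel" and u: "0 \<le> u"
  shows "(\<integral>\<^sup>+y\<in>{0..}. W y * emeasure (cell_claims h) {u + c * h - y..} \<partial>lborel)
    = (\<integral>\<^sup>+y\<in>{0..u}. W y * emeasure (cell_claims h) {u + c * h - y..} \<partial>lborel)
    + (\<integral>\<^sup>+y\<in>{u..}. W y * emeasure (cell_claims h) {u + c * h - y..} \<partial>lborel)"
  by (rule nn_integral_split_at[symmetric]) (use u in auto)

lemma half_line_kernel: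
  assumes [measurable]: "W \<in> borel_measurable borel"
  shows "(\<integral>\<^sup>+y\<in>{u..}. W y \<partial>lborel)
    = (\<integral>\<^sup>+y\<in>{u..}. W y * emeasure (cell_claims h) {..<u + c * h - y} \<partial>lborel)
    + (\<integral>\<^sup>+y\<in>{u..}. W y * emeasure (cell_claims h) {u + c * h - y..} \<partial>lborel)"
proof -
  have "(\<integral>\<^sup>+y\<in>{u..}. W y \<partial>lborel)
    = (\<integral>\<^sup>+y. W y * emeasure (cell_claims h) {..<u + c * h - y} * indicator {u..} y
       + W y * emeasure (cell_claims h) {u + c * h - y..} * indicator {u..} y \<partial>lborel)"
    by (intro nn_integral_cong) (simp add: distrib_right[symmetric] distrib_left[symmetric] tail_kernel_split)
  then show ?thesis by (simp add: nn_integral_add)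
qed

text \<open>
  Both sides of the step inequality are integrated over \<open>[u, \<infinity>)\<close>. The contributions of paths that stay in this
  half line cancel, which needs finiteness; what remains is an integral over a window of length \<open>c * h\<close> on the left and the inflow from
  \<open>[0, u]\<close> on the right.
\<close>

lemma subsolution_integrated:
  assumes [measurable]: "W \<in> borel_measurable borel" "F \<in> borel_measurable borel" and u: "0 \<le> u"
    and fin: "(\<integral>\<^sup>+y\<in>{u..}. W y \<partial>lborel) < \<infinity>"
    and sub: "\<And>x. W x \<le> F x + walk_step h W x"
  shows "(\<integral>\<^sup>+y\<in>{u..}. W y * emeasure (cell_claims h) {..<u + c * h - y} \<partial>lborel)
    \<le> (\<integral>\<^sup>+x\<in>{u..}. F x \<partial>lborel)
      + (\<integral>\<^sup>+y\<in>{0..u}. W y * emeasure (cell_claims h) {u + c * h - y..} \<partial>lborel)"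
proof -
  let ?X = "\<integral>\<^sup>+y\<in>{u..}. W y * emeasure (cell_claims h) {u + c * h - y..} \<partial>lborel"
  have "(\<integral>\<^sup>+y\<in>{u..}. W y \<partial>lborel) \<le> (\<integral>\<^sup>+x. F x * indicator {u..} x + walk_step h W x * indicator {u..} x \<partial>lborel)"
    by (intro nn_integral_mono) (use sub in \<open>auto simp: indicator_def\<close>)
  also have "\<dots> = (\<integral>\<^sup>+x\<in>{u..}. F x \<partial>lborel) + (\<integral>\<^sup>+x\<in>{u..}. walk_step h W x \<partial>lborel)"
    by (rule nn_integral_add) auto
  finally have le: "(\<integral>\<^sup>+y\<in>{u..}. W y * emeasure (cell_claims h) {..<u + c * h - y} \<partial>lborel) + ?X
     \<le> (\<integral>\<^sup>+x\<in>{u..}. F x \<partial>lborel)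
      + (\<integral>\<^sup>+y\<in>{0..u}. W y * emeasure (cell_claims h) {u + c * h - y..} \<partial>lborel) + ?X"
    unfolding half_line_kernel[of W u h, OF assms(1)] integral_walk_step[OF assms(1) u] half_line_split[OF assms(1) u]
    by (simp add: add.assoc)
  have "?X \<le> (\<integral>\<^sup>+y\<in>{u..}. W y \<partial>lborel)"
    unfolding half_line_kernel[of W u h, OF assms(1)] by simp
  then have "?X < \<infinity>" using fin by (rule order.strict_trans1)
  then show ?thesis using le ennreal_add_left_cancel_le[of ?X] by (auto simp: add.commute)
qed

lemma supersolution_integrated:
  assumes [measurable]: "W \<in> borel_measurable borel" "F \<in> borel_measurable borel" and u: "0 \<le> u"
    and fin: "(\<integral>\<^sup>+y\<in>{u..}. W y \<partial>lborel) < \<infinity>"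
    and super: "\<And>x. F x + walk_step h W x \<le> W x"
  shows "(\<integral>\<^sup>+x\<in>{u..}. F x \<partial>lborel)
      + (\<integral>\<^sup>+y\<in>{0..u}. W y * emeasure (cell_claims h) {u + c * h - y..} \<partial>lborel)
    \<le> (\<integral>\<^sup>+y\<in>{u..}. W y * emeasure (cell_claims h) {..<u + c * h - y} \<partial>lborel)"
proof -
  let ?X = "\<integral>\<^sup>+y\<in>{u..}. W y * emeasure (cell_claims h) {u + c * h - y..} \<partial>lborel"
  have "(\<integral>\<^sup>+x\<in>{u..}. F x \<partial>lborel) + (\<integral>\<^sup>+x\<in>{u..}. walk_step h W x \<partial>lborel)
      = (\<integral>\<^sup>+x. F x * indicator {u..} x + walk_step h W x * indicator {u..} x \<partial>lborel)"
    by (rule nn_integral_add[symmetric]) auto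
  also have "\<dots> \<le> (\<integral>\<^sup>+y\<in>{u..}. W y \<partial>lborel)"
    by (intro nn_integral_mono) (use super in \<open>auto simp: indicator_def\<close>)
  finally have le: "(\<integral>\<^sup>+x\<in>{u..}. F x \<partial>lborel)
      + (\<integral>\<^sup>+y\<in>{0..u}. W y * emeasure (cell_claims h) {u + c * h - y..} \<partial>lborel) + ?X
     \<le> (\<integral>\<^sup>+y\<in>{u..}. W y * emeasure (cell_claims h) {..<u + c * h - y} \<partial>lborel) + ?X"
    unfolding half_line_kernel[of W u h, OF assms(1)] integral_walk_step[OF assms(1) u] half_line_split[OF assms(1) u]
    by (simp add: add.assoc)
  have "?X \<le> (\<integral>\<^sup>+y\<in>{u..}. W y \<partial>lborel)"
    unfolding half_line_kernel[of W u h, OF assms(1)] by simp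
  then have "?X < \<infinity>" using fin by (rule order.strict_trans1)
  then show ?thesis using le ennreal_add_left_cancel_le[of ?X] by (auto simp: add.commute)
qed

text \<open>
  Since claims are nonnegative, the kernel on the left of \<open>subsolution_integrated\<close> is concentrated on the window
  \<open>[u, u + c * h)\<close>; there it is between \<open>exp (- lam * h)\<close> and \<open>1\<close>.
\<close>

lemma kernel_nonpos: "t \<le> 0 \<Longrightarrow> emeasure (cell_claims h) {..<t} = 0"
proof -
  assume t: "t \<le> 0"
  have "AE s in cell_claims h. \<not> s < t" using cell_claims_nonneg[of h] by eventually_elim (use t in auto)
  from emeasure_eq_0_AE[OF this] show ?thesis by (simp add: lessThan_def)
qed

lemma kernel_pos:
  assumes "0 < h" "0 < t" shows "ennreal (exp (- lam * h)) \<le> emeasure (cell_claims h) {..<t}"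
  using assms by (intro cell_claims_zero_mass) auto

lemma kernel_le_1: "emeasure (cell_claims h) A \<le> 1"
proof -
  interpret Q: prob_space "cell_claims h" by (rule prob_space_cell_claims)
  show ?thesis by (rule Q.emeasure_le_1)
qed

end

section \<open>The limit of the grid ruin probabilities\<close>

context lundberg_model
begin

text \<open>
  Lundberg's inequality, by induction on the number of steps.
\<close>

lemma ruin_lundberg: "ruin_prob h x \<le> ennreal (exp (- R * x))" if h: "0 < h"
proof -
  have "green h (ruin_rate h) n x \<le> ennreal (exp (- R * x))" for n
  proof (induction n arbitrary: x)
    case (Suc n)
    have "green h (ruin_rate h) (Suc n) x = (\<integral>\<^sup>+s. indicator {x + c * h<..} s \<partial>cell_claims h)
        + (\<integral>\<^sup>+s. (if x + c * h - s < 0 then 0 else green h (ruin_rate h) n (x + c * h - s)) \<partial>cell_claims h)"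
      by (simp add: ruin_rate_def walk_step_def)
    also have "\<dots> = (\<integral>\<^sup>+s. indicator {x + c * h<..} s
        + (if x + c * h - s < 0 then 0 else green h (ruin_rate h) n (x + c * h - s)) \<partial>cell_claims h)"
      by (rule nn_integral_add[symmetric]) measurable
    also have "\<dots> \<le> (\<integral>\<^sup>+s. ennreal (exp (- R * (x + c * h))) * ennreal (exp (R * s)) \<partial>cell_claims h)"
    proof (rule nn_integral_mono)
      fix s
      have e: "ennreal (exp (- R * (x + c * h))) * ennreal (exp (R * s)) = ennreal (exp (- R * (x + c * h - s)))"
        by (simp add: ennreal_mult[symmetric] exp_add[symmetric] algebra_simps)
      show "indicator {x + c * h<..} s + (if x + c * h - s < 0 then 0 else green h (ruin_rate h) n (x + c * h - s))
          \<le> ennreal (exp (- R * (x + c * h))) * ennreal (exp (R * s))"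
      proof (cases "x + c * h - s < 0")
        case True
        then have "1 \<le> exp (- R * (x + c * h - s))" using mult_pos_neg[OF R_pos True] by simp
        then have "1 \<le> ennreal (exp (- R * (x + c * h - s)))" by simp
        then show ?thesis unfolding e using True by (simp only: if_True add_0_right) (auto simp: indicator_def)
      next
        case False
        then show ?thesis unfolding e using Suc.IH[of "x + c * h - s"] by (simp add: indicator_def)
      qed
    qed
    also have "\<dots> = ennreal (exp (- R * (x + c * h))) * ennreal (exp (R * c * h))"
      by (subst nn_integral_cmult) (auto simp: exp_cell_claims[OF h])
    also have "\<dots> = ennreal (exp (- R * x))"
      by (simp add: ennreal_mult[symmetric] exp_add[symmetric] algebra_simps)
    finally show ?case .
  qed simp
  then show ?thesis unfolding ruin_prob_eq_SUP by (intro SUP_least)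
qed

lemma ruin_prob_integral_finite:
  assumes h: "0 < h" and u: "0 \<le> u"
  shows "(\<integral>\<^sup>+y\<in>{u..}. ruin_prob h y \<partial>lborel) < \<infinity>"
proof -
  have "(\<integral>\<^sup>+y\<in>{u..}. ruin_prob h y \<partial>lborel) \<le> (\<integral>\<^sup>+y\<in>{0..}. ennreal (exp (- R * y)) \<partial>lborel)"
    using ruin_lundberg[OF h] u by (intro nn_integral_mono) (auto simp: indicator_def)
  also have "\<dots> = ennreal (0 - (- exp (- R * 0) / R))"
  proof (rule nn_integral_FTC_atLeast)
    have "((\<lambda>x. exp (- R * x)) \<longlongrightarrow> 0) at_top"
      using R_pos by (intro filterlim_compose[OF exp_at_bot] filterlim_tendsto_neg_mult_at_bot[OF tendsto_const _ filterlim_ident]) auto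
    then show "((\<lambda>x. - exp (- R * x) / R) \<longlongrightarrow> 0) at_top"
      using tendsto_divide[OF tendsto_minus tendsto_const[of R]] R_pos by fastforce
  qed (use R_pos in \<open>auto intro!: derivative_eq_intros\<close>)
  finally show ?thesis by (rule order.strict_trans1) simp
qed

text \<open>
  The tail of the claims is right continuous, so no exceptional set occurs when the argument is approached
  from the right.
\<close>

lemma ladder_density_right_continuous:
  assumes "\<And>i. t \<le> s i" "s \<longlonglongrightarrow> t"
  shows "(\<lambda>i. ladder_density (s i)) \<longlonglongrightarrow> ladder_density t"
proof -
  have "continuous (at t within {t..}) claim_tail"
    using claim_tail_right_continuous[of t] by (simp add: at_within_Ici_at_right)
  then have "(claim_tail \<circ> s) \<longlonglongrightarrow> claim_tail t"
    unfolding continuous_within_sequentially using assms by (metis atLeast_iff)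
  then have "(\<lambda>i. claim_tail (s i)) \<longlonglongrightarrow> claim_tail t" by (simp only: o_def)
  then show ?thesis unfolding ladder_density_def by (intro tendsto_ennrealI tendsto_mult tendsto_const)
qed

lemma ladder_density_le: "ladder_density x \<le> ennreal (lam / c)"
  unfolding ladder_density_def using lam_pos c_pos claim_tail_le_1[of x]
  by (intro ennreal_leI) (simp add: divide_right_mono mult_left_le)

lemma ladder_density_antimono: "x \<le> y \<Longrightarrow> ladder_density y \<le> ladder_density x"
  unfolding ladder_density_def using lam_pos c_pos claim_tail_antimono
  by (intro ennreal_leI mult_left_mono) auto

text \<open>
  The integrated step inequality divided by the length \<open>c * h\<close> of the window, on which the probability of ruin is at most
  its value at \<open>u\<close>. The tails of the cells are bounded below by the probability of a single claim.
\<close>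

lemma ruin_prob_renewal_fine:
  assumes h: "0 < h" and u: "0 \<le> u"
  shows "ennreal (exp (- lam * h)) * ((\<integral>\<^sup>+x\<in>{u..}. ladder_density (x + c * h) \<partial>lborel)
      + (\<integral>\<^sup>+y\<in>{0..u}. ruin_prob h y * ladder_density (u + c * h - y) \<partial>lborel)) \<le> ruin_prob h u"
proof -
  let ?a = "c * h" and ?e = "ennreal (exp (- lam * h))"
  have a: "0 < ?a" using h c_pos by simp
  interpret Q: prob_space "cell_claims h" by (rule prob_space_cell_claims)
  have low: "ennreal ?a * (?e * ladder_density t) \<le> emeasure (cell_claims h) {t<..}" if "0 \<le> t" for t
  proof -
    have "ennreal ?a * (?e * ladder_density t) = ennreal (?a * (exp (- lam * h) * (lam / c * claim_tail t)))"
      unfolding ladder_density_def using a by (simp only: ennreal_mult' exp_ge_zero less_imp_le)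
    also have "?a * (exp (- lam * h) * (lam / c * claim_tail t)) = lam * h * exp (- lam * h) * claim_tail t"
      using c_pos by simp
    finally show ?thesis using cell_claims_tail_bounds(1)[OF h that] by (simp add: Q.emeasure_eq_measure ennreal_leI)
  qed
  have rate: "ennreal ?a * (?e * (\<integral>\<^sup>+x\<in>{u..}. ladder_density (x + ?a) \<partial>lborel)) \<le> (\<integral>\<^sup>+x\<in>{u..}. ruin_rate h x \<partial>lborel)"
  proof -
    have "ennreal ?a * (?e * (\<integral>\<^sup>+x\<in>{u..}. ladder_density (x + ?a) \<partial>lborel))
        = (\<integral>\<^sup>+x. ennreal ?a * (?e * (ladder_density (x + ?a) * indicator {u..} x)) \<partial>lborel)"
      by (simp add: nn_integral_cmult)
    also have "\<dots> \<le> (\<integral>\<^sup>+x\<in>{u..}. ruin_rate h x \<partial>lborel)"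
      using low a u by (intro nn_integral_mono) (auto simp: indicator_def ruin_rate_def)
    finally show ?thesis .
  qed
  have conv: "ennreal ?a * (?e * (\<integral>\<^sup>+y\<in>{0..u}. ruin_prob h y * ladder_density (u + ?a - y) \<partial>lborel))
     \<le> (\<integral>\<^sup>+y\<in>{0..u}. ruin_prob h y * emeasure (cell_claims h) {u + ?a - y..} \<partial>lborel)"
  proof -
    have "ennreal ?a * (?e * (\<integral>\<^sup>+y\<in>{0..u}. ruin_prob h y * ladder_density (u + ?a - y) \<partial>lborel))
        = (\<integral>\<^sup>+y. ennreal ?a * (?e * (ruin_prob h y * ladder_density (u + ?a - y) * indicator {0..u} y)) \<partial>lborel)"
      by (simp add: nn_integral_cmult)
    also have "\<dots> \<le> (\<integral>\<^sup>+y\<in>{0..u}. ruin_prob h y * emeasure (cell_claims h) {u + ?a - y..} \<partial>lborel)"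
    proof (rule nn_integral_mono)
      fix y
      have "ennreal ?a * (?e * ladder_density (u + ?a - y)) \<le> emeasure (cell_claims h) {u + ?a - y..}" if "y \<le> u"
        using low[of "u + ?a - y"] that a by (intro order_trans[OF low] emeasure_mono) auto
      from mult_left_mono[OF this, of "ruin_prob h y"]
      show "ennreal ?a * (?e * (ruin_prob h y * ladder_density (u + ?a - y) * indicator {0..u} y))
         \<le> ruin_prob h y * emeasure (cell_claims h) {u + ?a - y..} * indicator {0..u} y"
        by (auto simp: indicator_def mult_ac)
    qed
    finally show ?thesis .
  qed
  have "ennreal ?a * (?e * ((\<integral>\<^sup>+x\<in>{u..}. ladder_density (x + ?a) \<partial>lborel)
      + (\<integral>\<^sup>+y\<in>{0..u}. ruin_prob h y * ladder_density (u + ?a - y) \<partial>lborel)))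
     \<le> (\<integral>\<^sup>+x\<in>{u..}. ruin_rate h x \<partial>lborel)
      + (\<integral>\<^sup>+y\<in>{0..u}. ruin_prob h y * emeasure (cell_claims h) {u + ?a - y..} \<partial>lborel)"
    unfolding distrib_left by (intro add_mono rate conv)
  also have "\<dots> \<le> (\<integral>\<^sup>+y\<in>{u..}. ruin_prob h y * emeasure (cell_claims h) {..<u + ?a - y} \<partial>lborel)"
    by (rule supersolution_integrated[OF _ _ u ruin_prob_integral_finite[OF h u] ruin_prob_step]) auto
  also have "\<dots> \<le> (\<integral>\<^sup>+y. ruin_prob h u * indicator {u..u + ?a} y \<partial>lborel)"
  proof (rule nn_integral_mono)
    fix y
    show "ruin_prob h y * emeasure (cell_claims h) {..<u + ?a - y} * indicator {u..} y
        \<le> ruin_prob h u * indicator {u..u + ?a} y"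
    proof (cases "u \<le> y \<and> y \<le> u + ?a")
      case True
      then show ?thesis
        using mult_mono[OF ruin_prob_antimono[of u y h] kernel_le_1[of h "{..<u + ?a - y}"]] by (auto simp: indicator_def)
    next
      case False
      then have "u + ?a - y \<le> 0 \<or> y < u" by auto
      then show ?thesis using kernel_nonpos[of "u + ?a - y" h] by (auto simp: indicator_def)
    qed
  qed
  also have "\<dots> = ennreal ?a * ruin_prob h u"
    using a by (subst nn_integral_cmult_indicator) (auto simp: mult.commute)
  finally have "ennreal (1 / ?a) * (ennreal ?a * (?e * ((\<integral>\<^sup>+x\<in>{u..}. ladder_density (x + ?a) \<partial>lborel)
      + (\<integral>\<^sup>+y\<in>{0..u}. ruin_prob h y * ladder_density (u + ?a - y) \<partial>lborel)))) \<le> ennreal (1 / ?a) * (ennreal ?a * ruin_prob h u)"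
    by (rule mult_left_mono) simp
  moreover have "ennreal (1 / ?a) * (ennreal ?a * y) = y" for y
    unfolding mult.assoc[symmetric] using a by (subst ennreal_mult[symmetric]) auto
  ultimately show ?thesis by (simp only:)
qed

text \<open>
  The lower limit of the grid ruin probabilities as the mesh tends to \<open>0\<close>. Using a lower limit avoids
  the question of convergence.
\<close>

definition limit_ruin_prob :: "real \<Rightarrow> ennreal" where
  "limit_ruin_prob y = (SUP m. INF r\<in>{m..}. ruin_prob (1 / real (Suc r)) y)"

lemma limit_ruin_prob_measurable [measurable]: "limit_ruin_prob \<in> borel_measurable borel"
  unfolding limit_ruin_prob_def[abs_def] by measurable

lemma limit_ruin_prob_le_unit: "limit_ruin_prob (u + c) \<le> ruin_prob 1 u"
  unfolding limit_ruin_prob_def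
proof (rule SUP_least)
  fix m
  have "(INF r\<in>{m..}. ruin_prob (1 / real (Suc r)) (u + c)) \<le> ruin_prob (1 / real (Suc m)) (u + c)"
    by (rule INF_lower) simp
  also have "\<dots> \<le> ruin_prob 1 u" by (rule ruin_prob_fine_le_unit) simp
  finally show "(INF r\<in>{m..}. ruin_prob (1 / real (Suc r)) (u + c)) \<le> ruin_prob 1 u" .
qed

text \<open>
  Fatou's lemma in the form of monotone and dominated convergence applied to the infima over finer
  grids.
\<close>

lemma limit_ruin_prob_supersolution:
  assumes u: "0 \<le> u"
  shows "renewal_conv ladder_density limit_ruin_prob u + (\<integral>\<^sup>+x\<in>{u..}. ladder_density x \<partial>lborel) \<le> limit_ruin_prob u"
proof -
  define I where "I m y = (INF r\<in>{m..}. ruin_prob (1 / real (Suc r)) y)" for m y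
  define h where "h m = 1 / real (Suc m)" for m
  have [measurable]: "I m \<in> borel_measurable borel" for m unfolding I_def[abs_def] by measurable
  have h_lim: "h \<longlonglongrightarrow> 0" unfolding h_def[abs_def] using LIMSEQ_inverse_real_of_nat by (simp add: inverse_eq_divide)
  have h_pos: "0 < h m" for m by (simp add: h_def)
  have h_mono: "h r \<le> h m" if "m \<le> r" for m r using that by (simp add: h_def frac_le)
  have I_greatest: "X \<le> I m y" if "\<And>r. m \<le> r \<Longrightarrow> X \<le> ruin_prob (h r) y" for X m y
    unfolding I_def h_def[symmetric] using that by (intro INF_greatest) simp
  have I_le: "I m y \<le> ruin_prob (h r) y" if "m \<le> r" for m r y
    unfolding I_def h_def[symmetric] using that by (intro INF_lower) simp
  have I_le1: "I m y \<le> 1" if "0 \<le> y" for m y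
  proof -
    have "I m y \<le> ruin_prob (1 / real (Suc m)) y" unfolding I_def by (rule INF_lower) simp
    also have "\<dots> \<le> ennreal (exp (- R * y))" by (rule ruin_lundberg) simp
    also have "\<dots> \<le> 1" using R_pos that by simp
    finally show ?thesis .
  qed
  have I_lim: "(\<lambda>m. I m y) \<longlonglongrightarrow> limit_ruin_prob y" for y
    unfolding limit_ruin_prob_def I_def[symmetric]
    by (rule LIMSEQ_SUP) (auto simp: incseq_def I_def intro!: INF_superset_mono)
  let ?A = "\<lambda>m. \<integral>\<^sup>+x\<in>{u..}. ladder_density (x + c * h m) \<partial>lborel"
  let ?B = "\<lambda>m. \<integral>\<^sup>+y\<in>{0..u}. I m y * ladder_density (u + c * h m - y) \<partial>lborel"
  have le: "ennreal (exp (- lam * h m)) * (?A m + ?B m) \<le> limit_ruin_prob u" for m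
  proof -
    have "ennreal (exp (- lam * h m)) * (?A m + ?B m) \<le> I m u"
    proof (rule I_greatest)
      fix r assume r: "m \<le> r"
      have c_le: "c * h r \<le> c * h m" using h_mono[OF r] c_pos by simp
      have "ennreal (exp (- lam * h m)) * (?A m + ?B m)
        \<le> ennreal (exp (- lam * h r)) * ((\<integral>\<^sup>+x\<in>{u..}. ladder_density (x + c * h r) \<partial>lborel)
           + (\<integral>\<^sup>+y\<in>{0..u}. ruin_prob (h r) y * ladder_density (u + c * h r - y) \<partial>lborel))"
      proof (rule mult_mono)
        show "ennreal (exp (- lam * h m)) \<le> ennreal (exp (- lam * h r))"
          using h_mono[OF r] lam_pos by (intro ennreal_leI) simp
        show "?A m + ?B m \<le> (\<integral>\<^sup>+x\<in>{u..}. ladder_density (x + c * h r) \<partial>lborel)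
           + (\<integral>\<^sup>+y\<in>{0..u}. ruin_prob (h r) y * ladder_density (u + c * h r - y) \<partial>lborel)"
        proof (rule add_mono)
          show "?A m \<le> (\<integral>\<^sup>+x\<in>{u..}. ladder_density (x + c * h r) \<partial>lborel)"
          proof (rule nn_integral_mono)
            fix x
            have "ladder_density (x + c * h m) \<le> ladder_density (x + c * h r)"
              using c_le by (intro ladder_density_antimono) simp
            then show "ladder_density (x + c * h m) * indicator {u..} x \<le> ladder_density (x + c * h r) * indicator {u..} x"
              by (rule mult_right_mono) simp
          qed
          show "?B m \<le> (\<integral>\<^sup>+y\<in>{0..u}. ruin_prob (h r) y * ladder_density (u + c * h r - y) \<partial>lborel)"
          proof (rule nn_integral_mono)
            fix y
            have "ladder_density (u + c * h m - y) \<le> ladder_density (u + c * h r - y)"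
              using c_le by (intro ladder_density_antimono) simp
            from mult_mono[OF I_le[OF r, of y] this]
            have "I m y * ladder_density (u + c * h m - y) \<le> ruin_prob (h r) y * ladder_density (u + c * h r - y)" by simp
            then show "I m y * ladder_density (u + c * h m - y) * indicator {0..u} y
              \<le> ruin_prob (h r) y * ladder_density (u + c * h r - y) * indicator {0..u} y"
              by (rule mult_right_mono) simp
          qed
        qed
      qed simp_all
      also have "\<dots> \<le> ruin_prob (h r) u" by (rule ruin_prob_renewal_fine[OF h_pos u])
      finally show "ennreal (exp (- lam * h m)) * (?A m + ?B m) \<le> ruin_prob (h r) u" .
    qed
    also have "\<dots> \<le> limit_ruin_prob u" unfolding limit_ruin_prob_def I_def by (rule SUP_upper) simp
    finally show ?thesis .
  qed
  have shift: "(\<lambda>m. t + c * h m) \<longlonglongrightarrow> t" for t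
    using tendsto_add[OF tendsto_const tendsto_mult[OF tendsto_const h_lim], of t c] by simp
  have g_lim: "(\<lambda>m. ladder_density (t + c * h m)) \<longlonglongrightarrow> ladder_density t" for t
    using h_pos c_pos by (intro ladder_density_right_continuous shift) (simp add: less_imp_le)
  have A_lim: "?A \<longlonglongrightarrow> (\<integral>\<^sup>+x\<in>{u..}. ladder_density x \<partial>lborel)"
  proof (rule nn_integral_dominated_convergence[where w="\<lambda>x. ladder_density x * indicator {0..} x"])
    show "AE x in lborel. ladder_density (x + c * h m) * indicator {u..} x \<le> ladder_density x * indicator {0..} x" for m
      using u h_pos[of m] c_pos by (intro AE_I2) (auto simp: indicator_def intro!: ladder_density_antimono)
    show "(\<integral>\<^sup>+x\<in>{0..}. ladder_density x \<partial>lborel) < \<infinity>" by (simp add: ladder_mass)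
    show "AE x in lborel. (\<lambda>m. ladder_density (x + c * h m) * indicator {u..} x) \<longlonglongrightarrow> ladder_density x * indicator {u..} x"
      using g_lim by (intro AE_I2) (auto simp: indicator_def)
  qed auto
  have B_lim: "?B \<longlonglongrightarrow> (\<integral>\<^sup>+y\<in>{0..u}. limit_ruin_prob y * ladder_density (u - y) \<partial>lborel)"
  proof (rule nn_integral_dominated_convergence[where w="\<lambda>y. ennreal (lam / c) * indicator {0..u} y"])
    show "AE y in lborel. I m y * ladder_density (u + c * h m - y) * indicator {0..u} y \<le> ennreal (lam / c) * indicator {0..u} y" for m
      using mult_mono[OF I_le1 ladder_density_le] by (intro AE_I2) (auto simp: indicator_def)
    show "(\<integral>\<^sup>+y. ennreal (lam / c) * indicator {0..u} y \<partial>lborel) < \<infinity>"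
      using u by (subst nn_integral_cmult_indicator) (auto simp: ennreal_mult_less_top)
    show "AE y in lborel. (\<lambda>m. I m y * ladder_density (u + c * h m - y) * indicator {0..u} y)
        \<longlonglongrightarrow> limit_ruin_prob y * ladder_density (u - y) * indicator {0..u} y"
    proof (intro AE_I2)
      fix y
      have eq: "u + c * h m - y = (u - y) + c * h m" for m by simp
      have bd: "limit_ruin_prob y \<le> 1" if "0 \<le> y"
        using I_le1[OF that] by (intro LIMSEQ_le_const2[OF I_lim]) auto
      have bd2: "ladder_density (u - y) < \<infinity>" using ladder_density_le[of "u - y"] by (rule order.strict_trans1) simp
      show "(\<lambda>m. I m y * ladder_density (u + c * h m - y) * indicator {0..u} y)
        \<longlonglongrightarrow> limit_ruin_prob y * ladder_density (u - y) * indicator {0..u} y"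
      proof (cases "y \<in> {0..u}")
        case True
        then have "limit_ruin_prob y \<noteq> \<infinity>" using bd by (auto simp: top_unique)
        then show ?thesis unfolding eq using True bd2
          by (auto intro!: tendsto_mult_ennreal I_lim g_lim)
      qed simp
    qed
  qed auto
  have e_lim: "(\<lambda>m. ennreal (exp (- lam * h m))) \<longlonglongrightarrow> 1"
  proof -
    have "(\<lambda>m. exp (- lam * h m)) \<longlonglongrightarrow> exp (- lam * 0)"
      by (intro tendsto_intros h_lim)
    then show ?thesis using tendsto_ennrealI by fastforce
  qed
  have "(\<lambda>m. ennreal (exp (- lam * h m)) * (?A m + ?B m)) \<longlonglongrightarrow>
     1 * ((\<integral>\<^sup>+x\<in>{u..}. ladder_density x \<partial>lborel) + (\<integral>\<^sup>+y\<in>{0..u}. limit_ruin_prob y * ladder_density (u - y) \<partial>lborel))"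
    by (intro tendsto_mult_ennreal e_lim tendsto_add A_lim B_lim) auto
  then have "(\<integral>\<^sup>+x\<in>{u..}. ladder_density x \<partial>lborel) + (\<integral>\<^sup>+y\<in>{0..u}. limit_ruin_prob y * ladder_density (u - y) \<partial>lborel)
     \<le> limit_ruin_prob u"
    using le by (intro LIMSEQ_le_const2) auto
  then show ?thesis by (subst renewal_conv_commute) (simp_all add: add.commute)
qed

end

section \<open>Renewal inequality for window averages of Green functions\<close>

context risk_process
begin

lemma green_le:
  assumes "\<And>x. F x \<le> b" shows "green h F n u \<le> of_nat n * b"
proof (induction n arbitrary: u)
  case (Suc n)
  interpret Q: prob_space "cell_claims h" by (rule prob_space_cell_claims)
  have "walk_step h (green h F n) u \<le> (\<integral>\<^sup>+s. of_nat n * b \<partial>cell_claims h)"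
    unfolding walk_step_def using Suc by (intro nn_integral_mono) auto
  also have "\<dots> = of_nat n * b" using Q.emeasure_space_1 by simp
  finally show ?case using assms[of u] by (simp add: add_mono distrib_right)
qed simp

lemma green_integral_le:
  assumes [measurable]: "F \<in> borel_measurable borel"
  shows "(\<integral>\<^sup>+x\<in>{0..}. green h F n x \<partial>lborel) \<le> of_nat n * (\<integral>\<^sup>+x\<in>{0..}. F x \<partial>lborel)"
proof (induction n)
  case (Suc n)
  have step: "(\<integral>\<^sup>+x\<in>{0..}. green h F (Suc n) x \<partial>lborel)
     = (\<integral>\<^sup>+x\<in>{0..}. F x \<partial>lborel) + (\<integral>\<^sup>+x\<in>{0..}. walk_step h (green h F n) x \<partial>lborel)"
    by (simp add: distrib_right nn_integral_add)
  have "(\<integral>\<^sup>+x\<in>{0..}. walk_step h (green h F n) x \<partial>lborel) \<le> (\<integral>\<^sup>+x\<in>{0..}. green h F n x \<partial>lborel)"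
    unfolding integral_walk_step[OF green_measurable[OF assms] order_refl]
  proof (rule nn_integral_mono)
    fix y
    show "green h F n y * emeasure (cell_claims h) {0 + c * h - y..} * indicator {0..} y \<le> green h F n y * indicator {0..} y"
      using mult_left_mono[OF kernel_le_1[of h "{0 + c * h - y..}"], of "green h F n y"] by (auto simp: indicator_def)
  qed
  from add_left_mono[OF order_trans[OF this Suc], of "\<integral>\<^sup>+x\<in>{0..}. F x \<partial>lborel"]
  show ?case unfolding step of_nat_Suc distrib_right mult_1_left .
qed simp

definition window_mean :: "real \<Rightarrow> (real \<Rightarrow> ennreal) \<Rightarrow> real \<Rightarrow> ennreal" where
  "window_mean a W v = ennreal (1 / a) * (\<integral>\<^sup>+y. W y * (if v \<le> y \<and> y < v + a then 1 else 0) \<partial>lborel)"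

lemma window_mean_measurable [measurable]:
  assumes [measurable]: "W \<in> borel_measurable borel"
  shows "window_mean a W \<in> borel_measurable borel"
  unfolding window_mean_def[abs_def] by measurable

lemma window_integral_const:
  assumes "0 < a"
  shows "(\<integral>\<^sup>+y. b * (if v \<le> y \<and> y < v + a then 1 else 0) \<partial>lborel) = b * ennreal a"
proof -
  have "(\<integral>\<^sup>+y. b * (if v \<le> y \<and> y < v + a then 1 else 0) \<partial>lborel) = (\<integral>\<^sup>+y. b * indicator {v..<v + a} y \<partial>lborel)"
    by (intro nn_integral_cong) (auto simp: indicator_def)
  also have "\<dots> = b * ennreal a"
    using assms by (subst nn_integral_cmult_indicator) auto
  finally show ?thesis .
qed

lemma window_mean_ge:
  assumes "0 < a" "\<And>y. v \<le> y \<Longrightarrow> y \<le> v + a \<Longrightarrow> b \<le> W y"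
  shows "b \<le> window_mean a W v"
proof -
  have "b = ennreal (1 / a) * (b * ennreal a)"
    using assms(1) by (simp add: mult.left_commute[of _ b] ennreal_mult[symmetric])
  also have "\<dots> \<le> window_mean a W v"
    unfolding window_mean_def window_integral_const[OF assms(1), of b v, symmetric]
    using assms(2) by (intro mult_left_mono nn_integral_mono) auto
  finally show ?thesis .
qed

lemma window_mean_le:
  assumes "0 < a" "\<And>y. W y \<le> b"
  shows "window_mean a W v \<le> b"
proof -
  have "window_mean a W v \<le> ennreal (1 / a) * (b * ennreal a)"
    unfolding window_mean_def window_integral_const[OF assms(1), of b v, symmetric]
    using assms(2) by (intro mult_left_mono nn_integral_mono) auto
  also have "\<dots> = b" using assms(1) by (simp add: mult.left_commute[of _ b] ennreal_mult[symmetric])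
  finally show ?thesis .
qed

text \<open>
  Replacing a function by its window averages under an integral against a nondecreasing weight moves mass to the left by at
  most \<open>a\<close>, which the shift of the weight compensates; only the part of the integral over \<open>[0, a]\<close> is not covered by windows.
\<close>

lemma integral_le_window_mean:
  assumes [measurable]: "W \<in> borel_measurable borel" "k \<in> borel_measurable borel"
    and a: "0 < a" and W: "\<And>y. W y \<le> b" and k: "\<And>x y. x \<le> y \<Longrightarrow> k x \<le> k y" and k1: "\<And>x. k x \<le> 1"
  shows "(\<integral>\<^sup>+y\<in>{0..v}. W y * k y \<partial>lborel)
    \<le> b * ennreal a + (\<integral>\<^sup>+y\<in>{0..v}. window_mean a W y * k (y + a) \<partial>lborel)"
proof -
  let ?i = "\<lambda>y x. if y \<le> x \<and> x < y + a then 1 else (0::ennreal)"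
  have "(\<integral>\<^sup>+x. W x * k x * indicator {a..v} x \<partial>lborel)
     \<le> (\<integral>\<^sup>+x. \<integral>\<^sup>+y. ennreal (1 / a) * (W x * k (y + a) * ?i y x * indicator {0..v} y) \<partial>lborel \<partial>lborel)"
  proof (rule nn_integral_mono)
    fix x
    show "W x * k x * indicator {a..v} x
      \<le> (\<integral>\<^sup>+y. ennreal (1 / a) * (W x * k (y + a) * ?i y x * indicator {0..v} y) \<partial>lborel)"
    proof (cases "x \<in> {a..v}")
      case True
      have "W x * k x = (\<integral>\<^sup>+y. ennreal (1 / a) * (W x * k x) * indicator {x - a<..x} y \<partial>lborel)"
        using a by (subst nn_integral_cmult_indicator) (auto simp: mult.commute[of _ "W x * k x"] mult.assoc ennreal_mult[symmetric])
      also have "\<dots> \<le> (\<integral>\<^sup>+y. ennreal (1 / a) * (W x * k (y + a) * ?i y x * indicator {0..v} y) \<partial>lborel)"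
      proof (rule nn_integral_mono)
        fix y
        have "ennreal (1 / a) * (W x * k x) \<le> ennreal (1 / a) * (W x * k (y + a))" if "x - a < y"
          using that by (intro mult_left_mono k) auto
        then show "ennreal (1 / a) * (W x * k x) * indicator {x - a<..x} y
            \<le> ennreal (1 / a) * (W x * k (y + a) * ?i y x * indicator {0..v} y)"
          using True a by (auto simp: indicator_def)
      qed
      finally show ?thesis using True by simp
    qed simp
  qed
  also have "\<dots> = (\<integral>\<^sup>+y. \<integral>\<^sup>+x. ennreal (1 / a) * (W x * k (y + a) * ?i y x * indicator {0..v} y) \<partial>lborel \<partial>lborel)"
    by (rule lborel_pair.Fubini') measurable
  also have "\<dots> = (\<integral>\<^sup>+y\<in>{0..v}. window_mean a W y * k (y + a) \<partial>lborel)"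
  proof (rule nn_integral_cong)
    fix y
    have "(\<integral>\<^sup>+x. ennreal (1 / a) * (W x * k (y + a) * ?i y x * indicator {0..v} y) \<partial>lborel)
       = (\<integral>\<^sup>+x. (ennreal (1 / a) * k (y + a) * indicator {0..v} y) * (W x * ?i y x) \<partial>lborel)"
      by (intro nn_integral_cong) (simp only: mult_ac)
    also have "\<dots> = (ennreal (1 / a) * k (y + a) * indicator {0..v} y) * (\<integral>\<^sup>+x. W x * ?i y x \<partial>lborel)"
      by (rule nn_integral_cmult) measurable
    finally show "(\<integral>\<^sup>+x. ennreal (1 / a) * (W x * k (y + a) * ?i y x * indicator {0..v} y) \<partial>lborel)
      = window_mean a W y * k (y + a) * indicator {0..v} y"
      unfolding window_mean_def by (simp only: mult_ac)
  qed
  finally have high: "(\<integral>\<^sup>+x. W x * k x * indicator {a..v} x \<partial>lborel)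
     \<le> (\<integral>\<^sup>+y\<in>{0..v}. window_mean a W y * k (y + a) \<partial>lborel)" .
  have "(\<integral>\<^sup>+y\<in>{0..v}. W y * k y \<partial>lborel)
     \<le> (\<integral>\<^sup>+x. b * indicator {0..a} x + W x * k x * indicator {a..v} x \<partial>lborel)"
  proof (rule nn_integral_mono)
    fix x
    have "W x * k x \<le> b" using mult_mono[OF W k1, of x x] by simp
    then show "W x * k x * indicator {0..v} x \<le> b * indicator {0..a} x + W x * k x * indicator {a..v} x"
      by (auto simp: indicator_def)
  qed
  also have "\<dots> = b * ennreal a + (\<integral>\<^sup>+x. W x * k x * indicator {a..v} x \<partial>lborel)"
    using a by (subst nn_integral_add) (auto simp: nn_integral_cmult_indicator)
  finally show ?thesis using high by (meson add_left_mono order_trans)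
qed

end

context lundberg_model
begin

text \<open>
  The integrated step inequality divided by the length of the window. As a Green function need not be
  monotone, its average over the window \<open>[v, v + c * h)\<close> replaces its value, also inside the convolution. Two claims
  in a cell and the shift of the convolution by one window produce the error term of order \<open>h\<close>.
\<close>

lemma green_window_inequality:
  assumes [measurable]: "q \<in> borel_measurable borel" and Q: "\<And>x. q x \<le> ennreal Q" "0 \<le> Q"
    and h: "0 < h" and n: "real m * h = real n" and v: "0 \<le> v"
    and fin: "(\<integral>\<^sup>+x\<in>{0..}. q x \<partial>lborel) < \<infinity>"
  defines "A \<equiv> window_mean (c * h) (green h (\<lambda>x. ennreal h * q x) m)"
  shows "A v \<le> ennreal (exp (lam * h)) * (ennreal (1 / c) * (\<integral>\<^sup>+x\<in>{v..}. q x \<partial>lborel)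
      + (\<integral>\<^sup>+y\<in>{0..v}. A y * ladder_density (v - y - c * h) \<partial>lborel)
      + ennreal (h * (lam * (real n * Q) * (1 + lam / c * v))))"
proof -
  let ?a = "c * h" and ?F = "\<lambda>x. ennreal h * q x"
  define W where "W = green h ?F m"
  define b where "b = real n * Q"
  interpret CQ: prob_space "cell_claims h" by (rule prob_space_cell_claims)
  have a: "0 < ?a" and b: "0 \<le> b" using h c_pos Q by (auto simp: b_def)
  have [measurable]: "W \<in> borel_measurable borel" unfolding W_def by measurable
  have W_le: "W y \<le> ennreal b" for y
  proof -
    have "?F x \<le> ennreal (h * Q)" for x
      using mult_left_mono[OF Q(1), of "ennreal h"] h by (simp add: ennreal_mult')
    then have "W y \<le> of_nat m * ennreal (h * Q)" unfolding W_def by (rule green_le)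
    also have "\<dots> = ennreal b" using h Q n[symmetric] by (simp add: b_def ennreal_of_nat_eq_real_of_nat ennreal_mult''[symmetric] mult.assoc)
    finally show ?thesis .
  qed
  have finW: "(\<integral>\<^sup>+y\<in>{v..}. W y \<partial>lborel) < \<infinity>"
  proof -
    have "(\<integral>\<^sup>+y\<in>{v..}. W y \<partial>lborel) \<le> (\<integral>\<^sup>+y\<in>{0..}. W y \<partial>lborel)"
      using v by (intro nn_integral_mono) (auto simp: indicator_def)
    also have "\<dots> \<le> of_nat m * (\<integral>\<^sup>+x\<in>{0..}. ?F x \<partial>lborel)" unfolding W_def by (rule green_integral_le) measurable
    also have "(\<integral>\<^sup>+x\<in>{0..}. ?F x \<partial>lborel) = ennreal h * (\<integral>\<^sup>+x\<in>{0..}. q x \<partial>lborel)"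
      by (subst nn_integral_cmult[symmetric]) (auto simp: mult.assoc)
    also have "of_nat m * (ennreal h * (\<integral>\<^sup>+x\<in>{0..}. q x \<partial>lborel)) < \<infinity>"
      using fin by (simp add: ennreal_mult_less_top of_nat_less_top)
    finally show ?thesis .
  qed
  have sub: "W x \<le> ?F x + walk_step h W x" for x
    using green_incseq[of h ?F m x] by (simp add: W_def)
  let ?I = "\<integral>\<^sup>+x\<in>{v..}. q x \<partial>lborel" and ?J = "\<integral>\<^sup>+y\<in>{0..v}. A y * ladder_density (v - y - ?a) \<partial>lborel"
  have "ennreal (exp (- lam * h)) * (ennreal ?a * A v)
      = ennreal (exp (- lam * h)) * (\<integral>\<^sup>+y. W y * (if v \<le> y \<and> y < v + ?a then 1 else 0) \<partial>lborel)"
    unfolding A_def W_def[symmetric] window_mean_def using h c_pos by (simp add: mult.assoc[symmetric] ennreal_mult[symmetric])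
  also have "\<dots> = (\<integral>\<^sup>+y. ennreal (exp (- lam * h)) * (W y * (if v \<le> y \<and> y < v + ?a then 1 else 0)) \<partial>lborel)"
    by (rule nn_integral_cmult[symmetric]) measurable
  also have "\<dots> \<le> (\<integral>\<^sup>+y\<in>{v..}. W y * emeasure (cell_claims h) {..<v + ?a - y} \<partial>lborel)"
  proof (rule nn_integral_mono)
    fix y
    have "ennreal (exp (- lam * h)) * W y \<le> W y * emeasure (cell_claims h) {..<v + ?a - y}" if "y < v + ?a"
      using mult_left_mono[OF kernel_pos[OF h, of "v + ?a - y"], of "W y"] that by (simp add: mult.commute)
    then show "ennreal (exp (- lam * h)) * (W y * (if v \<le> y \<and> y < v + ?a then 1 else 0))
        \<le> W y * emeasure (cell_claims h) {..<v + ?a - y} * indicator {v..} y"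
      by (auto simp: indicator_def)
  qed
  also have "\<dots> \<le> (\<integral>\<^sup>+x\<in>{v..}. ?F x \<partial>lborel)
      + (\<integral>\<^sup>+y\<in>{0..v}. W y * emeasure (cell_claims h) {v + ?a - y..} \<partial>lborel)"
    by (rule subsolution_integrated[OF _ _ v finW sub]) auto
  finally have s1: "ennreal (exp (- lam * h)) * (ennreal ?a * A v) \<le> (\<integral>\<^sup>+x\<in>{v..}. ?F x \<partial>lborel)
      + (\<integral>\<^sup>+y\<in>{0..v}. W y * emeasure (cell_claims h) {v + ?a - y..} \<partial>lborel)" .
  have F_int: "(\<integral>\<^sup>+x\<in>{v..}. ?F x \<partial>lborel) = ennreal h * ?I"
    by (subst nn_integral_cmult[symmetric]) (auto simp: mult.assoc)
  have "(\<integral>\<^sup>+y\<in>{0..v}. W y * emeasure (cell_claims h) {v + ?a - y..} \<partial>lborel)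
     \<le> (\<integral>\<^sup>+y. ennreal (lam * h) * (W y * ennreal (claim_tail (v - y)) * indicator {0..v} y)
          + ennreal (b * (lam * h) ^ 2) * indicator {0..v} y \<partial>lborel)"
  proof (rule nn_integral_mono)
    fix y
    have "W y * emeasure (cell_claims h) {v + ?a - y..}
        \<le> ennreal (lam * h) * (W y * ennreal (claim_tail (v - y))) + ennreal (b * (lam * h) ^ 2)" if y: "y \<le> v"
    proof -
      have "emeasure (cell_claims h) {v + ?a - y..} \<le> emeasure (cell_claims h) {v - y<..}"
        using a by (intro emeasure_mono) auto
      also have "\<dots> \<le> ennreal (lam * h * claim_tail (v - y) + (lam * h) ^ 2)"
        using cell_claims_tail_bounds(2)[OF h, of "v - y"] y by (simp add: CQ.emeasure_eq_measure ennreal_leI)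
      also have "\<dots> = ennreal (lam * h) * ennreal (claim_tail (v - y)) + ennreal ((lam * h) ^ 2)"
        using lam_pos h claim_tail_pos[of "v - y"] by (subst ennreal_plus) (auto simp: ennreal_mult less_imp_le)
      finally have "W y * emeasure (cell_claims h) {v + ?a - y..}
          \<le> W y * (ennreal (lam * h) * ennreal (claim_tail (v - y)) + ennreal ((lam * h) ^ 2))"
        by (rule mult_left_mono) simp
      also have "\<dots> = ennreal (lam * h) * (W y * ennreal (claim_tail (v - y))) + W y * ennreal ((lam * h) ^ 2)"
        by (simp only: distrib_left mult_ac)
      also have "W y * ennreal ((lam * h) ^ 2) \<le> ennreal b * ennreal ((lam * h) ^ 2)"
        by (intro mult_right_mono W_le) simp
      also have "\<dots> = ennreal (b * (lam * h) ^ 2)" using b by (simp add: ennreal_mult)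
      finally show ?thesis by (simp add: add_left_mono)
    qed
    then show "W y * emeasure (cell_claims h) {v + ?a - y..} * indicator {0..v} y
        \<le> ennreal (lam * h) * (W y * ennreal (claim_tail (v - y)) * indicator {0..v} y)
          + ennreal (b * (lam * h) ^ 2) * indicator {0..v} y"
      by (auto simp: indicator_def)
  qed
  also have "\<dots> = ennreal (lam * h) * (\<integral>\<^sup>+y\<in>{0..v}. W y * ennreal (claim_tail (v - y)) \<partial>lborel) + ennreal (b * (lam * h) ^ 2 * v)"
    using v b by (subst nn_integral_add) (auto simp: nn_integral_cmult nn_integral_cmult_indicator ennreal_mult)
  finally have s2: "(\<integral>\<^sup>+y\<in>{0..v}. W y * emeasure (cell_claims h) {v + ?a - y..} \<partial>lborel)
     \<le> ennreal (lam * h) * (\<integral>\<^sup>+y\<in>{0..v}. W y * ennreal (claim_tail (v - y)) \<partial>lborel) + ennreal (b * (lam * h) ^ 2 * v)" .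
  have "(\<integral>\<^sup>+y\<in>{0..v}. W y * ennreal (claim_tail (v - y)) \<partial>lborel)
     \<le> ennreal b * ennreal ?a + (\<integral>\<^sup>+y\<in>{0..v}. window_mean ?a W y * ennreal (claim_tail (v - (y + ?a))) \<partial>lborel)"
    by (rule integral_le_window_mean[OF _ _ a W_le])
       (auto intro!: ennreal_leI claim_tail_antimono simp: claim_tail_le_1 simp del: diff_le_0_iff_le)
  then have s3: "(\<integral>\<^sup>+y\<in>{0..v}. W y * ennreal (claim_tail (v - y)) \<partial>lborel)
     \<le> ennreal b * ennreal ?a + (\<integral>\<^sup>+y\<in>{0..v}. A y * ennreal (claim_tail (v - (y + ?a))) \<partial>lborel)"
    by (simp only: A_def W_def)
  have main: "ennreal (exp (- lam * h)) * (ennreal ?a * A v) \<le> ennreal h * ?I + (ennreal (lam * h) *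
      (ennreal b * ennreal ?a + (\<integral>\<^sup>+y\<in>{0..v}. A y * ennreal (claim_tail (v - (y + ?a))) \<partial>lborel)) + ennreal (b * (lam * h) ^ 2 * v))"
    by (rule order_trans[OF s1[unfolded F_int] add_left_mono[OF order_trans[OF s2 add_right_mono[OF mult_left_mono[OF s3]]]]]) simp
  have J: "ennreal (lam * h) * (\<integral>\<^sup>+y\<in>{0..v}. A y * ennreal (claim_tail (v - (y + ?a))) \<partial>lborel) = ennreal ?a * ?J"
  proof -
    have g: "ennreal ?a * ladder_density t = ennreal (lam * h) * ennreal (claim_tail t)" for t
    proof -
      have "?a * (lam / c * claim_tail t) = lam * h * claim_tail t" using c_pos by simp
      then show ?thesis unfolding ladder_density_def using a lam_pos h
        by (simp only: ennreal_mult'[symmetric] less_imp_le mult_pos_pos)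
    qed
    have "ennreal (lam * h) * (\<integral>\<^sup>+y\<in>{0..v}. A y * ennreal (claim_tail (v - (y + ?a))) \<partial>lborel)
        = (\<integral>\<^sup>+y. ennreal (lam * h) * (A y * ennreal (claim_tail (v - (y + ?a))) * indicator {0..v} y) \<partial>lborel)"
      unfolding A_def by (rule nn_integral_cmult[symmetric]) measurable
    also have "\<dots> = (\<integral>\<^sup>+y. ennreal ?a * (A y * ladder_density (v - y - ?a) * indicator {0..v} y) \<partial>lborel)"
    proof (rule nn_integral_cong)
      fix y
      have "ennreal (lam * h) * (A y * ennreal (claim_tail (v - (y + ?a))) * indicator {0..v} y)
          = (ennreal (lam * h) * ennreal (claim_tail (v - (y + ?a)))) * (A y * indicator {0..v} y)" by (simp only: mult_ac)
      also have "\<dots> = ennreal ?a * (A y * ladder_density (v - y - ?a) * indicator {0..v} y)"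
        unfolding g[symmetric] by (simp only: mult_ac diff_diff_eq)
      finally show "ennreal (lam * h) * (A y * ennreal (claim_tail (v - (y + ?a))) * indicator {0..v} y)
          = ennreal ?a * (A y * ladder_density (v - y - ?a) * indicator {0..v} y)" .
    qed
    also have "\<dots> = ennreal ?a * ?J"
      unfolding A_def by (rule nn_integral_cmult) measurable
    finally show ?thesis .
  qed
  have err: "ennreal (lam * h) * (ennreal b * ennreal ?a) + ennreal (b * (lam * h) ^ 2 * v)
      = ennreal ?a * ennreal (h * (lam * b * (1 + lam / c * v)))"
  proof -
    have "lam * h * (b * ?a) + b * (lam * h) ^ 2 * v = ?a * (h * (lam * b * (1 + lam / c * v)))"
      using c_pos by (simp add: field_simps power2_eq_square)
    moreover have "0 \<le> lam * h * (b * ?a)" "0 \<le> b * (lam * h) ^ 2 * v" using lam_pos h b a v c_pos by auto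
    ultimately have "ennreal (lam * h * (b * ?a)) + ennreal (b * (lam * h) ^ 2 * v) = ennreal (?a * (h * (lam * b * (1 + lam / c * v))))"
      by (simp only: ennreal_plus[symmetric])
    then show ?thesis using lam_pos h b a by (simp only: ennreal_mult' less_imp_le mult_pos_pos)
  qed
  have Ih: "ennreal h * ?I = ennreal ?a * (ennreal (1 / c) * ?I)"
    using c_pos h by (simp add: mult.assoc[symmetric] ennreal_mult[symmetric])
  have "ennreal (exp (- lam * h)) * (ennreal ?a * A v)
     \<le> ennreal ?a * (ennreal (1 / c) * ?I) + (ennreal (lam * h) * (ennreal b * ennreal ?a) + ennreal ?a * ?J
          + ennreal (b * (lam * h) ^ 2 * v))"
    using main unfolding Ih distrib_left[of "ennreal (lam * h)"] J .
  also have "\<dots> = ennreal ?a * (ennreal (1 / c) * ?I) + ennreal ?a * ?J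
      + (ennreal (lam * h) * (ennreal b * ennreal ?a) + ennreal (b * (lam * h) ^ 2 * v))"
    by (simp only: add_ac)
  also have "\<dots> = ennreal ?a * (ennreal (1 / c) * ?I + ?J + ennreal (h * (lam * b * (1 + lam / c * v))))"
    unfolding err distrib_left[of "ennreal ?a"] ..
  finally have "ennreal (exp (- lam * h)) * (ennreal ?a * A v)
     \<le> ennreal ?a * (ennreal (1 / c) * ?I + ?J + ennreal (h * (lam * b * (1 + lam / c * v))))" .
  then have "ennreal (exp (lam * h) / ?a) * (ennreal (exp (- lam * h)) * (ennreal ?a * A v))
     \<le> ennreal (exp (lam * h) / ?a) * (ennreal ?a * (ennreal (1 / c) * ?I + ?J + ennreal (h * (lam * b * (1 + lam / c * v)))))"
    by (rule mult_left_mono) simp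
  moreover have "ennreal (exp (lam * h) / ?a) * (ennreal (exp (- lam * h)) * (ennreal ?a * y)) = y" for y
  proof -
    have nonneg: "0 \<le> exp (lam * h) / ?a" "0 \<le> exp (- lam * h)" using a by simp_all
    have "ennreal (exp (lam * h) / ?a * (exp (- lam * h) * ?a))
        = ennreal (exp (lam * h) / ?a) * (ennreal (exp (- lam * h)) * ennreal ?a)"
      by (simp only: ennreal_mult'[OF nonneg(1)] ennreal_mult'[OF nonneg(2)])
    moreover have "exp (lam * h) / ?a * (exp (- lam * h) * ?a) = 1" using h c_pos by (simp add: exp_minus)
    ultimately have "ennreal (exp (lam * h) / ?a) * (ennreal (exp (- lam * h)) * ennreal ?a) = 1" by simp
    then have "ennreal (exp (lam * h) / ?a) * (ennreal (exp (- lam * h)) * ennreal ?a) * y = y" by (simp only: mult_1_left)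
    then show ?thesis by (simp only: mult.assoc)
  qed
  moreover have "ennreal (exp (lam * h) / ?a) * (ennreal ?a * y) = ennreal (exp (lam * h)) * y" for y
    using h c_pos by (simp add: mult.assoc[symmetric] ennreal_mult[symmetric])
  ultimately show ?thesis unfolding b_def by (simp only:)
qed

end

section \<open>The exponential bound for Green functions on the unit grid\<close>

context lundberg_model
begin

text \<open>
  The argument may approach from either side, so the countably many atoms of the claim law must be
  excluded.
\<close>

lemma ladder_density_AE_continuous:
  assumes "s \<longlonglongrightarrow> 0"
  shows "AE y in lborel. (\<lambda>m. ladder_density (v - y - s m)) \<longlonglongrightarrow> ladder_density (v - y)"
proof -
  define D where "D = {x. \<not> isCont (cdf claim_law) x}"
  have "countable D" unfolding D_def by (intro mono_ctble_discont monoI claim.cdf_nondecreasing)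
  then have "countable ((\<lambda>x. v - x) ` D)" by simp
  then have "(\<lambda>x. v - x) ` D \<in> null_sets lborel" by (rule countable_imp_null_set_lborel)
  from AE_not_in[OF this] show ?thesis
  proof eventually_elim
    case (elim y)
    then have "v - y \<notin> D" by (metis diff_diff_eq2 diff_add_cancel add_diff_cancel_left' imageI)
    then have "isCont (cdf claim_law) (v - y)" by (simp add: D_def)
    moreover have "(\<lambda>m. v - y - s m) \<longlonglongrightarrow> v - y" using tendsto_diff[OF tendsto_const assms, of "v - y"] by simp
    ultimately have "(\<lambda>m. cdf claim_law (v - y - s m)) \<longlonglongrightarrow> cdf claim_law (v - y)"
      by (rule isCont_tendsto_compose)
    then show ?case unfolding ladder_density_def claim_cdf_eq
      by (intro tendsto_ennrealI tendsto_mult tendsto_diff tendsto_const)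
  qed
qed

text \<open>
  The upper limit of the window averages over finer and finer grids is a bounded subsolution of the
  renewal equation with forcing term \<open>1 / c * (\<integral> q' over [v, \<infinity>))\<close>, where \<open>q' x = q (x - 3 * c)\<close>. Its tilt and the integral
  of its tilt are both controlled by the integral of \<open>(1 + x) exp (R x) q'\<close>. Monotonicity of \<open>q\<close> is needed to pass from the
  unit grid to the fine grids.
\<close>

lemma green_upper_bound:
  assumes H: "h_I M Z \<le> ennreal H" and B: "exp_moment M c lam Z R k \<le> ennreal B" "0 \<le> B" "2 \<le> k"
    and q [measurable]: "q \<in> borel_measurable borel" and anti: "\<And>x y. x \<le> y \<Longrightarrow> q y \<le> q x"
    and Q: "\<And>x. q x \<le> ennreal Q" "0 \<le> Q"
    and T: "(\<integral>\<^sup>+x\<in>{0..}. ennreal ((1 + x) * exp (R * x)) * q (x - 3 * c) \<partial>lborel) \<le> ennreal T" "0 \<le> T"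
    and u: "0 \<le> u"
  shows "green 1 q n u \<le> ennreal (exp lam * exp (- R * (u + c)) * ((1 + H) * T / c))"
proof -
  interpret td: tilted_density ladder_density R "1 / (1 + \<theta>)" H "1 + B" k
    using ladder_tilted_density[OF H B] .
  define q' where "q' x = q (x - 3 * c)" for x
  have [measurable]: "q' \<in> borel_measurable borel" unfolding q'_def[abs_def] by measurable
  have q'_le: "q' x \<le> ennreal Q" for x unfolding q'_def by (rule Q)
  define h where "h r = 1 / real (Suc r)" for r
  have h_lim: "h \<longlonglongrightarrow> 0" unfolding h_def[abs_def] using LIMSEQ_inverse_real_of_nat by (simp add: inverse_eq_divide)
  have h_pos: "0 < h r" for r by (simp add: h_def)
  have h_mono: "h r \<le> h m" if "m \<le> r" for m r using that by (simp add: h_def frac_le)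
  have h_n: "real (n * Suc r) * h r = real n" for r
  proof -
    have "real (Suc r) \<noteq> 0" by simp
    then show ?thesis
      by (simp only: h_def of_nat_mult times_divide_eq_right mult_1_right) (rule nonzero_mult_div_cancel_right)
  qed
  define A where "A r = window_mean (c * h r) (green (h r) (\<lambda>x. ennreal (h r) * q' x) (n * Suc r))" for r
  define b where "b = ennreal (real n * Q)"
  have A_le: "A r y \<le> b" for r y
    unfolding A_def
  proof (rule window_mean_le)
    show "0 < c * h r" using c_pos h_pos by simp
    fix y
    have "green (h r) (\<lambda>x. ennreal (h r) * q' x) (n * Suc r) y \<le> of_nat (n * Suc r) * (ennreal (h r) * ennreal Q)"
      by (intro green_le mult_left_mono q'_le) simp
    also have "\<dots> = ennreal (real (n * Suc r) * (h r * Q))"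
      using h_pos[of r] Q(2) by (simp only: ennreal_of_nat_eq_real_of_nat ennreal_mult' less_imp_le of_nat_0_le_iff)
    also have "real (n * Suc r) * (h r * Q) = real n * Q" by (simp only: mult.assoc[symmetric] h_n)
    finally show "green (h r) (\<lambda>x. ennreal (h r) * q' x) (n * Suc r) y \<le> b" by (simp only: b_def)
  qed
  \<comment> \<open>The decreasing suprema converge to the upper limit, which makes dominated convergence available.\<close>
  define S where "S m y = (SUP r\<in>{m..}. A r y)" for m y
  define \<phi> where "\<phi> y = (INF m. S m y)" for y
  have [measurable]: "A r \<in> borel_measurable borel" for r unfolding A_def by measurable
  have [measurable]: "S m \<in> borel_measurable borel" for m unfolding S_def[abs_def] by measurable
  have [measurable]: "\<phi> \<in> borel_measurable borel" unfolding \<phi>_def[abs_def] by measurable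
  have S_le: "S m y \<le> b" for m y unfolding S_def by (intro SUP_least A_le)
  have S_lim: "(\<lambda>m. S m y) \<longlonglongrightarrow> \<phi> y" for y
    unfolding \<phi>_def by (rule LIMSEQ_INF) (auto simp: decseq_def S_def intro!: SUP_subset_mono)
  have \<phi>_le: "\<phi> y \<le> b" for y unfolding \<phi>_def by (rule INF_lower2[of 0]) (auto intro: S_le)
  have Tint: "(\<integral>\<^sup>+x\<in>{0..}. ennreal (w x) * q' x \<partial>lborel) \<le> ennreal T" if "\<And>x. 0 \<le> x \<Longrightarrow> w x \<le> (1 + x) * exp (R * x)" for w
    using that by (intro order_trans[OF nn_integral_mono T(1)]) (auto simp: indicator_def q'_def intro!: mult_right_mono ennreal_leI)
  have exp1: "1 \<le> exp (R * x)" if "0 \<le> x" for x using R_pos that by simp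
  have fin: "(\<integral>\<^sup>+x\<in>{0..}. q' x \<partial>lborel) < \<infinity>"
  proof -
    have "(\<integral>\<^sup>+x\<in>{0..}. ennreal 1 * q' x \<partial>lborel) \<le> ennreal T"
      using exp1 by (intro Tint) (smt (verit, ccfv_SIG) mult_le_cancel_right1)
    then show ?thesis by (simp add: order.strict_trans1)
  qed
  let ?I = "\<lambda>v. ennreal (1 / c) * (\<integral>\<^sup>+x\<in>{v..}. q' x \<partial>lborel)"
  define E where "E v = lam * (real n * Q) * (1 + lam / c * v)" for v
  have sub: "\<phi> v \<le> renewal_conv ladder_density \<phi> v + ?I v" if v: "0 \<le> v" for v
  proof -
    have E0: "0 \<le> E v" using lam_pos c_pos Q v by (simp add: E_def)
    let ?J = "\<lambda>m. \<integral>\<^sup>+y\<in>{0..v}. S m y * ladder_density (v - y - c * h m) \<partial>lborel"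
    have le: "\<phi> v \<le> ennreal (exp (lam * h m)) * (?I v + ?J m + ennreal (h m * E v))" for m
    proof -
      have "\<phi> v \<le> S m v" unfolding \<phi>_def by (rule INF_lower) simp
      also have "\<dots> \<le> ennreal (exp (lam * h m)) * (?I v + ?J m + ennreal (h m * E v))"
        unfolding S_def[of m v]
      proof (rule SUP_least)
        fix r assume "r \<in> {m..}"
        then have r: "m \<le> r" "h r \<le> h m" using h_mono by auto
        have "A r v \<le> ennreal (exp (lam * h r)) * (?I v
             + (\<integral>\<^sup>+y\<in>{0..v}. A r y * ladder_density (v - y - c * h r) \<partial>lborel) + ennreal (h r * E v))"
          unfolding A_def E_def by (rule green_window_inequality[OF _ q'_le Q(2) h_pos h_n v fin]) measurable
        also have "\<dots> \<le> ennreal (exp (lam * h m)) * (?I v + ?J m + ennreal (h m * E v))"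
        proof (rule mult_mono)
          show "ennreal (exp (lam * h r)) \<le> ennreal (exp (lam * h m))" using r lam_pos by (intro ennreal_leI) simp
          have "h r * E v \<le> h m * E v" using r E0 by (intro mult_right_mono)
          moreover have "(\<integral>\<^sup>+y\<in>{0..v}. A r y * ladder_density (v - y - c * h r) \<partial>lborel) \<le> ?J m"
          proof (rule nn_integral_mono)
            fix y
            have "c * h r \<le> c * h m" using r c_pos by simp
            then have "ladder_density (v - y - c * h r) \<le> ladder_density (v - y - c * h m)"
              by (intro ladder_density_antimono) simp
            moreover have "A r y \<le> S m y" unfolding S_def using r by (intro SUP_upper) simp
            ultimately have "A r y * ladder_density (v - y - c * h r) \<le> S m y * ladder_density (v - y - c * h m)"
              by (intro mult_mono) simp_all
            then show "A r y * ladder_density (v - y - c * h r) * indicator {0..v} y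
               \<le> S m y * ladder_density (v - y - c * h m) * indicator {0..v} y"
              by (rule mult_right_mono) simp
          qed
          ultimately show "?I v + (\<integral>\<^sup>+y\<in>{0..v}. A r y * ladder_density (v - y - c * h r) \<partial>lborel) + ennreal (h r * E v)
            \<le> ?I v + ?J m + ennreal (h m * E v)"
            by (intro add_mono order_refl ennreal_leI)
        qed simp_all
        finally show "A r v \<le> ennreal (exp (lam * h m)) * (?I v + ?J m + ennreal (h m * E v))" .
      qed
      finally show ?thesis .
    qed
    have bfin: "b < \<infinity>" by (simp add: b_def)
    have J_lim: "?J \<longlonglongrightarrow> (\<integral>\<^sup>+y\<in>{0..v}. \<phi> y * ladder_density (v - y) \<partial>lborel)"
    proof (rule nn_integral_dominated_convergence[where w="\<lambda>y. b * ennreal (lam / c) * indicator {0..v} y"])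
      show "AE y in lborel. S m y * ladder_density (v - y - c * h m) * indicator {0..v} y \<le> b * ennreal (lam / c) * indicator {0..v} y" for m
        by (intro AE_I2 mult_right_mono mult_mono S_le ladder_density_le) auto
      show "(\<integral>\<^sup>+y. b * ennreal (lam / c) * indicator {0..v} y \<partial>lborel) < \<infinity>"
        using v bfin by (subst nn_integral_cmult_indicator) (auto simp: ennreal_mult_less_top)
      have "(\<lambda>m. c * h m) \<longlonglongrightarrow> 0" using tendsto_mult[OF tendsto_const h_lim, of c] by simp
      from ladder_density_AE_continuous[OF this, of v]
      show "AE y in lborel. (\<lambda>m. S m y * ladder_density (v - y - c * h m) * indicator {0..v} y)
          \<longlonglongrightarrow> \<phi> y * ladder_density (v - y) * indicator {0..v} y"
      proof eventually_elim
        case (elim y)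
        have "\<phi> y < \<infinity>" using \<phi>_le bfin by (rule order.strict_trans1)
        moreover have "ladder_density (v - y) < \<infinity>" using ladder_density_le[of "v - y"] by (rule order.strict_trans1) simp
        ultimately have "(\<lambda>m. S m y * ladder_density (v - y - c * h m)) \<longlonglongrightarrow> \<phi> y * ladder_density (v - y)"
          by (intro tendsto_mult_ennreal S_lim elim) auto
        then show ?case by (cases "y \<in> {0..v}") auto
      qed
    qed auto
    have e_lim: "(\<lambda>m. ennreal (exp (lam * h m))) \<longlonglongrightarrow> ennreal 1"
    proof (rule tendsto_ennrealI)
      show "(\<lambda>m. exp (lam * h m)) \<longlonglongrightarrow> 1"
        using tendsto_exp[OF tendsto_mult[OF tendsto_const[of lam] h_lim]] by simp
    qed
    have E_lim: "(\<lambda>m. ennreal (h m * E v)) \<longlonglongrightarrow> ennreal 0"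
      using tendsto_mult[OF h_lim tendsto_const[of "E v"]] by (intro tendsto_ennrealI) simp
    have "(\<lambda>m. ennreal (exp (lam * h m)) * (?I v + ?J m + ennreal (h m * E v)))
        \<longlonglongrightarrow> ennreal 1 * (?I v + (\<integral>\<^sup>+y\<in>{0..v}. \<phi> y * ladder_density (v - y) \<partial>lborel) + ennreal 0)"
      by (intro tendsto_mult_ennreal e_lim tendsto_add tendsto_const J_lim E_lim) auto
    then have "\<phi> v \<le> ennreal 1 * (?I v + (\<integral>\<^sup>+y\<in>{0..v}. \<phi> y * ladder_density (v - y) \<partial>lborel) + ennreal 0)"
      using le by (intro LIMSEQ_le_const) auto
    then show ?thesis by (subst renewal_conv_commute) (simp_all add: add.commute)
  qed
  define a where "a v = (\<integral>\<^sup>+x\<in>{v..}. ennreal (1 / c * exp (R * x)) * q' x \<partial>lborel)" for v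
  have [measurable]: "a \<in> borel_measurable borel" unfolding a_def[abs_def] by measurable
  have Tc: "(\<integral>\<^sup>+x\<in>{0..}. ennreal (1 / c * w x) * q' x \<partial>lborel) \<le> ennreal (T / c)"
    if "\<And>x. 0 \<le> x \<Longrightarrow> w x \<le> (1 + x) * exp (R * x)" for w
  proof -
    have "(\<integral>\<^sup>+x\<in>{0..}. ennreal (1 / c * w x) * q' x \<partial>lborel)
       \<le> (\<integral>\<^sup>+x. ennreal (1 / c) * (ennreal ((1 + x) * exp (R * x)) * q' x * indicator {0..} x) \<partial>lborel)"
    proof (rule nn_integral_mono)
      fix x
      have "ennreal (1 / c * w x) \<le> ennreal (1 / c) * ennreal ((1 + x) * exp (R * x))" if "0 \<le> x"
        using c_pos \<open>\<And>x. 0 \<le> x \<Longrightarrow> w x \<le> (1 + x) * exp (R * x)\<close>[OF that]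
        by (subst ennreal_mult'[symmetric]) (auto intro!: ennreal_leI mult_left_mono simp: divide_right_mono)
      from mult_right_mono[OF this, of "q' x"]
      show "ennreal (1 / c * w x) * q' x * indicator {0..} x
          \<le> ennreal (1 / c) * (ennreal ((1 + x) * exp (R * x)) * q' x * indicator {0..} x)"
        by (auto simp: indicator_def mult.assoc)
    qed
    also have "\<dots> = ennreal (1 / c) * (\<integral>\<^sup>+x\<in>{0..}. ennreal ((1 + x) * exp (R * x)) * q' x \<partial>lborel)"
      by (rule nn_integral_cmult) measurable
    also have "\<dots> \<le> ennreal (1 / c) * ennreal T" by (intro mult_left_mono Tint) auto
    also have "\<dots> = ennreal (T / c)" using c_pos T(2) by (subst ennreal_mult[symmetric]) auto
    finally show ?thesis .
  qed
  have \<phi>_bound: "\<phi> v \<le> ennreal (exp (- R * v)) * ((1 + ennreal H) * ennreal (T / c))" if v: "0 \<le> v" for v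
  proof (rule td.renewal_upper_bound[where a=a and V="real n * Q", OF _ _ _ _ _ v])
    show "\<phi> v \<le> ennreal (real n * Q)" for v using \<phi>_le by (simp only: b_def)
    fix v :: real assume v: "0 \<le> v"
    have "?I v = (\<integral>\<^sup>+x. ennreal (1 / c) * (q' x * indicator {v..} x) \<partial>lborel)"
      by (rule nn_integral_cmult[symmetric]) measurable
    also have "\<dots> \<le> (\<integral>\<^sup>+x. ennreal (exp (- R * v)) * (ennreal (1 / c * exp (R * x)) * q' x * indicator {v..} x) \<partial>lborel)"
    proof (rule nn_integral_mono)
      fix x
      have "ennreal (1 / c) \<le> ennreal (exp (- R * v)) * ennreal (1 / c * exp (R * x))" if "v \<le> x"
      proof -
        have "1 \<le> exp (- R * v) * exp (R * x)" using that R_pos by (simp add: exp_add[symmetric])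
        then have "1 / c * 1 \<le> 1 / c * (exp (- R * v) * exp (R * x))" using c_pos by (intro mult_left_mono) auto
        then have "ennreal (1 / c) \<le> ennreal (exp (- R * v) * (1 / c * exp (R * x)))" by (intro ennreal_leI) (simp add: mult_ac)
        then show ?thesis by (simp only: ennreal_mult' exp_ge_zero)
      qed
      from mult_right_mono[OF this, of "q' x"]
      show "ennreal (1 / c) * (q' x * indicator {v..} x)
          \<le> ennreal (exp (- R * v)) * (ennreal (1 / c * exp (R * x)) * q' x * indicator {v..} x)"
        by (auto simp: indicator_def mult.assoc)
    qed
    also have "\<dots> = ennreal (exp (- R * v)) * a v" unfolding a_def by (rule nn_integral_cmult) measurable
    finally show "\<phi> v \<le> renewal_conv ladder_density \<phi> v + ennreal (exp (- R * v)) * a v"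
      using sub[OF v] by (meson add_left_mono order_trans)
    have "a v \<le> (\<integral>\<^sup>+x\<in>{0..}. ennreal (1 / c * exp (R * x)) * q' x \<partial>lborel)"
      unfolding a_def using v by (intro nn_integral_mono) (auto simp: indicator_def)
    also have "\<dots> \<le> ennreal (T / c)" by (rule Tc) (simp add: mult_right_mono)
    finally show "a v \<le> ennreal (T / c)" .
  next
    have "(\<integral>\<^sup>+u\<in>{0..}. a u \<partial>lborel) = (\<integral>\<^sup>+x\<in>{0..}. ennreal x * (ennreal (1 / c * exp (R * x)) * q' x) \<partial>lborel)"
      using nn_integral_tail_integral[of "\<lambda>x. ennreal (1 / c * exp (R * x)) * q' x" 0] by (simp add: a_def)
    also have "\<dots> = (\<integral>\<^sup>+x\<in>{0..}. ennreal (1 / c * (x * exp (R * x))) * q' x \<partial>lborel)"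
    proof (rule nn_integral_cong)
      fix x
      have "ennreal x * ennreal (1 / c * exp (R * x)) = ennreal (1 / c * (x * exp (R * x)))" if "0 \<le> x"
        using that c_pos by (subst ennreal_mult[symmetric]) (auto simp: mult_ac)
      then show "ennreal x * (ennreal (1 / c * exp (R * x)) * q' x) * indicator {0..} x
         = ennreal (1 / c * (x * exp (R * x))) * q' x * indicator {0..} x"
        by (auto simp: indicator_def mult.assoc[symmetric])
    qed
    also have "\<dots> \<le> ennreal (T / c)" by (rule Tc) (simp add: mult_right_mono)
    finally show "(\<integral>\<^sup>+u\<in>{0..}. a u \<partial>lborel) \<le> ennreal (T / c)" .
  qed measurable
  have unit_le: "ennreal (exp (- lam)) * green 1 q n u \<le> \<phi> (u + c)"
    unfolding \<phi>_def
  proof (rule INF_greatest)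
    fix m
    have "ennreal (exp (- lam)) * green 1 q n u \<le> A m (u + c)"
      unfolding A_def
    proof (rule window_mean_ge)
      show "0 < c * h m" using c_pos h_pos by simp
      fix y assume y: "u + c \<le> y" "y \<le> u + c + c * h m"
      have "c * h m \<le> c * 1" using c_pos by (intro mult_left_mono) (auto simp: h_def)
      then have "y \<le> u + 2 * c" using y by simp
      from green_unit_le_fine[OF u _ y(1) this q anti, of "Suc m" n]
      show "ennreal (exp (- lam)) * green 1 q n u \<le> green (h m) (\<lambda>x. ennreal (h m) * q' x) (n * Suc m) y"
        by (simp only: h_def q'_def zero_less_Suc)
    qed
    also have "\<dots> \<le> S m (u + c)" unfolding S_def by (rule SUP_upper) simp
    finally show "ennreal (exp (- lam)) * green 1 q n u \<le> S m (u + c)" .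
  qed
  have "green 1 q n u = ennreal (exp lam) * (ennreal (exp (- lam)) * green 1 q n u)"
    by (simp add: mult.assoc[symmetric] ennreal_mult[symmetric] exp_minus)
  also have "\<dots> \<le> ennreal (exp lam) * (ennreal (exp (- R * (u + c))) * ((1 + ennreal H) * ennreal (T / c)))"
    using u c_pos by (intro mult_left_mono order_trans[OF unit_le] \<phi>_bound) auto
  also have "\<dots> = ennreal (exp lam * exp (- R * (u + c)) * ((1 + H) * T / c))"
  proof -
    have "1 + ennreal H = ennreal (1 + H)" using ennreal_plus[of 1 H] td.h_nonneg by simp
    moreover have "0 \<le> 1 + H" using td.h_nonneg by simp
    ultimately have "(1 + ennreal H) * ennreal (T / c) = ennreal ((1 + H) * (T / c))" by (simp only: ennreal_mult')
    then show ?thesis by (simp only: times_divide_eq_right[symmetric] mult.assoc ennreal_mult'[OF exp_ge_zero])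
  qed
  finally show ?thesis .
qed

end

section \<open>Exponential moments of the claims of a unit interval\<close>

text \<open>
  The constants below are given as functions of bounds on the parameters, so that they visibly do
  not depend on the loading.
\<close>

definition claim_weight_bound :: "real \<Rightarrow> real \<Rightarrow> real \<Rightarrow> nat \<Rightarrow> real" where
  "claim_weight_bound lam c B k = c / lam * 2 ^ k * (2 + B)"

definition cell_weight_bound :: "real \<Rightarrow> real \<Rightarrow> real \<Rightarrow> real \<Rightarrow> nat \<Rightarrow> real" where
  "cell_weight_bound lam c R B k = claim_weight_bound lam c B k
     * exp (lam * (2 * (1 + (real k + R) * claim_weight_bound lam c B k) - 1))"

definition power_exp :: "nat \<Rightarrow> real \<Rightarrow> real \<Rightarrow> real" where
  "power_exp k R x = (1 + x) ^ k * exp (R * x)"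

definition power_exp_integral :: "nat \<Rightarrow> real \<Rightarrow> real \<Rightarrow> ennreal" where
  "power_exp_integral k R z = (\<integral>\<^sup>+x\<in>{0..<z}. ennreal (power_exp k R x) \<partial>lborel)"

lemma power_exp_measurable [measurable]: "power_exp k R \<in> borel_measurable borel"
  unfolding power_exp_def[abs_def] by measurable

lemma power_exp_integral_measurable [measurable]: "power_exp_integral k R \<in> borel_measurable borel"
proof -
  have "(\<lambda>z. \<integral>\<^sup>+x. ennreal (power_exp k R x) * (if 0 \<le> x \<and> x < z then 1 else 0) \<partial>lborel) \<in> borel_measurable borel"
    by measurable
  also have "(\<lambda>z. \<integral>\<^sup>+x. ennreal (power_exp k R x) * (if 0 \<le> x \<and> x < z then 1 else 0) \<partial>lborel) = power_exp_integral k R"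
    unfolding power_exp_integral_def by (intro ext nn_integral_cong) (auto simp: indicator_def)
  finally show ?thesis .
qed

lemma power_exp_ge_1: "0 \<le> x \<Longrightarrow> 0 \<le> R \<Longrightarrow> 1 \<le> power_exp k R x"
  unfolding power_exp_def using mult_mono[of 1 "(1 + x) ^ k" 1 "exp (R * x)"] by (simp add: one_le_power)

lemma power_exp_mono:
  assumes "0 \<le> x" "x \<le> y" "0 \<le> R" "R \<le> R'"
  shows "power_exp k R x \<le> power_exp k R' y"
proof -
  have "R * x \<le> R' * y" using assms by (intro mult_mono) auto
  then show ?thesis unfolding power_exp_def using assms by (intro mult_mono power_mono) auto
qed

lemma power_exp_add:
  assumes "0 \<le> x" "0 \<le> y"
  shows "power_exp k R (x + y) \<le> power_exp k R x * power_exp k R y"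
proof -
  have e: "exp (R * (x + y)) = exp (R * x) * exp (R * y)" by (simp only: distrib_left exp_add)
  have "(1 + (x + y)) ^ k \<le> ((1 + x) * (1 + y)) ^ k"
    using assms by (intro power_mono) (auto simp: algebra_simps)
  then have "(1 + (x + y)) ^ k * exp (R * (x + y)) \<le> ((1 + x) ^ k * (1 + y) ^ k) * exp (R * (x + y))"
    unfolding power_mult_distrib by (rule mult_right_mono) simp
  then show ?thesis unfolding power_exp_def e by (simp only: mult_ac)
qed

text \<open>
  The logarithmic derivative of \<open>power_exp k R\<close> on \<open>[0, \<infinity>)\<close> is at most \<open>k + R\<close>.
\<close>

lemma power_exp_le_integral:
  assumes z: "0 \<le> z" and R: "0 \<le> R"
  shows "ennreal (power_exp k R z) \<le> 1 + ennreal (real k + R) * power_exp_integral k R z"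
proof -
  let ?f = "\<lambda>x. real k * (1 + x) ^ (k - 1) * exp (R * x) + R * exp (R * x) * (1 + x) ^ k"
  have f0: "0 \<le> ?f x" if "0 \<le> x" for x using that R by simp
  have f_le: "?f x \<le> (real k + R) * power_exp k R x" if x: "0 \<le> x" for x
  proof -
    have "(1 + x) ^ (k - 1) \<le> (1 + x) ^ k" using x by (intro power_increasing) auto
    then have "real k * (1 + x) ^ (k - 1) * exp (R * x) \<le> real k * (1 + x) ^ k * exp (R * x)"
      by (intro mult_right_mono mult_left_mono) auto
    then show ?thesis by (simp add: power_exp_def algebra_simps)
  qed
  have der: "(power_exp k R has_real_derivative ?f x) (at x)" for x
  proof -
    have d1: "((\<lambda>x. (1 + x) ^ k) has_real_derivative real k * (1 + x) ^ (k - 1)) (at x)"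
      by (auto intro!: derivative_eq_intros)
    have d2: "((\<lambda>x. exp (R * x)) has_real_derivative R * exp (R * x)) (at x)"
      by (auto intro!: derivative_eq_intros)
    show ?thesis unfolding power_exp_def[abs_def] using DERIV_mult[OF d1 d2] .
  qed
  have "(\<integral>\<^sup>+x\<in>{0..z}. ennreal (?f x) \<partial>lborel) = ennreal (power_exp k R z - power_exp k R 0)"
  proof (rule nn_integral_FTC_Icc)
    show "?f \<in> borel_measurable borel" by measurable
  qed (use der f0 z in auto)
  then have "ennreal (power_exp k R z - power_exp k R 0) = (\<integral>\<^sup>+x\<in>{0..z}. ennreal (?f x) \<partial>lborel)" ..
  also have "\<dots> \<le> (\<integral>\<^sup>+x. ennreal (real k + R) * (ennreal (power_exp k R x) * indicator {0..<z} x) \<partial>lborel)"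
  proof (rule nn_integral_mono_AE)
    show "AE x in lborel. ennreal (?f x) * indicator {0..z} x
        \<le> ennreal (real k + R) * (ennreal (power_exp k R x) * indicator {0..<z} x)"
      using AE_lborel_singleton[of z]
    proof eventually_elim
      case (elim x)
      have "ennreal (?f x) \<le> ennreal (real k + R) * ennreal (power_exp k R x)" if "0 \<le> x"
        using f_le[OF that] R by (subst ennreal_mult'[symmetric]) (auto intro: ennreal_leI)
      then show ?case using elim by (auto simp: indicator_def)
    qed
  qed
  also have "\<dots> = ennreal (real k + R) * power_exp_integral k R z"
    unfolding power_exp_integral_def by (rule nn_integral_cmult) measurable
  finally have le: "ennreal (power_exp k R z - power_exp k R 0) \<le> ennreal (real k + R) * power_exp_integral k R z" .
  have "ennreal (power_exp k R z) = ennreal (1 + (power_exp k R z - 1))" by simp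
  also have "\<dots> = ennreal 1 + ennreal (power_exp k R z - 1)"
    using power_exp_ge_1[OF z R, of k] by (intro ennreal_plus) auto
  also have "\<dots> \<le> 1 + ennreal (real k + R) * power_exp_integral k R z"
    using le by (simp add: power_exp_def)
  finally show ?thesis .
qed

text \<open>
  Split at \<open>s\<close> and use submultiplicativity beyond.
\<close>

lemma power_exp_integral_add:
  assumes s: "0 \<le> s" and z: "0 \<le> z"
  shows "power_exp_integral k R (s + z)
    \<le> power_exp_integral k R s + ennreal (power_exp k R s) * power_exp_integral k R z"
proof -
  let ?w = "\<lambda>x. ennreal (power_exp k R x)"
  have "power_exp_integral k R (s + z)
      = (\<integral>\<^sup>+x. ?w x * indicator {0..<s} x + ?w x * indicator {s..<s + z} x \<partial>lborel)"
    unfolding power_exp_integral_def using s z by (intro nn_integral_cong) (auto simp: indicator_def)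
  also have "\<dots> = power_exp_integral k R s + (\<integral>\<^sup>+x. ?w x * indicator {s..<s + z} x \<partial>lborel)"
    unfolding power_exp_integral_def by (rule nn_integral_add) measurable
  also have "(\<integral>\<^sup>+x. ?w x * indicator {s..<s + z} x \<partial>lborel) = (\<integral>\<^sup>+x. ?w (s + 1 * x) * indicator {s..<s + z} (s + 1 * x) \<partial>lborel)"
    by (subst nn_integral_real_affine[where c=1 and t=s]) auto
  also have "\<dots> \<le> (\<integral>\<^sup>+x. ?w s * (?w x * indicator {0..<z} x) \<partial>lborel)"
  proof (rule nn_integral_mono)
    fix x
    have "?w (s + x) \<le> ?w s * ?w x" if "0 \<le> x"
      using power_exp_add[OF s that, of k R] s
      by (subst ennreal_mult'[symmetric]) (auto intro!: ennreal_leI simp: power_exp_def)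
    then show "?w (s + 1 * x) * indicator {s..<s + z} (s + 1 * x) \<le> ?w s * (?w x * indicator {0..<z} x)"
      by (auto simp: indicator_def)
  qed
  also have "\<dots> = ?w s * power_exp_integral k R z"
    unfolding power_exp_integral_def by (rule nn_integral_cmult) measurable
  finally show ?thesis by (simp add: add_left_mono)
qed

lemma power_exp_integral_le:
  assumes "0 \<le> z" "0 \<le> R"
  shows "power_exp_integral k R z \<le> ennreal (z * power_exp k R z)"
proof -
  have "power_exp_integral k R z \<le> (\<integral>\<^sup>+x. ennreal (power_exp k R z) * indicator {0..<z} x \<partial>lborel)"
    unfolding power_exp_integral_def using assms
    by (intro nn_integral_mono) (auto simp: indicator_def intro!: ennreal_leI power_exp_mono)
  also have "\<dots> = ennreal (power_exp k R z) * ennreal z"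
    using assms by (subst nn_integral_cmult_indicator) auto
  also have "\<dots> = ennreal (z * power_exp k R z)"
    using assms by (subst ennreal_mult'[symmetric]) (auto simp: power_exp_def mult.commute)
  finally show ?thesis .
qed

text \<open>
  The integrand increases, so its integral over \<open>[0, y)\<close> is at most twice that over the upper half, where \<open>y\<close> is at
  most \<open>2 x\<close> and the factor \<open>y ^ j\<close> can be moved inside.
\<close>

lemma dyadic_weight_bound:
  assumes y: "0 \<le> y" and R: "0 \<le> R" and j: "Suc j \<le> k"
  shows "ennreal (y ^ j) * (\<integral>\<^sup>+x\<in>{0..<y}. ennreal (power_exp 1 R x) \<partial>lborel)
    \<le> ennreal (2 ^ Suc j) * power_exp_integral k R y"
proof -
  let ?g = "\<lambda>x. ennreal (y ^ j) * (ennreal (power_exp 1 R x) * indicator {0..<y} x)"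
  have "ennreal (y ^ j) * (\<integral>\<^sup>+x\<in>{0..<y}. ennreal (power_exp 1 R x) \<partial>lborel) = (\<integral>\<^sup>+x. ?g x \<partial>lborel)"
    by (rule nn_integral_cmult[symmetric]) measurable
  also have "\<dots> = ennreal 2 * (\<integral>\<^sup>+t. ?g (- y + 2 * t) \<partial>lborel)"
    by (subst nn_integral_real_affine[where c=2 and t="- y"]) auto
  also have "\<dots> \<le> ennreal 2 * (\<integral>\<^sup>+t. ennreal (2 ^ j) * (ennreal (power_exp k R t) * indicator {0..<y} t) \<partial>lborel)"
  proof (intro mult_left_mono nn_integral_mono)
    fix t
    have "ennreal (y ^ j) * ennreal (power_exp 1 R (- y + 2 * t)) \<le> ennreal (2 ^ j) * ennreal (power_exp k R t)"
      if t: "0 \<le> - y + 2 * t" "- y + 2 * t < y"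
    proof -
      have t0: "0 \<le> t" using t y by simp
      have "y ^ j \<le> (2 * t) ^ j" using t y by (intro power_mono) auto
      also have "\<dots> \<le> 2 ^ j * (1 + t) ^ j"
        using t0 by (simp only: power_mult_distrib) (intro mult_left_mono power_mono, auto)
      finally have "y ^ j * power_exp 1 R (- y + 2 * t) \<le> 2 ^ j * (1 + t) ^ j * power_exp 1 R t"
        using t t0 R by (intro mult_mono power_exp_mono) (auto simp: power_exp_def)
      also have "\<dots> = 2 ^ j * ((1 + t) ^ Suc j * exp (R * t))" by (simp add: power_exp_def mult_ac)
      also have "\<dots> \<le> 2 ^ j * power_exp k R t"
        unfolding power_exp_def using t0 j by (intro mult_left_mono mult_right_mono power_increasing) auto
      finally show ?thesis
        using y by (simp only: ennreal_mult'[symmetric] zero_le_power zero_le_numeral ennreal_leI)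
    qed
    then show "?g (- y + 2 * t) \<le> ennreal (2 ^ j) * (ennreal (power_exp k R t) * indicator {0..<y} t)"
      using y by (auto simp: indicator_def)
  qed simp
  also have "\<dots> = ennreal (2 ^ Suc j) * power_exp_integral k R y"
    unfolding power_exp_integral_def
    by (subst nn_integral_cmult) (simp_all add: mult.assoc[symmetric] ennreal_mult')
  finally show ?thesis .
qed

text \<open>
  After a shift by \<open>d\<close> the spare power of \<open>1 + d + x\<close> yields the factor \<open>1 / d\<close>: large deficits are rare.
\<close>

lemma shifted_weight_bound:
  assumes d: "0 < d" and R: "0 \<le> R" and k: "2 \<le> k"
  shows "(\<integral>\<^sup>+x\<in>{0..<s - d}. ennreal (power_exp 1 R x) \<partial>lborel) \<le> ennreal (1 / d) * power_exp_integral k R s"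
proof -
  let ?w = "\<lambda>t. ennreal (1 / d) * (ennreal (power_exp k R t) * indicator {0..<s} t)"
  have "(\<integral>\<^sup>+x\<in>{0..<s - d}. ennreal (power_exp 1 R x) \<partial>lborel) \<le> (\<integral>\<^sup>+x. ?w (d + 1 * x) \<partial>lborel)"
  proof (rule nn_integral_mono)
    fix x
    have "ennreal (power_exp 1 R x) \<le> ennreal (1 / d) * ennreal (power_exp k R (d + x))" if x: "0 \<le> x"
    proof -
      have "d * (1 + x) \<le> (1 + (d + x)) * (1 + (d + x))" using d x by (intro mult_mono) auto
      also have "\<dots> = (1 + (d + x)) ^ 2" by (simp add: power2_eq_square)
      also have "\<dots> \<le> (1 + (d + x)) ^ k" using d x k by (intro power_increasing) auto
      finally have "d * (1 + x) * exp (R * x) \<le> (1 + (d + x)) ^ k * exp (R * (d + x))"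
        using d x R by (intro mult_mono) (auto simp: mult_left_mono)
      then have "power_exp 1 R x \<le> 1 / d * power_exp k R (d + x)"
        using d by (simp add: power_exp_def field_simps)
      then show ?thesis using d by (subst ennreal_mult'[symmetric]) (auto intro: ennreal_leI)
    qed
    then show "ennreal (power_exp 1 R x) * indicator {0..<s - d} x \<le> ?w (d + 1 * x)"
      using d by (auto simp: indicator_def)
  qed
  also have "\<dots> = (\<integral>\<^sup>+x. ?w x \<partial>lborel)"
    by (subst (2) nn_integral_real_affine[where c=1 and t=d]) auto
  also have "\<dots> = ennreal (1 / d) * power_exp_integral k R s"
    unfolding power_exp_integral_def by (rule nn_integral_cmult) measurable
  finally show ?thesis .
qed

context lundberg_model
begin

text \<open>
  By Tonelli the mean of the integrated weight is an integral of the weight against the claim tail, that is,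
  against the ladder density, where the moment assumption applies.
\<close>

lemma claim_weight:
  assumes B: "exp_moment M c lam Z R k \<le> ennreal B" "0 \<le> B" and c1: "c \<le> c1"
  shows "(\<integral>\<^sup>+z. power_exp_integral k R z \<partial>claim_law) \<le> ennreal (claim_weight_bound lam c1 B k)"
proof -
  let ?t = "\<lambda>x. ennreal (exp (R * x)) * ladder_density x"
  have "(\<integral>\<^sup>+z. power_exp_integral k R z \<partial>claim_law)
      = (\<integral>\<^sup>+x\<in>{0..}. ennreal (power_exp k R x) * ennreal (claim_tail x) \<partial>lborel)"
    unfolding power_exp_integral_def by (rule nn_integral_claim_tail[symmetric]) measurable
  also have "\<dots> \<le> (\<integral>\<^sup>+x. ennreal (c / lam * 2 ^ k) * (?t x * indicator {0..} x + ennreal (x ^ k) * ?t x * indicator {0..} x) \<partial>lborel)"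
  proof (rule nn_integral_mono)
    fix x
    have "ennreal (power_exp k R x) * ennreal (claim_tail x) \<le> ennreal (c / lam * 2 ^ k) * (?t x + ennreal (x ^ k) * ?t x)"
      if x: "0 \<le> x"
    proof -
      define g where "g = exp (R * x) * (lam / c * claim_tail x)"
      have g0: "0 \<le> g" using lam_pos c_pos claim_tail_pos[of x] by (simp add: g_def less_imp_le)
      have "(1 + x) ^ k \<le> (2 * max 1 x) ^ k" using x by (intro power_mono) auto
      also have "\<dots> = 2 ^ k * max 1 x ^ k" by (rule power_mult_distrib)
      also have "max 1 x ^ k \<le> 1 + x ^ k" using x by (simp add: max_def)
      finally have "(1 + x) ^ k * (c / lam * g) \<le> 2 ^ k * (1 + x ^ k) * (c / lam * g)"
        using c_pos lam_pos by (intro mult_right_mono mult_nonneg_nonneg[OF _ g0]) auto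
      also have "\<dots> = c / lam * 2 ^ k * (g + x ^ k * g)" by (simp add: algebra_simps add_divide_distrib)
      finally have "(1 + x) ^ k * (c / lam * g) \<le> c / lam * 2 ^ k * (g + x ^ k * g)" .
      moreover have "c / lam * g = exp (R * x) * claim_tail x" using c_pos lam_pos by (simp add: g_def)
      ultimately have "power_exp k R x * claim_tail x \<le> c / lam * 2 ^ k * (g + x ^ k * g)"
        by (simp only: power_exp_def mult.assoc)
      moreover have "ennreal (c / lam * 2 ^ k) * (?t x + ennreal (x ^ k) * ?t x) = ennreal (c / lam * 2 ^ k * (g + x ^ k * g))"
      proof -
        have t: "?t x = ennreal g" by (simp only: ladder_density_def g_def ennreal_mult'[OF exp_ge_zero])
        have "ennreal (g + x ^ k * g) = ennreal g + ennreal (x ^ k) * ennreal g"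
          using g0 x by (subst ennreal_plus) (auto simp: ennreal_mult')
        moreover have "0 \<le> c / lam * 2 ^ k" using c_pos lam_pos by simp
        ultimately show ?thesis unfolding t by (simp only: ennreal_mult')
      qed
      moreover have "ennreal (power_exp k R x) * ennreal (claim_tail x) = ennreal (power_exp k R x * claim_tail x)"
        using x by (simp add: ennreal_mult' power_exp_def)
      ultimately show ?thesis by (simp only: ennreal_leI)
    qed
    then show "ennreal (power_exp k R x) * ennreal (claim_tail x) * indicator {0..} x
       \<le> ennreal (c / lam * 2 ^ k) * (?t x * indicator {0..} x + ennreal (x ^ k) * ?t x * indicator {0..} x)"
      by (auto simp: indicator_def)
  qed
  also have "\<dots> = ennreal (c / lam * 2 ^ k) * (1 + (\<integral>\<^sup>+x\<in>{0..}. ennreal (x ^ k) * ?t x \<partial>lborel))"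
    by (subst nn_integral_cmult, measurable, subst nn_integral_add, measurable) (simp only: tilted_ladder_mass)
  also have "\<dots> \<le> ennreal (c / lam * 2 ^ k) * (1 + ennreal (1 + B))"
    by (intro mult_left_mono add_left_mono ladder_moment[OF B]) auto
  also have "\<dots> = ennreal (c / lam * 2 ^ k * (2 + B))"
  proof -
    have "1 + ennreal (1 + B) = ennreal (2 + B)"
      using ennreal_plus[of 1 "1 + B"] B(2) by simp
    moreover have "0 \<le> c / lam * 2 ^ k" using c_pos lam_pos by simp
    ultimately show ?thesis by (simp only: ennreal_mult')
  qed
  also have "\<dots> \<le> ennreal (claim_weight_bound lam c1 B k)"
    unfolding claim_weight_bound_def using c1 lam_pos B(2)
    by (intro ennreal_leI mult_right_mono divide_right_mono) auto
  finally show ?thesis .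
qed

text \<open>
  Adding one claim costs a bounded factor, by submultiplicativity of the weight. The growth is geometric in the number of
  claims, which is harmless for a Poisson number.
\<close>

lemma sum_weight:
  assumes B: "exp_moment M c lam Z R k \<le> ennreal B" "0 \<le> B" and c1: "c \<le> c1" and R1: "R \<le> R1"
  defines "L \<equiv> claim_weight_bound lam c1 B k"
  shows "(\<integral>\<^sup>+z. power_exp_integral k R (\<Sum>m<n. z m) \<partial>claims) \<le> ennreal (L * (2 * (1 + (real k + R1) * L)) ^ n)"
proof -
  have L0: "0 \<le> L" unfolding L_def claim_weight_bound_def using c1 c_pos lam_pos B(2) by simp
  let ?r = "real k + R1"
  have r: "0 \<le> ?r" using R1 R_pos by simp
  define b where "b = 1 + ?r * L"
  have b: "1 \<le> b" using r L0 by (simp add: b_def)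
  have "(\<integral>\<^sup>+z. power_exp_integral k R (\<Sum>m<n. z m) \<partial>claims) \<le> ennreal (L * (2 * b) ^ n)"
  proof (induction n)
    case 0
    have "power_exp_integral k R 0 = 0" by (simp add: power_exp_integral_def)
    then show ?case by simp
  next
    case (Suc n)
    let ?P = "power_exp_integral k R" and ?S = "\<lambda>z. \<Sum>m<n. z m :: real"
    let ?W = "\<lambda>z. 1 + ennreal ?r * ?P (?S z)"
    let ?G = "L * (2 * b) ^ n"
    have G0: "0 \<le> ?G" using L0 b by simp
    have W: "(\<integral>\<^sup>+z. ?W z \<partial>claims) \<le> ennreal (1 + ?r * ?G)"
    proof -
      have "(\<integral>\<^sup>+z. ?W z \<partial>claims) = 1 + ennreal ?r * (\<integral>\<^sup>+z. ?P (?S z) \<partial>claims)"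
      proof -
        have "(\<integral>\<^sup>+z. ?W z \<partial>claims) = (\<integral>\<^sup>+z. 1 \<partial>claims) + (\<integral>\<^sup>+z. ennreal ?r * ?P (?S z) \<partial>claims)"
          by (rule nn_integral_add) measurable
        moreover have "(\<integral>\<^sup>+z. ennreal ?r * ?P (?S z) \<partial>claims) = ennreal ?r * (\<integral>\<^sup>+z. ?P (?S z) \<partial>claims)"
          by (rule nn_integral_cmult) measurable
        ultimately show ?thesis by (simp add: claims.P.emeasure_space_1)
      qed
      also have "\<dots> \<le> 1 + ennreal ?r * ennreal ?G" by (intro add_left_mono mult_left_mono Suc.IH) simp
      also have "\<dots> = ennreal (1 + ?r * ?G)"
        using r G0 by (subst ennreal_plus) (auto simp: ennreal_mult)
      finally show ?thesis .
    qed
    have "(\<integral>\<^sup>+z. ?P (\<Sum>m<Suc n. z m) \<partial>claims) = (\<integral>\<^sup>+s. \<integral>\<^sup>+z. ?P (\<Sum>m<Suc n. case_nat s z m) \<partial>claims \<partial>claim_law)"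
      by (rule claims.nn_integral_case_nat) measurable
    also have "\<dots> \<le> (\<integral>\<^sup>+s. \<integral>\<^sup>+z. ?P (?S z) + ?W z * ?P s \<partial>claims \<partial>claim_law)"
    proof (rule nn_integral_mono_AE, use claim_pos in eventually_elim)
      fix s :: real assume s: "0 < s"
      show "(\<integral>\<^sup>+z. ?P (\<Sum>m<Suc n. case_nat s z m) \<partial>claims) \<le> (\<integral>\<^sup>+z. ?P (?S z) + ?W z * ?P s \<partial>claims)"
      proof (rule nn_integral_mono_AE, use claims_pos in eventually_elim)
        fix z :: "nat \<Rightarrow> real" assume "\<forall>m. 0 < z m"
        then have S: "0 \<le> ?S z" by (simp add: less_imp_le sum_nonneg)
        have "(\<Sum>m<Suc n. case_nat s z m) = ?S z + s" by (simp only: sum.lessThan_Suc_shift old.nat.case add.commute)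
        then have "?P (\<Sum>m<Suc n. case_nat s z m) = ?P (?S z + s)" by (simp only:)
        also have "\<dots> \<le> ?P (?S z) + ennreal (power_exp k R (?S z)) * ?P s"
          by (rule power_exp_integral_add[OF S less_imp_le[OF s]])
        also have "\<dots> \<le> ?P (?S z) + ?W z * ?P s"
        proof (intro add_left_mono mult_right_mono)
          have "ennreal (power_exp k R (?S z)) \<le> 1 + ennreal (real k + R) * ?P (?S z)"
            by (rule power_exp_le_integral[OF S less_imp_le[OF R_pos]])
          also have "\<dots> \<le> ?W z" using R1 by (intro add_left_mono mult_right_mono ennreal_leI) auto
          finally show "ennreal (power_exp k R (?S z)) \<le> ?W z" .
        qed simp
        finally show "?P (\<Sum>m<Suc n. case_nat s z m) \<le> ?P (?S z) + ?W z * ?P s" .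
      qed
    qed
    also have "\<dots> = (\<integral>\<^sup>+s. (\<integral>\<^sup>+z. ?P (?S z) \<partial>claims) + (\<integral>\<^sup>+z. ?W z \<partial>claims) * ?P s \<partial>claim_law)"
    proof (rule nn_integral_cong)
      fix s
      have "(\<integral>\<^sup>+z. ?P (?S z) + ?W z * ?P s \<partial>claims) = (\<integral>\<^sup>+z. ?P (?S z) \<partial>claims) + (\<integral>\<^sup>+z. ?W z * ?P s \<partial>claims)"
        by (rule nn_integral_add) measurable
      moreover have "(\<integral>\<^sup>+z. ?W z * ?P s \<partial>claims) = (\<integral>\<^sup>+z. ?W z \<partial>claims) * ?P s"
        by (rule nn_integral_multc) measurable
      ultimately show "(\<integral>\<^sup>+z. ?P (?S z) + ?W z * ?P s \<partial>claims) = (\<integral>\<^sup>+z. ?P (?S z) \<partial>claims) + (\<integral>\<^sup>+z. ?W z \<partial>claims) * ?P s"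
        by (simp only:)
    qed
    also have "\<dots> = (\<integral>\<^sup>+z. ?P (?S z) \<partial>claims) + (\<integral>\<^sup>+z. ?W z \<partial>claims) * (\<integral>\<^sup>+s. ?P s \<partial>claim_law)"
    proof -
      let ?A = "\<integral>\<^sup>+z. ?P (?S z) \<partial>claims" and ?w = "\<integral>\<^sup>+z. ?W z \<partial>claims"
      have "(\<integral>\<^sup>+s. ?A + ?w * ?P s \<partial>claim_law) = (\<integral>\<^sup>+s. ?A \<partial>claim_law) + (\<integral>\<^sup>+s. ?w * ?P s \<partial>claim_law)"
        by (rule nn_integral_add) measurable
      moreover have "(\<integral>\<^sup>+s. ?w * ?P s \<partial>claim_law) = ?w * (\<integral>\<^sup>+s. ?P s \<partial>claim_law)"
        by (rule nn_integral_cmult) measurable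
      moreover have "(\<integral>\<^sup>+s. ?A \<partial>claim_law) = ?A" using claim.emeasure_space_1 by simp
      ultimately show ?thesis by (simp only:)
    qed
    also have "\<dots> \<le> ennreal ?G + ennreal (1 + ?r * ?G) * ennreal L"
      unfolding L_def by (intro add_mono mult_mono Suc.IH[unfolded L_def] W[unfolded L_def] claim_weight[OF B c1]) auto
    also have "\<dots> = ennreal (?G + (1 + ?r * ?G) * L)"
      using G0 r L0 by (subst ennreal_plus) (auto simp: ennreal_mult)
    also have "?G + (1 + ?r * ?G) * L \<le> L * (2 * b) ^ Suc n"
    proof -
      have "1 \<le> (2 * b) ^ n" using b by (intro one_le_power) simp
      then have "L * 1 \<le> ?G" using L0 by (intro mult_left_mono)
      moreover have "1 * ?G \<le> b * ?G" using b G0 by (intro mult_right_mono)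
      moreover have "?G + (1 + ?r * ?G) * L = L + b * ?G" by (simp add: b_def algebra_simps)
      moreover have "L * (2 * b) ^ Suc n = b * ?G + b * ?G" by (simp add: algebra_simps)
      ultimately show ?thesis by linarith
    qed
    finally show ?case by (simp add: ennreal_leI)
  qed
  then show ?thesis by (simp only: b_def)
qed

lemma cell_weight:
  assumes B: "exp_moment M c lam Z R k \<le> ennreal B" "0 \<le> B" and c1: "c \<le> c1" and R1: "R \<le> R1"
  shows "(\<integral>\<^sup>+s. power_exp_integral k R s \<partial>cell_claims 1) \<le> ennreal (cell_weight_bound lam c1 R1 B k)"
proof -
  define L where "L = claim_weight_bound lam c1 B k"
  have L0: "0 \<le> L" unfolding L_def claim_weight_bound_def using c1 c_pos lam_pos B(2) by simp
  let ?b = "2 * (1 + (real k + R1) * L)"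
  have b: "0 \<le> ?b" using R1 R_pos L0 by simp
  have "(\<integral>\<^sup>+s. power_exp_integral k R s \<partial>cell_claims 1)
      = (\<integral>\<^sup>+n. (\<integral>\<^sup>+z. power_exp_integral k R (\<Sum>m<n. z m) \<partial>claims) \<partial>measure_pmf (cell_count 1))"
    by (rule nn_integral_cell_claims) measurable
  also have "\<dots> \<le> (\<integral>\<^sup>+n. ennreal L * ennreal ?b ^ n \<partial>measure_pmf (cell_count 1))"
  proof (rule nn_integral_mono)
    fix n
    show "(\<integral>\<^sup>+z. power_exp_integral k R (\<Sum>m<n. z m) \<partial>claims) \<le> ennreal L * ennreal ?b ^ n"
      using sum_weight[OF B c1 R1, of n] unfolding L_def[symmetric] ennreal_mult[OF L0 zero_le_power[OF b]] ennreal_power[OF b] .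
  qed
  also have "\<dots> = ennreal L * ennreal (exp (lam * 1 * (?b - 1)))"
    using lam_pos b by (subst nn_integral_cmult) (simp_all only: nn_integral_poisson_exp mult_1_right, simp_all)
  also have "\<dots> = ennreal (cell_weight_bound lam c1 R1 B k)"
    using L0 unfolding cell_weight_bound_def L_def[symmetric] by (simp only: ennreal_mult' mult_1_right)
  finally show ?thesis .
qed

end

section \<open>The numerator and the mean of the reserve\<close>

definition overshoot_weight_bound :: "real \<Rightarrow> real \<Rightarrow> real \<Rightarrow> real \<Rightarrow> nat \<Rightarrow> real" where
  "overshoot_weight_bound lam c R B k
     = 2 ^ k * power_exp k R (3 * c) * (3 * c + cell_weight_bound lam c R B k)"

context risk_process
begin

lemma green_add:
  assumes [measurable]: "F \<in> borel_measurable borel" "G \<in> borel_measurable borel"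
  shows "green h (\<lambda>x. F x + G x) n u = green h F n u + green h G n u"
proof (induction n arbitrary: u)
  case (Suc n)
  have "walk_step h (green h (\<lambda>x. F x + G x) n) u
      = (\<integral>\<^sup>+s. (if u + c * h - s < 0 then 0 else green h F n (u + c * h - s))
          + (if u + c * h - s < 0 then 0 else green h G n (u + c * h - s)) \<partial>cell_claims h)"
    unfolding walk_step_def by (intro nn_integral_cong) (simp add: Suc.IH)
  also have "\<dots> = walk_step h (green h F n) u + walk_step h (green h G n) u"
    unfolding walk_step_def by (rule nn_integral_add) measurable
  finally show ?case by (simp add: add_ac)
qed simp

lemma integral_against_cell_tail:
  assumes [measurable]: "w \<in> borel_measurable borel" "f \<in> borel_measurable borel"
  shows "(\<integral>\<^sup>+x\<in>{0..}. w x * (\<integral>\<^sup>+s. (if x - d < s then f s else 0) \<partial>cell_claims h) \<partial>lborel)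
    = (\<integral>\<^sup>+s. f s * (\<integral>\<^sup>+x\<in>{0..<s + d}. w x \<partial>lborel) \<partial>cell_claims h)"
proof -
  interpret Q: prob_space "cell_claims h" by (rule prob_space_cell_claims)
  interpret P: pair_sigma_finite "cell_claims h" lborel ..
  let ?k = "\<lambda>x s. f s * (w x * (if 0 \<le> x \<and> x - d < s then 1 else 0))"
  have "(\<integral>\<^sup>+x\<in>{0..}. w x * (\<integral>\<^sup>+s. (if x - d < s then f s else 0) \<partial>cell_claims h) \<partial>lborel)
      = (\<integral>\<^sup>+x. \<integral>\<^sup>+s. ?k x s \<partial>cell_claims h \<partial>lborel)"
  proof (rule nn_integral_cong)
    fix x
    have "(\<integral>\<^sup>+s. ?k x s \<partial>cell_claims h) = (\<integral>\<^sup>+s. (w x * indicator {0..} x) * (if x - d < s then f s else 0) \<partial>cell_claims h)"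
      by (intro nn_integral_cong) (auto simp: indicator_def mult.commute)
    also have "\<dots> = (w x * indicator {0..} x) * (\<integral>\<^sup>+s. (if x - d < s then f s else 0) \<partial>cell_claims h)"
      by (rule nn_integral_cmult) measurable
    finally show "w x * (\<integral>\<^sup>+s. (if x - d < s then f s else 0) \<partial>cell_claims h) * indicator {0..} x
      = (\<integral>\<^sup>+s. ?k x s \<partial>cell_claims h)" by (simp only: mult_ac)
  qed
  also have "\<dots> = (\<integral>\<^sup>+s. \<integral>\<^sup>+x. ?k x s \<partial>lborel \<partial>cell_claims h)"
    by (rule P.Fubini') measurable
  also have "\<dots> = (\<integral>\<^sup>+s. f s * (\<integral>\<^sup>+x\<in>{0..<s + d}. w x \<partial>lborel) \<partial>cell_claims h)"
  proof (rule nn_integral_cong)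
    fix s
    have "(\<integral>\<^sup>+x. ?k x s \<partial>lborel) = f s * (\<integral>\<^sup>+x. w x * (if 0 \<le> x \<and> x - d < s then 1 else 0) \<partial>lborel)"
      by (rule nn_integral_cmult) measurable
    also have "(\<integral>\<^sup>+x. w x * (if 0 \<le> x \<and> x - d < s then 1 else 0) \<partial>lborel) = (\<integral>\<^sup>+x\<in>{0..<s + d}. w x \<partial>lborel)"
      by (intro nn_integral_cong) (auto simp: indicator_def)
    finally show "(\<integral>\<^sup>+x. ?k x s \<partial>lborel) = f s * (\<integral>\<^sup>+x\<in>{0..<s + d}. w x \<partial>lborel)" .
  qed
  finally show ?thesis .
qed

lemma overshoot_mean_measurable [measurable]: "overshoot_mean j \<in> borel_measurable borel"
proof -
  interpret Q: prob_space "cell_claims 1" by (rule prob_space_cell_claims)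
  show ?thesis unfolding overshoot_mean_def[abs_def] by measurable
qed

lemma overshoot_mean_antimono: "x \<le> y \<Longrightarrow> overshoot_mean j y \<le> overshoot_mean j x"
  unfolding overshoot_mean_def by (intro nn_integral_mono) auto

text \<open>
  The set integral in the moment of the surplus is evaluated as a nonnegative one. For measurability the power is taken of the positive
  part, which is a continuous function of the surplus and agrees with it on the event of ruin.
\<close>

lemma moment_mass_integral:
  assumes u: "0 \<le> u" and fin: "moment_mass j u < \<infinity>"
  shows "surplus_moment M (surplus u) j = enn2real (moment_mass j u) / measure M (ruined u)"
proof -
  let ?X = "surplus_before_ruin (surplus u)" and ?p = "\<lambda>x :: real. max 0 x ^ j"
  have "continuous_on UNIV ?p" by (intro continuous_intros)
  note meas [measurable] = ruin_penalty_measurable[OF this u]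
  have pen: "ruin_penalty ?p u \<omega> = ennreal (?X \<omega> ^ j) * indicator (ruined u) \<omega>" for \<omega>
  proof (cases "\<omega> \<in> ruined u")
    case True
    then have "max 0 (?X \<omega>) = ?X \<omega>" using surplus_before_ruin_nonneg[OF True u] by simp
    then show ?thesis by (simp add: ruin_penalty_def)
  qed (simp add: ruin_penalty_def)
  have eq: "indicator (ruined u) \<omega> *\<^sub>R ?X \<omega> ^ j = enn2real (ruin_penalty ?p u \<omega>)" for \<omega>
    unfolding pen using surplus_before_ruin_nonneg[OF _ u, of \<omega>] by (cases "\<omega> \<in> ruined u") auto
  have pen_finite: "ennreal (enn2real (ruin_penalty ?p u \<omega>)) = ruin_penalty ?p u \<omega>" for \<omega>
    unfolding pen by (intro ennreal_enn2real) (auto simp: indicator_def)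
  have "(LINT \<omega>:ruined u|M. ?X \<omega> ^ j) = (\<integral>\<omega>. enn2real (ruin_penalty ?p u \<omega>) \<partial>M)"
    unfolding set_lebesgue_integral_def eq ..
  also have "\<dots> = enn2real (\<integral>\<^sup>+\<omega>. ennreal (enn2real (ruin_penalty ?p u \<omega>)) \<partial>M)"
    by (rule integral_eq_nn_integral) (auto intro!: measurable_compose[OF meas])
  also have "(\<integral>\<^sup>+\<omega>. ennreal (enn2real (ruin_penalty ?p u \<omega>)) \<partial>M) = moment_mass j u"
    unfolding pen_finite unfolding pen moment_mass_def ..
  finally show ?thesis by (simp only: surplus_moment_def ruined_def)
qed

end

lemma nn_integral_poisson_mean:
  assumes a: "0 < a"
  shows "(\<integral>\<^sup>+n. of_nat n \<partial>measure_pmf (poisson_pmf a)) = ennreal a"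
proof -
  let ?f = "\<lambda>n. real n * (a ^ n / fact n * exp (- a))"
  have "(\<lambda>n. a * (a ^ n /\<^sub>R fact n * exp (- a))) sums (a * (exp a * exp (- a)))"
    by (intro sums_mult sums_mult2 exp_converges)
  moreover have "?f (Suc n) = a * (a ^ n /\<^sub>R fact n * exp (- a))" for n
  proof -
    have r: "real (Suc n) / fact (Suc n) = 1 / fact n" by (simp add: fact_Suc del: of_nat_Suc)
    have "?f (Suc n) = real (Suc n) / fact (Suc n) * (a ^ Suc n * exp (- a))"
      by (simp only: times_divide_eq_left times_divide_eq_right)
    also have "\<dots> = a * (a ^ n /\<^sub>R fact n * exp (- a))"
      unfolding r by (simp add: divide_inverse mult_ac)
    finally show ?thesis .
  qed
  ultimately have "(\<lambda>n. ?f (Suc n)) sums a" by (simp add: exp_minus)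
  then have sums: "?f sums a" using sums_Suc_iff[of ?f a] by simp
  have "(\<integral>\<^sup>+n. of_nat n \<partial>measure_pmf (poisson_pmf a)) = (\<Sum>n. ennreal (pmf (poisson_pmf a) n) * of_nat n)"
    by (simp add: nn_integral_measure_pmf nn_integral_count_space_nat)
  also have "\<dots> = (\<Sum>n. ennreal (?f n))"
  proof (rule suminf_cong)
    fix n
    have "ennreal (pmf (poisson_pmf a) n) * of_nat n = ennreal (a ^ n / fact n * exp (- a)) * ennreal (real n)"
      using a by (simp add: ennreal_of_nat_eq_real_of_nat)
    also have "\<dots> = ennreal (?f n)"
      using a by (subst ennreal_mult[symmetric]) (auto simp: mult_ac)
    finally show "ennreal (pmf (poisson_pmf a) n) * of_nat n = ennreal (?f n)" .
  qed
  also have "\<dots> = ennreal a" using a by (intro suminf_ennreal_eq sums) auto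
  finally show ?thesis .
qed

context lundberg_model
begin

lemma mean_cell_claims: "(\<integral>\<^sup>+s. ennreal s \<partial>cell_claims 1) = ennreal (lam * claim_moment M Z 1)"
proof -
  let ?m = "ennreal (claim_moment M Z 1)"
  have mean: "(\<integral>\<^sup>+z. ennreal z \<partial>claim_law) = ?m"
  proof -
    have "(\<integral>\<^sup>+z. ennreal z \<partial>claim_law) = (\<integral>\<^sup>+\<omega>. ennreal (Z (Suc 0) \<omega>) \<partial>M)"
      unfolding claim_law_def by (subst nn_integral_distr) auto
    also have "\<dots> = ennreal (\<integral>\<omega>. Z (Suc 0) \<omega> \<partial>M)"
      using first_claim_pos by (intro nn_integral_eq_integral claim_integrable) (auto elim: eventually_mono)
    finally show ?thesis by (simp add: claim_moment_def)
  qed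
  have sum: "(\<integral>\<^sup>+z. ennreal (\<Sum>m<n. z m) \<partial>claims) = of_nat n * ?m" for n
  proof -
    have "(\<integral>\<^sup>+z. ennreal (\<Sum>m<n. z m) \<partial>claims) = (\<integral>\<^sup>+z. (\<Sum>m<n. ennreal (z m)) \<partial>claims)"
      by (rule nn_integral_cong_AE, use claims_pos in eventually_elim)
         (simp add: sum_ennreal less_imp_le)
    also have "\<dots> = (\<Sum>m<n. \<integral>\<^sup>+z. ennreal (z m) \<partial>claims)"
      by (rule nn_integral_sum) measurable
    also have "\<dots> = (\<Sum>m<n. ?m)"
    proof (rule sum.cong)
      fix m :: nat
      have "(\<integral>\<^sup>+z. ennreal (z m) \<partial>claims) = (\<integral>\<^sup>+s. ennreal s \<partial>distr claims claim_law (\<lambda>z. z m))"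
        by (subst nn_integral_distr) auto
      also have "distr claims claim_law (\<lambda>z. z m) = claim_law" by (rule claims.PiM_component) simp
      finally show "(\<integral>\<^sup>+z. ennreal (z m) \<partial>claims) = ?m" by (simp only: mean)
    qed simp
    finally show ?thesis by simp
  qed
  have "(\<integral>\<^sup>+s. ennreal s \<partial>cell_claims 1) = (\<integral>\<^sup>+n. of_nat n * ?m \<partial>measure_pmf (cell_count 1))"
    by (subst nn_integral_cell_claims) (simp_all add: sum)
  also have "\<dots> = (\<integral>\<^sup>+n. of_nat n \<partial>measure_pmf (cell_count 1)) * ?m"
    by (rule nn_integral_multc) simp
  also have "\<dots> = ennreal (lam * claim_moment M Z 1)"
    using lam_pos nn_integral_poisson_mean[of lam] by (simp add: ennreal_mult')
  finally show ?thesis .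
qed

text \<open>
  Obtained from the unit grid: the claims up to time \<open>1\<close> have the law \<open>cell_claims 1\<close>.
\<close>

lemma expected_surplus: "(\<integral>\<omega>. surplus 0 1 \<omega> \<partial>M) = c - lam * claim_moment M Z 1"
proof -
  let ?S = "\<lambda>\<omega>. c - surplus 0 1 \<omega>"
  have [measurable]: "surplus 0 1 \<in> borel_measurable M" by (rule surplus_measurable) simp
  have S: "?S \<omega> = (\<Sum>m<cell_increments 1 \<omega> 0. claim_seq \<omega> m)" if "\<omega> \<in> space M" for \<omega>
    using counting_0[OF that] by (simp add: surplus_eq cell_increments_def)
  have nonneg: "AE \<omega> in M. 0 \<le> ?S \<omega>"
    using AE_positive_claims AE_space
  proof eventually_elim
    case (elim \<omega>)
    then show ?case unfolding S[OF elim(2)]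
      by (intro sum_nonneg) (simp add: positive_claims_def claim_seq_def less_imp_le)
  qed
  let ?f = "\<lambda>(x::real) (\<nu>::nat \<Rightarrow> nat) z. ennreal (\<Sum>m<\<nu> 0. z m)"
  have f: "cell_cost_measurable ?f"
    unfolding cell_cost_measurable_def split_beta' by measurable
  have "(\<integral>\<^sup>+\<omega>. ennreal (?S \<omega>) \<partial>M) = (\<integral>\<^sup>+\<omega>. ?f 0 (cell_increments 1 \<omega>) (claim_seq \<omega>) \<partial>M)"
    by (intro nn_integral_cong) (simp only: S)
  also have "\<dots> = cell_mean 1 ?f 0" by (rule nn_integral_unit_cost[OF f])
  also have "\<dots> = (\<integral>\<^sup>+s. ennreal s \<partial>cell_claims 1)"
    by (rule cell_mean_first_cell[where G="\<lambda>x s. ennreal s"]) measurable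
  finally have nn: "(\<integral>\<^sup>+\<omega>. ennreal (?S \<omega>) \<partial>M) = ennreal (lam * claim_moment M Z 1)"
    by (simp only: mean_cell_claims)
  have int: "integrable M ?S"
    by (rule integrableI_nonneg[OF _ nonneg]) (simp_all only: nn ennreal_less_top infinity_ennreal_def, measurable)
  have "(\<integral>\<omega>. ?S \<omega> \<partial>M) = enn2real (ennreal (lam * claim_moment M Z 1))"
    unfolding nn[symmetric] by (rule integral_eq_nn_integral[OF _ nonneg]) measurable
  also have "\<dots> = lam * claim_moment M Z 1" using lam_pos mean_claim_pos by simp
  finally have "(\<integral>\<omega>. ?S \<omega> \<partial>M) = lam * claim_moment M Z 1" .
  moreover have "(\<integral>\<omega>. surplus 0 1 \<omega> \<partial>M) = (\<integral>\<omega>. c - ?S \<omega> \<partial>M)" by simp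
  moreover have "(\<integral>\<omega>. c - ?S \<omega> \<partial>M) = c - (\<integral>\<omega>. ?S \<omega> \<partial>M)"
    using int by (subst Bochner_Integration.integral_diff) (simp_all add: prob_space)
  ultimately show ?thesis by simp
qed

end

section \<open>Bounds with constants independent of the loading\<close>

locale bounded_lundberg_model = lundberg_model +
  fixes k :: nat and H B c0 c1 R1 :: real
  assumes hazard_bound: "h_I M Z \<le> ennreal H"
    and moment_bound: "exp_moment M c lam Z R k \<le> ennreal B" and B_nonneg: "0 \<le> B" and k_ge: "2 \<le> k"
    and c0_pos: "0 < c0" and c0_le: "c0 \<le> c" and c_le: "c \<le> c1" and R_le: "R \<le> R1"
begin

abbreviation claim_bound :: real where "claim_bound \<equiv> cell_weight_bound lam c1 R1 B k"
abbreviation tilt_cutoff :: real where "tilt_cutoff \<equiv> 2 * (1 + H) * (1 + B)"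

lemma H_nonneg: "0 \<le> H"
  using hazard_bound_pos[OF hazard_bound] mean_claim_pos by (smt (verit) divide_pos_pos)

lemma claim_bound_pos: "0 < claim_bound"
  unfolding cell_weight_bound_def claim_weight_bound_def
  using c_le c_pos lam_pos B_nonneg by (intro mult_pos_pos divide_pos_pos) auto

lemma claim_bound: "(\<integral>\<^sup>+s. power_exp_integral k R s \<partial>cell_claims 1) \<le> ennreal claim_bound"
  by (rule cell_weight[OF moment_bound B_nonneg c_le R_le])

text \<open>
  Lower Lundberg bound, passing from the limit of fine grids to the unit grid at the cost of one \<open>c\<close>.
\<close>

lemma ruin_prob_lower:
  assumes v: "0 \<le> v"
  shows "ennreal (exp (- R * (v + c))) \<le> 2 * ennreal (exp (R * tilt_cutoff)) * ruin_prob 1 v"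
proof -
  interpret td: tilted_density ladder_density R "1 / (1 + \<theta>)" H "1 + B" k
    using ladder_tilted_density[OF hazard_bound moment_bound B_nonneg k_ge] .
  have "ennreal (exp (- R * (v + c))) \<le> 2 * ennreal (exp (R * td.cutoff)) * limit_ruin_prob (v + c)"
    by (rule td.ruin_functional_lower_bound[OF limit_ruin_prob_measurable limit_ruin_prob_supersolution])
       (use v c_pos in auto)
  also have "\<dots> \<le> 2 * ennreal (exp (R * td.cutoff)) * ruin_prob 1 v"
    by (intro mult_left_mono limit_ruin_prob_le_unit) simp
  finally show ?thesis by (simp only: td.cutoff_def)
qed

text \<open>
  Tonelli reduces this to the weight \<open>(s + c) ^ j\<close> times the integral of \<open>(1 + x) exp (R x)\<close> up to \<open>s + 3 c\<close>; the dyadic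
  bound converts it into the weight of order \<open>k\<close>, at the price of one power more than \<open>j\<close>.
\<close>

lemma overshoot_weight:
  assumes j: "Suc j \<le> k"
  shows "(\<integral>\<^sup>+x\<in>{0..}. ennreal ((1 + x) * exp (R * x)) * overshoot_mean j (x - 3 * c) \<partial>lborel)
    \<le> ennreal (overshoot_weight_bound lam c1 R1 B k)"
proof -
  let ?P = "power_exp_integral k R" and ?e = "power_exp k R (3 * c)"
  have e0: "0 \<le> ?e" using c_pos by (simp add: power_exp_def)
  have "(\<integral>\<^sup>+x\<in>{0..}. ennreal ((1 + x) * exp (R * x)) * overshoot_mean j (x - 3 * c) \<partial>lborel)
      = (\<integral>\<^sup>+s. ennreal ((s + c) ^ j) * (\<integral>\<^sup>+x\<in>{0..<s + 3 * c}. ennreal (power_exp 1 R x) \<partial>lborel) \<partial>cell_claims 1)"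
  proof -
    have "(1 + x) * exp (R * x) = power_exp 1 R x" for x by (simp add: power_exp_def)
    then show ?thesis unfolding overshoot_mean_def
      by (simp only:) (rule integral_against_cell_tail, measurable)
  qed
  also have "\<dots> \<le> (\<integral>\<^sup>+s. ennreal (2 ^ k) * (ennreal (3 * c * ?e) + ennreal ?e * ?P s) \<partial>cell_claims 1)"
  proof (rule nn_integral_mono_AE, use cell_claims_nonneg in eventually_elim)
    fix s :: real assume s: "0 \<le> s"
    have "ennreal ((s + c) ^ j) * (\<integral>\<^sup>+x\<in>{0..<s + 3 * c}. ennreal (power_exp 1 R x) \<partial>lborel)
        \<le> ennreal ((s + 3 * c) ^ j) * (\<integral>\<^sup>+x\<in>{0..<s + 3 * c}. ennreal (power_exp 1 R x) \<partial>lborel)"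
      using s c_pos by (intro mult_right_mono ennreal_leI power_mono) auto
    also have "\<dots> \<le> ennreal (2 ^ Suc j) * ?P (s + 3 * c)"
      using s c_pos R_pos j by (intro dyadic_weight_bound) auto
    also have "\<dots> \<le> ennreal (2 ^ k) * ?P (3 * c + s)"
      unfolding add.commute[of s] using j by (intro mult_right_mono ennreal_leI power_increasing) auto
    also have "\<dots> \<le> ennreal (2 ^ k) * (?P (3 * c) + ennreal ?e * ?P s)"
      using s c_pos by (intro mult_left_mono power_exp_integral_add) auto
    also have "\<dots> \<le> ennreal (2 ^ k) * (ennreal (3 * c * ?e) + ennreal ?e * ?P s)"
      using c_pos R_pos by (intro mult_left_mono add_right_mono power_exp_integral_le) auto
    finally show "ennreal ((s + c) ^ j) * (\<integral>\<^sup>+x\<in>{0..<s + 3 * c}. ennreal (power_exp 1 R x) \<partial>lborel)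
        \<le> ennreal (2 ^ k) * (ennreal (3 * c * ?e) + ennreal ?e * ?P s)" .
  qed
  also have "\<dots> = ennreal (2 ^ k) * (ennreal (3 * c * ?e) + ennreal ?e * (\<integral>\<^sup>+s. ?P s \<partial>cell_claims 1))"
  proof -
    interpret Q: prob_space "cell_claims 1" by (rule prob_space_cell_claims)
    have "(\<integral>\<^sup>+s. ennreal (2 ^ k) * (ennreal (3 * c * ?e) + ennreal ?e * ?P s) \<partial>cell_claims 1)
       = ennreal (2 ^ k) * (\<integral>\<^sup>+s. ennreal (3 * c * ?e) + ennreal ?e * ?P s \<partial>cell_claims 1)"
      by (rule nn_integral_cmult) measurable
    also have "(\<integral>\<^sup>+s. ennreal (3 * c * ?e) + ennreal ?e * ?P s \<partial>cell_claims 1)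
       = (\<integral>\<^sup>+s. ennreal (3 * c * ?e) \<partial>cell_claims 1) + (\<integral>\<^sup>+s. ennreal ?e * ?P s \<partial>cell_claims 1)"
      by (rule nn_integral_add) measurable
    also have "(\<integral>\<^sup>+s. ennreal ?e * ?P s \<partial>cell_claims 1) = ennreal ?e * (\<integral>\<^sup>+s. ?P s \<partial>cell_claims 1)"
      by (rule nn_integral_cmult) measurable
    also have "(\<integral>\<^sup>+s. ennreal (3 * c * ?e) \<partial>cell_claims 1) = ennreal (3 * c * ?e)"
      using Q.emeasure_space_1 by simp
    finally show ?thesis .
  qed
  also have "\<dots> \<le> ennreal (2 ^ k) * (ennreal (3 * c * ?e) + ennreal ?e * ennreal claim_bound)"
    by (intro mult_left_mono add_left_mono claim_bound) auto
  also have "\<dots> = ennreal (2 ^ k * (3 * c * ?e + ?e * claim_bound))"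
  proof -
    have "ennreal (3 * c * ?e + ?e * claim_bound) = ennreal (3 * c * ?e) + ennreal (?e * claim_bound)"
      using e0 c_pos claim_bound_pos by (intro ennreal_plus) auto
    then show ?thesis using e0 by (simp only: ennreal_mult'[OF e0] ennreal_mult'[OF zero_le_power[OF zero_le_numeral]])
  qed
  also have "2 ^ k * (3 * c * ?e + ?e * claim_bound) = 2 ^ k * ?e * (3 * c + claim_bound)"
    by (simp add: algebra_simps)
  also have "ennreal (2 ^ k * ?e * (3 * c + claim_bound)) \<le> ennreal (overshoot_weight_bound lam c1 R1 B k)"
    unfolding overshoot_weight_bound_def using c_pos c_le R_pos R_le claim_bound_pos
    by (intro ennreal_leI mult_mono power_exp_mono) (auto simp: power_exp_def)
  finally show ?thesis .
qed

text \<open>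
  Some finite bound suffices, since it only serves to make the comparison principle applicable.
\<close>

lemma overshoot_mean_bounded:
  assumes j: "Suc j \<le> k"
  shows "\<exists>Q\<ge>0. \<forall>x. overshoot_mean j x \<le> ennreal Q"
proof -
  interpret Q: prob_space "cell_claims 1" by (rule prob_space_cell_claims)
  let ?P = "power_exp_integral k R"
  define X where "X = (\<integral>\<^sup>+s. ennreal ((1 + c) ^ k) * (1 + ennreal (real k + R) * ?P s) \<partial>cell_claims 1)"
  have le: "overshoot_mean j x \<le> X" for x
    unfolding overshoot_mean_def X_def
  proof (rule nn_integral_mono_AE, use cell_claims_nonneg in eventually_elim)
    fix s :: real assume s: "0 \<le> s"
    have "(s + c) ^ j \<le> ((1 + c) * (1 + s)) ^ j"
      using s c_pos by (intro power_mono) (auto simp: algebra_simps)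
    also have "\<dots> \<le> ((1 + c) * (1 + s)) ^ k"
    proof (rule power_increasing)
      show "1 \<le> (1 + c) * (1 + s)" using mult_mono[of 1 "1 + c" 1 "1 + s"] s c_pos by simp
    qed (use j in simp)
    also have "\<dots> = (1 + c) ^ k * ((1 + s) ^ k * 1)" by (simp add: power_mult_distrib)
    also have "\<dots> \<le> (1 + c) ^ k * power_exp k R s"
      unfolding power_exp_def using s c_pos R_pos by (intro mult_left_mono) auto
    finally have "ennreal ((s + c) ^ j) \<le> ennreal ((1 + c) ^ k) * ennreal (power_exp k R s)"
      using c_pos by (subst ennreal_mult'[symmetric]) (auto intro: ennreal_leI)
    also have "\<dots> \<le> ennreal ((1 + c) ^ k) * (1 + ennreal (real k + R) * ?P s)"
      using s R_pos by (intro mult_left_mono power_exp_le_integral) auto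
    finally show "(if x < s then ennreal ((s + c) ^ j) else 0) \<le> ennreal ((1 + c) ^ k) * (1 + ennreal (real k + R) * ?P s)"
      by simp
  qed
  have "X = ennreal ((1 + c) ^ k) * (\<integral>\<^sup>+s. 1 + ennreal (real k + R) * ?P s \<partial>cell_claims 1)"
    unfolding X_def by (rule nn_integral_cmult) measurable
  also have "(\<integral>\<^sup>+s. 1 + ennreal (real k + R) * ?P s \<partial>cell_claims 1)
      = (\<integral>\<^sup>+s. 1 \<partial>cell_claims 1) + (\<integral>\<^sup>+s. ennreal (real k + R) * ?P s \<partial>cell_claims 1)"
    by (rule nn_integral_add) measurable
  also have "(\<integral>\<^sup>+s. ennreal (real k + R) * ?P s \<partial>cell_claims 1) = ennreal (real k + R) * (\<integral>\<^sup>+s. ?P s \<partial>cell_claims 1)"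
    by (rule nn_integral_cmult) measurable
  finally have X: "X = ennreal ((1 + c) ^ k) * (1 + ennreal (real k + R) * (\<integral>\<^sup>+s. ?P s \<partial>cell_claims 1))"
    using Q.emeasure_space_1 by simp
  have "(\<integral>\<^sup>+s. ?P s \<partial>cell_claims 1) < \<infinity>" using claim_bound by (rule order.strict_trans1) simp
  then have "X < \<infinity>" unfolding X by (simp add: ennreal_mult_less_top)
  then have "ennreal (enn2real X) = X" by simp
  then show ?thesis using le by (intro exI[of _ "enn2real X"]) simp
qed

lemma moment_mass_upper:
  assumes j: "Suc j \<le> k" and u: "0 \<le> u"
  shows "moment_mass j u
    \<le> ennreal (exp lam * exp (- R * (u + c)) * ((1 + H) * overshoot_weight_bound lam c1 R1 B k / c))"
proof -
  obtain Q where Q: "0 \<le> Q" "\<And>x. overshoot_mean j x \<le> ennreal Q" using overshoot_mean_bounded[OF j] by blast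
  have T0: "0 \<le> overshoot_weight_bound lam c1 R1 B k"
    unfolding overshoot_weight_bound_def using c_pos c_le claim_bound_pos by (simp add: power_exp_def)
  have "green 1 (overshoot_mean j) n u
    \<le> ennreal (exp lam * exp (- R * (u + c)) * ((1 + H) * overshoot_weight_bound lam c1 R1 B k / c))" for n
    by (rule green_upper_bound[OF hazard_bound moment_bound B_nonneg k_ge overshoot_mean_measurable
          overshoot_mean_antimono Q(2,1) overshoot_weight[OF j] T0 u])
  then show ?thesis by (intro order_trans[OF moment_mass_le_green[OF u]] SUP_least)
qed

text \<open>
  The probability that the next step leads below \<open>c - K\<close>.
\<close>

definition deficit_tail :: "real \<Rightarrow> real \<Rightarrow> ennreal" where
  "deficit_tail K x = emeasure (cell_claims 1) {x + K<..}"

text \<open>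
  The probability that the next step leads below zero, but not below \<open>c - K\<close>.
\<close>

definition small_deficit :: "real \<Rightarrow> real \<Rightarrow> ennreal" where
  "small_deficit K x = (\<integral>\<^sup>+s. (if c - K \<le> x + c - s \<and> x + c - s < 0 then 1 else 0) \<partial>cell_claims 1)"

lemma deficit_tail_eq: "deficit_tail K x = (\<integral>\<^sup>+s. (if x - (- K) < s then 1 else 0) \<partial>cell_claims 1)"
proof -
  have "deficit_tail K x = (\<integral>\<^sup>+s. indicator {x + K<..} s \<partial>cell_claims 1)" by (simp add: deficit_tail_def)
  also have "\<dots> = (\<integral>\<^sup>+s. (if x - (- K) < s then 1 else 0) \<partial>cell_claims 1)"
    by (intro nn_integral_cong) (auto simp: indicator_def)
  finally show ?thesis .
qed

lemma deficit_measurable [measurable]: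
  "deficit_tail K \<in> borel_measurable borel" "small_deficit K \<in> borel_measurable borel"
proof -
  interpret Q: prob_space "cell_claims 1" by (rule prob_space_cell_claims)
  show "deficit_tail K \<in> borel_measurable borel"
    unfolding deficit_tail_eq[abs_def] by measurable
  show "small_deficit K \<in> borel_measurable borel"
    unfolding small_deficit_def[abs_def] by measurable
qed

lemma green_deficit_tail:
  assumes K: "3 * c < K" and v: "0 \<le> v"
  shows "green 1 (deficit_tail K) n v
    \<le> ennreal (exp lam * exp (- R * (v + c)) * ((1 + H) * (claim_bound / (K - 3 * c)) / c))"
proof (rule green_upper_bound[OF hazard_bound moment_bound B_nonneg k_ge _ _ _ zero_le_one _ _ v])
  let ?d = "K - 3 * c"
  show "deficit_tail K y \<le> deficit_tail K x" if "x \<le> y" for x y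
    unfolding deficit_tail_def using that by (intro emeasure_mono) auto
  show "deficit_tail K x \<le> ennreal 1" for x
    unfolding deficit_tail_def using kernel_le_1 by simp
  show "0 \<le> claim_bound / ?d" using claim_bound_pos K by simp
  have w: "(1 + x) * exp (R * x) = power_exp 1 R x" for x by (simp add: power_exp_def)
  have shift: "x - 3 * c - (- K) = x - (3 * c - K)" for x by simp
  have "(\<integral>\<^sup>+x\<in>{0..}. ennreal ((1 + x) * exp (R * x)) * deficit_tail K (x - 3 * c) \<partial>lborel)
      = (\<integral>\<^sup>+s. 1 * (\<integral>\<^sup>+x\<in>{0..<s + (3 * c - K)}. ennreal (power_exp 1 R x) \<partial>lborel) \<partial>cell_claims 1)"
    unfolding deficit_tail_eq w shift by (rule integral_against_cell_tail) measurable
  also have "\<dots> \<le> (\<integral>\<^sup>+s. ennreal (1 / ?d) * power_exp_integral k R s \<partial>cell_claims 1)"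
  proof (rule nn_integral_mono)
    fix s
    have eq: "s + (3 * c - K) = s - ?d" by simp
    show "1 * (\<integral>\<^sup>+x\<in>{0..<s + (3 * c - K)}. ennreal (power_exp 1 R x) \<partial>lborel) \<le> ennreal (1 / ?d) * power_exp_integral k R s"
      unfolding eq mult_1_left using K R_pos k_ge by (intro shifted_weight_bound) auto
  qed
  also have "\<dots> = ennreal (1 / ?d) * (\<integral>\<^sup>+s. power_exp_integral k R s \<partial>cell_claims 1)"
    by (rule nn_integral_cmult) measurable
  also have "\<dots> \<le> ennreal (1 / ?d) * ennreal claim_bound"
    by (intro mult_left_mono claim_bound) simp
  also have "\<dots> = ennreal (claim_bound / ?d)"
    using K by (subst ennreal_mult'[symmetric]) auto
  finally show "(\<integral>\<^sup>+x\<in>{0..}. ennreal ((1 + x) * exp (R * x)) * deficit_tail K (x - 3 * c) \<partial>lborel) \<le> ennreal (claim_bound / ?d)" .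
qed measurable

lemma forced_prob_nonneg: "0 \<le> forced_prob K"
  unfolding forced_prob_def using lam_pos claim_tail_pos[of "K + 3 * c"] by (simp add: less_imp_le)

text \<open>
  Ruin of the walk started at \<open>u - K\<close> comes with a small or with a large deficit. The small ones are
  counted by the numerator, after the final stage with its independent probability; the large ones are rare.
\<close>

lemma ruin_prob_le_moment_mass:
  assumes K: "3 * c < K" and u: "K \<le> u"
  shows "ennreal (c ^ j * forced_prob K) * ruin_prob 1 (u - K)
    \<le> moment_mass j u + ennreal (c ^ j * forced_prob K)
        * ennreal (exp lam * exp (- R * (u - K + c)) * ((1 + H) * (claim_bound / (K - 3 * c)) / c))"
proof -
  let ?a = "ennreal (c ^ j * forced_prob K)" and ?v = "u - K"
  let ?b = "ennreal (exp lam * exp (- R * (?v + c)) * ((1 + H) * (claim_bound / (K - 3 * c)) / c))"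
  have a: "?a = ennreal (c ^ j) * ennreal (forced_prob K)"
    using c_pos by (intro ennreal_mult') simp
  have u0: "0 \<le> u" and cK: "c \<le> K" using K u c_pos by auto
  have rate: "ruin_rate 1 x \<le> small_deficit K x + deficit_tail K x" for x
  proof -
    have "ruin_rate 1 x = (\<integral>\<^sup>+s. indicator {x + c<..} s \<partial>cell_claims 1)" by (simp add: ruin_rate_def)
    also have "\<dots> \<le> (\<integral>\<^sup>+s. (if c - K \<le> x + c - s \<and> x + c - s < 0 then 1 else 0)
        + (if x - (- K) < s then 1 else 0) \<partial>cell_claims 1)"
      by (intro nn_integral_mono) (auto simp: indicator_def)
    also have "\<dots> = small_deficit K x + deficit_tail K x"
      unfolding small_deficit_def deficit_tail_eq by (rule nn_integral_add) measurable
    finally show ?thesis .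
  qed
  have "?a * green 1 (ruin_rate 1) n ?v \<le> moment_mass j u + ?a * ?b" for n
  proof -
    have "?a * green 1 (ruin_rate 1) n ?v \<le> ?a * green 1 (\<lambda>x. small_deficit K x + deficit_tail K x) n ?v"
      by (intro mult_left_mono green_mono rate) simp
    also have "\<dots> = ?a * green 1 (small_deficit K) n ?v + ?a * green 1 (deficit_tail K) n ?v"
      by (subst green_add) (simp_all add: distrib_left)
    also have "\<dots> \<le> moment_mass j u + ?a * ?b"
    proof (rule add_mono)
      have "?a * green 1 (small_deficit K) n ?v = ennreal (c ^ j) * green 1 (\<lambda>x. ennreal (forced_prob K) * small_deficit K x) n ?v"
        unfolding a by (subst green_cmult) (simp_all only: mult.assoc deficit_measurable)
      also have "(\<lambda>x. ennreal (forced_prob K) * small_deficit K x) = cell_mean 1 (forced_cost K)"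
        unfolding small_deficit_def by (rule ext) (rule cell_mean_forced[symmetric])
      finally show "?a * green 1 (small_deficit K) n ?v \<le> moment_mass j u"
        using forced_le_moment_mass[OF u0 cK, of j n] by (simp only:)
      show "?a * green 1 (deficit_tail K) n ?v \<le> ?a * ?b"
        using u by (intro mult_left_mono green_deficit_tail[OF K]) auto
    qed
    finally show ?thesis .
  qed
  then show ?thesis unfolding ruin_prob_eq_SUP SUP_mult_left_ennreal by (intro SUP_least)
qed

end

section \<open>The two-sided bound for the moment\<close>

definition surplus_moment_bound :: "real \<Rightarrow> real \<Rightarrow> real \<Rightarrow> real \<Rightarrow> real \<Rightarrow> real \<Rightarrow> nat \<Rightarrow> real" where
  "surplus_moment_bound lam c0 c1 R H B k = 2 * exp lam * (1 + H) * overshoot_weight_bound lam c1 R B k / c0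
     * exp (R * (2 * (1 + H) * (1 + B)))"

text \<open>
  Chosen so that large deficits account for at most half of the ruin probability of the walk started at \<open>u - K\<close>.
\<close>

definition forced_reserve :: "real \<Rightarrow> real \<Rightarrow> real \<Rightarrow> real \<Rightarrow> real \<Rightarrow> real \<Rightarrow> nat \<Rightarrow> real" where
  "forced_reserve lam c0 c1 R H B k = 3 * c1 + 4 * exp lam * (1 + H) * cell_weight_bound lam c1 R B k
     * exp (R * (2 * (1 + H) * (1 + B))) / c0"

context bounded_lundberg_model
begin

lemma tilt_le: "exp (R * tilt_cutoff) \<le> exp (R1 * tilt_cutoff)"
  using R_le H_nonneg B_nonneg by (simp add: mult_right_mono)

text \<open>
  The factors \<open>exp (- R * (u + c))\<close> of the bounds for the numerator and the denominator cancel.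
\<close>

lemma surplus_moment_upper:
  assumes j: "Suc j \<le> k" and u: "0 \<le> u"
  shows "0 \<le> surplus_moment M (surplus u) j"
    and "surplus_moment M (surplus u) j \<le> surplus_moment_bound lam c0 c1 R1 H B k"
proof -
  let ?T = "overshoot_weight_bound lam c1 R1 B k" and ?e = "exp (- R * (u + c))" and ?E = "exp (R * tilt_cutoff)"
  define p where "p = measure M (ruined u)"
  have T0: "0 \<le> ?T"
    unfolding overshoot_weight_bound_def using c_pos c_le claim_bound_pos by (simp add: power_exp_def)
  have fin: "moment_mass j u < \<infinity>" using moment_mass_upper[OF j u] by (rule order.strict_trans1) simp
  have p: "?e \<le> 2 * ?E * p"
  proof -
    have "ennreal ?e \<le> 2 * ennreal ?E * ruin_prob 1 u" by (rule ruin_prob_lower[OF u])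
    also have "\<dots> \<le> 2 * ennreal ?E * ennreal p"
      using ruin_prob_unit_le[OF u] by (intro mult_left_mono) (simp_all add: p_def emeasure_eq_measure)
    also have "\<dots> = ennreal (2 * ?E * p)" by (simp add: ennreal_mult' p_def)
    finally show ?thesis by (subst (asm) ennreal_le_iff) (simp_all add: p_def)
  qed
  have p_pos: "0 < p" using p by (smt (verit) exp_gt_zero mult_le_0_iff mult_pos_pos)
  define a where "a = exp lam * ((1 + H) * ?T / c)"
  have a0: "0 \<le> a" using T0 H_nonneg c_pos by (simp add: a_def)
  have "enn2real (moment_mass j u) \<le> enn2real (ennreal (exp lam * ?e * ((1 + H) * ?T / c)))"
    by (intro enn2real_mono moment_mass_upper[OF j u]) simp
  also have "\<dots> = a * ?e" using T0 H_nonneg c_pos by (simp add: a_def)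
  also have "\<dots> \<le> a * (2 * ?E * p)" using p a0 by (rule mult_left_mono)
  finally have "enn2real (moment_mass j u) / p \<le> a * (2 * ?E)"
    using p_pos by (simp add: divide_le_eq mult.assoc)
  also have "\<dots> \<le> exp lam * ((1 + H) * ?T / c0) * (2 * exp (R1 * tilt_cutoff))"
    unfolding a_def using T0 H_nonneg c_pos c0_pos c0_le tilt_le
    by (intro mult_mono mult_left_mono divide_left_mono) auto
  also have "\<dots> = surplus_moment_bound lam c0 c1 R1 H B k"
    by (simp add: surplus_moment_bound_def)
  finally show "surplus_moment M (surplus u) j \<le> surplus_moment_bound lam c0 c1 R1 H B k"
    unfolding moment_mass_integral[OF u fin] p_def .
  show "0 \<le> surplus_moment M (surplus u) j"
    unfolding moment_mass_integral[OF u fin] by simp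
qed

text \<open>
  For \<open>u \<ge> K\<close> numerator and denominator are compared with \<open>exp (- R * (u - K + c))\<close>; below \<open>K\<close> the denominator is
  bounded by \<open>1\<close>.
\<close>

lemma surplus_moment_lower:
  assumes j: "Suc j \<le> k" and u: "0 \<le> u"
  defines "K \<equiv> forced_reserve lam c0 c1 R1 H B k"
  shows "c0 ^ j * (exp (- lam) * (1 - exp (- lam)) * claim_tail (K + 3 * c1)) / (4 * exp (R1 * tilt_cutoff))
    \<le> surplus_moment M (surplus u) j"
proof -
  let ?E = "exp (R * tilt_cutoff)" and ?E1 = "exp (R1 * tilt_cutoff)"
  define a where "a = c ^ j * forced_prob K"
  define p where "p = measure M (ruined u)"
  define m where "m = enn2real (moment_mass j u)"
  have fin: "moment_mass j u < \<infinity>" using moment_mass_upper[OF j u] by (rule order.strict_trans1) simp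
  have m: "moment_mass j u = ennreal m" using fin by (simp add: m_def)
  have a0: "0 \<le> a" using c_pos forced_prob_nonneg by (simp add: a_def)
  have p_pos: "0 < p"
  proof -
    have "ennreal (exp (- R * (u + c))) \<le> 2 * ennreal ?E * ruin_prob 1 u" by (rule ruin_prob_lower[OF u])
    also have "\<dots> \<le> 2 * ennreal ?E * ennreal p"
      using ruin_prob_unit_le[OF u] by (intro mult_left_mono) (simp_all add: p_def emeasure_eq_measure)
    finally have "p \<noteq> 0" by auto
    then show ?thesis by (simp add: p_def less_le)
  qed
  have E: "1 \<le> ?E" "1 \<le> ?E1" "?E \<le> ?E1"
    using R_pos R_le H_nonneg B_nonneg tilt_le by simp_all
  have gap: "4 * exp lam * (1 + H) * claim_bound * ?E1 / c0 \<le> K - 3 * c"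
    unfolding K_def forced_reserve_def using c_le by simp
  have gap_pos: "0 < 4 * exp lam * (1 + H) * claim_bound * ?E1 / c0"
    using H_nonneg claim_bound_pos c0_pos by (intro divide_pos_pos mult_pos_pos) auto
  have K: "3 * c < K" using gap gap_pos by simp
  have main: "a / (4 * ?E) * p \<le> m"
  proof (cases "K \<le> u")
    case True
    define v where "v = u - K"
    define e where "e = exp (- R * (v + c))"
    define r where "r = enn2real (ruin_prob 1 v)"
    have v: "0 \<le> v" using True by (simp add: v_def)
    have r: "ruin_prob 1 v = ennreal r"
    proof -
      have "ruin_prob 1 v < \<infinity>" using ruin_lundberg[of 1 v] by (auto intro: order.strict_trans1)
      then show ?thesis by (simp add: r_def)
    qed
    have r0: "0 \<le> r" by (simp add: r_def)
    have e_le: "e \<le> 2 * ?E * r"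
    proof -
      have "ennreal e \<le> 2 * ennreal ?E * ennreal r" using ruin_prob_lower[OF v] by (simp only: r e_def)
      also have "\<dots> = ennreal (2 * ?E * r)" using r0 by (simp add: ennreal_mult')
      finally show ?thesis using r0 by (subst (asm) ennreal_le_iff) simp_all
    qed
    define d where "d = exp lam * ((1 + H) * (claim_bound / (K - 3 * c)) / c)"
    have d0: "0 \<le> d" using H_nonneg claim_bound_pos K c_pos by (simp add: d_def)
    have d: "d * (4 * ?E) \<le> 1"
    proof -
      have "4 * exp lam * (1 + H) * claim_bound * ?E \<le> 4 * exp lam * (1 + H) * claim_bound * ?E1"
        using E H_nonneg claim_bound_pos by (intro mult_left_mono) auto
      also have "\<dots> \<le> (K - 3 * c) * c0" using gap c0_pos by (simp add: divide_le_eq)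
      also have "\<dots> \<le> (K - 3 * c) * c" using K c0_le by (intro mult_left_mono) auto
      finally have "4 * exp lam * (1 + H) * claim_bound * ?E / ((K - 3 * c) * c) \<le> 1"
        using K c_pos by (simp add: divide_le_eq)
      moreover have "d * (4 * ?E) = 4 * exp lam * (1 + H) * claim_bound * ?E / ((K - 3 * c) * c)"
        by (simp add: d_def)
      ultimately show ?thesis by simp
    qed
    have "ennreal (a * r) \<le> ennreal (m + a * (d * e))"
    proof -
      have "ennreal (a * r) = ennreal a * ruin_prob 1 (u - K)"
        unfolding r[unfolded v_def] using a0 by (intro ennreal_mult')
      also have "\<dots> \<le> ennreal m + ennreal a * ennreal (exp lam * exp (- R * (u - K + c)) * ((1 + H) * (claim_bound / (K - 3 * c)) / c))"
        using ruin_prob_le_moment_mass[OF K True, of j] by (simp only: m a_def)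
      also have "exp lam * exp (- R * (u - K + c)) * ((1 + H) * (claim_bound / (K - 3 * c)) / c) = d * e"
        by (simp add: d_def e_def v_def)
      also have "ennreal m + ennreal a * ennreal (d * e) = ennreal (m + a * (d * e))"
        using a0 d0 by (subst ennreal_plus) (auto simp: ennreal_mult' m_def e_def)
      finally show ?thesis .
    qed
    then have le: "a * r \<le> m + a * (d * e)"
      using a0 d0 by (subst (asm) ennreal_le_iff) (auto simp: m_def e_def)
    have "e / (2 * ?E) \<le> r" using e_le by (simp add: divide_le_eq mult.commute)
    moreover have "d * e \<le> e / (4 * ?E)"
    proof -
      have "d \<le> 1 / (4 * ?E)" using d by (simp add: le_divide_eq)
      then have "d * e \<le> 1 / (4 * ?E) * e" by (rule mult_right_mono) (simp add: e_def)
      then show ?thesis by simp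
    qed
    ultimately have "e / (4 * ?E) \<le> r - d * e" by (simp add: field_simps)
    then have "a * (e / (4 * ?E)) \<le> a * (r - d * e)" using a0 by (rule mult_left_mono)
    also have "\<dots> \<le> m" using le by (simp add: algebra_simps)
    finally have low: "a * (e / (4 * ?E)) \<le> m" .
    have "p \<le> e"
    proof -
      have "ennreal p \<le> ruin_prob 1 (u - c)"
        using emeasure_ruined_le[OF u] by (simp add: p_def emeasure_eq_measure)
      also have "\<dots> \<le> ennreal (exp (- R * (u - c)))" by (rule ruin_lundberg) simp
      also have "\<dots> \<le> ennreal e"
        unfolding e_def v_def using K c_pos R_pos by (intro ennreal_leI) simp
      finally show ?thesis by (subst (asm) ennreal_le_iff) (simp_all add: e_def)
    qed
    then have "a / (4 * ?E) * p \<le> a / (4 * ?E) * e" using a0 by (intro mult_left_mono) auto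
    also have "\<dots> \<le> m" using low by simp
    finally show ?thesis .
  next
    case False
    then have "ennreal (c ^ j) * ennreal (forced_prob K) \<le> ennreal m"
      using moment_mass_small_reserve[OF u, of K j] by (simp add: m)
    then have "ennreal a \<le> ennreal m"
      using c_pos by (simp add: a_def ennreal_mult')
    then have am: "a \<le> m" by (subst (asm) ennreal_le_iff) (simp_all add: m_def)
    have "a / (4 * ?E) * p \<le> a * 1"
    proof (rule mult_mono)
      have "1 \<le> 4 * ?E" using E(1) by linarith
      then have "a * 1 \<le> a * (4 * ?E)" using a0 by (rule mult_left_mono)
      then show "a / (4 * ?E) \<le> a" by (simp add: divide_le_eq)
    qed (use a0 in \<open>simp_all add: p_def\<close>)
    then show ?thesis using am by simp
  qed
  have "c0 ^ j * (exp (- lam) * (1 - exp (- lam)) * claim_tail (K + 3 * c1)) \<le> a"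
    unfolding a_def forced_prob_def using c0_pos c0_le lam_pos c_le claim_tail_pos
    by (intro mult_mono power_mono claim_tail_antimono) (auto simp: less_imp_le)
  then have "c0 ^ j * (exp (- lam) * (1 - exp (- lam)) * claim_tail (K + 3 * c1)) / (4 * ?E1) \<le> a / (4 * ?E)"
    using a0 E by (intro frac_le) auto
  also have "\<dots> \<le> m / p" using main p_pos by (simp add: le_divide_eq)
  also have "m / p = surplus_moment M (surplus u) j"
    unfolding moment_mass_integral[OF u fin] m_def p_def ..
  finally show ?thesis .
qed

end

lemma (in lundberg_model) adjustment_coefficient_le:
  assumes H: "h_I M Z \<le> ennreal H"
  shows "R \<le> 4 * H * (1 + \<theta>)"
proof -
  have "0 < H" using hazard_bound_pos[OF H] mean_claim_pos by (smt (verit) divide_pos_pos)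
  moreover have "R / (2 * H) \<le> 2 * (1 + \<theta>)"
    using exp_R_bound[OF H] exp_ge_add_one_self[of "R / (2 * H)"] by linarith
  ultimately show ?thesis by (simp add: divide_le_eq mult_ac)
qed

theorem theorem4:
  fixes k j :: nat
    and \<Theta> :: "real set"
    and M :: "'a measure" and lam :: real and c R :: "real \<Rightarrow> real"
    and N :: "real \<Rightarrow> 'a \<Rightarrow> nat" and Z :: "nat \<Rightarrow> 'a \<Rightarrow> real"
    and M\<^sub>D\<^sub>V :: "real \<Rightarrow> 'b measure" and lam\<^sub>D\<^sub>V c\<^sub>D\<^sub>V R\<^sub>D\<^sub>V :: "real \<Rightarrow> real"
    and N\<^sub>D\<^sub>V :: "real \<Rightarrow> real \<Rightarrow> 'b \<Rightarrow> nat" and Z\<^sub>D\<^sub>V :: "real \<Rightarrow> nat \<Rightarrow> 'b \<Rightarrow> real"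
    and s s\<^sub>D\<^sub>V :: "real \<Rightarrow> real \<Rightarrow> real"
  defines "s \<equiv> \<lambda>\<theta> u. surplus_moment M (reserve (c \<theta>) N Z u) j"
    and "s\<^sub>D\<^sub>V \<equiv> \<lambda>\<theta> u. surplus_moment (M\<^sub>D\<^sub>V \<theta>) (reserve (c\<^sub>D\<^sub>V \<theta>) (N\<^sub>D\<^sub>V \<theta>) (Z\<^sub>D\<^sub>V \<theta>) u) j"
  assumes "k \<ge> 2" and "j \<in> {1..k - 1}"
    and "is_interval \<Theta>" and "bounded \<Theta>" and "\<Theta> \<subseteq> {0<..}"
    and "\<forall>\<theta>\<in>\<Theta>. c \<theta> = (1 + \<theta>) * lam * claim_moment M Z 1"
    and "\<forall>\<theta>\<in>\<Theta>. reserve_model M (c \<theta>) lam N Z"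
    and "\<forall>\<theta>\<in>\<Theta>. reserve_model (M\<^sub>D\<^sub>V \<theta>) (c\<^sub>D\<^sub>V \<theta>) (lam\<^sub>D\<^sub>V \<theta>) (N\<^sub>D\<^sub>V \<theta>) (Z\<^sub>D\<^sub>V \<theta>)"
    and "\<forall>\<theta>\<in>\<Theta>. moments_match k M (reserve (c \<theta>) N Z)
           (M\<^sub>D\<^sub>V \<theta>) (reserve (c\<^sub>D\<^sub>V \<theta>) (N\<^sub>D\<^sub>V \<theta>) (Z\<^sub>D\<^sub>V \<theta>))"
    and "\<forall>i\<in>{1..k}. \<exists>m. \<forall>\<theta>\<in>\<Theta>. claim_moment (M\<^sub>D\<^sub>V \<theta>) (Z\<^sub>D\<^sub>V \<theta>) i = m"
    and "\<exists>a. \<forall>\<theta>\<in>\<Theta>. safety_loading (M\<^sub>D\<^sub>V \<theta>) (c\<^sub>D\<^sub>V \<theta>) (lam\<^sub>D\<^sub>V \<theta>) (Z\<^sub>D\<^sub>V \<theta>) = a * \<theta>"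
    and A1: "\<forall>\<theta>\<in>\<Theta>. adjustment_coefficient M (c \<theta>) lam Z (R \<theta>)"
    and A1_DV: "\<forall>\<theta>\<in>\<Theta>. adjustment_coefficient (M\<^sub>D\<^sub>V \<theta>) (c\<^sub>D\<^sub>V \<theta>) (lam\<^sub>D\<^sub>V \<theta>) (Z\<^sub>D\<^sub>V \<theta>) (R\<^sub>D\<^sub>V \<theta>)"
    and A2: "\<forall>\<theta>\<in>\<Theta>. exp_moment M (c \<theta>) lam Z (R \<theta>) k < \<infinity>"
    and A2_DV: "\<forall>\<theta>\<in>\<Theta>. exp_moment (M\<^sub>D\<^sub>V \<theta>) (c\<^sub>D\<^sub>V \<theta>) (lam\<^sub>D\<^sub>V \<theta>) (Z\<^sub>D\<^sub>V \<theta>) (R\<^sub>D\<^sub>V \<theta>) k < \<infinity>"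
    and A3: "h_I M Z < \<infinity>"
    and A3_DV: "\<forall>\<theta>\<in>\<Theta>. h_I (M\<^sub>D\<^sub>V \<theta>) (Z\<^sub>D\<^sub>V \<theta>) < \<infinity>"
    and A2_bounded: "\<exists>B::real. \<forall>\<theta>\<in>\<Theta>. exp_moment M (c \<theta>) lam Z (R \<theta>) k \<le> ennreal B"
    and A2_DV_bounded: "\<exists>B::real. \<forall>\<theta>\<in>\<Theta>.
           exp_moment (M\<^sub>D\<^sub>V \<theta>) (c\<^sub>D\<^sub>V \<theta>) (lam\<^sub>D\<^sub>V \<theta>) (Z\<^sub>D\<^sub>V \<theta>) (R\<^sub>D\<^sub>V \<theta>) k \<le> ennreal B"
    and A3_DV_bounded: "\<exists>B::real. \<forall>\<theta>\<in>\<Theta>. h_I (M\<^sub>D\<^sub>V \<theta>) (Z\<^sub>D\<^sub>V \<theta>) \<le> ennreal B"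
  shows "(\<exists>C\<ge>0. \<forall>\<theta>\<in>\<Theta>. \<forall>u\<ge>0. \<bar>s \<theta> u - s\<^sub>D\<^sub>V \<theta> u\<bar> \<le> C) \<and>
         (\<exists>C\<ge>0. \<forall>\<theta>\<in>\<Theta>. \<forall>u\<ge>0. s \<theta> u \<noteq> 0 \<and> \<bar>(s \<theta> u - s\<^sub>D\<^sub>V \<theta> u) / s \<theta> u\<bar> \<le> C)"
proof -
  have jk: "1 \<le> j" "Suc j \<le> k" using assms(3,4) by auto
  show ?thesis
  proof (cases "\<Theta> = {}")
    case False
    then obtain t0 where t0: "t0 \<in> \<Theta>" by blast
    obtain b where b: "\<And>t. t \<in> \<Theta> \<Longrightarrow> t \<le> b"
      using assms(6) unfolding bounded_iff by (metis abs_le_iff real_norm_def)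
    have pos: "0 < t" if "t \<in> \<Theta>" for t using assms(7) that by auto
    obtain B where B: "\<And>t. t \<in> \<Theta> \<Longrightarrow> exp_moment M (c t) lam Z (R t) k \<le> ennreal B"
      using A2_bounded by blast
    obtain B' where B': "\<And>t. t \<in> \<Theta> \<Longrightarrow> exp_moment (M\<^sub>D\<^sub>V t) (c\<^sub>D\<^sub>V t) (lam\<^sub>D\<^sub>V t) (Z\<^sub>D\<^sub>V t) (R\<^sub>D\<^sub>V t) k \<le> ennreal B'"
      using A2_DV_bounded by blast
    define H where "H = enn2real (h_I M Z)"
    have H: "h_I M Z \<le> ennreal H" using A3 by (simp add: H_def)
    obtain H' where H': "\<And>t. t \<in> \<Theta> \<Longrightarrow> h_I (M\<^sub>D\<^sub>V t) (Z\<^sub>D\<^sub>V t) \<le> ennreal H'" using A3_DV_bounded by blast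
    obtain a where a: "\<And>t. t \<in> \<Theta> \<Longrightarrow> safety_loading (M\<^sub>D\<^sub>V t) (c\<^sub>D\<^sub>V t) (lam\<^sub>D\<^sub>V t) (Z\<^sub>D\<^sub>V t) = a * t"
      using assms(13) by blast
    have "1 \<in> {1..k}" using assms(3) by simp
    then obtain m' where m': "\<And>t. t \<in> \<Theta> \<Longrightarrow> claim_moment (M\<^sub>D\<^sub>V t) (Z\<^sub>D\<^sub>V t) 1 = m'" using assms(12) by blast
    let ?m = "claim_moment M Z 1"
    have orig: "lundberg_model M (c t) lam N Z (R t)" if "t \<in> \<Theta>" for t
    proof -
      have mod: "reserve_model M (c t) lam N Z" using assms(9) that by blast
      then have "prob_space M" by (simp add: reserve_model_def)
      with mod show ?thesis using A1 that
        by (simp add: lundberg_model_def lundberg_model_axioms_def risk_process_def risk_process_axioms_def)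
    qed
    have dv: "lundberg_model (M\<^sub>D\<^sub>V t) (c\<^sub>D\<^sub>V t) (lam\<^sub>D\<^sub>V t) (N\<^sub>D\<^sub>V t) (Z\<^sub>D\<^sub>V t) (R\<^sub>D\<^sub>V t)" if "t \<in> \<Theta>" for t
    proof -
      have mod: "reserve_model (M\<^sub>D\<^sub>V t) (c\<^sub>D\<^sub>V t) (lam\<^sub>D\<^sub>V t) (N\<^sub>D\<^sub>V t) (Z\<^sub>D\<^sub>V t)" using assms(10) that by blast
      then have "prob_space (M\<^sub>D\<^sub>V t)" by (simp add: reserve_model_def)
      with mod show ?thesis using A1_DV that
        by (simp add: lundberg_model_def lundberg_model_axioms_def risk_process_def risk_process_axioms_def)
    qed
    have lam: "0 < lam" and m: "0 < ?m"
    proof -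
      interpret lundberg_model M "c t0" lam N Z "R t0" by (rule orig[OF t0])
      show "0 < lam" "0 < ?m" by (rule lam_pos, rule mean_claim_pos)
    qed
    have m'_pos: "0 < m'"
      using lundberg_model.mean_claim_pos[OF dv[OF t0]] m'[OF t0] by simp
    have c: "c t = (1 + t) * (lam * ?m)" if "t \<in> \<Theta>" for t using assms(8) that by simp
    have loading: "safety_loading M (c t) lam Z = t" if "t \<in> \<Theta>" for t
      using c[OF that] lam m by (simp add: safety_loading_def)
    define l where "l = lam * ?m / m'"
    \<comment> \<open>The mean at time \<open>1\<close> gives \<open>lam * m = lam\<^sub>D\<^sub>V * m' * a\<close>, so the intensity of the approximating model is constant.\<close>
    have dv_consts: "0 < a" "lam\<^sub>D\<^sub>V t = l / a" "c\<^sub>D\<^sub>V t = (1 + a * t) * (l / a * m')" if t: "t \<in> \<Theta>" for t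
    proof -
      interpret D: lundberg_model "M\<^sub>D\<^sub>V t" "c\<^sub>D\<^sub>V t" "lam\<^sub>D\<^sub>V t" "N\<^sub>D\<^sub>V t" "Z\<^sub>D\<^sub>V t" "R\<^sub>D\<^sub>V t" by (rule dv[OF t])
      have "c t - lam * ?m = c\<^sub>D\<^sub>V t - lam\<^sub>D\<^sub>V t * m'"
      proof -
        have "(\<integral>\<omega>. reserve (c t) N Z 0 1 \<omega> ^ 1 \<partial>M) = (\<integral>\<omega>. reserve (c\<^sub>D\<^sub>V t) (N\<^sub>D\<^sub>V t) (Z\<^sub>D\<^sub>V t) 0 1 \<omega> ^ 1 \<partial>M\<^sub>D\<^sub>V t)"
          using assms(11) t \<open>1 \<in> {1..k}\<close> unfolding moments_match_def by (metis order_refl zero_le_one)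
        then show ?thesis
          unfolding power_one_right lundberg_model.expected_surplus[OF orig[OF t]] D.expected_surplus m'[OF t] .
      qed
      moreover have cD: "c\<^sub>D\<^sub>V t = (1 + a * t) * (lam\<^sub>D\<^sub>V t * m')"
        using D.one_plus_loading D.lam_pos m'_pos unfolding m'[OF t] a[OF t] by (simp add: field_simps)
      ultimately have "t * (lam * ?m) = t * (a * (lam\<^sub>D\<^sub>V t * m'))"
        unfolding c[OF t] by (simp add: algebra_simps)
      then have eq: "lam * ?m = a * (lam\<^sub>D\<^sub>V t * m')" using pos[OF t] by simp
      moreover have "0 < lam * ?m" using lam m by simp
      ultimately show a0: "0 < a" using D.lam_pos m'_pos by (metis less_asym mult_pos_pos zero_less_mult_iff)
      show lamD: "lam\<^sub>D\<^sub>V t = l / a" using eq a0 m'_pos by (simp add: l_def field_simps)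
      show "c\<^sub>D\<^sub>V t = (1 + a * t) * (l / a * m')" using cD lamD by simp
    qed
    define c0 c1 R1 where "c0 = lam * ?m" and "c1 = (1 + b) * (lam * ?m)" and "R1 = 4 * H * (1 + b)"
    define c0' c1' R1' where "c0' = l / a * m'" and "c1' = (1 + a * b) * (l / a * m')" and "R1' = 4 * H' * (1 + a * b)"
    note const_defs = c0_def c1_def R1_def c0'_def c1'_def R1'_def
    have a_pos: "0 < a" by (rule dv_consts(1)[OF t0])
    have l_pos: "0 < l" using lam m m'_pos by (simp add: l_def)
    have orig_b: "bounded_lundberg_model M (c t) lam N Z (R t) k H (max 0 B) c0 c1 R1" if t: "t \<in> \<Theta>" for t
    proof -
      interpret lundberg_model M "c t" lam N Z "R t" by (rule orig[OF t])
      have "0 \<le> H" by (simp add: H_def)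
      then have "R t \<le> R1"
        using adjustment_coefficient_le[OF H] b[OF t] unfolding loading[OF t] const_defs
        by (elim order_trans) (auto intro!: mult_left_mono)
      moreover have "exp_moment M (c t) lam Z (R t) k \<le> ennreal (max 0 B)"
        using B[OF t] by (rule order_trans) (simp add: ennreal_leI)
      ultimately show ?thesis
        using H assms(3) lam m c[OF t] pos[OF t] b[OF t]
        by unfold_locales (auto simp: const_defs intro!: mult_right_mono mult_pos_pos)
    qed
    have dv_b: "bounded_lundberg_model (M\<^sub>D\<^sub>V t) (c\<^sub>D\<^sub>V t) (l / a) (N\<^sub>D\<^sub>V t) (Z\<^sub>D\<^sub>V t) (R\<^sub>D\<^sub>V t) k H' (max 0 B') c0' c1' R1'"
      if t: "t \<in> \<Theta>" for t
    proof -
      interpret lundberg_model "M\<^sub>D\<^sub>V t" "c\<^sub>D\<^sub>V t" "l / a" "N\<^sub>D\<^sub>V t" "Z\<^sub>D\<^sub>V t" "R\<^sub>D\<^sub>V t"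
        using dv[OF t] unfolding dv_consts(2)[OF t] .
      have "0 < H'" using hazard_bound_pos[OF H'[OF t]] mean_claim_pos by (smt (verit) divide_pos_pos)
      moreover have "safety_loading (M\<^sub>D\<^sub>V t) (c\<^sub>D\<^sub>V t) (l / a) (Z\<^sub>D\<^sub>V t) = a * t"
        using a[OF t] unfolding dv_consts(2)[OF t] .
      ultimately have "R\<^sub>D\<^sub>V t \<le> R1'"
        using adjustment_coefficient_le[OF H'[OF t]] b[OF t] a_pos unfolding const_defs
        by (elim order_trans) (auto intro!: mult_left_mono)
      moreover have "exp_moment (M\<^sub>D\<^sub>V t) (c\<^sub>D\<^sub>V t) (l / a) (Z\<^sub>D\<^sub>V t) (R\<^sub>D\<^sub>V t) k \<le> ennreal (max 0 B')"
        using B'[OF t] unfolding dv_consts(2)[OF t] by (rule order_trans) (simp add: ennreal_leI)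
      ultimately show ?thesis
        using H'[OF t] assms(3) dv_consts(3)[OF t] pos[OF t] b[OF t] a_pos l_pos m'_pos
        by unfold_locales (auto simp: const_defs intro!: mult_right_mono mult_left_mono divide_right_mono)
    qed
    define U where "U = surplus_moment_bound lam c0 c1 R1 H (max 0 B) k"
    define U' where "U' = surplus_moment_bound (l / a) c0' c1' R1' H' (max 0 B') k"
    define L where "L = c0 ^ j * (exp (- lam) * (1 - exp (- lam))
      * (1 - claim_cdf M Z (forced_reserve lam c0 c1 R1 H (max 0 B) k + 3 * c1)))
      / (4 * exp (R1 * (2 * (1 + H) * (1 + max 0 B))))"
    have L: "0 < L"
    proof -
      interpret lundberg_model M "c t0" lam N Z "R t0" by (rule orig[OF t0])
      show ?thesis unfolding L_def const_defs using lam m claim_tail_pos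
        by (intro divide_pos_pos mult_pos_pos zero_less_power) auto
    qed
    have s: "L \<le> s t u" "s t u \<le> U" if "t \<in> \<Theta>" "0 \<le> u" for t u
      using bounded_lundberg_model.surplus_moment_lower[OF orig_b[OF that(1)] jk(2) that(2)]
        bounded_lundberg_model.surplus_moment_upper(2)[OF orig_b[OF that(1)] jk(2) that(2)]
      unfolding s_def L_def U_def by blast+
    have sd: "0 \<le> s\<^sub>D\<^sub>V t u" "s\<^sub>D\<^sub>V t u \<le> U'" if "t \<in> \<Theta>" "0 \<le> u" for t u
      using bounded_lundberg_model.surplus_moment_upper[OF dv_b[OF that(1)] jk(2) that(2)]
      unfolding s\<^sub>D\<^sub>V_def U'_def by blast+
    have U0: "0 \<le> U" "0 \<le> U'"
      using s[OF t0 order_refl] sd[OF t0 order_refl] L by linarith+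
    have diff: "\<bar>s t u - s\<^sub>D\<^sub>V t u\<bar> \<le> U + U'" if "t \<in> \<Theta>" "0 \<le> u" for t u
      using s[OF that] sd[OF that] L U0 by linarith
    have rel: "s t u \<noteq> 0 \<and> \<bar>(s t u - s\<^sub>D\<^sub>V t u) / s t u\<bar> \<le> (U + U') / L" if "t \<in> \<Theta>" "0 \<le> u" for t u
    proof -
      have "0 < s t u" using s(1)[OF that] L by linarith
      moreover have "\<bar>s t u - s\<^sub>D\<^sub>V t u\<bar> / s t u \<le> (U + U') / L"
        using diff[OF that] s(1)[OF that] L U0 by (intro frac_le) auto
      ultimately show ?thesis by (simp add: abs_divide)
    qed
    show ?thesis
      using diff rel U0 L by (intro conjI exI[of _ "U + U'"] exI[of _ "(U + U') / L"]) auto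
  qed auto
qed

end
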